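(* Let $0<\rho\le 1$, $0\le\delta<1$, $\delta\le\rho$ and $a\in APS^0_{\rho,\delta}$. Then the bounded operators $$U(a)(D):\ L^2(\mathbb R^d,l^2(\mathbb R^d))\to L^2(\mathbb R^d,l^2(\mathbb R^d)),\qquad A(a(y,D)):\ B^2(\mathbb R^d)\otimes L^2(\mathbb R^d)\to B^2(\mathbb R^d)\otimes L^2(\mathbb R^d)$$ are unitarily equivalent.
   Context: Notation: $\langle\xi\rangle=(1+|\xi|^2)^{1/2}$, $e_\lambda(x)=e^{2\pi i\lambda\cdot x}$, $\widehat f(\xi)=\int f(x)e^{-2\pi ix\cdot\xi}dx$ (also for Hilbert space valued $f$). $C_{\rm ap}(\mathbb R^d)$: uniform limits of finite linear combinations of the $e_\lambda$, $\lambda\in\mathbb R^d$. Mean value $\mathscr M(f)=\lim_{T\to\infty}T^{-d}\int_{[0,T]^d}f(x)\,dx$. $B^2(\mathbb R^d)$: completion of $C_{\rm ap}(\mathbb R^d)$ for $(f,g)_B=\mathscr M(f\overline g)$. $\otimes$ is the Hilbert space tensor product. Symbols: $APS^0_{\rho,\delta}$ is the set of $a\in C^\infty(\mathbb R^{2d})$ such that $a(\cdot,\xi)\in C_{\rm ap}(\mathbb R^d)$ for all $\xi$ and $\sup_{x,\xi}\langle\xi\rangle^{\rho|\alpha|-\delta|\beta|}|\partial_\xi^\alpha\partial_x^\beta a(x,\xi)|<\infty$ for all multi-indices $\alpha,\beta$. Sequence spaces: $l^2=l^2(\mathbb R^d)$ is the (nonseparable) Hilbert space of square summable functions $z=(z_\lambda)_{\lambda\in\mathbb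 R^d}$ on $\mathbb R^d$ with counting measure. $\mathscr S(\mathbb R^d,l^2_f)$: finite sums $\sum_j\varphi_j\delta_{(\lambda_j)}$, $\varphi_j\in\mathscr S(\mathbb R^d)$, where $\delta_{(\lambda)}$ is the sequence equal to $1$ at $\lambda$ and $0$ elsewhere. $L^2(\mathbb R^d,l^2)$ is the Bochner space. The operator $U(a)(D)$: with $a_\lambda(\xi)=\mathscr M_x(a(x,\xi)e^{-2\pi i\lambda\cdot x})$ and $(U(a)(\xi)z)_\lambda=\sum_{\lambda'}a_{\lambda'-\lambda}(\xi-\lambda')z_{\lambda'}$, put $U(a)(D)F(x)=\int_{\mathbb R^d}e^{2\pi i\xi\cdot x}U(a)(\xi)\cdot\widehat F(\xi)\,d\xi$ for $F\in\mathscr S(\mathbb R^d,l^2_f)$. For $a\in APS^0_{\rho,\delta}$ it extends to a bounded operator on $L^2(\mathbb R^d,l^2)$. The operator $A(a(y,D))$: $(Au)(x,y)=\int_{\mathbb R^d}e^{2\pi i\xi\cdot y}a(x+y,\xi)\,\mathscr F_2u(x,\xi)\,d\xi$ for finite sums $u(x,y)=\sum_je_{\xi_j}(x)f_j(y)$, $f_j\in\mathscr S(\mathbb R^d)$, where $\mathscr F_2$ is the Fourier transform in the second variable. For $a\in APS^0_{\rho,\delta}$ it extends to a bounded operator on $B^2(\mathbb R^d)\otimes L^2(\mathbb R^d)$. *)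

theory Defs
  imports "HOL-Analysis.Analysis"
begin

subsection \<open>Complex inner product spaces and Hilbert space completion\<close>

class complex_semi_inner = ab_group_add +
  fixes scaleC :: "complex \<Rightarrow> 'a \<Rightarrow> 'a"  (infixr \<open>*\<^sub>C\<close> 75)
    and cinner :: "'a \<Rightarrow> 'a \<Rightarrow> complex"
  assumes scaleC_add_right: "c *\<^sub>C (x + y) = c *\<^sub>C x + c *\<^sub>C y"
    and scaleC_add_left: "(c + d) *\<^sub>C x = c *\<^sub>C x + d *\<^sub>C x"
    and scaleC_scaleC: "c *\<^sub>C d *\<^sub>C x = (c * d) *\<^sub>C x"
    and scaleC_one: "1 *\<^sub>C x = x"
    and cinner_add_left: "cinner (x + y) z = cinner x z + cinner y z"
    and cinner_scaleC_left: "cinner (c *\<^sub>C x) y = c * cinner x y"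
    and cinner_commute: "cinner x y = cnj (cinner y x)"
    and cinner_ge_zero: "0 \<le> Re (cinner x x)"

class complex_inner = complex_semi_inner + real_inner +
  assumes scaleR_scaleC: "r *\<^sub>R x = complex_of_real r *\<^sub>C x"
    and inner_eq_Re_cinner: "inner x y = Re (cinner x y)"

class complex_hilbert = complex_inner + complete_space

instantiation complex :: complex_hilbert
begin
definition scaleC_complex_def: "scaleC c z = c * (z :: complex)"
definition cinner_complex_def: "cinner z w = z * cnj (w :: complex)"
instance
  by standard (auto simp: scaleC_complex_def cinner_complex_def algebra_simps scaleR_conv_of_real inner_complex_def)
end

context complex_semi_inner
begin

lemma scaleC_zero_left [simp]: "0 *\<^sub>C x = 0"
  using scaleC_add_left[of 0 0 x] by simp

lemma scaleC_zero_right [simp]: "c *\<^sub>C 0 = 0"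
  using scaleC_add_right[of c 0 0] by simp

lemma scaleC_minus_right: "c *\<^sub>C (- x) = - (c *\<^sub>C x)"
  using scaleC_add_right[of c x "- x"] by (simp add: eq_neg_iff_add_eq_0 add.commute)

lemma scaleC_diff_right: "c *\<^sub>C (x - y) = c *\<^sub>C x - c *\<^sub>C y"
  using scaleC_add_right[of c x "- y"] by (simp add: scaleC_minus_right)

lemma cinner_zero_left [simp]: "cinner 0 x = 0"
  using cinner_add_left[of 0 0 x] by simp

lemma cinner_zero_right [simp]: "cinner x 0 = 0"
  using cinner_commute[of x 0] by simp

lemma cinner_add_right: "cinner x (y + z) = cinner x y + cinner x z"
  by (metis cinner_add_left cinner_commute complex_cnj_add)

lemma cinner_scaleC_right: "cinner x (c *\<^sub>C y) = cnj c * cinner x y"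
  by (metis cinner_scaleC_left cinner_commute complex_cnj_mult)

lemma cinner_minus_left: "cinner (- x) y = - cinner x y"
proof -
  have "z + w = 0 \<Longrightarrow> w = - z" for z w :: complex by (simp add: complex_eq_iff)
  then show ?thesis using cinner_add_left[of x "- x" y] by simp
qed

lemma cinner_minus_right: "cinner x (- y) = - cinner x y"
  by (metis cinner_minus_left cinner_commute complex_cnj_minus)

lemma cinner_diff_left: "cinner (x - y) z = cinner x z - cinner y z"
  using cinner_add_left[of x "- y" z] by (simp add: cinner_minus_left)

lemma cinner_diff_right: "cinner x (y - z) = cinner x y - cinner x z"
  using cinner_add_right[of x y "- z"] by (simp add: cinner_minus_right)

lemma cinner_sum_left: "cinner (sum f A) y = (\<Sum>i\<in>A. cinner (f i) y)"
  by (induction A rule: infinite_finite_induct) (auto simp: cinner_add_left)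

lemma cinner_sum_right: "cinner x (sum f A) = (\<Sum>i\<in>A. cinner x (f i))"
  by (induction A rule: infinite_finite_induct) (auto simp: cinner_add_right)

lemma cinner_self_real: "cinner x x = complex_of_real (Re (cinner x x))"
  using cinner_commute[of x x] by (simp add: complex_eq_iff)

definition csnorm :: "'a \<Rightarrow> real" where
  "csnorm x = sqrt (Re (cinner x x))"

lemma csnorm_ge_zero [simp]: "0 \<le> csnorm x"
  by (simp add: csnorm_def cinner_ge_zero)

lemma csnorm_zero [simp]: "csnorm 0 = 0"
  by (simp add: csnorm_def)

lemma csnorm_power2: "(csnorm x)\<^sup>2 = Re (cinner x x)"
  by (simp add: csnorm_def cinner_ge_zero)

lemma csnorm_minus: "csnorm (- x) = csnorm x"
  by (simp add: csnorm_def cinner_minus_left cinner_minus_right)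

lemma csnorm_minus_commute: "csnorm (x - y) = csnorm (y - x)"
  using csnorm_minus[of "x - y"] by simp

lemma csnorm_scaleC: "csnorm (c *\<^sub>C x) = cmod c * csnorm x"
proof -
  have "cinner (c *\<^sub>C x) (c *\<^sub>C x) = complex_of_real ((cmod c)\<^sup>2) * cinner x x"
    by (simp add: cinner_scaleC_left cinner_scaleC_right complex_norm_square algebra_simps del: of_real_power)
  then show ?thesis
    by (simp add: csnorm_def real_sqrt_mult del: of_real_power)
qed

lemma cinner_Cauchy_Schwarz: "cmod (cinner x y) \<le> csnorm x * csnorm y"
proof -
  define B where "B = cinner x y"
  define C where "C = Re (cinner y y)"
  have C0: "C \<ge> 0" by (simp add: C_def cinner_ge_zero)
  have yx: "cinner y x = cnj B" unfolding B_def by (rule cinner_commute)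
  have yy: "cinner y y = complex_of_real C" unfolding C_def by (rule cinner_self_real)
  have key: "0 \<le> Re (cinner x x) - 2 * t * (cmod B)\<^sup>2 + t\<^sup>2 * (cmod B)\<^sup>2 * C" for t :: real
  proof -
    define c where "c = complex_of_real t * B"
    have BB: "B * cnj B = complex_of_real ((cmod B)\<^sup>2)"
      by (metis complex_norm_square of_real_power)
    have "cinner (x - c *\<^sub>C y) (x - c *\<^sub>C y) =
        cinner x x - cnj c * B - c * cnj B + c * cnj c * cinner y y"
      by (simp add: cinner_diff_left cinner_diff_right cinner_scaleC_left cinner_scaleC_right
          B_def[symmetric] yx algebra_simps)
    also have "\<dots> = cinner x x - 2 * complex_of_real t * (B * cnj B)
        + (complex_of_real t)\<^sup>2 * (B * cnj B) * complex_of_real C"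
      by (simp add: c_def yy algebra_simps power2_eq_square)
    also have "\<dots> = cinner x x - complex_of_real (2 * t * (cmod B)\<^sup>2)
        + complex_of_real (t\<^sup>2 * (cmod B)\<^sup>2 * C)"
      by (simp add: BB)
    finally show ?thesis
      using cinner_ge_zero[of "x - c *\<^sub>C y"] by (simp del: of_real_mult of_real_power)
  qed
  have "(cmod B)\<^sup>2 \<le> Re (cinner x x) * C"
  proof (cases "C = 0")
    case True
    have "B = 0"
    proof (rule ccontr)
      assume "B \<noteq> 0"
      then have "(cmod B)\<^sup>2 > 0" by simp
      then show False
        using key[of "(Re (cinner x x) + 1) / (2 * (cmod B)\<^sup>2)"] True by (simp add: field_simps)
    qed
    then show ?thesis by (simp add: True)
  next
    case False
    then have "C > 0" using C0 by simp
    then show ?thesis using key[of "1 / C"]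
      by (simp add: field_simps power2_eq_square)
  qed
  then have "sqrt ((cmod B)\<^sup>2) \<le> sqrt (Re (cinner x x) * C)"
    by (rule real_sqrt_le_mono)
  then show ?thesis
    by (simp add: B_def C_def csnorm_def real_sqrt_mult)
qed

lemma csnorm_triangle: "csnorm (x + y) \<le> csnorm x + csnorm y"
proof (rule power2_le_imp_le)
  have "(csnorm (x + y))\<^sup>2 = (csnorm x)\<^sup>2 + (csnorm y)\<^sup>2 + 2 * Re (cinner x y)"
    using arg_cong[OF cinner_commute[of y x], of Re]
    by (simp add: csnorm_power2 cinner_add_left cinner_add_right)
  also have "Re (cinner x y) \<le> csnorm x * csnorm y"
    using cinner_Cauchy_Schwarz[of x y] complex_Re_le_cmod order_trans by blast
  finally show "(csnorm (x + y))\<^sup>2 \<le> (csnorm x + csnorm y)\<^sup>2"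
    by (simp add: power2_sum)
qed simp

lemma csnorm_diff_triangle: "csnorm (x - z) \<le> csnorm (x - y) + csnorm (y - z)"
  using csnorm_triangle[of "x - y" "y - z"] by (simp add: add_diff_eq)

lemma csnorm_diff_abs: "\<bar>csnorm x - csnorm y\<bar> \<le> csnorm (x - y)"
  using csnorm_triangle[of "x - y" y] csnorm_triangle[of "y - x" x] csnorm_minus_commute[of x y]
  by simp

definition csCauchy :: "(nat \<Rightarrow> 'a) \<Rightarrow> bool" where
  "csCauchy X \<longleftrightarrow> (\<forall>e>0. \<exists>N. \<forall>m\<ge>N. \<forall>n\<ge>N. csnorm (X m - X n) < e)"

definition csnull :: "(nat \<Rightarrow> 'a) \<Rightarrow> bool" where
  "csnull X \<longleftrightarrow> (\<lambda>n. csnorm (X n)) \<longlonglongrightarrow> 0"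

definition completion_rel :: "(nat \<Rightarrow> 'a) \<Rightarrow> (nat \<Rightarrow> 'a) \<Rightarrow> bool" where
  "completion_rel X Y \<longleftrightarrow> csCauchy X \<and> csCauchy Y \<and> csnull (\<lambda>n. X n - Y n)"

lemma csCauchy_const: "csCauchy (\<lambda>_. x)"
  by (auto simp: csCauchy_def)

lemma csCauchy_add:
  assumes "csCauchy X" "csCauchy Y"
  shows "csCauchy (\<lambda>n. X n + Y n)"
  unfolding csCauchy_def
proof (intro allI impI)
  fix e :: real assume "e > 0"
  then obtain M N where "\<forall>m\<ge>M. \<forall>n\<ge>M. csnorm (X m - X n) < e / 2"
    "\<forall>m\<ge>N. \<forall>n\<ge>N. csnorm (Y m - Y n) < e / 2"
    using assms unfolding csCauchy_def by (meson half_gt_zero)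
  then have "csnorm (X m + Y m - (X n + Y n)) < e" if "m \<ge> max M N" "n \<ge> max M N" for m n
    using that csnorm_triangle[of "X m - X n" "Y m - Y n"]
    by (auto simp: algebra_simps) (smt (verit, best) field_sum_of_halves)
  then show "\<exists>N. \<forall>m\<ge>N. \<forall>n\<ge>N. csnorm (X m + Y m - (X n + Y n)) < e"
    by blast
qed

lemma csCauchy_scaleC:
  assumes "csCauchy X"
  shows "csCauchy (\<lambda>n. c *\<^sub>C X n)"
  unfolding csCauchy_def
proof (intro allI impI)
  fix e :: real assume e: "e > 0"
  then have "e / (cmod c + 1) > 0"
    by (simp add: add_nonneg_pos)
  then obtain N where N: "\<forall>m\<ge>N. \<forall>n\<ge>N. csnorm (X m - X n) < e / (cmod c + 1)"
    using assms unfolding csCauchy_def by meson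
  have "csnorm (c *\<^sub>C X m - c *\<^sub>C X n) < e" if "m \<ge> N" "n \<ge> N" for m n
  proof -
    have "csnorm (c *\<^sub>C X m - c *\<^sub>C X n) = cmod c * csnorm (X m - X n)"
      by (simp add: scaleC_diff_right[symmetric] csnorm_scaleC)
    also have "\<dots> \<le> (cmod c + 1) * csnorm (X m - X n)"
      by (simp add: mult_right_mono)
    also have "\<dots> < (cmod c + 1) * (e / (cmod c + 1))"
      using N that by (intro mult_strict_left_mono) (auto simp: add_nonneg_pos)
    also have "\<dots> = e" by (smt (verit) norm_ge_zero nonzero_mult_div_cancel_left times_divide_eq_right)
    finally show ?thesis .
  qed
  then show "\<exists>N. \<forall>m\<ge>N. \<forall>n\<ge>N. csnorm (c *\<^sub>C X m - c *\<^sub>C X n) < e" by blast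
qed

lemma csCauchy_uminus:
  assumes "csCauchy X"
  shows "csCauchy (\<lambda>n. - X n)"
  using assms unfolding csCauchy_def
  by (simp add: minus_diff_commute csnorm_minus_commute)

lemma csCauchy_diff: "csCauchy X \<Longrightarrow> csCauchy Y \<Longrightarrow> csCauchy (\<lambda>n. X n - Y n)"
  using csCauchy_add[of X "\<lambda>n. - Y n"] csCauchy_uminus[of Y] by simp

lemma csCauchy_bounded:
  assumes "csCauchy X"
  obtains B where "B > 0" "\<And>n. csnorm (X n) \<le> B"
proof -
  obtain N where N: "\<forall>m\<ge>N. \<forall>n\<ge>N. csnorm (X m - X n) < 1"
    using assms unfolding csCauchy_def by (meson zero_less_one)
  define B where "B = 1 + csnorm (X N) + (\<Sum>i<N. csnorm (X i))"
  have s0: "(\<Sum>i<N. csnorm (X i)) \<ge> 0"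
    by (simp add: sum_nonneg)
  have "csnorm (X n) \<le> B" for n
  proof (cases "n < N")
    case True
    have "csnorm (X n) \<le> (\<Sum>i<N. csnorm (X i))"
      using True by (intro member_le_sum) auto
    then show ?thesis by (simp add: B_def add_increasing)
  next
    case False
    then have "csnorm (X n - X N) < 1" using N by simp
    then show ?thesis using csnorm_triangle[of "X n - X N" "X N"] s0
      by (simp add: B_def)
  qed
  moreover have "B > 0" using s0 csnorm_ge_zero[of "X N"] unfolding B_def by linarith
  ultimately show ?thesis using that by blast
qed

lemma csnull_add: "csnull X \<Longrightarrow> csnull Y \<Longrightarrow> csnull (\<lambda>n. X n + Y n)"
  unfolding csnull_def
proof -
  assume a: "(\<lambda>n. csnorm (X n)) \<longlonglongrightarrow> 0" "(\<lambda>n. csnorm (Y n)) \<longlonglongrightarrow> 0"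
  show "(\<lambda>n. csnorm (X n + Y n)) \<longlonglongrightarrow> 0"
    by (rule tendsto_sandwich[OF _ _ tendsto_const tendsto_add_zero[OF a]])
      (auto simp: csnorm_triangle)
qed

lemma csnull_uminus: "csnull X \<Longrightarrow> csnull (\<lambda>n. - X n)"
  by (simp add: csnull_def csnorm_minus)

lemma csnull_scaleC: "csnull X \<Longrightarrow> csnull (\<lambda>n. c *\<^sub>C X n)"
  unfolding csnull_def csnorm_scaleC by (rule tendsto_mult_right_zero)

lemma completion_part_equivp: "part_equivp completion_rel"
proof (rule part_equivpI)
  show "\<exists>X. completion_rel X X"
    by (rule exI[of _ "\<lambda>_. 0"]) (simp add: completion_rel_def csCauchy_const csnull_def)
  show "symp completion_rel"
    unfolding symp_def completion_rel_def csnull_def by (simp add: csnorm_minus_commute)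
  show "transp completion_rel"
  proof (rule transpI)
    fix X Y Z assume "completion_rel X Y" "completion_rel Y Z"
    then show "completion_rel X Z"
      using csnull_add[of "\<lambda>n. X n - Y n" "\<lambda>n. Y n - Z n"]
      by (simp add: completion_rel_def add_diff_eq)
  qed
qed

lemma completion_rel_add:
  "completion_rel X X' \<Longrightarrow> completion_rel Y Y' \<Longrightarrow> completion_rel (\<lambda>n. X n + Y n) (\<lambda>n. X' n + Y' n)"
  using csnull_add[of "\<lambda>n. X n - X' n" "\<lambda>n. Y n - Y' n"]
  by (auto simp: completion_rel_def csCauchy_add algebra_simps)

lemma completion_rel_uminus:
  "completion_rel X X' \<Longrightarrow> completion_rel (\<lambda>n. - X n) (\<lambda>n. - X' n)"
  using csnull_uminus[of "\<lambda>n. X n - X' n"]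
  by (auto simp: completion_rel_def csCauchy_uminus algebra_simps)

lemma completion_rel_diff:
  "completion_rel X X' \<Longrightarrow> completion_rel Y Y' \<Longrightarrow> completion_rel (\<lambda>n. X n - Y n) (\<lambda>n. X' n - Y' n)"
  using completion_rel_add[of X X' "\<lambda>n. - Y n" "\<lambda>n. - Y' n"] completion_rel_uminus[of Y Y'] by simp

lemma completion_rel_scaleC:
  "completion_rel X X' \<Longrightarrow> completion_rel (\<lambda>n. c *\<^sub>C X n) (\<lambda>n. c *\<^sub>C X' n)"
  using csnull_scaleC[of "\<lambda>n. X n - X' n" c]
  by (auto simp: completion_rel_def csCauchy_scaleC scaleC_diff_right)

lemma cinner_diff_bound:
  "cmod (cinner x y - cinner x' y') \<le> csnorm (x - x') * csnorm y + csnorm x' * csnorm (y - y')"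
proof -
  have "cinner x y - cinner x' y' = cinner (x - x') y + cinner x' (y - y')"
    by (simp add: cinner_diff_left cinner_diff_right)
  then show ?thesis
    using norm_triangle_ineq[of "cinner (x - x') y" "cinner x' (y - y')"]
      cinner_Cauchy_Schwarz[of "x - x'" y] cinner_Cauchy_Schwarz[of x' "y - y'"] by simp
qed

lemma csCauchy_cinner_convergent:
  assumes "csCauchy X" "csCauchy Y"
  shows "convergent (\<lambda>n. cinner (X n) (Y n))"
proof -
  obtain B where B: "B > 0" "\<And>n. csnorm (X n) \<le> B" using csCauchy_bounded[OF assms(1)] by blast
  obtain C where C: "C > 0" "\<And>n. csnorm (Y n) \<le> C" using csCauchy_bounded[OF assms(2)] by blast
  have "Cauchy (\<lambda>n. cinner (X n) (Y n))"
    unfolding Cauchy_iff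
  proof (intro allI impI)
    fix e :: real assume e: "e > 0"
    obtain M where M: "\<forall>m\<ge>M. \<forall>n\<ge>M. csnorm (X m - X n) < e / (2 * C)"
      using assms(1) e C(1) unfolding csCauchy_def by (meson divide_pos_pos mult_pos_pos zero_less_numeral)
    obtain N where N: "\<forall>m\<ge>N. \<forall>n\<ge>N. csnorm (Y m - Y n) < e / (2 * B)"
      using assms(2) e B(1) unfolding csCauchy_def by (meson divide_pos_pos mult_pos_pos zero_less_numeral)
    have "cmod (cinner (X m) (Y m) - cinner (X n) (Y n)) < e" if "m \<ge> max M N" "n \<ge> max M N" for m n
    proof -
      have "csnorm (X m - X n) * csnorm (Y m) \<le> csnorm (X m - X n) * C"
        by (simp add: C mult_left_mono)
      also have "\<dots> < e / (2 * C) * C"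
        using M that C(1) by (intro mult_strict_right_mono) auto
      finally have 1: "csnorm (X m - X n) * csnorm (Y m) < e / 2" using C(1) by simp
      have "csnorm (X n) * csnorm (Y m - Y n) \<le> B * csnorm (Y m - Y n)"
        by (simp add: B mult_right_mono)
      also have "\<dots> < B * (e / (2 * B))"
        using N that B(1) by (intro mult_strict_left_mono) auto
      finally have 2: "csnorm (X n) * csnorm (Y m - Y n) < e / 2" using B(1) by simp
      show ?thesis using 1 2 cinner_diff_bound[of "X m" "Y m" "X n" "Y n"] by linarith
    qed
    then show "\<exists>M. \<forall>m\<ge>M. \<forall>n\<ge>M. cmod (cinner (X m) (Y m) - cinner (X n) (Y n)) < e" by blast
  qed
  then show ?thesis by (rule Cauchy_convergent)
qed

lemma completion_rel_cinner:
  assumes "completion_rel X X'" "completion_rel Y Y'"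
  shows "lim (\<lambda>n. cinner (X n) (Y n)) = lim (\<lambda>n. cinner (X' n) (Y' n))"
proof -
  have c: "csCauchy X" "csCauchy X'" "csCauchy Y" "csCauchy Y'"
    using assms by (auto simp: completion_rel_def)
  obtain B where B: "B > 0" "\<And>n. csnorm (X' n) \<le> B" using csCauchy_bounded[OF c(2)] by blast
  obtain C where C: "C > 0" "\<And>n. csnorm (Y n) \<le> C" using csCauchy_bounded[OF c(3)] by blast
  have n: "(\<lambda>n. csnorm (X n - X' n)) \<longlonglongrightarrow> 0" "(\<lambda>n. csnorm (Y n - Y' n)) \<longlonglongrightarrow> 0"
    using assms by (auto simp: completion_rel_def csnull_def)
  have "(\<lambda>n. csnorm (X n - X' n) * C + B * csnorm (Y n - Y' n)) \<longlonglongrightarrow> 0 * C + B * 0"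
    by (intro tendsto_intros n)
  then have lim0: "(\<lambda>n. csnorm (X n - X' n) * C + B * csnorm (Y n - Y' n)) \<longlonglongrightarrow> 0" by simp
  have "(\<lambda>n. cinner (X n) (Y n) - cinner (X' n) (Y' n)) \<longlonglongrightarrow> 0"
  proof (rule Lim_null_comparison[OF _ lim0], rule always_eventually, rule allI)
    fix n
    have "csnorm (X n - X' n) * csnorm (Y n) \<le> csnorm (X n - X' n) * C"
      "csnorm (X' n) * csnorm (Y n - Y' n) \<le> B * csnorm (Y n - Y' n)"
      by (simp_all add: B C mult_left_mono mult_right_mono)
    then show "cmod (cinner (X n) (Y n) - cinner (X' n) (Y' n)) \<le>
        csnorm (X n - X' n) * C + B * csnorm (Y n - Y' n)"
      using cinner_diff_bound[of "X n" "Y n" "X' n" "Y' n"] by linarith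
  qed
  moreover obtain L where L: "(\<lambda>n. cinner (X' n) (Y' n)) \<longlonglongrightarrow> L"
    using csCauchy_cinner_convergent[OF c(2,4)] by (auto simp: convergent_def)
  ultimately have "(\<lambda>n. cinner (X n) (Y n) - cinner (X' n) (Y' n) + cinner (X' n) (Y' n)) \<longlonglongrightarrow> 0 + L"
    by (rule tendsto_add)
  then show ?thesis using L by (simp add: limI)
qed

end

lemma csnorm_eq_norm: "csnorm (x :: 'a :: complex_inner) = norm x"
  by (simp add: csnorm_def norm_eq_sqrt_inner inner_eq_Re_cinner)

text \<open>The Hilbert space completion of a space with a positive semidefinite inner product:
  Cauchy sequences modulo null sequences (so null vectors are divided out).\<close>

quotient_type (overloaded) 'a hcompletion =
  "nat \<Rightarrow> 'a :: complex_semi_inner" / partial: "completion_rel"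
  by (rule completion_part_equivp)

instantiation hcompletion :: (complex_semi_inner) complex_inner
begin

lift_definition zero_hcompletion :: "'a hcompletion" is "\<lambda>_. 0"
  by (simp add: completion_rel_def csCauchy_const csnull_def)

lift_definition plus_hcompletion :: "'a hcompletion \<Rightarrow> 'a hcompletion \<Rightarrow> 'a hcompletion"
  is "\<lambda>X Y n. X n + Y n" by (rule completion_rel_add)

lift_definition uminus_hcompletion :: "'a hcompletion \<Rightarrow> 'a hcompletion"
  is "\<lambda>X n. - X n" by (rule completion_rel_uminus)

lift_definition minus_hcompletion :: "'a hcompletion \<Rightarrow> 'a hcompletion \<Rightarrow> 'a hcompletion"
  is "\<lambda>X Y n. X n - Y n" by (rule completion_rel_diff)

lift_definition scaleC_hcompletion :: "complex \<Rightarrow> 'a hcompletion \<Rightarrow> 'a hcompletion"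
  is "\<lambda>c X n. c *\<^sub>C X n" by (rule completion_rel_scaleC)

lift_definition cinner_hcompletion :: "'a hcompletion \<Rightarrow> 'a hcompletion \<Rightarrow> complex"
  is "\<lambda>X Y. lim (\<lambda>n. cinner (X n) (Y n))" by (rule completion_rel_cinner)

definition "scaleR r x = complex_of_real r *\<^sub>C (x :: 'a hcompletion)"
definition "inner x y = Re (cinner x (y :: 'a hcompletion))"
definition "norm x = sqrt (inner x (x :: 'a hcompletion))"
definition "dist x y = norm (x - y :: 'a hcompletion)"
definition "sgn x = inverse (norm x) *\<^sub>R (x :: 'a hcompletion)"
definition uniformity_hcompletion :: "('a hcompletion \<times> 'a hcompletion) filter" where
  "uniformity_hcompletion = (INF e\<in>{0<..}. principal {(x, y). dist x y < e})"
definition open_hcompletion :: "'a hcompletion set \<Rightarrow> bool" where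
  "open_hcompletion U \<longleftrightarrow> (\<forall>x\<in>U. \<forall>\<^sub>F (x', y) in uniformity. x' = x \<longrightarrow> y \<in> U)"

instance
proof
  fix x y z :: "'a hcompletion" and c d :: complex and r s :: real and U :: "'a hcompletion set"
  show g1: "x + y + z = x + (y + z)"
    by transfer (simp add: completion_rel_def csCauchy_add csnull_def add.assoc)
  show g2: "x + y = y + x"
    by transfer (simp add: completion_rel_def csCauchy_add csnull_def add.commute)
  show g3: "0 + x = x" by transfer simp
  show g4: "- x + x = 0"
    by transfer (simp add: completion_rel_def csCauchy_const csnull_def)
  show g5: "x - y = x + - y"
    by transfer (simp add: completion_rel_def csCauchy_diff csnull_def)
  have s1: "c *\<^sub>C (x + y) = c *\<^sub>C x + c *\<^sub>C y" for c
    by transfer (simp add: completion_rel_def csCauchy_add csCauchy_scaleC csnull_def scaleC_add_right)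
  have s2: "(c + d) *\<^sub>C x = c *\<^sub>C x + d *\<^sub>C x" for c d
    by transfer (simp add: completion_rel_def csCauchy_add csCauchy_scaleC csnull_def scaleC_add_left)
  have s3: "c *\<^sub>C d *\<^sub>C x = (c * d) *\<^sub>C x" for c d
    by transfer (simp add: completion_rel_def csCauchy_add csCauchy_scaleC csnull_def scaleC_scaleC)
  have s4: "1 *\<^sub>C x = x"
    by transfer (simp add: completion_rel_def csCauchy_add csCauchy_scaleC csnull_def scaleC_one)
  show "c *\<^sub>C (x + y) = c *\<^sub>C x + c *\<^sub>C y" "(c + d) *\<^sub>C x = c *\<^sub>C x + d *\<^sub>C x"
    "c *\<^sub>C d *\<^sub>C x = (c * d) *\<^sub>C x" "1 *\<^sub>C x = x"
    by (rule s1, rule s2, rule s3, rule s4)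
  show "r *\<^sub>R (x + y) = r *\<^sub>R x + r *\<^sub>R y" "(r + s) *\<^sub>R x = r *\<^sub>R x + s *\<^sub>R x"
    "r *\<^sub>R s *\<^sub>R x = (r * s) *\<^sub>R x" "1 *\<^sub>R x = x"
    by (simp_all add: scaleR_hcompletion_def s1 s2 s3 s4)
  have i1: "cinner (x + y) z = cinner x z + cinner y z" for x y z :: "'a hcompletion"
  proof transfer
    fix X Y Z :: "nat \<Rightarrow> 'a"
    assume "completion_rel X X" "completion_rel Y Y" "completion_rel Z Z"
    then have "convergent (\<lambda>n. cinner (X n) (Z n))" "convergent (\<lambda>n. cinner (Y n) (Z n))"
      by (auto simp: completion_rel_def csCauchy_cinner_convergent)
    then show "lim (\<lambda>n. cinner (X n + Y n) (Z n)) = lim (\<lambda>n. cinner (X n) (Z n)) + lim (\<lambda>n. cinner (Y n) (Z n))"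
      unfolding cinner_add_left by (intro limI tendsto_add) (auto simp: convergent_LIMSEQ_iff)
  qed
  have i2: "cinner (c *\<^sub>C x) y = c * cinner x y" for c and x y :: "'a hcompletion"
  proof transfer
    fix c and X Y :: "nat \<Rightarrow> 'a"
    assume "completion_rel X X" "completion_rel Y Y"
    then have "convergent (\<lambda>n. cinner (X n) (Y n))"
      by (auto simp: completion_rel_def csCauchy_cinner_convergent)
    then show "lim (\<lambda>n. cinner (c *\<^sub>C X n) (Y n)) = c * lim (\<lambda>n. cinner (X n) (Y n))"
      unfolding cinner_scaleC_left by (intro limI tendsto_mult) (auto simp: convergent_LIMSEQ_iff)
  qed
  have i3: "cinner x y = cnj (cinner y x)" for x y :: "'a hcompletion"
  proof transfer
    fix X Y :: "nat \<Rightarrow> 'a"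
    assume "completion_rel X X" "completion_rel Y Y"
    then have "convergent (\<lambda>n. cinner (Y n) (X n))"
      by (auto simp: completion_rel_def csCauchy_cinner_convergent)
    then have "(\<lambda>n. cnj (cinner (Y n) (X n))) \<longlonglongrightarrow> cnj (lim (\<lambda>n. cinner (Y n) (X n)))"
      by (intro tendsto_cnj) (auto simp: convergent_LIMSEQ_iff)
    then show "lim (\<lambda>n. cinner (X n) (Y n)) = cnj (lim (\<lambda>n. cinner (Y n) (X n)))"
      unfolding cinner_commute[symmetric] by (rule limI)
  qed
  have i4: "0 \<le> Re (cinner x x) \<and> (Re (cinner x x) = 0 \<longrightarrow> x = 0)" for x :: "'a hcompletion"
  proof transfer
    fix X :: "nat \<Rightarrow> 'a"
    assume X: "completion_rel X X"
    then have "convergent (\<lambda>n. cinner (X n) (X n))"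
      by (auto simp: completion_rel_def csCauchy_cinner_convergent)
    then have *: "(\<lambda>n. Re (cinner (X n) (X n))) \<longlonglongrightarrow> Re (lim (\<lambda>n. cinner (X n) (X n)))"
      by (intro tendsto_Re) (auto simp: convergent_LIMSEQ_iff)
    then have "0 \<le> Re (lim (\<lambda>n. cinner (X n) (X n)))"
      by (rule LIMSEQ_le_const) (auto simp: cinner_ge_zero)
    moreover have "completion_rel X (\<lambda>_. 0)" if "Re (lim (\<lambda>n. cinner (X n) (X n))) = 0"
      using X tendsto_real_sqrt[OF *] that
      by (simp add: completion_rel_def csnull_def csCauchy_const csnorm_def[symmetric])
    ultimately show "0 \<le> Re (lim (\<lambda>n. cinner (X n) (X n))) \<and>
        (Re (lim (\<lambda>n. cinner (X n) (X n))) = 0 \<longrightarrow> completion_rel X (\<lambda>_. 0))"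
      by blast
  qed
  have i5: "cinner 0 (0 :: 'a hcompletion) = 0"
    by transfer simp
  show "cinner (x + y) z = cinner x z + cinner y z" "cinner (c *\<^sub>C x) y = c * cinner x y"
    "cinner x y = cnj (cinner y x)" "0 \<le> Re (cinner x x)"
    by (rule i1, rule i2, rule i3, rule i4[THEN conjunct1])
  show "inner x y = inner y x"
    using arg_cong[OF i3[of x y], of Re] by (simp only: inner_hcompletion_def cnj.sel)
  show "inner (x + y) z = inner x z + inner y z" by (simp add: inner_hcompletion_def i1)
  show "inner (r *\<^sub>R x) y = r * inner x y"
    by (simp add: inner_hcompletion_def scaleR_hcompletion_def i2)
  show "0 \<le> inner x x" using i4 by (simp add: inner_hcompletion_def)
  show "inner x x = 0 \<longleftrightarrow> x = 0" using i4[of x] i5 by (auto simp: inner_hcompletion_def)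
  show "norm x = sqrt (inner x x)" "dist x y = norm (x - y)" "sgn x = inverse (norm x) *\<^sub>R x"
    by (simp_all add: norm_hcompletion_def dist_hcompletion_def sgn_hcompletion_def)
  show "uniformity = (INF e\<in>{0<..}. principal {(x, y :: 'a hcompletion). dist x y < e})"
    by (rule uniformity_hcompletion_def)
  show "open U \<longleftrightarrow> (\<forall>x\<in>U. \<forall>\<^sub>F (x', y) in uniformity. x' = x \<longrightarrow> y \<in> U)"
    by (rule open_hcompletion_def)
  show "r *\<^sub>R x = complex_of_real r *\<^sub>C x" "inner x y = Re (cinner x y)"
    by (simp_all add: scaleR_hcompletion_def inner_hcompletion_def)
qed

end

lift_definition to_completion :: "'a :: complex_semi_inner \<Rightarrow> 'a hcompletion" is "\<lambda>x _. x"
  by (simp add: completion_rel_def csCauchy_const csnull_def)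

lemma cinner_to_completion: "cinner (to_completion x) (to_completion y) = cinner x y"
  by transfer simp

lemma to_completion_diff: "to_completion (x - y) = to_completion x - to_completion y"
  by transfer (simp add: completion_rel_def csCauchy_const csnull_def)

lemma norm_to_completion: "norm (to_completion x) = csnorm x"
  by (simp add: csnorm_eq_norm[symmetric]) (simp add: csnorm_def cinner_to_completion)

lemma norm_abs_hcompletion:
  assumes "csCauchy X"
  shows "(\<lambda>n. csnorm (X n)) \<longlonglongrightarrow> norm (abs_hcompletion X)"
proof -
  have X: "completion_rel X X"
    using assms by (simp add: completion_rel_def csnull_def)
  have "cinner (abs_hcompletion X) (abs_hcompletion X) = lim (\<lambda>n. cinner (X n) (X n))"
    using X by (simp add: cinner_hcompletion.abs_eq)
  then have "(\<lambda>n. cinner (X n) (X n)) \<longlonglongrightarrow> cinner (abs_hcompletion X) (abs_hcompletion X)"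
    using csCauchy_cinner_convergent[OF assms assms] by (simp add: convergent_LIMSEQ_iff)
  then have "(\<lambda>n. sqrt (Re (cinner (X n) (X n)))) \<longlonglongrightarrow>
      sqrt (Re (cinner (abs_hcompletion X) (abs_hcompletion X)))"
    by (intro tendsto_real_sqrt tendsto_Re)
  then show ?thesis
    by (simp add: csnorm_def[symmetric] csnorm_eq_norm)
qed

lemma to_completion_LIMSEQ:
  assumes "csCauchy X"
  shows "(\<lambda>n. to_completion (X n)) \<longlonglongrightarrow> abs_hcompletion X"
  unfolding LIMSEQ_iff
proof (intro allI impI)
  fix e :: real assume e: "e > 0"
  obtain N where N: "\<forall>m\<ge>N. \<forall>n\<ge>N. csnorm (X m - X n) < e / 2"
    using assms e unfolding csCauchy_def by (meson half_gt_zero)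
  have X: "completion_rel X X"
    using assms by (simp add: completion_rel_def csnull_def)
  have "norm (to_completion (X n) - abs_hcompletion X) < e" if "n \<ge> N" for n
  proof -
    have c: "completion_rel (\<lambda>_. X n) (\<lambda>_. X n)"
      by (simp add: completion_rel_def csCauchy_const csnull_def)
    have eq: "to_completion (X n) - abs_hcompletion X = abs_hcompletion (\<lambda>k. X n - X k)"
      using X c by (simp add: to_completion.abs_eq to_completion_def minus_hcompletion.abs_eq)
    have "csCauchy (\<lambda>k. X n - X k)"
      using completion_rel_diff[OF c X] by (simp add: completion_rel_def)
    then have "(\<lambda>k. csnorm (X n - X k)) \<longlonglongrightarrow> norm (to_completion (X n) - abs_hcompletion X)"
      unfolding eq by (rule norm_abs_hcompletion)
    then have "norm (to_completion (X n) - abs_hcompletion X) \<le> e / 2"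
      by (rule LIMSEQ_le_const2) (use N that in \<open>auto intro!: exI[of _ N] less_imp_le\<close>)
    then show ?thesis using e by simp
  qed
  then show "\<exists>N. \<forall>n\<ge>N. norm (to_completion (X n) - abs_hcompletion X) < e" by blast
qed

lemma to_completion_dense:
  assumes "e > 0"
  shows "\<exists>y. norm (x - to_completion y) < e"
proof -
  obtain X where X: "csCauchy X" "x = abs_hcompletion X"
    by (induction x rule: hcompletion.abs_induct) (auto simp: completion_rel_def)
  show ?thesis
    using LIMSEQ_D[OF to_completion_LIMSEQ[OF X(1)] assms] unfolding X(2)
    by (auto simp: norm_minus_commute)
qed

instance hcompletion :: (complex_semi_inner) complex_hilbert
proof
  fix Y :: "nat \<Rightarrow> 'a hcompletion" assume Y: "Cauchy Y"
  have "\<exists>y. norm (Y n - to_completion y) < 1 / Suc n" for n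
    by (rule to_completion_dense) simp
  then obtain X where X: "norm (Y n - to_completion (X n)) < 1 / Suc n" for n
    using choice[of "\<lambda>n y. norm (Y n - to_completion y) < 1 / Suc n"] by blast
  have d0: "(\<lambda>n. Y n - to_completion (X n)) \<longlonglongrightarrow> 0"
    by (rule Lim_null_comparison[OF _ LIMSEQ_inverse_real_of_nat])
      (use X in \<open>auto intro!: always_eventually less_imp_le simp: divide_inverse\<close>)
  have "Cauchy (\<lambda>n. to_completion (X n))"
    unfolding Cauchy_iff
  proof (intro allI impI)
    fix e :: real assume e: "e > 0"
    obtain M where M: "\<forall>m\<ge>M. \<forall>n\<ge>M. norm (Y m - Y n) < e / 3"
      using Y e unfolding Cauchy_iff by (meson divide_pos_pos zero_less_numeral)
    obtain N where N: "\<forall>n\<ge>N. norm (Y n - to_completion (X n)) < e / 3"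
      using LIMSEQ_D[OF d0, of "e / 3"] e by auto
    have "norm (to_completion (X m) - to_completion (X n)) < e" if "m \<ge> max M N" "n \<ge> max M N" for m n
    proof -
      have "to_completion (X m) - to_completion (X n) =
          (Y m - Y n) - (Y m - to_completion (X m)) + (Y n - to_completion (X n))" by simp
      also have "norm \<dots> \<le> norm (Y m - Y n) + norm (Y m - to_completion (X m)) + norm (Y n - to_completion (X n))"
        by (meson add_right_mono norm_triangle_ineq norm_triangle_ineq4 order_trans)
      also have "\<dots> < e / 3 + e / 3 + e / 3"
        using M N that by (intro add_strict_mono) auto
      finally show ?thesis by simp
    qed
    then show "\<exists>M. \<forall>m\<ge>M. \<forall>n\<ge>M. norm (to_completion (X m) - to_completion (X n)) < e" by blast
  qed
  then have "csCauchy X"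
    by (simp add: Cauchy_iff csCauchy_def norm_to_completion to_completion_diff[symmetric])
  from tendsto_add[OF d0 to_completion_LIMSEQ[OF this]] show "convergent Y"
    by (auto simp: convergent_def)
qed

lemma norm_scaleC: "norm (c *\<^sub>C x) = cmod c * norm (x :: 'a :: complex_inner)"
  using csnorm_scaleC[of c x] by (simp add: csnorm_eq_norm)

lemma norm_cinner_le: "cmod (cinner x y) \<le> norm x * norm (y :: 'a :: complex_inner)"
  using cinner_Cauchy_Schwarz[of x y] by (simp add: csnorm_eq_norm)

lemma cinner_self_norm: "cinner x x = complex_of_real ((norm (x :: 'a :: complex_inner))\<^sup>2)"
  by (subst cinner_self_real) (simp only: csnorm_power2[symmetric] csnorm_eq_norm)

lemma bounded_linear_scaleC: "bounded_linear (\<lambda>x :: 'a :: complex_inner. c *\<^sub>C x)"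
proof (rule bounded_linear_intro[where K = "cmod c"])
  show "c *\<^sub>C r *\<^sub>R x = r *\<^sub>R c *\<^sub>C x" for r and x :: 'a
    by (simp add: scaleR_scaleC scaleC_scaleC mult.commute)
qed (simp_all add: scaleC_add_right norm_scaleC mult.commute)

lemma bounded_bilinear_cinner: "bounded_bilinear (cinner :: 'a :: complex_inner \<Rightarrow> 'a \<Rightarrow> complex)"
proof
  show "\<exists>K. \<forall>a b :: 'a. cmod (cinner a b) \<le> norm a * norm b * K"
    by (rule exI[of _ 1]) (simp add: norm_cinner_le)
  show "cinner (r *\<^sub>R x) y = r *\<^sub>R cinner x y" "cinner x (r *\<^sub>R y) = r *\<^sub>R cinner x y"
    for r and x y :: 'a
    by (simp_all only: scaleR_scaleC[where 'a = 'a] cinner_scaleC_left cinner_scaleC_right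
        scaleR_conv_of_real complex_cnj_complex_of_real)
qed (simp_all add: cinner_add_left cinner_add_right)

subsection \<open>Square summable families\<close>

typedef 'i ell2 = "{z :: 'i \<Rightarrow> complex. (\<lambda>i. (cmod (z i))\<^sup>2) summable_on UNIV}"
  morphisms ell2_nth Abs_ell2
  by (rule exI[of _ "\<lambda>_. 0"]) simp

setup_lifting type_definition_ell2

lemma ell2_mult_abs_summable:
  fixes z w :: "'i \<Rightarrow> complex"
  assumes "(\<lambda>i. (cmod (z i))\<^sup>2) summable_on UNIV" "(\<lambda>i. (cmod (w i))\<^sup>2) summable_on UNIV"
  shows "(\<lambda>i. cmod (z i) * cmod (w i)) summable_on UNIV"
proof (rule summable_on_comparison_test)
  show "(\<lambda>i. (cmod (z i))\<^sup>2 + (cmod (w i))\<^sup>2) summable_on UNIV"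
    by (rule summable_on_add[OF assms])
  show "cmod (z i) * cmod (w i) \<le> (cmod (z i))\<^sup>2 + (cmod (w i))\<^sup>2" for i
    using sum_squares_bound[of "cmod (z i)" "cmod (w i)"] mult_nonneg_nonneg[OF norm_ge_zero[of "z i"] norm_ge_zero[of "w i"]]
    by linarith
qed auto

lemma ell2_mult_summable:
  fixes z w :: "'i \<Rightarrow> complex"
  assumes "(\<lambda>i. (cmod (z i))\<^sup>2) summable_on UNIV" "(\<lambda>i. (cmod (w i))\<^sup>2) summable_on UNIV"
  shows "(\<lambda>i. z i * cnj (w i)) summable_on UNIV"
  by (rule abs_summable_summable) (simp add: norm_mult ell2_mult_abs_summable[OF assms])

instantiation ell2 :: (type) complex_inner
begin

lift_definition zero_ell2 :: "'a ell2" is "\<lambda>_. 0" by simp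

lift_definition plus_ell2 :: "'a ell2 \<Rightarrow> 'a ell2 \<Rightarrow> 'a ell2" is "\<lambda>z w i. z i + w i"
proof -
  fix z w :: "'a \<Rightarrow> complex"
  assume *: "(\<lambda>i. (cmod (z i))\<^sup>2) summable_on UNIV" "(\<lambda>i. (cmod (w i))\<^sup>2) summable_on UNIV"
  show "(\<lambda>i. (cmod (z i + w i))\<^sup>2) summable_on UNIV"
  proof (rule summable_on_comparison_test)
    show "(\<lambda>i. (cmod (z i))\<^sup>2 + (cmod (w i))\<^sup>2 + 2 * (cmod (z i) * cmod (w i))) summable_on UNIV"
      by (intro summable_on_add summable_on_cmult_right ell2_mult_abs_summable *)
    show "(cmod (z i + w i))\<^sup>2 \<le> (cmod (z i))\<^sup>2 + (cmod (w i))\<^sup>2 + 2 * (cmod (z i) * cmod (w i))" for i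
      using power_mono[OF norm_triangle_ineq[of "z i" "w i"], of 2] by (simp add: power2_sum)
  qed auto
qed

lift_definition uminus_ell2 :: "'a ell2 \<Rightarrow> 'a ell2" is "\<lambda>z i. - z i" by simp

definition "z - w = z + - (w :: 'a ell2)"

lift_definition scaleC_ell2 :: "complex \<Rightarrow> 'a ell2 \<Rightarrow> 'a ell2" is "\<lambda>c z i. c * z i"
  by (simp add: norm_mult power_mult_distrib summable_on_cmult_right)

lift_definition cinner_ell2 :: "'a ell2 \<Rightarrow> 'a ell2 \<Rightarrow> complex"
  is "\<lambda>z w. \<Sum>\<^sub>\<infinity>i. z i * cnj (w i)" .

definition "scaleR r z = complex_of_real r *\<^sub>C (z :: 'a ell2)"
definition "inner z w = Re (cinner z (w :: 'a ell2))"
definition "norm z = sqrt (inner z (z :: 'a ell2))"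
definition "dist z w = norm (z - w :: 'a ell2)"
definition "sgn z = inverse (norm z) *\<^sub>R (z :: 'a ell2)"
definition uniformity_ell2 :: "('a ell2 \<times> 'a ell2) filter" where
  "uniformity_ell2 = (INF e\<in>{0<..}. principal {(x, y). dist x y < e})"
definition open_ell2 :: "'a ell2 set \<Rightarrow> bool" where
  "open_ell2 U \<longleftrightarrow> (\<forall>x\<in>U. \<forall>\<^sub>F (x', y) in uniformity. x' = x \<longrightarrow> y \<in> U)"

instance
proof
  fix x y z :: "'a ell2" and c d :: complex and r s :: real and U :: "'a ell2 set"
  show "x + y + z = x + (y + z)" by transfer (simp add: add.assoc)
  show "x + y = y + x" by transfer (simp add: add.commute)
  show g3: "0 + x = x" by transfer simp
  show "- x + x = 0" by transfer simp
  show "x - y = x + - y" by (rule minus_ell2_def)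
  have s1: "c *\<^sub>C (x + y) = c *\<^sub>C x + c *\<^sub>C y" for c by transfer (simp add: algebra_simps)
  have s2: "(c + d) *\<^sub>C x = c *\<^sub>C x + d *\<^sub>C x" for c d by transfer (simp add: algebra_simps)
  have s3: "c *\<^sub>C d *\<^sub>C x = (c * d) *\<^sub>C x" for c d by transfer (simp add: algebra_simps)
  have s4: "1 *\<^sub>C x = x" by transfer simp
  show "c *\<^sub>C (x + y) = c *\<^sub>C x + c *\<^sub>C y" "(c + d) *\<^sub>C x = c *\<^sub>C x + d *\<^sub>C x"
    "c *\<^sub>C d *\<^sub>C x = (c * d) *\<^sub>C x" "1 *\<^sub>C x = x"
    by (rule s1, rule s2, rule s3, rule s4)
  show "r *\<^sub>R (x + y) = r *\<^sub>R x + r *\<^sub>R y" "(r + s) *\<^sub>R x = r *\<^sub>R x + s *\<^sub>R x"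
    "r *\<^sub>R s *\<^sub>R x = (r * s) *\<^sub>R x" "1 *\<^sub>R x = x"
    by (simp_all add: scaleR_ell2_def s1 s2 s3 s4)
  have i1: "cinner (x + y) z = cinner x z + cinner y z"
    by transfer (simp add: distrib_right infsum_add ell2_mult_summable)
  have i2: "cinner (c *\<^sub>C x) y = c * cinner x y" for c
    by transfer (simp add: mult.assoc infsum_cmult_right')
  have i3: "cinner x y = cnj (cinner y x)" for y
    by transfer (simp add: infsum_cnj[symmetric] mult.commute del: infsum_cnj)
  have i4: "cinner x x = complex_of_real (\<Sum>\<^sub>\<infinity>i. (cmod (ell2_nth x i))\<^sup>2)"
  proof transfer
    fix z :: "'a \<Rightarrow> complex"
    assume "(\<lambda>i. (cmod (z i))\<^sup>2) summable_on UNIV"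
    then have "((\<lambda>i. complex_of_real ((cmod (z i))\<^sup>2)) has_sum complex_of_real (\<Sum>\<^sub>\<infinity>i. (cmod (z i))\<^sup>2)) UNIV"
      by (intro has_sum_of_real has_sum_infsum)
    then show "(\<Sum>\<^sub>\<infinity>i. z i * cnj (z i)) = complex_of_real (\<Sum>\<^sub>\<infinity>i. (cmod (z i))\<^sup>2)"
      by (simp only: complex_norm_square infsumI)
  qed
  have i5: "0 \<le> Re (cinner x x)"
    unfolding i4 by (simp add: infsum_nonneg)
  have i6: "Re (cinner x x) = 0 \<longleftrightarrow> x = 0"
  proof
    assume "Re (cinner x x) = 0"
    then have *: "(\<Sum>\<^sub>\<infinity>i. (cmod (ell2_nth x i))\<^sup>2) = 0" unfolding i4 by simp
    have "(cmod (ell2_nth x i))\<^sup>2 = 0" for i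
      by (rule nonneg_infsum_le_0D[of _ UNIV]) (use * ell2_nth[of x] in auto)
    then show "x = 0" by (simp add: ell2_nth_inject[symmetric] zero_ell2.rep_eq fun_eq_iff)
  next
    assume "x = 0"
    then show "Re (cinner x x) = 0" by transfer simp
  qed
  show "cinner (x + y) z = cinner x z + cinner y z" "cinner (c *\<^sub>C x) y = c * cinner x y"
    "cinner x y = cnj (cinner y x)" "0 \<le> Re (cinner x x)"
    by (rule i1, rule i2, rule i3, rule i5)
  show "inner x y = inner y x"
    using arg_cong[OF i3[of y], of Re] by (simp only: inner_ell2_def cnj.sel)
  show "inner (x + y) z = inner x z + inner y z" by (simp add: inner_ell2_def i1)
  show "inner (r *\<^sub>R x) y = r * inner x y" by (simp add: inner_ell2_def scaleR_ell2_def i2)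
  show "0 \<le> inner x x" using i5 by (simp add: inner_ell2_def)
  show "inner x x = 0 \<longleftrightarrow> x = 0" using i6 by (simp add: inner_ell2_def)
  show "norm x = sqrt (inner x x)" "dist x y = norm (x - y)" "sgn x = inverse (norm x) *\<^sub>R x"
    by (simp_all add: norm_ell2_def dist_ell2_def sgn_ell2_def)
  show "uniformity = (INF e\<in>{0<..}. principal {(x, y :: 'a ell2). dist x y < e})"
    by (rule uniformity_ell2_def)
  show "open U \<longleftrightarrow> (\<forall>x\<in>U. \<forall>\<^sub>F (x', y) in uniformity. x' = x \<longrightarrow> y \<in> U)"
    by (rule open_ell2_def)
  show "r *\<^sub>R x = complex_of_real r *\<^sub>C x" "inner x y = Re (cinner x y)"
    by (simp_all add: scaleR_ell2_def inner_ell2_def)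
qed

end

lift_definition ell2_delta :: "'i \<Rightarrow> 'i ell2" is "\<lambda>i j. if j = i then 1 else 0"
proof -
  fix i :: 'i
  have "(\<lambda>j. (cmod (if j = i then 1 else 0))\<^sup>2) summable_on {i}" by simp
  then show "(\<lambda>j. (cmod (if j = i then 1 else 0))\<^sup>2) summable_on UNIV"
    by (rule summable_on_cong_neutral[THEN iffD1, rotated -1]) auto
qed

subsection \<open>Bochner spaces\<close>

text \<open>Bochner's notion of measurability, which for the nonseparable space \<^typ>\<open>'i ell2\<close> is stronger than
  \<^const>\<open>borel_measurable\<close>; the library's Bochner integral is restricted to
  \<^class>\<open>second_countable_topology\<close> and therefore does not apply to it.\<close>

definition strongly_measurable :: "'a measure \<Rightarrow> ('a \<Rightarrow> 'b :: topological_space) \<Rightarrow> bool" where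
  "strongly_measurable M f \<longleftrightarrow>
    (\<exists>s. (\<forall>n. simple_function M (s n)) \<and> (\<forall>x\<in>space M. (\<lambda>n. s n x) \<longlonglongrightarrow> f x))"

definition has_strong_integral :: "'a measure \<Rightarrow> ('a \<Rightarrow> 'b :: real_normed_vector) \<Rightarrow> 'b \<Rightarrow> bool" where
  "has_strong_integral M f I \<longleftrightarrow> strongly_measurable M f \<and>
    (\<exists>s. (\<forall>n. Bochner_Integration.simple_bochner_integrable M (s n)) \<and>
      (\<lambda>n. \<integral>\<^sup>+ x. ennreal (norm (f x - s n x)) \<partial>M) \<longlonglongrightarrow> 0 \<and>
      (\<lambda>n. Bochner_Integration.simple_bochner_integral M (s n)) \<longlonglongrightarrow> I)"

definition strong_integral :: "'a measure \<Rightarrow> ('a \<Rightarrow> 'b :: real_normed_vector) \<Rightarrow> 'b" where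
  "strong_integral M f =
    (if \<exists>I. has_strong_integral M f I then THE I. has_strong_integral M f I else 0)"

definition square_integrable :: "('a :: euclidean_space \<Rightarrow> 'b :: real_normed_vector) \<Rightarrow> bool" where
  "square_integrable f \<longleftrightarrow> strongly_measurable lborel f \<and> integrable lborel (\<lambda>x. (norm (f x))\<^sup>2)"

lemma strongly_measurable_compose2:
  assumes "strongly_measurable M f" "strongly_measurable M g"
    and h: "\<And>x y X Y. X \<longlonglongrightarrow> x \<Longrightarrow> Y \<longlonglongrightarrow> y \<Longrightarrow> (\<lambda>n. h (X n) (Y n)) \<longlonglongrightarrow> h x y"
  shows "strongly_measurable M (\<lambda>x. h (f x) (g x))"
proof -
  obtain s t where "\<forall>n. simple_function M (s n)" "\<forall>x\<in>space M. (\<lambda>n. s n x) \<longlonglongrightarrow> f x"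
    "\<forall>n. simple_function M (t n)" "\<forall>x\<in>space M. (\<lambda>n. t n x) \<longlonglongrightarrow> g x"
    using assms(1,2) unfolding strongly_measurable_def by blast
  then show ?thesis
    unfolding strongly_measurable_def
    by (intro exI[of _ "\<lambda>n x. h (s n x) (t n x)"]) (auto intro: h simple_function_compose2)
qed

lemma strongly_measurable_const: "strongly_measurable M (\<lambda>_. c)"
  unfolding strongly_measurable_def by (intro exI[of _ "\<lambda>_ _. c"]) auto

lemma strongly_measurable_borel:
  fixes f :: "'a \<Rightarrow> 'b :: {second_countable_topology, metric_space}"
  assumes "strongly_measurable M f"
  shows "f \<in> borel_measurable M"
proof -
  obtain s where s: "\<forall>n. simple_function M (s n)" "\<forall>x\<in>space M. (\<lambda>n. s n x) \<longlonglongrightarrow> f x"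
    using assms unfolding strongly_measurable_def by blast
  show ?thesis
  proof (rule borel_measurable_LIMSEQ_metric)
    show "s n \<in> borel_measurable M" for n
      using s(1) by (simp add: borel_measurable_simple_function)
    show "(\<lambda>n. s n x) \<longlonglongrightarrow> f x" if "x \<in> space M" for x
      using s(2) that by simp
  qed
qed

lemma strongly_measurable_add:
  fixes f g :: "'a \<Rightarrow> 'b :: real_normed_vector"
  shows "strongly_measurable M f \<Longrightarrow> strongly_measurable M g \<Longrightarrow> strongly_measurable M (\<lambda>x. f x + g x)"
  by (rule strongly_measurable_compose2) (auto intro: tendsto_add)

lemma strongly_measurable_scaleC:
  fixes f :: "'a \<Rightarrow> 'b :: complex_inner"
  shows "strongly_measurable M f \<Longrightarrow> strongly_measurable M (\<lambda>x. c *\<^sub>C f x)"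
  by (rule strongly_measurable_compose2[where h = "\<lambda>x _. c *\<^sub>C x", OF _ strongly_measurable_const[of _ c]])
    (auto intro: bounded_linear.tendsto[OF bounded_linear_scaleC])

lemma strongly_measurable_cinner:
  fixes f g :: "'a \<Rightarrow> 'b :: complex_inner"
  shows "strongly_measurable M f \<Longrightarrow> strongly_measurable M g \<Longrightarrow>
    (\<lambda>x. cinner (f x) (g x)) \<in> borel_measurable M"
  by (rule strongly_measurable_borel, rule strongly_measurable_compose2)
    (auto intro: bounded_bilinear.tendsto[OF bounded_bilinear_cinner])

lemma strongly_measurable_norm:
  fixes f :: "'a \<Rightarrow> 'b :: real_normed_vector"
  assumes "strongly_measurable M f"
  shows "(\<lambda>x. norm (f x)) \<in> borel_measurable M"
  by (rule strongly_measurable_borel,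
      rule strongly_measurable_compose2[where h = "\<lambda>x _. norm x", OF assms strongly_measurable_const[of _ 0]])
    (auto intro: tendsto_norm)

lemma square_integrable_0: "square_integrable (\<lambda>_. 0)"
  by (simp add: square_integrable_def strongly_measurable_const)

lemma square_integrable_add:
  assumes "square_integrable f" "square_integrable g"
  shows "square_integrable (\<lambda>x. f x + g x)"
proof -
  have m: "strongly_measurable lborel (\<lambda>x. f x + g x)"
    using assms by (simp add: square_integrable_def strongly_measurable_add)
  have "integrable lborel (\<lambda>x. (norm (f x + g x))\<^sup>2)"
  proof (rule Bochner_Integration.integrable_bound)
    show "integrable lborel (\<lambda>x. 2 * (norm (f x))\<^sup>2 + 2 * (norm (g x))\<^sup>2)"
      using assms by (simp add: square_integrable_def)
    show "(\<lambda>x. (norm (f x + g x))\<^sup>2) \<in> borel_measurable lborel"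
      using strongly_measurable_norm[OF m] by simp
    have "(norm (f x + g x))\<^sup>2 \<le> 2 * (norm (f x))\<^sup>2 + 2 * (norm (g x))\<^sup>2" for x
    proof -
      have "(norm (f x + g x))\<^sup>2 \<le> (norm (f x) + norm (g x))\<^sup>2"
        by (rule power_mono[OF norm_triangle_ineq]) simp
      also have "\<dots> \<le> 2 * (norm (f x))\<^sup>2 + 2 * (norm (g x))\<^sup>2"
        using sum_squares_bound[of "norm (f x)" "norm (g x)"] by (simp add: power2_sum)
      finally show ?thesis .
    qed
    then show "AE x in lborel. norm ((norm (f x + g x))\<^sup>2) \<le> norm (2 * (norm (f x))\<^sup>2 + 2 * (norm (g x))\<^sup>2)"
      by simp
  qed
  then show ?thesis using m by (simp add: square_integrable_def)
qed

lemma square_integrable_scaleC: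
  "square_integrable f \<Longrightarrow> square_integrable (\<lambda>x. c *\<^sub>C (f x :: 'b :: complex_inner))"
  by (simp add: square_integrable_def strongly_measurable_scaleC norm_scaleC power_mult_distrib)

lemma scaleC_minus1: "(- 1) *\<^sub>C x = - (x :: 'b :: complex_inner)"
  by (metis scaleR_scaleC of_real_1 of_real_minus scaleR_minus1_left)

lemma square_integrable_uminus:
  "square_integrable f \<Longrightarrow> square_integrable (\<lambda>x. - (f x :: 'b :: complex_inner))"
  using square_integrable_scaleC[of f "- 1"] by (simp add: scaleC_minus1)

lemma square_integrable_cinner:
  fixes f g :: "'a :: euclidean_space \<Rightarrow> 'b :: complex_inner"
  assumes "square_integrable f" "square_integrable g"
  shows "integrable lborel (\<lambda>x. cinner (f x) (g x))"
proof (rule Bochner_Integration.integrable_bound)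
  show "integrable lborel (\<lambda>x. (norm (f x))\<^sup>2 + (norm (g x))\<^sup>2)"
    using assms by (simp add: square_integrable_def)
  show "(\<lambda>x. cinner (f x) (g x)) \<in> borel_measurable lborel"
    using assms unfolding square_integrable_def by (intro strongly_measurable_cinner) auto
  have "cmod (cinner (f x) (g x)) \<le> (norm (f x))\<^sup>2 + (norm (g x))\<^sup>2" for x
    using norm_cinner_le[of "f x" "g x"] sum_squares_bound[of "norm (f x)" "norm (g x)"]
      mult_nonneg_nonneg[OF norm_ge_zero[of "f x"] norm_ge_zero[of "g x"]] by linarith
  then show "AE x in lborel. cmod (cinner (f x) (g x)) \<le> norm ((norm (f x))\<^sup>2 + (norm (g x))\<^sup>2)"
    by simp
qed

definition L2_rel :: "('a :: euclidean_space \<Rightarrow> 'b :: real_normed_vector) \<Rightarrow> ('a \<Rightarrow> 'b) \<Rightarrow> bool" where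
  "L2_rel f g \<longleftrightarrow> square_integrable f \<and> square_integrable g \<and> (AE x in lborel. f x = g x)"

lemma L2_rel_refl: "L2_rel f f \<longleftrightarrow> square_integrable f"
  by (simp add: L2_rel_def)

quotient_type (overloaded) ('a, 'b) L2 =
  "'a :: euclidean_space \<Rightarrow> 'b :: complex_inner" / partial: L2_rel
proof (rule part_equivpI)
  show "\<exists>f :: 'a \<Rightarrow> 'b. L2_rel f f"
    by (rule exI[of _ "\<lambda>_. 0"]) (simp add: L2_rel_refl square_integrable_0)
  show "symp (L2_rel :: ('a \<Rightarrow> 'b) \<Rightarrow> _)"
    unfolding symp_def L2_rel_def by (auto elim: AE_mp)
  show "transp (L2_rel :: ('a \<Rightarrow> 'b) \<Rightarrow> _)"
  proof (rule transpI)
    fix f g h :: "'a \<Rightarrow> 'b" assume "L2_rel f g" "L2_rel g h"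
    then have *: "square_integrable f" "square_integrable h"
      "AE x in lborel. f x = g x" "AE x in lborel. g x = h x" by (auto simp: L2_rel_def)
    from *(3,4) have "AE x in lborel. f x = h x" by eventually_elim simp
    with * show "L2_rel f h" by (simp add: L2_rel_def)
  qed
qed

instantiation L2 :: (euclidean_space, complex_inner) complex_inner
begin

lift_definition zero_L2 :: "('a, 'b) L2" is "\<lambda>_. 0"
  by (simp add: L2_rel_refl square_integrable_0)

lift_definition plus_L2 :: "('a, 'b) L2 \<Rightarrow> ('a, 'b) L2 \<Rightarrow> ('a, 'b) L2" is "\<lambda>f g x. f x + g x"
  by (auto simp: L2_rel_def square_integrable_add)

lift_definition uminus_L2 :: "('a, 'b) L2 \<Rightarrow> ('a, 'b) L2" is "\<lambda>f x. - f x"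
  by (auto simp: L2_rel_def square_integrable_uminus)

definition "f - g = f + - (g :: ('a, 'b) L2)"

lift_definition scaleC_L2 :: "complex \<Rightarrow> ('a, 'b) L2 \<Rightarrow> ('a, 'b) L2" is "\<lambda>c f x. c *\<^sub>C f x"
  by (auto simp: L2_rel_def square_integrable_scaleC)

lift_definition cinner_L2 :: "('a, 'b) L2 \<Rightarrow> ('a, 'b) L2 \<Rightarrow> complex"
  is "\<lambda>f g. LINT x|lborel. cinner (f x) (g x)"
proof -
  fix f f' g g' :: "'a \<Rightarrow> 'b"
  assume "L2_rel f f'" "L2_rel g g'"
  then have *: "square_integrable f" "square_integrable f'" "square_integrable g" "square_integrable g'"
    and ae: "AE x in lborel. f x = f' x" "AE x in lborel. g x = g' x"
    by (auto simp: L2_rel_def)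
  from ae have "AE x in lborel. cinner (f x) (g x) = cinner (f' x) (g' x)"
    by eventually_elim simp
  then show "(LINT x|lborel. cinner (f x) (g x)) = (LINT x|lborel. cinner (f' x) (g' x))"
    using square_integrable_cinner[OF *(1,3)] square_integrable_cinner[OF *(2,4)]
    by (intro integral_cong_AE) auto
qed

definition "scaleR r f = complex_of_real r *\<^sub>C (f :: ('a, 'b) L2)"
definition "inner f g = Re (cinner f (g :: ('a, 'b) L2))"
definition "norm f = sqrt (inner f (f :: ('a, 'b) L2))"
definition "dist f g = norm (f - g :: ('a, 'b) L2)"
definition "sgn f = inverse (norm f) *\<^sub>R (f :: ('a, 'b) L2)"
definition uniformity_L2 :: "(('a, 'b) L2 \<times> ('a, 'b) L2) filter" where
  "uniformity_L2 = (INF e\<in>{0<..}. principal {(x, y). dist x y < e})"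
definition open_L2 :: "('a, 'b) L2 set \<Rightarrow> bool" where
  "open_L2 U \<longleftrightarrow> (\<forall>x\<in>U. \<forall>\<^sub>F (x', y) in uniformity. x' = x \<longrightarrow> y \<in> U)"

instance
proof
  fix x y z :: "('a, 'b) L2" and c d :: complex and r s :: real and U :: "('a, 'b) L2 set"
  show "x + y + z = x + (y + z)"
    by transfer (simp add: L2_rel_def square_integrable_add add.assoc)
  show "x + y = y + x"
    by transfer (simp add: L2_rel_def square_integrable_add add.commute)
  show g3: "0 + x = x" by transfer simp
  show "- x + x = 0" by transfer (simp add: L2_rel_def square_integrable_0)
  show "x - y = x + - y" by (rule minus_L2_def)
  have s1: "c *\<^sub>C (x + y) = c *\<^sub>C x + c *\<^sub>C y" for c
    by transfer (simp add: L2_rel_def square_integrable_add square_integrable_scaleC scaleC_add_right)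
  have s2: "(c + d) *\<^sub>C x = c *\<^sub>C x + d *\<^sub>C x" for c d
    by transfer (simp add: L2_rel_def square_integrable_add square_integrable_scaleC scaleC_add_left)
  have s3: "c *\<^sub>C d *\<^sub>C x = (c * d) *\<^sub>C x" for c d
    by transfer (simp add: L2_rel_def square_integrable_scaleC scaleC_scaleC)
  have s4: "1 *\<^sub>C x = x" by transfer (simp add: L2_rel_def scaleC_one)
  show "c *\<^sub>C (x + y) = c *\<^sub>C x + c *\<^sub>C y" "(c + d) *\<^sub>C x = c *\<^sub>C x + d *\<^sub>C x"
    "c *\<^sub>C d *\<^sub>C x = (c * d) *\<^sub>C x" "1 *\<^sub>C x = x"
    by (rule s1, rule s2, rule s3, rule s4)
  show "r *\<^sub>R (x + y) = r *\<^sub>R x + r *\<^sub>R y" "(r + s) *\<^sub>R x = r *\<^sub>R x + s *\<^sub>R x"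
    "r *\<^sub>R s *\<^sub>R x = (r * s) *\<^sub>R x" "1 *\<^sub>R x = x"
    by (simp_all add: scaleR_L2_def s1 s2 s3 s4)
  have i1: "cinner (x + y) z = cinner x z + cinner y z"
    by transfer (simp add: L2_rel_refl cinner_add_left square_integrable_cinner)
  have i2: "cinner (c *\<^sub>C x) y = c * cinner x y" for c
    by transfer (simp add: cinner_scaleC_left)
  have i3: "cinner x y = cnj (cinner y x)" for y
  proof transfer
    fix f g :: "'a \<Rightarrow> 'b"
    have "(LINT t|lborel. cinner (f t) (g t)) = (LINT t|lborel. cnj (cinner (g t) (f t)))"
      by (rule Bochner_Integration.integral_cong[OF refl]) (rule cinner_commute)
    then show "(LINT t|lborel. cinner (f t) (g t)) = cnj (LINT t|lborel. cinner (g t) (f t))"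
      by simp
  qed
  have i4: "0 \<le> Re (cinner x x) \<and> (Re (cinner x x) = 0 \<longleftrightarrow> x = 0)"
  proof transfer
    fix f :: "'a \<Rightarrow> 'b" assume "L2_rel f f"
    then have f: "square_integrable f" by (simp add: L2_rel_refl)
    then have int: "integrable lborel (\<lambda>t. (norm (f t))\<^sup>2)" by (simp add: square_integrable_def)
    have eq: "Re (LINT t|lborel. cinner (f t) (f t)) = (LINT t|lborel. (norm (f t))\<^sup>2)"
      by (simp add: cinner_self_norm del: of_real_power)
    have "(LINT t|lborel. (norm (f t))\<^sup>2) = 0 \<longleftrightarrow> (AE t in lborel. (norm (f t))\<^sup>2 = 0)"
      by (rule integral_nonneg_eq_0_iff_AE[OF int]) simp
    then show "0 \<le> Re (LINT t|lborel. cinner (f t) (f t)) \<and>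
        (Re (LINT t|lborel. cinner (f t) (f t)) = 0 \<longleftrightarrow> L2_rel f (\<lambda>_. 0))"
      unfolding eq using f by (simp add: L2_rel_def square_integrable_0)
  qed
  show "cinner (x + y) z = cinner x z + cinner y z" "cinner (c *\<^sub>C x) y = c * cinner x y"
    "cinner x y = cnj (cinner y x)" "0 \<le> Re (cinner x x)"
    by (rule i1, rule i2, rule i3, rule i4[THEN conjunct1])
  show "inner x y = inner y x"
    using arg_cong[OF i3[of y], of Re] by (simp only: inner_L2_def cnj.sel)
  show "inner (x + y) z = inner x z + inner y z" by (simp add: inner_L2_def i1)
  show "inner (r *\<^sub>R x) y = r * inner x y" by (simp add: inner_L2_def scaleR_L2_def i2)
  show "0 \<le> inner x x" using i4 by (simp add: inner_L2_def)
  show "inner x x = 0 \<longleftrightarrow> x = 0" using i4 by (simp add: inner_L2_def)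
  show "norm x = sqrt (inner x x)" "dist x y = norm (x - y)" "sgn x = inverse (norm x) *\<^sub>R x"
    by (simp_all add: norm_L2_def dist_L2_def sgn_L2_def)
  show "uniformity = (INF e\<in>{0<..}. principal {(x, y :: ('a, 'b) L2). dist x y < e})"
    by (rule uniformity_L2_def)
  show "open U \<longleftrightarrow> (\<forall>x\<in>U. \<forall>\<^sub>F (x', y) in uniformity. x' = x \<longrightarrow> y \<in> U)"
    by (rule open_L2_def)
  show "r *\<^sub>R x = complex_of_real r *\<^sub>C x" "inner x y = Re (cinner x y)"
    by (simp_all add: scaleR_L2_def inner_L2_def)
qed

end

subsection \<open>Hilbert space tensor products\<close>

text \<open>Formal finite linear combinations of pairs, with the semi-inner product determined by
  \<open>\<langle>x \<otimes> y, x' \<otimes> y'\<rangle> = \<langle>x, x'\<rangle> \<langle>y, y'\<rangle>\<close>. The bilinear relations are null vectors and are divided out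
  in the completion.\<close>

typedef ('a, 'b) pre_tensor = "{f :: 'a \<times> 'b \<Rightarrow> complex. finite {p. f p \<noteq> 0}}"
  morphisms pre_tensor_nth Abs_pre_tensor
  by (rule exI[of _ "\<lambda>_. 0"]) simp

setup_lifting type_definition_pre_tensor

definition pre_tensor_form ::
  "('a :: complex_semi_inner \<times> 'b :: complex_semi_inner) set \<Rightarrow> ('a \<times> 'b \<Rightarrow> complex) \<Rightarrow> ('a \<times> 'b \<Rightarrow> complex) \<Rightarrow> complex" where
  "pre_tensor_form S f g =
    (\<Sum>p\<in>S. \<Sum>q\<in>S. f p * cnj (g q) * cinner (fst p) (fst q) * cinner (snd p) (snd q))"

lemma pre_tensor_form_mono:
  assumes "finite T" "{p. f p \<noteq> 0} \<subseteq> S" "{p. g p \<noteq> 0} \<subseteq> S" "S \<subseteq> T"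
  shows "pre_tensor_form S f g = pre_tensor_form T f g"
  unfolding pre_tensor_form_def
  using assms by (intro sum.mono_neutral_cong_left ballI) (auto intro!: sum.neutral)

lemma gram_decomposition:
  fixes x :: "'i \<Rightarrow> 'a :: complex_semi_inner"
  assumes "finite S"
  shows "\<exists>(m :: nat) v. \<forall>p\<in>S. \<forall>q\<in>S. cinner (x p) (x q) = (\<Sum>k<m. v k p * cnj (v k q))"
  using assms
proof (induction S arbitrary: x)
  case empty
  then show ?case by simp
next
  case (insert s S)
  show ?case
  proof (cases "Re (cinner (x s) (x s)) = 0")
    case True
    then have n0: "csnorm (x s) = 0" by (simp add: csnorm_def)
    have z: "cinner (x s) y = 0" "cinner y (x s) = 0" for y
      using cinner_Cauchy_Schwarz[of "x s" y] cinner_Cauchy_Schwarz[of y "x s"] by (simp_all add: n0)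
    obtain m :: nat and v where v: "\<forall>p\<in>S. \<forall>q\<in>S. cinner (x p) (x q) = (\<Sum>k<m. v k p * cnj (v k q))"
      using insert.IH by blast
    show ?thesis
      by (rule exI[of _ m], rule exI[of _ "\<lambda>k p. if p = s then 0 else v k p"])
        (use v z insert.hyps in \<open>auto intro!: sum.cong\<close>)
  next
    case False
    define r where "r = Re (cinner (x s) (x s))"
    have r: "r > 0" "cinner (x s) (x s) = complex_of_real r"
      using False cinner_ge_zero[of "x s"] cinner_self_real[of "x s"] by (auto simp: r_def)
    define c where "c p = cinner (x p) (x s) / complex_of_real r" for p
    define x' where "x' p = x p - c p *\<^sub>C x s" for p
    obtain m :: nat and v where v: "\<forall>p\<in>S. \<forall>q\<in>S. cinner (x' p) (x' q) = (\<Sum>k<m. v k p * cnj (v k q))"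
      using insert.IH by blast
    define w where "w k p = (if k = m then c p * complex_of_real (sqrt r) else if p = s then 0 else v k p)" for k p
    have sqrt: "complex_of_real (sqrt r) * complex_of_real (sqrt r) = complex_of_real r"
      using r(1) by (simp flip: of_real_mult)
    have xs: "cinner (x p) (x s) = c p * complex_of_real r" for p
      using r(1) by (simp add: c_def)
    have sx: "cinner (x s) (x p) = cnj (c p) * complex_of_real r" for p
      using arg_cong[OF xs[of p], of cnj] cinner_commute[of "x s" "x p"] by simp
    have cs: "c s = 1" using r by (simp add: c_def)
    have last: "w m p * cnj (w m q) = c p * cnj (c q) * complex_of_real r" for p q
      by (simp add: w_def sqrt[symmetric] mult.assoc mult.left_commute)
    have x': "cinner (x' p) (x' q) = cinner (x p) (x q) - c p * cnj (c q) * complex_of_real r" for p q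
      by (simp add: x'_def cinner_diff_left cinner_diff_right cinner_scaleC_left cinner_scaleC_right
          xs sx cs algebra_simps)
    have "cinner (x p) (x q) = (\<Sum>k<Suc m. w k p * cnj (w k q))" if "p \<in> insert s S" "q \<in> insert s S" for p q
    proof (cases "p = s \<or> q = s")
      case True
      have "(\<Sum>k<m. w k p * cnj (w k q)) = 0"
        by (rule sum.neutral) (use True in \<open>auto simp: w_def\<close>)
      then show ?thesis using True by (auto simp: last xs sx cs)
    next
      case False
      then have "(\<Sum>k<m. w k p * cnj (w k q)) = cinner (x' p) (x' q)"
        using v that by (auto simp: w_def intro!: sum.cong)
      then show ?thesis by (simp add: last x')
    qed
    then show ?thesis by blast
  qed
qed

lemma pre_tensor_form_ge_zero:
  assumes "finite S"
  shows "0 \<le> Re (pre_tensor_form S f f)"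
proof -
  obtain m :: nat and v where v: "\<forall>p\<in>S. \<forall>q\<in>S. cinner (fst p) (fst q) = (\<Sum>k<m. v k p * cnj (v k q))"
    using gram_decomposition[OF assms, of fst] by blast
  have "pre_tensor_form S f f =
      (\<Sum>p\<in>S. \<Sum>q\<in>S. \<Sum>k<m. (f p * v k p) * cnj (f q * v k q) * cinner (snd p) (snd q))"
    unfolding pre_tensor_form_def
    by (intro sum.cong refl) (simp add: v sum_distrib_left sum_distrib_right mult.assoc mult.left_commute mult.commute)
  also have "\<dots> = (\<Sum>k<m. \<Sum>p\<in>S. \<Sum>q\<in>S. (f p * v k p) * cnj (f q * v k q) * cinner (snd p) (snd q))"
    by (subst sum.swap[of _ "{..<m}"], subst sum.swap[of _ "{..<m}"]) (rule refl)
  also have "\<dots> = (\<Sum>k<m. cinner (\<Sum>p\<in>S. (f p * v k p) *\<^sub>C snd p) (\<Sum>p\<in>S. (f p * v k p) *\<^sub>C snd p))"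
  proof (rule sum.cong[OF refl])
    fix k
    show "(\<Sum>p\<in>S. \<Sum>q\<in>S. (f p * v k p) * cnj (f q * v k q) * cinner (snd p) (snd q)) =
        cinner (\<Sum>p\<in>S. (f p * v k p) *\<^sub>C snd p) (\<Sum>p\<in>S. (f p * v k p) *\<^sub>C snd p)"
      by (subst cinner_sum_left, subst cinner_sum_right)
        (simp only: cinner_scaleC_left cinner_scaleC_right mult.assoc mult.left_commute)
  qed
  finally show ?thesis
    by (simp add: sum_nonneg cinner_ge_zero)
qed

instantiation pre_tensor :: (complex_semi_inner, complex_semi_inner) complex_semi_inner
begin

lift_definition zero_pre_tensor :: "('a, 'b) pre_tensor" is "\<lambda>_. 0" by simp

lift_definition plus_pre_tensor :: "('a, 'b) pre_tensor \<Rightarrow> ('a, 'b) pre_tensor \<Rightarrow> ('a, 'b) pre_tensor"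
  is "\<lambda>f g p. f p + g p"
proof -
  fix f g :: "'a \<times> 'b \<Rightarrow> complex"
  assume "finite {p. f p \<noteq> 0}" "finite {p. g p \<noteq> 0}"
  then show "finite {p. f p + g p \<noteq> 0}"
    by (rule finite_subset[OF _ finite_UnI, rotated]) auto
qed

lift_definition uminus_pre_tensor :: "('a, 'b) pre_tensor \<Rightarrow> ('a, 'b) pre_tensor" is "\<lambda>f p. - f p" by simp

definition "f - g = f + - (g :: ('a, 'b) pre_tensor)"

lift_definition scaleC_pre_tensor :: "complex \<Rightarrow> ('a, 'b) pre_tensor \<Rightarrow> ('a, 'b) pre_tensor"
  is "\<lambda>c f p. c * f p" by (rule finite_subset[rotated]) auto

lift_definition cinner_pre_tensor :: "('a, 'b) pre_tensor \<Rightarrow> ('a, 'b) pre_tensor \<Rightarrow> complex"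
  is "\<lambda>f g. pre_tensor_form ({p. f p \<noteq> 0} \<union> {p. g p \<noteq> 0}) f g" .

instance
proof
  fix x y z :: "('a, 'b) pre_tensor" and c d :: complex
  show "x + y + z = x + (y + z)" by transfer (simp add: add.assoc)
  show "x + y = y + x" by transfer (simp add: add.commute)
  show "0 + x = x" by transfer simp
  show "- x + x = 0" by transfer simp
  show "x - y = x + - y" by (rule minus_pre_tensor_def)
  show "c *\<^sub>C (x + y) = c *\<^sub>C x + c *\<^sub>C y" by transfer (simp add: algebra_simps)
  show "(c + d) *\<^sub>C x = c *\<^sub>C x + d *\<^sub>C x" by transfer (simp add: algebra_simps)
  show "c *\<^sub>C d *\<^sub>C x = (c * d) *\<^sub>C x" by transfer (simp add: algebra_simps)
  show "1 *\<^sub>C x = x" by transfer simp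
  show "cinner (x + y) z = cinner x z + cinner y z"
  proof transfer
    fix f g h :: "'a \<times> 'b \<Rightarrow> complex"
    assume fin: "finite {p. f p \<noteq> 0}" "finite {p. g p \<noteq> 0}" "finite {p. h p \<noteq> 0}"
    define T where "T = {p. f p \<noteq> 0} \<union> {p. g p \<noteq> 0} \<union> {p. h p \<noteq> 0}"
    have "finite T" using fin by (simp add: T_def)
    note * = pre_tensor_form_mono[OF this]
    have "pre_tensor_form ({p. f p + g p \<noteq> 0} \<union> {p. h p \<noteq> 0}) (\<lambda>p. f p + g p) h =
        pre_tensor_form T (\<lambda>p. f p + g p) h" by (rule *) (auto simp: T_def)
    moreover have "pre_tensor_form ({p. f p \<noteq> 0} \<union> {p. h p \<noteq> 0}) f h = pre_tensor_form T f h"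
      by (rule *) (auto simp: T_def)
    moreover have "pre_tensor_form ({p. g p \<noteq> 0} \<union> {p. h p \<noteq> 0}) g h = pre_tensor_form T g h"
      by (rule *) (auto simp: T_def)
    ultimately show "pre_tensor_form ({p. f p + g p \<noteq> 0} \<union> {p. h p \<noteq> 0}) (\<lambda>p. f p + g p) h =
        pre_tensor_form ({p. f p \<noteq> 0} \<union> {p. h p \<noteq> 0}) f h + pre_tensor_form ({p. g p \<noteq> 0} \<union> {p. h p \<noteq> 0}) g h"
      by (simp add: pre_tensor_form_def distrib_right sum.distrib)
  qed
  show "cinner (c *\<^sub>C x) y = c * cinner x y"
  proof transfer
    fix c and f g :: "'a \<times> 'b \<Rightarrow> complex"
    assume fin: "finite {p. f p \<noteq> 0}" "finite {p. g p \<noteq> 0}"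
    have "pre_tensor_form ({p. c * f p \<noteq> 0} \<union> {p. g p \<noteq> 0}) (\<lambda>p. c * f p) g =
        pre_tensor_form ({p. f p \<noteq> 0} \<union> {p. g p \<noteq> 0}) (\<lambda>p. c * f p) g"
      by (rule pre_tensor_form_mono) (use fin in auto)
    then show "pre_tensor_form ({p. c * f p \<noteq> 0} \<union> {p. g p \<noteq> 0}) (\<lambda>p. c * f p) g =
        c * pre_tensor_form ({p. f p \<noteq> 0} \<union> {p. g p \<noteq> 0}) f g"
      by (simp add: pre_tensor_form_def sum_distrib_left mult.assoc)
  qed
  show "cinner x y = cnj (cinner y x)"
  proof transfer
    fix f g :: "'a \<times> 'b \<Rightarrow> complex"
    have 1: "cnj (cinner (fst q) (fst p)) = cinner (fst p) (fst q)" for p q :: "'a \<times> 'b"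
      by (rule cinner_commute[symmetric])
    have 2: "cnj (cinner (snd q) (snd p)) = cinner (snd p) (snd q)" for p q :: "'a \<times> 'b"
      by (rule cinner_commute[symmetric])
    have "cnj (pre_tensor_form S g f) = pre_tensor_form S f g" for S
      unfolding pre_tensor_form_def
      by (subst sum.swap) (simp add: 1 2 mult.commute)
    then show "pre_tensor_form ({p. f p \<noteq> 0} \<union> {p. g p \<noteq> 0}) f g =
        cnj (pre_tensor_form ({p. g p \<noteq> 0} \<union> {p. f p \<noteq> 0}) g f)"
      by (simp add: Un_commute)
  qed
  show "0 \<le> Re (cinner x x)"
    by transfer (simp add: pre_tensor_form_ge_zero)
qed

end

lift_definition pre_tensor_pair :: "'a \<Rightarrow> 'b \<Rightarrow> ('a, 'b) pre_tensor"
  is "\<lambda>x y p. if p = (x, y) then 1 else 0" by simp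

type_synonym ('a, 'b) htensor = "('a, 'b) pre_tensor hcompletion"

definition htensor :: "'a :: complex_inner \<Rightarrow> 'b :: complex_inner \<Rightarrow> ('a, 'b) htensor"
  (infixr \<open>\<otimes>\<^sub>H\<close> 70) where
  "x \<otimes>\<^sub>H y = to_completion (pre_tensor_pair x y)"

lemma cinner_htensor: "cinner (x \<otimes>\<^sub>H y) (x' \<otimes>\<^sub>H y') = cinner x x' * cinner y y'"
proof -
  have "cinner (pre_tensor_pair x y) (pre_tensor_pair x' y') = cinner x x' * cinner y y'"
  proof transfer
    fix x x' :: 'a and y y' :: 'b
    let ?f = "\<lambda>p. if p = (x, y) then 1 else (0 :: complex)"
    let ?g = "\<lambda>p. if p = (x', y') then 1 else (0 :: complex)"
    have "pre_tensor_form ({p. ?f p \<noteq> 0} \<union> {p. ?g p \<noteq> 0}) ?f ?g =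
        (\<Sum>p\<in>{(x, y), (x', y')}. \<Sum>q\<in>{(x, y), (x', y')}.
          if q = (x', y') then (if p = (x, y) then cinner (fst p) x' * cinner (snd p) y' else 0) else 0)"
      unfolding pre_tensor_form_def by (intro sum.cong) auto
    also have "\<dots> = cinner x x' * cinner y y'"
    proof -
      have "(\<Sum>q\<in>{(x, y), (x', y')}. if q = r then c q else 0) = c r"
        if "r \<in> {(x, y), (x', y')}" for r and c :: "'a \<times> 'b \<Rightarrow> complex"
        using that by (subst sum.delta) auto
      then show ?thesis by simp
    qed
    finally show "pre_tensor_form ({p. ?f p \<noteq> 0} \<union> {p. ?g p \<noteq> 0}) ?f ?g = cinner x x' * cinner y y'" .
  qed
  then show ?thesis by (simp add: htensor_def cinner_to_completion)
qed

lemma strongly_measurable_iff_borel: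
  fixes f :: "'a \<Rightarrow> 'b :: {second_countable_topology, real_normed_vector}"
  shows "strongly_measurable M f \<longleftrightarrow> f \<in> borel_measurable M"
proof
  assume "f \<in> borel_measurable M"
  from borel_measurable_implies_sequence_metric[OF this, of 0]
  show "strongly_measurable M f"
    unfolding strongly_measurable_def by blast
qed (rule strongly_measurable_borel)

lemma strong_integral_eq_integral:
  fixes f :: "'a \<Rightarrow> 'b :: {second_countable_topology, banach}"
  shows "strong_integral M f = integral\<^sup>L M f"
proof -
  have "has_strong_integral M f = has_bochner_integral M f"
    by (rule ext) (auto simp: has_strong_integral_def has_bochner_integral.simps strongly_measurable_iff_borel)
  then show ?thesis
    by (simp add: strong_integral_def lebesgue_integral_def)
qed

subsection \<open>Almost periodic functions\<close>

definition expc :: "real^'n \<Rightarrow> real^'n \<Rightarrow> complex" where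
  "expc l x = cis (2 * pi * (l \<bullet> x))"

definition trig_polynomials :: "(real^'n \<Rightarrow> complex) set" where
  "trig_polynomials = {f. \<exists>S c. finite S \<and> f = (\<lambda>x. \<Sum>l\<in>S. c l * expc l x)}"

definition C_ap :: "(real^'n \<Rightarrow> complex) set" where
  "C_ap = {f. \<exists>p. (\<forall>n :: nat. p n \<in> trig_polynomials) \<and> uniform_limit UNIV p f sequentially}"

definition mean_value :: "(real^'n \<Rightarrow> complex) \<Rightarrow> complex" where
  "mean_value f = Lim at_top (\<lambda>T. (LINT x:cbox 0 (\<chi> i. T)|lborel. f x) / complex_of_real T ^ CARD('n))"

lemma norm_expc [simp]: "cmod (expc l x) = 1"
  by (simp add: expc_def)

lemma expc_add: "expc (k + l) x = expc k x * expc l x"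
  by (simp add: expc_def cis_mult inner_add_left distrib_left)

lemma expc_diff: "expc (k - l) x = expc k x * cnj (expc l x)"
  by (simp add: expc_def cis_mult cis_cnj inner_diff_left right_diff_distrib)

lemma continuous_expc: "continuous_on S (expc l)"
  unfolding expc_def by (intro continuous_intros)

lemma trig_expc: "(\<lambda>x. c * expc l x) \<in> trig_polynomials"
  unfolding trig_polynomials_def
  by (intro CollectI exI[of _ "{l}"] exI[of _ "\<lambda>_. c"]) simp

lemma trig_add:
  assumes "f \<in> trig_polynomials" "g \<in> trig_polynomials"
  shows "(\<lambda>x. f x + g x) \<in> trig_polynomials"
proof -
  obtain S c T d where fin: "finite S" "finite T"
    and f: "f = (\<lambda>x. \<Sum>l\<in>S. c l * expc l x)" and g: "g = (\<lambda>x. \<Sum>l\<in>T. d l * expc l x)"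
    using assms unfolding trig_polynomials_def by blast
  have 1: "(\<Sum>l\<in>S. c l * expc l x) = (\<Sum>l\<in>S \<union> T. (if l \<in> S then c l else 0) * expc l x)" for x
    by (rule sum.mono_neutral_cong_left) (use fin in auto)
  have 2: "(\<Sum>l\<in>T. d l * expc l x) = (\<Sum>l\<in>S \<union> T. (if l \<in> T then d l else 0) * expc l x)" for x
    by (rule sum.mono_neutral_cong_left) (use fin in auto)
  show ?thesis
    unfolding trig_polynomials_def f g
    by (intro CollectI exI[of _ "S \<union> T"] exI[of _ "\<lambda>l. (if l \<in> S then c l else 0) + (if l \<in> T then d l else 0)"])
      (use fin in \<open>simp add: 1 2 distrib_right sum.distrib\<close>)
qed

lemma trig_sum:
  assumes "finite I" "\<And>i. i \<in> I \<Longrightarrow> f i \<in> trig_polynomials"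
  shows "(\<lambda>x. \<Sum>i\<in>I. f i x) \<in> trig_polynomials"
  using assms
proof (induction I)
  case empty
  then show ?case using trig_expc[of 0 0] by simp
next
  case (insert i I)
  then show ?case using trig_add[of "f i" "\<lambda>x. \<Sum>i\<in>I. f i x"] by simp
qed

lemma trig_mult_cnj:
  assumes "f \<in> trig_polynomials" "g \<in> trig_polynomials"
  shows "(\<lambda>x. f x * cnj (g x)) \<in> trig_polynomials"
proof -
  obtain S c T d where fin: "finite S" "finite T"
    and f: "f = (\<lambda>x. \<Sum>l\<in>S. c l * expc l x)" and g: "g = (\<lambda>x. \<Sum>l\<in>T. d l * expc l x)"
    using assms unfolding trig_polynomials_def by blast
  have eq: "(\<lambda>x. f x * cnj (g x)) = (\<lambda>x. \<Sum>l\<in>S. \<Sum>k\<in>T. (c l * cnj (d k)) * expc (l - k) x)"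
    unfolding f g cnj_sum sum_product
    by (intro ext sum.cong refl) (simp add: expc_diff mult_ac)
  show ?thesis
    unfolding eq by (intro trig_sum trig_expc fin)
qed

lemma trig_cmult:
  assumes "f \<in> trig_polynomials"
  shows "(\<lambda>x. c * f x) \<in> trig_polynomials"
proof -
  obtain S d where fin: "finite S" and f: "f = (\<lambda>x. \<Sum>l\<in>S. d l * expc l x)"
    using assms unfolding trig_polynomials_def by blast
  show ?thesis
    unfolding f sum_distrib_left mult.assoc[symmetric] by (intro trig_sum trig_expc fin)
qed

lemma trig_continuous: "f \<in> trig_polynomials \<Longrightarrow> continuous_on S f"
  unfolding trig_polynomials_def by (auto intro!: continuous_intros continuous_expc)

lemma trig_bounded:
  assumes "f \<in> trig_polynomials"
  shows "bounded (range f)"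
proof -
  obtain S c where fin: "finite S" and f: "f = (\<lambda>x. \<Sum>l\<in>S. c l * expc l x)"
    using assms unfolding trig_polynomials_def by blast
  have "cmod (f x) \<le> (\<Sum>l\<in>S. cmod (c l))" for x
    unfolding f by (rule sum_norm_le) (simp add: norm_mult)
  then show ?thesis by (auto simp: bounded_iff)
qed

lemma C_ap_iff:
  "f \<in> C_ap \<longleftrightarrow> (\<forall>e>0. \<exists>p\<in>trig_polynomials. \<forall>x. cmod (f x - p x) < e)"
proof
  assume "f \<in> C_ap"
  then obtain p :: "nat \<Rightarrow> _" where p: "\<And>n. p n \<in> trig_polynomials" "uniform_limit UNIV p f sequentially"
    unfolding C_ap_def by blast
  show "\<forall>e>0. \<exists>p\<in>trig_polynomials. \<forall>x. cmod (f x - p x) < e"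
  proof (intro allI impI)
    fix e :: real assume "e > 0"
    then obtain n where "\<forall>x. dist (p n x) (f x) < e"
      using p(2) unfolding uniform_limit_iff eventually_sequentially by blast
    then have "\<forall>x. cmod (f x - p n x) < e"
      by (simp add: dist_norm norm_minus_commute)
    then show "\<exists>p\<in>trig_polynomials. \<forall>x. cmod (f x - p x) < e"
      using p(1) by blast
  qed
next
  assume a: "\<forall>e>0. \<exists>p\<in>trig_polynomials. \<forall>x. cmod (f x - p x) < e"
  have "\<forall>n. \<exists>p. p \<in> trig_polynomials \<and> (\<forall>x. cmod (f x - p x) < inverse (real (Suc n)))"
    using a by (meson inverse_positive_iff_positive of_nat_0_less_iff zero_less_Suc)
  then obtain p where p: "\<And>n. p n \<in> trig_polynomials" "\<And>n x. cmod (f x - p n x) < inverse (real (Suc n))"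
    by metis
  have "uniform_limit UNIV p f sequentially"
    unfolding uniform_limit_iff
  proof (intro allI impI)
    fix e :: real assume "e > 0"
    then have "\<forall>\<^sub>F n in sequentially. inverse (real (Suc n)) < e"
      using order_tendstoD(2)[OF LIMSEQ_inverse_real_of_nat] by blast
    then show "\<forall>\<^sub>F n in sequentially. \<forall>x\<in>UNIV. dist (p n x) (f x) < e"
    proof eventually_elim
      case (elim n)
      then show ?case using p(2)[of _ n] by (auto simp: dist_norm norm_minus_commute intro: less_trans)
    qed
  qed
  then show "f \<in> C_ap" unfolding C_ap_def using p(1) by blast
qed

lemma trig_C_ap: "f \<in> trig_polynomials \<Longrightarrow> f \<in> C_ap"
  unfolding C_ap_iff by (metis diff_self norm_zero)

lemma expc_C_ap: "expc l \<in> C_ap"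
  using trig_C_ap[OF trig_expc[of 1 l]] by simp

lemma C_ap_continuous:
  assumes "f \<in> C_ap" shows "continuous_on S f"
proof -
  obtain p :: "nat \<Rightarrow> _" where p: "\<And>n. p n \<in> trig_polynomials" "uniform_limit UNIV p f sequentially"
    using assms unfolding C_ap_def by blast
  have "continuous_on UNIV f"
    by (rule uniform_limit_theorem[OF _ p(2)]) (auto simp: p trig_continuous)
  then show ?thesis by (rule continuous_on_subset) simp
qed

lemma C_ap_bounded:
  assumes "f \<in> C_ap"
  obtains B where "B > 0" "\<And>x. cmod (f x) \<le> B"
proof -
  obtain p where p: "p \<in> trig_polynomials" "\<And>x. cmod (f x - p x) < 1"
    using assms unfolding C_ap_iff by (meson zero_less_one)
  obtain B where B: "B > 0" "\<And>x. cmod (p x) \<le> B"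
    using trig_bounded[OF p(1)] by (auto simp: bounded_pos)
  have "cmod (f x) \<le> B + 1" for x
    using norm_triangle_sub[of "f x" "p x"] p(2)[of x] B(2)[of x] by linarith
  then show ?thesis using that[of "B + 1"] B(1) by simp
qed

lemma C_ap_add:
  assumes "f \<in> C_ap" "g \<in> C_ap"
  shows "(\<lambda>x. f x + g x) \<in> C_ap"
  unfolding C_ap_iff
proof (intro allI impI)
  fix e :: real assume e: "e > 0"
  obtain p where p: "p \<in> trig_polynomials" "\<And>x. cmod (f x - p x) < e / 2"
    using assms(1) e unfolding C_ap_iff by (meson half_gt_zero)
  obtain q where q: "q \<in> trig_polynomials" "\<And>x. cmod (g x - q x) < e / 2"
    using assms(2) e unfolding C_ap_iff by (meson half_gt_zero)
  have "cmod (f x + g x - (p x + q x)) < e" for x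
    using norm_diff_triangle_ineq[of "f x" "g x" "p x" "q x"] p(2)[of x] q(2)[of x] by linarith
  then show "\<exists>p\<in>trig_polynomials. \<forall>x. cmod (f x + g x - p x) < e"
    using trig_add[OF p(1) q(1)] by (intro bexI[of _ "\<lambda>x. p x + q x"]) auto
qed

lemma C_ap_mult_cnj:
  assumes "f \<in> C_ap" "g \<in> C_ap"
  shows "(\<lambda>x. f x * cnj (g x)) \<in> C_ap"
  unfolding C_ap_iff
proof (intro allI impI)
  fix e :: real assume e: "e > 0"
  obtain B where B: "B > 0" "\<And>x. cmod (f x) \<le> B" using C_ap_bounded[OF assms(1)] by blast
  obtain q where q: "q \<in> trig_polynomials" "\<And>x. cmod (g x - q x) < e / (2 * B)"
    using assms(2) e B(1) unfolding C_ap_iff by (meson divide_pos_pos mult_pos_pos zero_less_numeral)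
  obtain C where C: "C > 0" "\<And>x. cmod (q x) \<le> C"
    using trig_bounded[OF q(1)] by (auto simp: bounded_pos)
  obtain p where p: "p \<in> trig_polynomials" "\<And>x. cmod (f x - p x) < e / (2 * C)"
    using assms(1) e C(1) unfolding C_ap_iff by (meson divide_pos_pos mult_pos_pos zero_less_numeral)
  have "cmod (f x * cnj (g x) - p x * cnj (q x)) < e" for x
  proof -
    have "f x * cnj (g x) - p x * cnj (q x) = f x * cnj (g x - q x) + (f x - p x) * cnj (q x)"
      by (simp add: algebra_simps)
    then have "cmod (f x * cnj (g x) - p x * cnj (q x)) \<le>
        cmod (f x) * cmod (g x - q x) + cmod (f x - p x) * cmod (q x)"
      by (metis norm_triangle_ineq norm_mult complex_mod_cnj)
    also have "\<dots> \<le> B * cmod (g x - q x) + cmod (f x - p x) * C"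
      by (intro add_mono mult_right_mono mult_left_mono B C) auto
    also have "\<dots> < B * (e / (2 * B)) + e / (2 * C) * C"
      by (intro add_strict_mono mult_strict_left_mono mult_strict_right_mono q p B C)
    also have "\<dots> = e" using B(1) C(1) by simp
    finally show ?thesis .
  qed
  then show "\<exists>p\<in>trig_polynomials. \<forall>x. cmod (f x * cnj (g x) - p x) < e"
    using trig_mult_cnj[OF p(1) q(1)] by (intro bexI[of _ "\<lambda>x. p x * cnj (q x)"]) auto
qed

lemma C_ap_const: "(\<lambda>_ :: real^'n. c) \<in> C_ap"
  using trig_C_ap[OF trig_expc[of c 0]] by (simp add: expc_def)

lemma C_ap_cmult: "f \<in> C_ap \<Longrightarrow> (\<lambda>x. c * f x) \<in> C_ap"
proof -
  assume f: "f \<in> C_ap"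
  have "(\<lambda>x. 1 * cnj (f x)) \<in> C_ap" by (rule C_ap_mult_cnj[OF C_ap_const f])
  from C_ap_mult_cnj[OF C_ap_const[of c] this] show ?thesis by simp
qed

subsubsection \<open>Existence of the mean value\<close>

definition cube_avg :: "(real^'n \<Rightarrow> complex) \<Rightarrow> real \<Rightarrow> complex" where
  "cube_avg f T = (LINT x:cbox 0 (\<chi> i. T)|lborel. f x) / complex_of_real T ^ CARD('n)"

lemma measure_cube: "T \<ge> 0 \<Longrightarrow> measure lborel (cbox (0 :: real^'n) (\<chi> i. T)) = T ^ CARD('n)"
  by (subst content_cbox_cart) (auto simp: interval_eq_empty_cart)

lemma C_ap_set_integrable:
  "f \<in> C_ap \<Longrightarrow> set_integrable lborel (cbox a b) f"
  unfolding set_integrable_def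
  by (intro borel_integrable_compact compact_cbox C_ap_continuous)

lemma integrable_indicator_cbox: "integrable lborel (indicat_real (cbox a b))"
  by (rule integrable_real_indicator) (simp, rule emeasure_lborel_cbox_finite)

lemma norm_cube_avg_le:
  fixes f :: "real^'n \<Rightarrow> complex"
  assumes "f \<in> C_ap" "\<And>x. cmod (f x) \<le> B" "T > 0"
  shows "cmod (cube_avg f T) \<le> B"
proof -
  have "cmod (LINT x:cbox 0 (\<chi> i. T)|lborel. f x) \<le> B * measure lborel (cbox (0 :: real^'n) (\<chi> i. T))"
  proof -
    have "cmod (LINT x|lborel. indicat_real (cbox 0 (\<chi> i. T)) x *\<^sub>R f x) \<le>
        (LINT x|lborel. indicat_real (cbox (0 :: real^'n) (\<chi> i. T)) x * B)"
    proof (rule Bochner_Integration.integral_norm_bound_integral)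
      show "integrable lborel (\<lambda>x. indicat_real (cbox 0 (\<chi> i. T)) x *\<^sub>R f x)"
        using C_ap_set_integrable[OF assms(1)] by (simp add: set_integrable_def)
      show "integrable lborel (\<lambda>x. indicat_real (cbox 0 (\<chi> i. T)) x * B)"
        by (rule integrable_mult_left) (simp add: integrable_indicator_cbox)
    qed (auto simp: indicator_def assms(2))
    then show ?thesis by (simp add: set_lebesgue_integral_def mult.commute)
  qed
  then show ?thesis
    using assms(3) by (simp add: cube_avg_def norm_divide norm_power measure_cube divide_le_eq)
qed

lemma cube_avg_add:
  "f \<in> C_ap \<Longrightarrow> g \<in> C_ap \<Longrightarrow> cube_avg (\<lambda>x. f x + g x) T = cube_avg f T + cube_avg g T"
  by (simp add: cube_avg_def set_integral_add C_ap_set_integrable add_divide_distrib)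

lemma cube_avg_cmult: "cube_avg (\<lambda>x. c * f x) T = c * cube_avg f T"
  by (simp add: cube_avg_def)

lemma cube_avg_diff:
  assumes "f \<in> C_ap" "g \<in> C_ap"
  shows "cube_avg (\<lambda>x. f x - g x) T = cube_avg f T - cube_avg g T"
  using cube_avg_add[OF assms(1) C_ap_cmult[OF assms(2), of "-1"], of T] cube_avg_cmult[of "-1" g T] by simp

lemma cube_avg_cnj: "cube_avg (\<lambda>x. cnj (f x)) T = cnj (cube_avg f T)"
proof -
  have "(LINT x:A|lborel. cnj (f x)) = cnj (LINT x:A|lborel. f x)" for A
    unfolding set_lebesgue_integral_def by (subst Bochner_Integration.integral_cnj[symmetric]) simp
  then show ?thesis by (simp add: cube_avg_def)
qed

lemma C_ap_diff: "f \<in> C_ap \<Longrightarrow> g \<in> C_ap \<Longrightarrow> (\<lambda>x. f x - g x) \<in> C_ap"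
  using C_ap_add[of f "\<lambda>x. - 1 * g x"] C_ap_cmult[of g "- 1"] by simp

lemma cube_avg_const: "T > 0 \<Longrightarrow> cube_avg (\<lambda>_ :: real^'n. 1) T = 1"
  by (simp add: cube_avg_def set_lebesgue_integral_def, subst Bochner_Integration.integral_scaleR_left)
    (simp_all add: integrable_indicator_cbox measure_cube scaleR_conv_of_real)

lemma cube_avg_expc_bound:
  fixes l :: "real^'n"
  assumes "l $ i \<noteq> 0" "T > t" "t = 1 / (2 * \<bar>l $ i\<bar>)"
  shows "cmod (cube_avg (expc l) T) \<le> t / T"
proof -
  have t0: "t > 0" using assms by auto
  then have t: "t > 0" "T > 0" using assms by linarith+
  define c :: "real^'n" where "c = axis i t"
  have lc: "l \<bullet> c = l $ i * t" by (simp add: c_def inner_axis)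
  have "l $ i * t = 1 / 2 \<or> l $ i * t = - 1 / 2"
    using assms(1,3) by (cases "l $ i > 0") (auto simp: field_simps)
  then have "2 * pi * (l \<bullet> c) = pi \<or> 2 * pi * (l \<bullet> c) = - pi"
    unfolding lc by auto
  then have "cis (2 * pi * (l \<bullet> c)) = - 1"
    by (elim disjE) (simp_all only: cis.ctr cos_pi sin_pi cos_minus sin_minus complex_eq_iff, auto)
  then have shift: "expc l (x + c) = - expc l x" for x
    by (simp add: expc_def inner_add_right distrib_left flip: cis_mult)
  let ?v = "\<chi> i. T"
  define Q where "Q = cbox (0 :: real^'n) ?v"
  define Q' where "Q' = cbox (- c) (?v - c)"
  define R where "R = cbox (0 :: real^'n) (?v - c)"
  have int: "integrable lborel (\<lambda>x. indicat_real (cbox a b) x *\<^sub>R expc l x)" for a b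
    using C_ap_set_integrable[OF expc_C_ap] by (simp add: set_integrable_def)
  have inti: "integrable lborel (indicat_real (cbox a b))" for a b :: "real^'n"
    by (rule integrable_indicator_cbox)
  have cn: "c $ j \<ge> 0" "c $ j \<le> t" for j using t by (auto simp: c_def axis_def)
  have RQ: "R \<subseteq> Q" "R \<subseteq> Q'"
    using cn t unfolding R_def Q_def Q'_def
    by (auto simp: mem_box_cart) (smt (verit, ccfv_SIG) cn(1))+
  have mQ: "measure lborel Q = T ^ CARD('n)" unfolding Q_def using t by (simp add: measure_cube)
  have "measure lborel Q' = (\<Prod>j\<in>UNIV. (?v - c) $ j - (- c) $ j)"
    unfolding Q'_def by (rule content_cbox_cart) (use t in \<open>auto simp: interval_ne_empty_cart\<close>)
  then have mQ': "measure lborel Q' = T ^ CARD('n)" by simp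
  have "measure lborel R = (\<Prod>j\<in>UNIV. (?v - c) $ j - 0 $ j)"
    unfolding R_def by (rule content_cbox_cart) (use cn(2) assms(2) in \<open>auto simp: interval_ne_empty_cart intro: order_trans less_imp_le\<close>)
  also have "\<dots> = ((?v - c) $ i - 0 $ i) * (\<Prod>j\<in>UNIV - {i}. (?v - c) $ j - 0 $ j)"
    by (rule prod.remove) auto
  also have "(\<Prod>j\<in>UNIV - {i}. (?v - c) $ j - 0 $ j) = T ^ (CARD('n) - 1)"
    by (simp add: c_def axis_def)
  finally have mR: "measure lborel R = (T - t) * T ^ (CARD('n) - 1)"
    by (simp add: c_def)
  have pow: "T ^ CARD('n) = T * T ^ (CARD('n) - 1)"
    by (simp add: power_eq_if)
  define I where "I = (\<lambda>A. LINT x|lborel. indicat_real A x *\<^sub>R expc l x)"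
  have diff: "cmod (I A - I R) \<le> t * T ^ (CARD('n) - 1)"
    if A: "A = cbox a b" "R \<subseteq> A" "measure lborel A = T ^ CARD('n)" for A a b
  proof -
    have "I A - I R = (LINT x|lborel. indicat_real A x *\<^sub>R expc l x - indicat_real R x *\<^sub>R expc l x)"
      unfolding I_def A(1) R_def by (rule Bochner_Integration.integral_diff[symmetric]) (rule int)+
    also have "cmod \<dots> \<le> (LINT x|lborel. indicat_real A x - indicat_real R x)"
    proof (rule Bochner_Integration.integral_norm_bound_integral)
      show "integrable lborel (\<lambda>x. indicat_real A x *\<^sub>R expc l x - indicat_real R x *\<^sub>R expc l x)"
        unfolding A(1) R_def by (intro Bochner_Integration.integrable_diff int)
      show "integrable lborel (\<lambda>x. indicat_real A x - indicat_real R x)"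
        unfolding A(1) R_def by (intro Bochner_Integration.integrable_diff inti)
      show "cmod (indicat_real A x *\<^sub>R expc l x - indicat_real R x *\<^sub>R expc l x)
          \<le> indicat_real A x - indicat_real R x" for x
        using A(2) by (auto simp: indicator_def)
    qed
    also have "\<dots> = measure lborel A - measure lborel R"
      unfolding A(1) R_def by (subst Bochner_Integration.integral_diff) (rule inti, rule inti, simp)
    also have "\<dots> = t * T ^ (CARD('n) - 1)"
      unfolding A(3) mR pow by (simp add: algebra_simps)
    finally show ?thesis .
  qed
  have "I Q = (LINT x|lborel. indicat_real Q (c + x) *\<^sub>R expc l (c + x))"
  proof -
    have m: "(\<lambda>x. indicat_real Q x *\<^sub>R expc l x) \<in> borel_measurable borel"
      using borel_measurable_integrable[OF int[of 0 ?v]] by (simp add: Q_def)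
    have "I Q = (LINT x|distr lborel borel ((+) c). indicat_real Q x *\<^sub>R expc l x)"
      unfolding I_def by (subst lborel_distr_plus) (rule refl)
    also have "\<dots> = (LINT x|lborel. indicat_real Q (c + x) *\<^sub>R expc l (c + x))"
      by (rule integral_distr) (use m in auto)
    finally show ?thesis .
  qed
  also have "\<dots> = (LINT x|lborel. - (indicat_real Q' x *\<^sub>R expc l x))"
  proof (rule Bochner_Integration.integral_cong[OF refl])
    fix x
    have "c + x \<in> Q \<longleftrightarrow> x \<in> Q'"
      by (auto simp: Q_def Q'_def mem_box_cart algebra_simps)
        (metis add.commute add_increasing2 le_minus_iff minus_le_iff diff_ge_0_iff_ge diff_minus_eq_add)+
    then show "indicat_real Q (c + x) *\<^sub>R expc l (c + x) = - (indicat_real Q' x *\<^sub>R expc l x)"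
      using shift[of x] by (auto simp: indicator_def add.commute)
  qed
  also have "\<dots> = - I Q'" by (simp add: I_def)
  finally have "2 * I Q = (I Q - I R) - (I Q' - I R)" by simp
  then have "cmod (2 * I Q) \<le> cmod (I Q - I R) + cmod (I Q' - I R)"
    by (metis norm_triangle_ineq4)
  also have "\<dots> \<le> t * T ^ (CARD('n) - 1) + t * T ^ (CARD('n) - 1)"
    by (intro add_mono diff RQ mQ mQ') (rule Q_def Q'_def)+
  finally have IQ: "cmod (I Q) \<le> t * T ^ (CARD('n) - 1)" by (simp add: norm_mult)
  have "cmod (cube_avg (expc l) T) = cmod (I Q) / T ^ CARD('n)"
    using t by (simp add: cube_avg_def set_lebesgue_integral_def I_def Q_def norm_divide norm_power)
  also have "\<dots> \<le> t * T ^ (CARD('n) - 1) / T ^ CARD('n)"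
    using IQ t by (intro divide_right_mono) auto
  also have "\<dots> = t / T" unfolding pow using t by simp
  finally show ?thesis .
qed

lemma cube_avg_expc_tendsto: "(cube_avg (expc l) \<longlongrightarrow> (if l = 0 then 1 else 0)) at_top"
proof (cases "l = 0")
  case True
  have "\<forall>\<^sub>F T in at_top. cube_avg (expc l) T = 1"
    using eventually_gt_at_top[of 0]
  proof eventually_elim
    case (elim T)
    then show ?case using cube_avg_const[of T] True by (simp add: expc_def[abs_def])
  qed
  then show ?thesis using True by (simp add: tendsto_eventually)
next
  case False
  then obtain i where i: "l $ i \<noteq> 0" by (auto simp: vec_eq_iff)
  define t where "t = 1 / (2 * \<bar>l $ i\<bar>)"
  have "((\<lambda>T. t / T) \<longlongrightarrow> 0) at_top"
    by (rule tendsto_divide_0[OF tendsto_const]) (simp add: filterlim_at_top_imp_at_infinity filterlim_ident)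
  moreover have "\<forall>\<^sub>F T in at_top. cmod (cube_avg (expc l) T) \<le> t / T"
    using eventually_gt_at_top[of t]
    by eventually_elim (rule cube_avg_expc_bound[OF i _ t_def])
  ultimately have "(cube_avg (expc l) \<longlongrightarrow> 0) at_top"
    by (rule Lim_null_comparison[rotated])
  then show ?thesis using False by simp
qed

lemma cube_avg_sum:
  assumes "finite S" "\<And>l. l \<in> S \<Longrightarrow> f l \<in> C_ap"
  shows "cube_avg (\<lambda>x. \<Sum>l\<in>S. f l x) T = (\<Sum>l\<in>S. cube_avg (f l) T) \<and> (\<lambda>x. \<Sum>l\<in>S. f l x) \<in> C_ap"
  using assms
proof (induction S)
  case empty
  then show ?case using C_ap_const[of 0] by (simp add: cube_avg_def)
next
  case (insert l S)
  then show ?case using C_ap_add[of "f l" "\<lambda>x. \<Sum>l\<in>S. f l x"] by (simp add: cube_avg_add)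
qed

lemma trig_cube_avg_converges:
  assumes "f \<in> trig_polynomials"
  shows "\<exists>m. (cube_avg f \<longlongrightarrow> m) at_top"
proof -
  obtain S c where fin: "finite S" and f: "f = (\<lambda>x. \<Sum>l\<in>S. c l * expc l x)"
    using assms unfolding trig_polynomials_def by blast
  have "cube_avg f = (\<lambda>T. \<Sum>l\<in>S. c l * cube_avg (expc l) T)"
    unfolding f using cube_avg_sum[OF fin, of "\<lambda>l x. c l * expc l x"]
    by (simp add: fun_eq_iff C_ap_cmult expc_C_ap cube_avg_cmult)
  moreover have "((\<lambda>T. \<Sum>l\<in>S. c l * cube_avg (expc l) T) \<longlongrightarrow> (\<Sum>l\<in>S. c l * (if l = 0 then 1 else 0))) at_top"
    by (intro tendsto_sum tendsto_mult tendsto_const cube_avg_expc_tendsto)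
  ultimately show ?thesis by metis
qed

lemma C_ap_cube_avg_converges:
  assumes "f \<in> C_ap"
  shows "\<exists>m. (cube_avg f \<longlongrightarrow> m) at_top"
proof -
  obtain p :: "nat \<Rightarrow> _" where p: "\<And>n. p n \<in> trig_polynomials" "uniform_limit UNIV p f sequentially"
    using assms unfolding C_ap_def by blast
  have pC: "p n \<in> C_ap" for n by (rule trig_C_ap[OF p(1)])
  have unif: "uniform_limit {0<..} (\<lambda>n. cube_avg (p n)) (cube_avg f) sequentially"
    unfolding uniform_limit_iff
  proof (intro allI impI)
    fix e :: real assume e: "e > 0"
    then have "\<forall>\<^sub>F n in sequentially. \<forall>x\<in>UNIV. dist (p n x) (f x) < e / 2"
      using p(2) unfolding uniform_limit_iff by (meson half_gt_zero)
    then show "\<forall>\<^sub>F n in sequentially. \<forall>T\<in>{0<..}. dist (cube_avg (p n) T) (cube_avg f T) < e"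
    proof eventually_elim
      case (elim n)
      have "cmod (cube_avg (p n) T - cube_avg f T) \<le> e / 2" if "T > 0" for T
        unfolding cube_avg_diff[OF pC assms, symmetric]
        by (rule norm_cube_avg_le[OF C_ap_diff[OF pC assms] _ that])
          (use elim in \<open>auto simp: dist_norm intro: less_imp_le\<close>)
      then show ?case using e by (fastforce simp: dist_norm)
    qed
  qed
  obtain m where m: "\<And>n. (cube_avg (p n) \<longlongrightarrow> m n) at_top"
    using trig_cube_avg_converges[OF p(1)] by metis
  have "Cauchy m"
    unfolding Cauchy_iff
  proof (intro allI impI)
    fix e :: real assume e: "e > 0"
    then have "\<forall>\<^sub>F n in sequentially. \<forall>T\<in>{0<..}. dist (cube_avg (p n) T) (cube_avg f T) < e / 3"
      using unif unfolding uniform_limit_iff by (meson divide_pos_pos zero_less_numeral)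
    then obtain N where N: "\<And>n T. n \<ge> N \<Longrightarrow> T > 0 \<Longrightarrow> dist (cube_avg (p n) T) (cube_avg f T) < e / 3"
      unfolding eventually_sequentially by auto
    have "cmod (m k - m n) < e" if "k \<ge> N" "n \<ge> N" for k n
    proof -
      have "((\<lambda>T. cmod (cube_avg (p k) T - cube_avg (p n) T)) \<longlongrightarrow> cmod (m k - m n)) at_top"
        by (intro tendsto_intros m)
      moreover have "\<forall>\<^sub>F T in at_top. cmod (cube_avg (p k) T - cube_avg (p n) T) \<le> 2 * e / 3"
        using eventually_gt_at_top[of 0]
      proof eventually_elim
        case (elim T)
        have "dist (cube_avg (p k) T) (cube_avg (p n) T) \<le> 2 * e / 3"
          using dist_triangle2[of "cube_avg (p k) T" "cube_avg (p n) T" "cube_avg f T"]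
            N[OF that(1) elim] N[OF that(2) elim] by linarith
        then show ?case by (simp add: dist_norm)
      qed
      ultimately have "cmod (m k - m n) \<le> 2 * e / 3"
        by (rule tendsto_upperbound) simp
      then show ?thesis using e by linarith
    qed
    then show "\<exists>M. \<forall>k\<ge>M. \<forall>n\<ge>M. cmod (m k - m n) < e" by blast
  qed
  then obtain L where L: "m \<longlonglongrightarrow> L" using Cauchy_convergent by (auto simp: convergent_def)
  have "(cube_avg f \<longlongrightarrow> L) at_top"
    by (rule swap_uniform_limit'[OF _ L unif]) (auto simp: m eventually_gt_at_top)
  then show ?thesis by blast
qed

lemma mean_value_eq: "mean_value f = Lim at_top (cube_avg f)"
  by (simp add: mean_value_def cube_avg_def[abs_def])

lemma mean_value_tendsto:
  assumes "f \<in> C_ap"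
  shows "(cube_avg f \<longlongrightarrow> mean_value f) at_top"
  using C_ap_cube_avg_converges[OF assms] tendsto_Lim[of at_top "cube_avg f"]
  by (auto simp: mean_value_eq)

lemma mean_value_eqI: "(cube_avg f \<longlongrightarrow> m) at_top \<Longrightarrow> mean_value f = m"
  unfolding mean_value_eq by (intro tendsto_Lim) auto

typedef (overloaded) 'n cap = "C_ap :: (real ^ 'n :: finite \<Rightarrow> complex) set"
  by (rule exI[of _ "\<lambda>_. 0"]) (rule C_ap_const)

setup_lifting type_definition_cap

instantiation cap :: (finite) complex_semi_inner
begin

lift_definition zero_cap :: "'a cap" is "\<lambda>_. 0" by (rule C_ap_const)
lift_definition plus_cap :: "'a cap \<Rightarrow> 'a cap \<Rightarrow> 'a cap" is "\<lambda>f g x. f x + g x" by (rule C_ap_add)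
lift_definition minus_cap :: "'a cap \<Rightarrow> 'a cap \<Rightarrow> 'a cap" is "\<lambda>f g x. f x - g x" by (rule C_ap_diff)
lift_definition uminus_cap :: "'a cap \<Rightarrow> 'a cap" is "\<lambda>f x. - f x"
  using C_ap_cmult[of _ "- 1"] by simp
lift_definition scaleC_cap :: "complex \<Rightarrow> 'a cap \<Rightarrow> 'a cap" is "\<lambda>c f x. c * f x" by (rule C_ap_cmult)
lift_definition cinner_cap :: "'a cap \<Rightarrow> 'a cap \<Rightarrow> complex" is "\<lambda>f g. mean_value (\<lambda>x. f x * cnj (g x))" .

instance
proof
  fix x y z :: "'a cap" and c d :: complex
  show "x + y + z = x + (y + z)" by transfer (simp add: add.assoc)
  show "x + y = y + x" by transfer (simp add: add.commute)
  show "0 + x = x" by transfer simp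
  show "- x + x = 0" by transfer simp
  show "x - y = x + - y" by transfer simp
  show "c *\<^sub>C (x + y) = c *\<^sub>C x + c *\<^sub>C y" by transfer (simp add: algebra_simps)
  show "(c + d) *\<^sub>C x = c *\<^sub>C x + d *\<^sub>C x" by transfer (simp add: algebra_simps)
  show "c *\<^sub>C d *\<^sub>C x = (c * d) *\<^sub>C x" by transfer (simp add: algebra_simps)
  show "1 *\<^sub>C x = x" by transfer simp
  show "cinner (x + y) z = cinner x z + cinner y z"
  proof transfer
    fix f g h :: "real^'a \<Rightarrow> complex" assume *: "f \<in> C_ap" "g \<in> C_ap" "h \<in> C_ap"
    have "((\<lambda>T. cube_avg (\<lambda>x. f x * cnj (h x)) T + cube_avg (\<lambda>x. g x * cnj (h x)) T) \<longlongrightarrow>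
        mean_value (\<lambda>x. f x * cnj (h x)) + mean_value (\<lambda>x. g x * cnj (h x))) at_top"
      by (intro tendsto_add mean_value_tendsto C_ap_mult_cnj *)
    moreover have "cube_avg (\<lambda>x. (f x + g x) * cnj (h x)) =
        (\<lambda>T. cube_avg (\<lambda>x. f x * cnj (h x)) T + cube_avg (\<lambda>x. g x * cnj (h x)) T)"
      by (simp add: fun_eq_iff distrib_right cube_avg_add C_ap_mult_cnj *)
    ultimately show "mean_value (\<lambda>x. (f x + g x) * cnj (h x)) =
        mean_value (\<lambda>x. f x * cnj (h x)) + mean_value (\<lambda>x. g x * cnj (h x))"
      by (intro mean_value_eqI) simp
  qed
  show "cinner (c *\<^sub>C x) y = c * cinner x y"
  proof transfer
    fix c and f g :: "real^'a \<Rightarrow> complex" assume *: "f \<in> C_ap" "g \<in> C_ap"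
    have "((\<lambda>T. c * cube_avg (\<lambda>x. f x * cnj (g x)) T) \<longlongrightarrow> c * mean_value (\<lambda>x. f x * cnj (g x))) at_top"
      by (intro tendsto_mult tendsto_const mean_value_tendsto C_ap_mult_cnj *)
    then show "mean_value (\<lambda>x. c * f x * cnj (g x)) = c * mean_value (\<lambda>x. f x * cnj (g x))"
      by (intro mean_value_eqI) (simp add: mult.assoc cube_avg_cmult[abs_def])
  qed
  show "cinner x y = cnj (cinner y x)"
  proof transfer
    fix f g :: "real^'a \<Rightarrow> complex" assume *: "f \<in> C_ap" "g \<in> C_ap"
    have "((\<lambda>T. cnj (cube_avg (\<lambda>x. g x * cnj (f x)) T)) \<longlongrightarrow> cnj (mean_value (\<lambda>x. g x * cnj (f x)))) at_top"
      by (intro tendsto_cnj mean_value_tendsto C_ap_mult_cnj *)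
    then show "mean_value (\<lambda>x. f x * cnj (g x)) = cnj (mean_value (\<lambda>x. g x * cnj (f x)))"
      by (intro mean_value_eqI) (simp add: mult.commute flip: cube_avg_cnj)
  qed
  show "0 \<le> Re (cinner x x)"
  proof transfer
    fix f :: "real^'a \<Rightarrow> complex" assume *: "f \<in> C_ap"
    have "((\<lambda>T. Re (cube_avg (\<lambda>x. f x * cnj (f x)) T)) \<longlongrightarrow> Re (mean_value (\<lambda>x. f x * cnj (f x)))) at_top"
      by (intro tendsto_Re mean_value_tendsto C_ap_mult_cnj *)
    moreover have "\<forall>\<^sub>F T in at_top. 0 \<le> Re (cube_avg (\<lambda>x. f x * cnj (f x)) T)"
      using eventually_gt_at_top[of 0]
    proof eventually_elim
      case (elim T)
      have "(LINT x:cbox 0 (\<chi> i. T)|lborel. f x * cnj (f x)) =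
          complex_of_real (LINT x:cbox 0 (\<chi> i. T)|lborel. (cmod (f x))\<^sup>2)"
        by (simp only: complex_norm_square[symmetric] set_integral_complex_of_real)
      moreover have "0 \<le> (LINT x:cbox 0 (\<chi> i. T)|lborel. (cmod (f x))\<^sup>2)"
        by (simp add: set_lebesgue_integral_def)
      ultimately show ?case using elim by (simp add: cube_avg_def flip: of_real_power)
    qed
    ultimately show "0 \<le> Re (mean_value (\<lambda>x. f x * cnj (f x)))"
      by (rule tendsto_lowerbound) simp
  qed
qed

end

subsection \<open>Smooth functions and symbol classes\<close>

text \<open>Iterated partial derivatives along a list of coordinate directions. As the order of
  differentiation is irrelevant for smooth functions, a multi-index \<open>\<alpha>\<close> is represented by a list in
  which the \<open>i\<close>-th coordinate direction occurs \<open>\<alpha>\<^sub>i\<close> times, so that \<open>|\<alpha>|\<close> is its length.\<close>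

definition iter_deriv :: "'a list \<Rightarrow> ('a :: euclidean_space \<Rightarrow> complex) \<Rightarrow> 'a \<Rightarrow> complex" where
  "iter_deriv vs f = foldr (\<lambda>v g x. frechet_derivative g (at x) v) vs f"

definition smooth :: "('a :: euclidean_space \<Rightarrow> complex) \<Rightarrow> bool" where
  "smooth f \<longleftrightarrow> (\<forall>vs. set vs \<subseteq> Basis \<longrightarrow> (\<forall>x. iter_deriv vs f differentiable (at x)))"

definition schwartz :: "('a :: euclidean_space \<Rightarrow> complex) \<Rightarrow> bool" where
  "schwartz f \<longleftrightarrow> smooth f \<and>
    (\<forall>(k :: nat) vs. set vs \<subseteq> Basis \<longrightarrow> bounded (range (\<lambda>x. norm x ^ k *\<^sub>R iter_deriv vs f x)))"

definition japanese_bracket :: "real^'n \<Rightarrow> real" where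
  "japanese_bracket xi = sqrt (1 + (norm xi)\<^sup>2)"

definition APS0 :: "real \<Rightarrow> real \<Rightarrow> ((real^'n) \<times> (real^'n) \<Rightarrow> complex) set" where
  "APS0 \<rho> \<delta> = {a. smooth a \<and> (\<forall>xi. (\<lambda>x. a (x, xi)) \<in> C_ap) \<and>
    (\<forall>\<alpha> \<beta>. set \<alpha> \<subseteq> Basis \<and> set \<beta> \<subseteq> Basis \<longrightarrow>
      bounded (range (\<lambda>(x, xi). japanese_bracket xi powr (\<rho> * real (length \<alpha>) - \<delta> * real (length \<beta>)) *\<^sub>R
        iter_deriv (map (\<lambda>v. (0, v)) \<alpha> @ map (\<lambda>v. (v, 0)) \<beta>) a (x, xi))))}"

definition fourier :: "(real^'n \<Rightarrow> 'h :: complex_inner) \<Rightarrow> real^'n \<Rightarrow> 'h" where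
  "fourier f xi = strong_integral lborel (\<lambda>x. expc (- xi) x *\<^sub>C f x)"

subsection \<open>Bounded extensions and unitary equivalence\<close>

definition bounded_clinear :: "('a :: complex_inner \<Rightarrow> 'b :: complex_inner) \<Rightarrow> bool" where
  "bounded_clinear T \<longleftrightarrow> bounded_linear T \<and> (\<forall>c x. T (c *\<^sub>C x) = c *\<^sub>C T x)"

text \<open>The bounded operator extending a densely defined one, where \<open>ext T\<close> says that \<open>T\<close> agrees with
  the latter on its domain; totalized by \<open>0\<close> if there is no bounded extension.\<close>

definition bounded_extension :: "(('a :: complex_inner \<Rightarrow> 'b :: complex_inner) \<Rightarrow> bool) \<Rightarrow> 'a \<Rightarrow> 'b" where
  "bounded_extension ext =
    (if \<exists>T. bounded_clinear T \<and> ext T then THE T. bounded_clinear T \<and> ext T else (\<lambda>_. 0))"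

definition unitary :: "('a :: complex_inner \<Rightarrow> 'b :: complex_inner) \<Rightarrow> bool" where
  "unitary V \<longleftrightarrow> bounded_clinear V \<and> surj V \<and> (\<forall>x y. cinner (V x) (V y) = cinner x y)"

definition unitarily_equivalent ::
  "('a :: complex_inner \<Rightarrow> 'a) \<Rightarrow> ('b :: complex_inner \<Rightarrow> 'b) \<Rightarrow> bool" where
  "unitarily_equivalent S T \<longleftrightarrow> (\<exists>V. unitary V \<and> V \<circ> S = T \<circ> V)"

subsection \<open>The operator \<open>U(a)(D)\<close>\<close>

definition symbol_coeff :: "((real^'n) \<times> (real^'n) \<Rightarrow> complex) \<Rightarrow> real^'n \<Rightarrow> real^'n \<Rightarrow> complex" where
  "symbol_coeff a l xi = mean_value (\<lambda>x. a (x, xi) * expc (- l) x)"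

text \<open>Only applied to finitely supported \<open>z\<close>, for which the resulting family is square summable by
  Bessel's inequality whenever the functions \<open>a(\<cdot>, \<xi>)\<close> are almost periodic.\<close>

definition U_symbol ::
  "((real^'n) \<times> (real^'n) \<Rightarrow> complex) \<Rightarrow> real^'n \<Rightarrow> (real^'n) ell2 \<Rightarrow> (real^'n) ell2" where
  "U_symbol a xi z =
    Abs_ell2 (\<lambda>l. \<Sum>\<^sub>\<infinity>l'. symbol_coeff a (l' - l) (xi - l') * ell2_nth z l')"

definition schwartz_l2f :: "(real^'n \<Rightarrow> (real^'n) ell2) set" where
  "schwartz_l2f = {F. \<exists>(m :: nat) \<phi> l. (\<forall>j<m. schwartz (\<phi> j)) \<and>
    F = (\<lambda>x. \<Sum>j<m. \<phi> j x *\<^sub>C ell2_delta (l j))}"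

definition U_fun ::
  "((real^'n) \<times> (real^'n) \<Rightarrow> complex) \<Rightarrow> (real^'n \<Rightarrow> (real^'n) ell2) \<Rightarrow> real^'n \<Rightarrow> (real^'n) ell2" where
  "U_fun a F x = strong_integral lborel (\<lambda>xi. expc xi x *\<^sub>C U_symbol a xi (fourier F xi))"

definition U_op ::
  "((real^'n) \<times> (real^'n) \<Rightarrow> complex) \<Rightarrow> (real^'n, (real^'n) ell2) L2 \<Rightarrow> (real^'n, (real^'n) ell2) L2" where
  "U_op a = bounded_extension (\<lambda>T. \<forall>F\<in>schwartz_l2f.
    square_integrable (U_fun a F) \<and> T (abs_L2 F) = abs_L2 (U_fun a F))"

subsection \<open>The operator \<open>A(a(y, D))\<close>\<close>

type_synonym 'n B2 = "'n cap hcompletion"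

type_synonym 'n B2_L2 = "('n cap hcompletion, (real^'n, complex) L2) htensor"

definition expc_B2 :: "real^'n \<Rightarrow> 'n B2" where
  "expc_B2 l = to_completion (Abs_cap (expc l))"

text \<open>The identification of an almost periodic function \<open>W : \<real>\<^sup>d \<rightarrow> H\<close> with an element of
  \<open>B\<^sup>2(\<real>\<^sup>d) \<otimes> H\<close>: trigonometric polynomials \<open>\<Sum>\<^sub>j e\<^sub>\<lambda>\<^sub>j h\<^sub>j\<close> correspond to \<open>\<Sum>\<^sub>j e\<^sub>\<lambda>\<^sub>j \<otimes> h\<^sub>j\<close>, and uniform
  limits of the former to the norm limits of the latter.\<close>

definition represents_ap ::
  "(real^'n \<Rightarrow> 'h :: complex_inner) \<Rightarrow> ('n B2, 'h) htensor \<Rightarrow> bool" where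
  "represents_ap W k \<longleftrightarrow> (\<forall>\<epsilon>>0. \<exists>(m :: nat) l h.
    (\<forall>x. norm (W x - (\<Sum>j<m. expc (l j) x *\<^sub>C h j)) < \<epsilon>) \<and>
    norm (k - (\<Sum>j<m. expc_B2 (l j) \<otimes>\<^sub>H h j)) < \<epsilon>)"

definition A_fun ::
  "((real^'n) \<times> (real^'n) \<Rightarrow> complex) \<Rightarrow> (real^'n \<Rightarrow> real^'n \<Rightarrow> complex) \<Rightarrow> real^'n \<Rightarrow> real^'n \<Rightarrow> complex" where
  "A_fun a u x y = (LINT xi|lborel. expc xi y * a (x + y, xi) * fourier (u x) xi)"

definition A_op :: "((real^'n) \<times> (real^'n) \<Rightarrow> complex) \<Rightarrow> 'n B2_L2 \<Rightarrow> 'n B2_L2" where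
  "A_op a = bounded_extension (\<lambda>T. \<forall>(m :: nat) l f. (\<forall>j<m. schwartz (f j)) \<longrightarrow>
    (let u = (\<lambda>x y. \<Sum>j<m. expc (l j) x * f j y) in
      (\<forall>x. square_integrable (A_fun a u x)) \<and>
      represents_ap (\<lambda>x. abs_L2 (A_fun a u x)) (T (\<Sum>j<m. expc_B2 (l j) \<otimes>\<^sub>H abs_L2 (f j)))))"

end

theory Submission
  imports Defs
begin

text \<open>Let \<open>V\<close> be the unitary map with \<open>V (\<phi> \<delta>\<^sub>\<lambda>) = e\<^sub>-\<^sub>\<lambda> \<otimes> f\<close>, \<open>f = e\<^sub>-\<^sub>\<lambda> \<phi>\<close>. For a Schwartz function \<open>\<phi>\<close>
  and the Fourier transform \<open>F\<close> of \<open>f\<close>, the function \<open>g(z, y) = \<integral> e\<^sup>2\<^sup>\<pi>\<^sup>i\<^sup>\<xi>\<^sup>\<cdot>\<^sup>y a(z, \<xi>) F(\<xi>) d\<xi>\<close> is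
  almost periodic in \<open>z\<close>. Its Bohr coefficients in \<open>z\<close> give \<open>U(a)(D)\<close> on \<open>\<phi> \<delta>\<^sub>\<lambda>\<close>, up to modulation,
  and its values at \<open>z = x + y\<close> give \<open>A(a(y,D))\<close> on \<open>e\<^sub>-\<^sub>\<lambda> \<otimes> f\<close>.
  For a trigonometric polynomial in \<open>z\<close> it is clear that \<open>V\<close> takes one into the other; the general
  case follows by approximating \<open>g(z, \<cdot>)\<close> in \<open>L\<^sup>2\<close> by such polynomials, uniformly in \<open>z\<close>, where the
  decay of \<open>g\<close> in \<open>y\<close> comes from integration by parts.
  Hence \<open>V\<close> intertwines the densely defined operators, and a bounded operator extends one of them if
  and only if its conjugate by \<open>V\<close> extends the other; the argument does not use \<open>L\<^sup>2\<close> bounds.\<close>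

text \<open>The modulations in V come from a formal computation. Let g(z, y) be the sum over
  \<kappa> of c_\<kappa>(y) e_\<kappa>(z). In component k of U(a)(D) on \<phi> \<delta>_\<lambda>
  the symbol enters as a_{\<lambda>-k}(\<xi>-\<lambda>); translating \<xi> by \<lambda> turns the
  transform of \<phi> into that of f and yields the sum of e_\<lambda> c_\<kappa>
  \<delta>_{\<lambda>-\<kappa>}. V sends it to the sum of e_{\<kappa>-\<lambda>} \<otimes>
  e_\<kappa> c_\<kappa>, that is e_{-\<lambda>}(x) g(x+y, y). The Bohr series of g need not converge
  uniformly, so finite sums are used, with an error controlled in two ways at once: uniformly in x
  on the side of A, in L^2 on the side of U. One majorant E(y) of the squared error, free of z,
  serves both. Two obstacles shape the rest. The space l^2(R^d) is nonseparable, so measurability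
  and integrals are secured through separable ranges. And a tensor is tied to a function only by
  \<open>represents_ap\<close>, so this relation must be shown single valued
  (\<open>represents_ap_unique\<close>).\<close>

subsection \<open>Strong measurability and the strong integral\<close>

text \<open>A criterion of Pettis type: with a separable range and measurable distances to a dense
  sequence, a nearest point to \<open>f x\<close> among the first members of the sequence depends on
  x as a simple function, and these functions converge to \<open>f\<close>.\<close>

lemma strongly_measurable_if_countable_closure:
  fixes f :: "'a \<Rightarrow> 'b :: real_normed_vector"
  assumes D: "countable D" "\<And>x. x \<in> space M \<Longrightarrow> f x \<in> closure D"
    and meas: "\<And>d. d \<in> D \<Longrightarrow> (\<lambda>x. norm (f x - d)) \<in> borel_measurable M"
  shows "strongly_measurable M f"
proof (cases "D = {}")
  case True
  then have "space M = {}" using D(2) by auto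
  then show ?thesis
    unfolding strongly_measurable_def
    by (intro exI[of _ "\<lambda>_ _. 0"]) auto
next
  case False
  define d where "d = from_nat_into D"
  have d: "d k \<in> D" for k using False by (simp add: d_def from_nat_into)
  have dsurj: "\<exists>k. d k = y" if "y \<in> D" for y
    using that D(1) unfolding d_def by (metis from_nat_into_to_nat_on)
  have [measurable]: "(\<lambda>x. norm (f x - d k)) \<in> borel_measurable M" for k
    by (rule meas[OF d])
  \<comment> \<open>\<open>I n x\<close> is the least index of a point among the first n + 1 that is
    nearest to \<open>f x\<close>; breaking ties by \<open>LEAST\<close> makes the choice
    measurable.\<close>
  define P where "P n x k \<longleftrightarrow> k \<le> n \<and> (\<forall>j\<in>{..n}. norm (f x - d k) \<le> norm (f x - d j))" for n k x
  define I where "I n x = (LEAST k. P n x k)" for n x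
  have ex: "\<exists>k. P n x k" for n x
    using ex_min_if_finite[of "(\<lambda>j. norm (f x - d j)) ` {..n}"]
    by (fastforce simp: P_def not_less)
  have PI: "P n x (I n x)" for n x
    unfolding I_def using ex by (rule LeastI_ex)
  have [measurable]: "I n \<in> measurable M (count_space UNIV)" for n
    unfolding I_def P_def by measurable
  have simple: "simple_function M (I n)" for n
    unfolding simple_function_def
  proof (intro conjI ballI)
    have "I n ` space M \<subseteq> {..n}" using PI[of n] by (auto simp: P_def)
    then show "finite (I n ` space M)" by (rule finite_subset) simp
    show "I n -` {x} \<inter> space M \<in> sets M" for x by measurable
  qed
  have "(\<lambda>n. d (I n x)) \<longlonglongrightarrow> f x" if x: "x \<in> space M" for x
    unfolding LIMSEQ_iff
  proof (intro allI impI)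
    fix e :: real assume "e > 0"
    then obtain y where "y \<in> D" "dist y (f x) < e"
      using D(2)[OF x] unfolding closure_approachable by blast
    then obtain j where j: "norm (f x - d j) < e"
      using dsurj by (metis dist_norm norm_minus_commute)
    have "norm (d (I n x) - f x) < e" if "n \<ge> j" for n
      using PI[of n x] that j unfolding P_def by (metis atMost_iff le_less_trans norm_minus_commute)
    then show "\<exists>j. \<forall>n\<ge>j. norm (d (I n x) - f x) < e" by blast
  qed
  then show ?thesis
    unfolding strongly_measurable_def
    by (intro exI[of _ "\<lambda>n x. d (I n x)"]) (auto intro: simple_function_compose1[OF simple])
qed

lemma strongly_measurable_countable_closure:
  assumes "strongly_measurable M f"
  obtains D where "countable D" "\<And>x. x \<in> space M \<Longrightarrow> f x \<in> closure D"
proof -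
  obtain s where s: "\<And>n. simple_function M (s n)" "\<And>x. x \<in> space M \<Longrightarrow> (\<lambda>n. s n x) \<longlonglongrightarrow> f x"
    using assms unfolding strongly_measurable_def by blast
  have "countable (\<Union>n. s n ` space M)"
    using s(1) by (auto simp: simple_function_def intro: countable_finite)
  moreover have "f x \<in> closure (\<Union>n. s n ` space M)" if "x \<in> space M" for x
    using that
    by (intro Lim_in_closed_set[OF closed_closure _ _ s(2)[OF that]])
      (auto intro!: always_eventually closure_subset[THEN subsetD])
  ultimately show ?thesis by (rule that)
qed

lemma strongly_measurable_diff:
  fixes f g :: "'a \<Rightarrow> 'b :: real_normed_vector"
  shows "strongly_measurable M f \<Longrightarrow> strongly_measurable M g \<Longrightarrow> strongly_measurable M (\<lambda>x. f x - g x)"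
  by (rule strongly_measurable_compose2) (auto intro: tendsto_diff)

text \<open>The simple approximants of the \<open>F n\<close> converge only pointwise, so a diagonal
  sequence is not at hand. Instead the union of the countable sets belonging to the
  \<open>F n\<close> has \<open>f x\<close> in its closure, and the distances are limits of
  measurable functions.\<close>

lemma strongly_measurable_LIMSEQ:
  fixes f :: "'a \<Rightarrow> 'b :: real_normed_vector"
  assumes fn: "\<And>n :: nat. strongly_measurable M (F n)"
    and lim: "\<And>x. x \<in> space M \<Longrightarrow> (\<lambda>n. F n x) \<longlonglongrightarrow> f x"
  shows "strongly_measurable M f"
proof -
  have "\<forall>n. \<exists>D. countable D \<and> (\<forall>x\<in>space M. F n x \<in> closure D)"
    using fn by (metis strongly_measurable_countable_closure)
  then obtain D where D: "\<And>n. countable (D n)" "\<And>n x. x \<in> space M \<Longrightarrow> F n x \<in> closure (D n)"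
    by metis
  show ?thesis
  proof (rule strongly_measurable_if_countable_closure)
    show "countable (\<Union>n. D n)" using D(1) by blast
    show "f x \<in> closure (\<Union>n. D n)" if "x \<in> space M" for x
    proof (rule Lim_in_closed_set[OF closed_closure _ _ lim[OF that]])
      show "\<forall>\<^sub>F n in sequentially. F n x \<in> closure (\<Union>n. D n)"
        using D(2)[OF that] closure_mono[of _ "\<Union>n. D n"] by (intro always_eventually allI) blast
    qed simp
    show "(\<lambda>x. norm (f x - d)) \<in> borel_measurable M" for d
    proof (rule borel_measurable_LIMSEQ_metric)
      show "(\<lambda>x. norm (F n x - d)) \<in> borel_measurable M" for n
        by (intro strongly_measurable_norm strongly_measurable_diff fn strongly_measurable_const)
      show "(\<lambda>n. norm (F n x - d)) \<longlonglongrightarrow> norm (f x - d)" if "x \<in> space M" for x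
        by (intro tendsto_intros lim that)
    qed
  qed
qed

text \<open>The image of a countable dense set is dense in the range, so the target may be
  nonseparable. The integrand of U(a)(D) is handled in this way.\<close>

lemma continuous_strongly_measurable:
  fixes f :: "'a :: euclidean_space \<Rightarrow> 'b :: real_normed_vector"
  assumes "continuous_on UNIV f"
  shows "strongly_measurable lborel f"
proof -
  obtain S :: "'a set" where S: "countable S" "S \<subseteq> UNIV" "UNIV \<subseteq> closure S"
    using separable[of UNIV] by blast
  show ?thesis
  proof (rule strongly_measurable_if_countable_closure)
    show "countable (f ` S)" using S(1) by simp
    have "f ` closure S \<subseteq> closure (f ` S)"
      by (rule image_closure_subset) (auto intro: continuous_on_subset[OF assms] closure_subset[THEN subsetD])
    then show "f x \<in> closure (f ` S)" for x using S(3) by blast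
    show "(\<lambda>x. norm (f x - d)) \<in> borel_measurable lborel" for d
      unfolding measurable_lborel2
      by (rule borel_measurable_continuous_onI) (intro continuous_intros assms)
  qed
qed

lemma strongly_measurable_if:
  fixes f g :: "'a \<Rightarrow> 'b :: topological_space"
  assumes "strongly_measurable M f" "strongly_measurable M g" "{x \<in> space M. P x} \<in> sets M"
  shows "strongly_measurable M (\<lambda>x. if P x then f x else g x)"
proof -
  obtain s t where "\<And>n. simple_function M (s n)" "\<And>x. x \<in> space M \<Longrightarrow> (\<lambda>n. s n x) \<longlonglongrightarrow> f x"
    "\<And>n. simple_function M (t n)" "\<And>x. x \<in> space M \<Longrightarrow> (\<lambda>n. t n x) \<longlonglongrightarrow> g x"
    using assms unfolding strongly_measurable_def by blast
  then show ?thesis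
    unfolding strongly_measurable_def using assms(3)
    by (intro exI[of _ "\<lambda>n x. if P x then s n x else t n x"]) (auto intro: simple_function_If)
qed

lemma bounded_bilinear_scaleC: "bounded_bilinear (scaleC :: complex \<Rightarrow> 'a :: complex_inner \<Rightarrow> 'a)"
proof
  show "\<exists>K. \<forall>c x. norm (c *\<^sub>C x :: 'a) \<le> norm c * norm x * K"
    by (rule exI[of _ 1]) (simp add: norm_scaleC)
  show "(r *\<^sub>R c) *\<^sub>C x = r *\<^sub>R c *\<^sub>C x" "c *\<^sub>C r *\<^sub>R x = r *\<^sub>R c *\<^sub>C x" for r c and x :: 'a
    by (simp_all only: scaleR_scaleC[where 'a = 'a] scaleC_scaleC scaleR_conv_of_real mult.commute)
qed (simp_all add: scaleC_add_left scaleC_add_right)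

lemma strongly_measurable_scaleC_fun:
  fixes f :: "'a \<Rightarrow> 'b :: complex_inner"
  assumes "h \<in> borel_measurable M" "strongly_measurable M f"
  shows "strongly_measurable M (\<lambda>x. h x *\<^sub>C f x)"
  by (rule strongly_measurable_compose2[OF assms(1)[folded strongly_measurable_iff_borel] assms(2)])
    (rule bounded_bilinear.tendsto[OF bounded_bilinear_scaleC])

section \<open>The strong integral: existence, uniqueness, interchange with bounded linear
  maps\<close>

lemma norm_simple_bochner_integral_diff_le:
  fixes f :: "'a \<Rightarrow> 'b :: real_normed_vector"
  assumes f: "strongly_measurable M f"
    and s: "Bochner_Integration.simple_bochner_integrable M s"
    and t: "Bochner_Integration.simple_bochner_integrable M t"
  shows "ennreal (norm (Bochner_Integration.simple_bochner_integral M s - Bochner_Integration.simple_bochner_integral M t)) \<le>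
    (\<integral>\<^sup>+ x. norm (f x - s x) \<partial>M) + (\<integral>\<^sup>+ x. norm (f x - t x) \<partial>M)"
    (is "ennreal (norm (?s - ?t)) \<le> ?S + ?T")
proof -
  have m: "(\<lambda>x. norm (f x - u x)) \<in> borel_measurable M"
    if "Bochner_Integration.simple_bochner_integrable M u" for u
  proof -
    have "simple_function M u" using that by (auto elim: Bochner_Integration.simple_bochner_integrable.cases)
    then have "strongly_measurable M u"
      unfolding strongly_measurable_def by (intro exI[of _ "\<lambda>_. u"]) auto
    then show ?thesis by (intro strongly_measurable_norm strongly_measurable_diff f)
  qed
  have "ennreal (norm (?s - ?t)) = norm (Bochner_Integration.simple_bochner_integral M (\<lambda>x. s x - t x))"
    using s t by (subst simple_bochner_integral_diff) auto
  also have "\<dots> \<le> Bochner_Integration.simple_bochner_integral M (\<lambda>x. norm (s x - t x))"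
    using simple_bochner_integrable_compose2[of "(-)" M "s" "t"] s t
    by (auto intro!: simple_bochner_integral_norm_bound)
  also have "\<dots> = (\<integral>\<^sup>+x. norm (s x - t x) \<partial>M)"
    using simple_bochner_integrable_compose2[of "\<lambda>x y. norm (x - y)" M "s" "t"] s t
    by (auto intro!: simple_bochner_integral_eq_nn_integral)
  also have "\<dots> \<le> (\<integral>\<^sup>+x. ennreal (norm (f x - s x)) + ennreal (norm (f x - t x)) \<partial>M)"
  proof (rule nn_integral_mono)
    fix x
    have "norm (s x - t x) \<le> norm (f x - s x) + norm (f x - t x)"
      by (metis dual_order.refl norm_diff_triangle_le norm_minus_commute)
    then show "ennreal (norm (s x - t x)) \<le> ennreal (norm (f x - s x)) + ennreal (norm (f x - t x))"
      by (metis ennreal_leI ennreal_plus norm_ge_zero)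
  qed
  also have "\<dots> = ?S + ?T"
    by (rule nn_integral_add) (use m s t in auto)
  finally show ?thesis .
qed

lemma has_strong_integral_exists:
  fixes f :: "'a \<Rightarrow> 'b :: {real_normed_vector, complete_space}"
  assumes f: "strongly_measurable M f" and int: "integrable M (\<lambda>x. norm (f x))"
  shows "\<exists>I. has_strong_integral M f I"
proof -
  obtain s where s: "\<And>n. simple_function M (s n)" "\<And>x. x \<in> space M \<Longrightarrow> (\<lambda>n. s n x) \<longlonglongrightarrow> f x"
    using f unfolding strongly_measurable_def by blast
  have [measurable]: "(\<lambda>x. norm (f x)) \<in> borel_measurable M" by (rule strongly_measurable_norm[OF f])
  have sm: "strongly_measurable M (s n)" for n
    unfolding strongly_measurable_def by (intro exI[of _ "\<lambda>_. s n"]) (auto simp: s(1))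
  have [measurable]: "(\<lambda>x. norm (s n x)) \<in> borel_measurable M" for n
    by (rule strongly_measurable_norm[OF sm])
  \<comment> \<open>Truncation at twice \<open>norm (f x)\<close> provides an integrable majorant.
    The factor exceeds 1 so that the truncation is eventually inactive wherever \<open>f x\<close>
    is nonzero.\<close>
  define t where "t n x = (if norm (s n x) \<le> 2 * norm (f x) then s n x else 0)" for n x
  have t_simple: "simple_function M (t n)" for n
    unfolding t_def by (intro simple_function_If s(1)) auto
  have t_le: "norm (t n x) \<le> 2 * norm (f x)" for n x by (simp add: t_def)
  have t_lim: "(\<lambda>n. t n x) \<longlonglongrightarrow> f x" if x: "x \<in> space M" for x
  proof (cases "f x = 0")
    case True
    then have "t n x = 0" for n using t_le[of n x] by simp
    then show ?thesis using True by simp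
  next
    case False
    have "(\<lambda>n. norm (s n x)) \<longlonglongrightarrow> norm (f x)" by (intro tendsto_norm s x)
    then have "\<forall>\<^sub>F n in sequentially. norm (s n x) < 2 * norm (f x)"
      by (rule order_tendstoD(2)) (use False in simp)
    then have "\<forall>\<^sub>F n in sequentially. s n x = t n x"
      by eventually_elim (simp add: t_def)
    then show ?thesis using s(2)[OF x] by (rule Lim_transform_eventually[rotated])
  qed
  have fin: "(\<integral>\<^sup>+ x. norm (f x) \<partial>M) < \<infinity>"
    using int by (simp add: integrable_iff_bounded)
  have t_int: "Bochner_Integration.simple_bochner_integrable M (t n)" for n
  proof (rule simple_bochner_integrableI_bounded[OF t_simple])
    have "(\<integral>\<^sup>+ x. norm (t n x) \<partial>M) \<le> (\<integral>\<^sup>+ x. 2 * ennreal (norm (f x)) \<partial>M)"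
      using t_le by (intro nn_integral_mono) (simp add: ennreal_mult'[symmetric] flip: ennreal_numeral)
    also have "\<dots> = 2 * (\<integral>\<^sup>+ x. norm (f x) \<partial>M)"
      by (rule nn_integral_cmult) simp
    also have "\<dots> < \<infinity>" using fin by (simp add: ennreal_mult_less_top)
    finally show "(\<integral>\<^sup>+ x. norm (t n x) \<partial>M) < \<infinity>" .
  qed
  have tm: "strongly_measurable M (t n)" for n
    unfolding strongly_measurable_def by (intro exI[of _ "\<lambda>_. t n"]) (auto simp: t_simple)
  have "(\<lambda>n. \<integral>\<^sup>+ x. ennreal (norm (f x - t n x)) \<partial>M) \<longlonglongrightarrow> (\<integral>\<^sup>+ x. 0 \<partial>M)"
  proof (rule nn_integral_dominated_convergence[where w = "\<lambda>x. 3 * ennreal (norm (f x))"])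
    show "(\<lambda>x. ennreal (norm (f x - t j x))) \<in> borel_measurable M" for j
      using strongly_measurable_norm[OF strongly_measurable_diff[OF f tm]] by measurable
    show "AE x in M. ennreal (norm (f x - t j x)) \<le> 3 * ennreal (norm (f x))" for j
    proof (rule AE_I2)
      fix x
      have "norm (f x - t j x) \<le> 3 * norm (f x)"
        using norm_triangle_ineq4[of "f x" "t j x"] t_le[of j x] by simp
      then show "ennreal (norm (f x - t j x)) \<le> 3 * ennreal (norm (f x))"
        by (simp add: ennreal_mult'[symmetric] flip: ennreal_numeral)
    qed
    show "(\<integral>\<^sup>+ x. 3 * ennreal (norm (f x)) \<partial>M) < \<infinity>"
      using fin by (subst nn_integral_cmult) (auto simp: ennreal_mult_less_top)
    show "AE x in M. (\<lambda>i. ennreal (norm (f x - t i x))) \<longlonglongrightarrow> 0"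
    proof (rule AE_I2)
      fix x assume "x \<in> space M"
      then have "(\<lambda>i. norm (f x - t i x)) \<longlonglongrightarrow> norm (f x - f x)"
        by (intro tendsto_intros t_lim)
      then show "(\<lambda>i. ennreal (norm (f x - t i x))) \<longlonglongrightarrow> 0"
        using tendsto_ennrealI by fastforce
    qed
  qed auto
  then have lim0: "(\<lambda>n. \<integral>\<^sup>+ x. ennreal (norm (f x - t n x)) \<partial>M) \<longlonglongrightarrow> 0" by simp
  let ?i = "\<lambda>n. Bochner_Integration.simple_bochner_integral M (t n)"
  have "Cauchy ?i"
    unfolding Cauchy_iff
  proof (intro allI impI)
    fix e :: real assume e: "e > 0"
    then have "0 < ennreal (e / 2)" by simp
    then obtain N where N: "\<And>n. n \<ge> N \<Longrightarrow> (\<integral>\<^sup>+ x. ennreal (norm (f x - t n x)) \<partial>M) < ennreal (e / 2)"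
      using order_tendstoD(2)[OF lim0] unfolding eventually_sequentially by blast
    have "norm (?i m - ?i n) < e" if "m \<ge> N" "n \<ge> N" for m n
    proof -
      have "ennreal (norm (?i m - ?i n)) < ennreal (e / 2) + ennreal (e / 2)"
        using norm_simple_bochner_integral_diff_le[OF f t_int t_int, of m n]
          add_strict_mono[OF N[OF that(1)] N[OF that(2)]] by (rule le_less_trans)
      also have "\<dots> = ennreal e" using e by (simp flip: ennreal_plus)
      finally show ?thesis using e by (simp add: ennreal_less_iff)
    qed
    then show "\<exists>M. \<forall>m\<ge>M. \<forall>n\<ge>M. norm (?i m - ?i n) < e" by blast
  qed
  then obtain I where "?i \<longlonglongrightarrow> I" using Cauchy_convergent by (auto simp: convergent_def)
  then show ?thesis
    unfolding has_strong_integral_def using f t_int lim0 by blast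
qed

text \<open>Composing the simple approximants with \<open>L\<close> leads back to the ordinary
  Bochner integral in a separable space. Uniqueness of the strong integral and its evaluation by
  coordinates both rest on this.\<close>

lemma has_strong_integral_bounded_linear:
  fixes f :: "'a \<Rightarrow> 'b :: real_normed_vector" and L :: "'b \<Rightarrow> 'c :: {banach, second_countable_topology}"
  assumes "has_strong_integral M f I" and L: "bounded_linear L"
  shows "has_bochner_integral M (\<lambda>x. L (f x)) (L I)"
proof -
  interpret L: bounded_linear L by (rule L)
  obtain s where f: "strongly_measurable M f"
    and s: "\<And>n. Bochner_Integration.simple_bochner_integrable M (s n)"
      "(\<lambda>n. \<integral>\<^sup>+ x. ennreal (norm (f x - s n x)) \<partial>M) \<longlonglongrightarrow> 0"
      "(\<lambda>n. Bochner_Integration.simple_bochner_integral M (s n)) \<longlonglongrightarrow> I"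
    using assms(1) unfolding has_strong_integral_def by blast
  obtain K where K: "K > 0" "\<And>x. norm (L x) \<le> norm x * K" using L.pos_bounded by blast
  show ?thesis
  proof (rule has_bochner_integral.intros)
    show "(\<lambda>x. L (f x)) \<in> borel_measurable M"
      by (rule strongly_measurable_borel,
          rule strongly_measurable_compose2[where h = "\<lambda>x _. L x", OF f strongly_measurable_const[of _ 0]])
        (auto intro: L.tendsto)
    show "Bochner_Integration.simple_bochner_integrable M (\<lambda>x. L (s i x))" for i
      by (rule simple_bochner_integrable_compose2[OF _ s(1) s(1), where p = "\<lambda>x _. L x"]) (simp add: L.zero)
    show "(\<lambda>i. Bochner_Integration.simple_bochner_integral M (\<lambda>x. L (s i x))) \<longlonglongrightarrow> L I"
      using L.tendsto[OF s(3)] by (simp add: simple_bochner_integral_linear[OF L.linear_axioms s(1)])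
    have sm: "strongly_measurable M (s i)" for i
      using s(1)[of i] unfolding strongly_measurable_def
      by (intro exI[of _ "\<lambda>_. s i"]) (auto elim: Bochner_Integration.simple_bochner_integrable.cases)
    have m: "(\<lambda>x. norm (f x - s i x)) \<in> borel_measurable M" for i
      by (intro strongly_measurable_norm strongly_measurable_diff f sm)
    have le: "(\<integral>\<^sup>+ x. ennreal (norm (L (f x) - L (s i x))) \<partial>M) \<le> ennreal K * (\<integral>\<^sup>+ x. ennreal (norm (f x - s i x)) \<partial>M)" for i
    proof -
      have "(\<integral>\<^sup>+ x. ennreal (norm (L (f x) - L (s i x))) \<partial>M) \<le> (\<integral>\<^sup>+ x. ennreal K * ennreal (norm (f x - s i x)) \<partial>M)"
        using K by (intro nn_integral_mono) (simp add: L.diff[symmetric] ennreal_mult'[symmetric] mult.commute)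
      also have "\<dots> = ennreal K * (\<integral>\<^sup>+ x. ennreal (norm (f x - s i x)) \<partial>M)"
        by (rule nn_integral_cmult) (use m in measurable)
      finally show ?thesis .
    qed
    have "(\<lambda>i. ennreal K * (\<integral>\<^sup>+ x. ennreal (norm (f x - s i x)) \<partial>M)) \<longlonglongrightarrow> ennreal K * 0"
      by (rule ennreal_tendsto_cmult[OF _ s(2)]) simp
    then have *: "(\<lambda>i. ennreal K * (\<integral>\<^sup>+ x. ennreal (norm (f x - s i x)) \<partial>M)) \<longlonglongrightarrow> 0"
      by simp
    show "(\<lambda>i. \<integral>\<^sup>+ x. ennreal (norm (L (f x) - L (s i x))) \<partial>M) \<longlonglongrightarrow> 0"
    proof (rule tendsto_sandwich[rotated 3])
      show "(\<lambda>i. ennreal K * (\<integral>\<^sup>+ x. ennreal (norm (f x - s i x)) \<partial>M)) \<longlonglongrightarrow> 0"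
        by (rule *)
    qed (auto simp: le)
  qed
qed

text \<open>One functional suffices as a test, the inner product with \<open>I - J\<close>, for
  which integrals are unique.\<close>

lemma has_strong_integral_unique:
  fixes f :: "'a \<Rightarrow> 'b :: complex_inner"
  assumes "has_strong_integral M f I" "has_strong_integral M f J"
  shows "I = J"
proof -
  have "bounded_linear (\<lambda>x :: 'b. cinner x (I - J))"
    by (rule bounded_bilinear.bounded_linear_left[OF bounded_bilinear_cinner])
  from has_strong_integral_bounded_linear[OF assms(1) this] has_strong_integral_bounded_linear[OF assms(2) this]
  have "cinner I (I - J) = cinner J (I - J)" by (rule has_bochner_integral_eq)
  then have "cinner (I - J) (I - J) = 0" by (simp add: cinner_diff_left)
  then show ?thesis by (simp add: cinner_self_norm)
qed

lemma strong_integral_eqI: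
  fixes f :: "'a \<Rightarrow> 'b :: complex_inner"
  shows "has_strong_integral M f I \<Longrightarrow> strong_integral M f = I"
  unfolding strong_integral_def using has_strong_integral_unique by (auto intro!: the_equality)

lemma strong_integral_bounded_linear:
  fixes f :: "'a \<Rightarrow> 'b :: complex_hilbert" and L :: "'b \<Rightarrow> 'c :: {banach, second_countable_topology}"
  assumes "strongly_measurable M f" "integrable M (\<lambda>x. norm (f x))" "bounded_linear L"
  shows "L (strong_integral M f) = (LINT x|M. L (f x))"
proof -
  obtain I where I: "has_strong_integral M f I" using has_strong_integral_exists[OF assms(1,2)] by blast
  show ?thesis
    using has_bochner_integral_integral_eq[OF has_strong_integral_bounded_linear[OF I assms(3)]]
    by (simp add: strong_integral_eqI[OF I])
qed

subsection \<open>Completeness of the sequence space and of the Bochner space\<close>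

lemma ell2_nth_simps [simp]:
  "ell2_nth 0 i = 0" "ell2_nth (z + w) i = ell2_nth z i + ell2_nth w i"
  "ell2_nth (- z) i = - ell2_nth z i" "ell2_nth (z - w) i = ell2_nth z i - ell2_nth w i"
  "ell2_nth (c *\<^sub>C z) i = c * ell2_nth z i"
  unfolding minus_ell2_def zero_ell2.rep_eq plus_ell2.rep_eq uminus_ell2.rep_eq scaleC_ell2.rep_eq
  by simp_all

lemma ell2_nth_sum: "ell2_nth (sum f A) i = (\<Sum>j\<in>A. ell2_nth (f j) i)"
  by (induction A rule: infinite_finite_induct) auto

lemma ell2_nth_delta: "ell2_nth (ell2_delta k) i = (if i = k then 1 else 0)"
  by (simp add: ell2_delta.rep_eq)

lemma ell2_eqI: "(\<And>i. ell2_nth z i = ell2_nth w i) \<Longrightarrow> z = w"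
  by (simp add: ell2_nth_inject[symmetric] fun_eq_iff)

lemma ell2_summable: "(\<lambda>i. (cmod (ell2_nth z i))\<^sup>2) summable_on UNIV"
  using ell2_nth[of z] by simp

lemma cinner_ell2_delta: "cinner z (ell2_delta k) = ell2_nth z k"
proof -
  have "cinner z (ell2_delta k) = (\<Sum>\<^sub>\<infinity>i. if i = k then ell2_nth z k else 0)"
    unfolding cinner_ell2.rep_eq by (intro infsum_cong) (simp add: ell2_nth_delta)
  also have "\<dots> = (\<Sum>\<^sub>\<infinity>i\<in>{k}. ell2_nth z k)"
    by (rule infsum_cong_neutral) auto
  finally show ?thesis by simp
qed

lemma bounded_linear_ell2_nth: "bounded_linear (\<lambda>z. ell2_nth z k)"
  unfolding cinner_ell2_delta[symmetric]
  by (rule bounded_bilinear.bounded_linear_left[OF bounded_bilinear_cinner])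

lemma norm_ell2_power2: "(norm z)\<^sup>2 = (\<Sum>\<^sub>\<infinity>i. (cmod (ell2_nth z i))\<^sup>2)"
proof -
  have "complex_of_real ((norm z)\<^sup>2) = (\<Sum>\<^sub>\<infinity>i. complex_of_real ((cmod (ell2_nth z i))\<^sup>2))"
    by (subst cinner_self_norm[symmetric]) (simp only: cinner_ell2.rep_eq complex_norm_square)
  also have "\<dots> = complex_of_real (\<Sum>\<^sub>\<infinity>i. (cmod (ell2_nth z i))\<^sup>2)"
    by (rule infsumI[OF has_sum_of_real[OF has_sum_infsum[OF ell2_summable]]])
  finally show ?thesis by (simp only: of_real_eq_iff)
qed

lemma sum_ell2_nth_le: "finite S \<Longrightarrow> (\<Sum>i\<in>S. (cmod (ell2_nth z i))\<^sup>2) \<le> (norm z)\<^sup>2"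
  unfolding norm_ell2_power2 by (rule finite_sum_le_infsum[OF ell2_summable]) auto

lemma Abs_ell2_bound:
  assumes "\<And>S. finite S \<Longrightarrow> (\<Sum>i\<in>S. (cmod (z i))\<^sup>2) \<le> B\<^sup>2" "0 \<le> B"
  shows "ell2_nth (Abs_ell2 z) = z" "norm (Abs_ell2 z) \<le> B"
proof -
  have s: "(\<lambda>i. (cmod (z i))\<^sup>2) summable_on UNIV"
    by (rule nonneg_bdd_above_summable_on) (auto intro!: bdd_aboveI2 assms)
  then show eq: "ell2_nth (Abs_ell2 z) = z" by (simp add: Abs_ell2_inverse)
  have "(norm (Abs_ell2 z))\<^sup>2 \<le> B\<^sup>2"
    unfolding norm_ell2_power2 eq by (rule infsum_le_finite_sums[OF s assms(1)])
  then show "norm (Abs_ell2 z) \<le> B" using assms(2) by (rule power2_le_imp_le)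
qed

instance ell2 :: (type) complex_hilbert
proof
  fix Z :: "nat \<Rightarrow> 'a ell2" assume Z: "Cauchy Z"
  have "Cauchy (\<lambda>n. ell2_nth (Z n) i)" for i
    by (rule bounded_linear.Cauchy[OF bounded_linear_ell2_nth Z])
  then have "\<exists>w. \<forall>i. (\<lambda>n. ell2_nth (Z n) i) \<longlonglongrightarrow> w i"
    by (intro choice allI) (simp add: Cauchy_convergent_iff convergent_def)
  then obtain w where w: "\<And>i. (\<lambda>n. ell2_nth (Z n) i) \<longlonglongrightarrow> w i" by blast
  \<comment> \<open>Fatou by hand: a bound for the finite partial sums of \<open>Z m - Z n\<close>
    survives the limit in m coordinate by coordinate. It places the differences of \<open>w\<close>
    and \<open>Z n\<close> in the space before \<open>w\<close> itself is known to be square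
    summable.\<close>
  have tail: "\<exists>N. \<forall>n\<ge>N. ell2_nth (Abs_ell2 (\<lambda>i. w i - ell2_nth (Z n) i)) = (\<lambda>i. w i - ell2_nth (Z n) i) \<and>
      norm (Abs_ell2 (\<lambda>i. w i - ell2_nth (Z n) i)) \<le> e" if e: "e > 0" for e
  proof -
    obtain N where N: "\<And>m n. m \<ge> N \<Longrightarrow> n \<ge> N \<Longrightarrow> norm (Z m - Z n) < e"
      using Z e unfolding Cauchy_iff by blast
    have "(\<Sum>i\<in>S. (cmod (w i - ell2_nth (Z n) i))\<^sup>2) \<le> e\<^sup>2" if "n \<ge> N" "finite S" for n S
    proof (rule LIMSEQ_le_const2)
      show "(\<lambda>m. \<Sum>i\<in>S. (cmod (ell2_nth (Z m) i - ell2_nth (Z n) i))\<^sup>2) \<longlonglongrightarrow>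
          (\<Sum>i\<in>S. (cmod (w i - ell2_nth (Z n) i))\<^sup>2)"
        by (intro tendsto_intros w)
      have "(\<Sum>i\<in>S. (cmod (ell2_nth (Z m) i - ell2_nth (Z n) i))\<^sup>2) \<le> e\<^sup>2" if "m \<ge> N" for m
        using sum_ell2_nth_le[OF \<open>finite S\<close>, of "Z m - Z n"]
          power_mono[OF less_imp_le[OF N[OF that \<open>n \<ge> N\<close>]], of 2] by simp
      then show "\<exists>M. \<forall>m\<ge>M. (\<Sum>i\<in>S. (cmod (ell2_nth (Z m) i - ell2_nth (Z n) i))\<^sup>2) \<le> e\<^sup>2" by blast
    qed
    then have "ell2_nth (Abs_ell2 (\<lambda>i. w i - ell2_nth (Z n) i)) = (\<lambda>i. w i - ell2_nth (Z n) i) \<and>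
        norm (Abs_ell2 (\<lambda>i. w i - ell2_nth (Z n) i)) \<le> e" if "n \<ge> N" for n
      using that e by (intro conjI Abs_ell2_bound) auto
    then show ?thesis by blast
  qed
  obtain N where "ell2_nth (Abs_ell2 (\<lambda>i. w i - ell2_nth (Z N) i)) = (\<lambda>i. w i - ell2_nth (Z N) i)"
    using tail[of 1] by auto
  then have W: "ell2_nth (Abs_ell2 (\<lambda>i. w i - ell2_nth (Z N) i) + Z N) i = w i" for i by simp
  define W where "W = Abs_ell2 (\<lambda>i. w i - ell2_nth (Z N) i) + Z N"
  have "Z \<longlonglongrightarrow> W"
    unfolding LIMSEQ_iff
  proof (intro allI impI)
    fix e :: real assume "e > 0"
    then obtain N where N: "\<And>n. n \<ge> N \<Longrightarrow> ell2_nth (Abs_ell2 (\<lambda>i. w i - ell2_nth (Z n) i)) = (\<lambda>i. w i - ell2_nth (Z n) i) \<and>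
        norm (Abs_ell2 (\<lambda>i. w i - ell2_nth (Z n) i)) \<le> e / 2"
      using tail[of "e / 2"] by auto
    have "norm (Z n - W) < e" if "n \<ge> N" for n
    proof -
      have "Abs_ell2 (\<lambda>i. w i - ell2_nth (Z n) i) = W - Z n"
        using N[OF that] W by (intro ell2_eqI) (simp add: W_def)
      then show ?thesis using N[OF that] \<open>e > 0\<close> by (simp add: norm_minus_commute)
    qed
    then show "\<exists>N. \<forall>n\<ge>N. norm (Z n - W) < e" by blast
  qed
  then show "convergent Z" by (auto simp: convergent_def)
qed

section \<open>Representatives in the Bochner space and its completeness\<close>

lemma square_integrable_diff:
  "square_integrable f \<Longrightarrow> square_integrable g \<Longrightarrow> square_integrable (\<lambda>x. f x - (g x :: 'b :: complex_inner))"
  using square_integrable_add[of f "\<lambda>x. - g x"] square_integrable_uminus[of g] by simp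

lemma square_integrable_sum:
  "(\<And>i. i \<in> I \<Longrightarrow> square_integrable (f i)) \<Longrightarrow> square_integrable (\<lambda>x. \<Sum>i\<in>I. f i x)"
  by (induction I rule: infinite_finite_induct) (auto intro: square_integrable_0 square_integrable_add)

lemma abs_L2_add:
  "square_integrable f \<Longrightarrow> square_integrable g \<Longrightarrow> abs_L2 (\<lambda>x. f x + g x) = abs_L2 f + abs_L2 g"
  by (simp add: plus_L2.abs_eq L2_rel_refl)

lemma abs_L2_scaleC: "square_integrable f \<Longrightarrow> abs_L2 (\<lambda>x. c *\<^sub>C f x) = c *\<^sub>C abs_L2 f"
  by (simp add: scaleC_L2.abs_eq L2_rel_refl)

lemma abs_L2_diff:
  assumes "square_integrable f" "square_integrable g"
  shows "abs_L2 (\<lambda>x. f x - g x) = abs_L2 f - abs_L2 g"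
proof -
  have "abs_L2 (\<lambda>x. (f x - g x) + g x) = abs_L2 (\<lambda>x. f x - g x) + abs_L2 g"
    by (rule abs_L2_add[OF square_integrable_diff[OF assms] assms(2)])
  then show ?thesis by simp
qed

lemma abs_L2_0: "abs_L2 (\<lambda>_. 0) = 0"
  by (simp add: zero_L2_def)

lemma abs_L2_sum:
  assumes "\<And>i. i \<in> I \<Longrightarrow> square_integrable (f i)"
  shows "abs_L2 (\<lambda>x. \<Sum>i\<in>I. f i x) = (\<Sum>i\<in>I. abs_L2 (f i))"
  using assms
  by (induction I rule: infinite_finite_induct) (simp_all add: abs_L2_0 abs_L2_add square_integrable_sum)

lemma abs_L2_cong_AE:
  "square_integrable f \<Longrightarrow> square_integrable g \<Longrightarrow> AE x in lborel. f x = g x \<Longrightarrow> abs_L2 f = abs_L2 g"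
  by (rule Quotient_rel_abs[OF Quotient_L2]) (simp add: L2_rel_def)

lemma L2_cases:
  obtains f where "square_integrable f" "F = abs_L2 f"
  by (induction F rule: L2.abs_induct) (auto simp: L2_rel_refl)

lemma cinner_abs_L2:
  "square_integrable f \<Longrightarrow> square_integrable g \<Longrightarrow>
    cinner (abs_L2 f) (abs_L2 g) = (LINT x|lborel. cinner (f x) (g x))"
  by (simp add: cinner_L2.abs_eq L2_rel_refl)

lemma norm_abs_L2:
  assumes "square_integrable f"
  shows "(norm (abs_L2 f))\<^sup>2 = (LINT x|lborel. (norm (f x))\<^sup>2)"
proof -
  have "complex_of_real ((norm (abs_L2 f))\<^sup>2) = (LINT x|lborel. complex_of_real ((norm (f x))\<^sup>2))"
    by (simp only: cinner_self_norm[symmetric] cinner_abs_L2[OF assms assms])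
  then show ?thesis by (simp only: integral_complex_of_real of_real_eq_iff)
qed

lemma norm_abs_L2_le:
  assumes "square_integrable f" "integrable lborel g" "\<And>x. (norm (f x))\<^sup>2 \<le> g x"
  shows "(norm (abs_L2 f))\<^sup>2 \<le> (LINT x|lborel. g x)"
  unfolding norm_abs_L2[OF assms(1)]
  using assms by (intro integral_mono) (auto simp: square_integrable_def)

lemma square_integrable_bound:
  assumes "strongly_measurable lborel f" "integrable lborel g" "\<And>x. (norm (f x))\<^sup>2 \<le> g x"
  shows "square_integrable f"
  unfolding square_integrable_def
proof
  show "integrable lborel (\<lambda>x. (norm (f x))\<^sup>2)"
  proof (rule Bochner_Integration.integrable_bound[OF assms(2)])
    show "(\<lambda>x. (norm (f x))\<^sup>2) \<in> borel_measurable lborel"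
      using strongly_measurable_norm[OF assms(1)] by measurable
    show "AE x in lborel. norm ((norm (f x))\<^sup>2) \<le> norm (g x)"
      by (rule AE_I2) (use assms(3) in \<open>auto intro: order_trans[OF _ abs_ge_self]\<close>)
  qed
qed (rule assms)

lemma geometric_increments_convergent:
  fixes u :: "nat \<Rightarrow> 'a :: {real_normed_vector, complete_space}"
  assumes "\<And>k. norm (u (Suc k) - u k) \<le> C * (1 / 2) ^ k"
  shows "\<exists>l. u \<longlonglongrightarrow> l \<and> (\<forall>k. norm (l - u k) \<le> 2 * C * (1 / 2) ^ k)"
proof -
  have C: "C \<ge> 0" using order_trans[OF norm_ge_zero assms[of 0]] by simp
  \<comment> \<open>The subtracted term makes the induction exact: the next increment uses up one
    half of it and the other half is the term for n + 1.\<close>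
  have "norm (u (k + n) - u k) \<le> 2 * C * (1 / 2) ^ k - 2 * C * (1 / 2) ^ (k + n)" for k n
  proof (induction n)
    case (Suc n)
    have "norm (u (k + Suc n) - u k) \<le> norm (u (Suc (k + n)) - u (k + n)) + norm (u (k + n) - u k)"
      using norm_triangle_ineq[of "u (Suc (k + n)) - u (k + n)" "u (k + n) - u k"] by simp
    then show ?case using Suc assms[of "k + n"] by simp
  qed simp
  moreover have "2 * C * (1 / 2) ^ n \<ge> 0" for n :: nat using C by simp
  ultimately have le: "norm (u (k + n) - u k) \<le> 2 * C * (1 / 2) ^ k" for k n
    by (smt (verit, best))
  have le': "norm (u n - u k) \<le> 2 * C * (1 / 2) ^ k" if "n \<ge> k" for k n
    using le[of k "n - k"] that by simp
  have "(\<lambda>k. 2 * (2 * C * (1 / 2) ^ k)) \<longlonglongrightarrow> 2 * (2 * C * 0)"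
    by (intro tendsto_intros) auto
  then have lim0: "(\<lambda>k. 2 * (2 * C * (1 / 2) ^ k)) \<longlonglongrightarrow> 0" by simp
  have "Cauchy u"
    unfolding Cauchy_iff
  proof (intro allI impI)
    fix e :: real assume "e > 0"
    then obtain k where k: "2 * (2 * C * (1 / 2) ^ k) < e"
      using order_tendstoD(2)[OF lim0] unfolding eventually_sequentially by blast
    have "norm (u m - u n) < e" if "m \<ge> k" "n \<ge> k" for m n
      using norm_triangle_ineq4[of "u m - u k" "u n - u k"] le'[OF that(1)] le'[OF that(2)] k by simp
    then show "\<exists>M. \<forall>m\<ge>M. \<forall>n\<ge>M. norm (u m - u n) < e" by blast
  qed
  then obtain l where l: "u \<longlonglongrightarrow> l" using Cauchy_convergent by (auto simp: convergent_def)
  have "norm (l - u k) \<le> 2 * C * (1 / 2) ^ k" for k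
    by (rule LIMSEQ_le_const2[of "\<lambda>n. norm (u n - u k)"])
      (use le' in \<open>auto intro!: tendsto_intros l\<close>)
  with l show ?thesis by blast
qed

lemma Cauchy_imp_convergent_subfamily:
  fixes X :: "nat \<Rightarrow> 'a :: real_normed_vector"
  assumes "Cauchy X" "(\<lambda>k. X (r k)) \<longlonglongrightarrow> F" "\<And>k. r k \<ge> k"
  shows "X \<longlonglongrightarrow> F"
  unfolding LIMSEQ_iff
proof (intro allI impI)
  fix e :: real assume e: "e > 0"
  obtain N where N: "\<And>m n. m \<ge> N \<Longrightarrow> n \<ge> N \<Longrightarrow> norm (X m - X n) < e / 2"
    using assms(1) e unfolding Cauchy_iff by (meson half_gt_zero)
  obtain M where M: "\<And>k. k \<ge> M \<Longrightarrow> norm (X (r k) - F) < e / 2"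
    using assms(2) e unfolding LIMSEQ_iff by (meson half_gt_zero)
  have "norm (X n - F) < e" if "n \<ge> N" for n
  proof -
    have "norm (X n - X (r (max M N))) < e / 2"
      using N[OF that, of "r (max M N)"] assms(3)[of "max M N"] by simp
    then show ?thesis
      using norm_triangle_ineq[of "X n - X (r (max M N))" "X (r (max M N)) - F"] M[of "max M N"] by simp
  qed
  then show "\<exists>N. \<forall>n\<ge>N. norm (X n - F) < e" by blast
qed

text \<open>Riesz--Fischer: along a subsequence whose increments have norm at most \<open>4\<^sup>-\<^sup>k\<close>, the function
  \<open>G = \<Sum>\<^sub>k 4\<^sup>k \<parallel>f\<^sub>k\<^sub>+\<^sub>1 - f\<^sub>k\<parallel>\<^sup>2\<close> is integrable, and it controls all increments pointwise.\<close>

instance L2 :: (euclidean_space, complex_hilbert) complex_hilbert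
proof
  fix X :: "nat \<Rightarrow> ('a, 'b) L2" assume X: "Cauchy X"
  have "\<forall>k. \<exists>N. \<forall>m\<ge>N. \<forall>n\<ge>N. norm (X m - X n) < (1 / 4) ^ k"
    using X unfolding Cauchy_iff by simp
  then obtain N where N: "\<And>k m n. m \<ge> N k \<Longrightarrow> n \<ge> N k \<Longrightarrow> norm (X m - X n) < (1 / 4) ^ k"
    by metis
  \<comment> \<open>The sum makes \<open>r\<close> increasing and at least \<open>N k\<close>; the
    summand k makes it at least k.\<close>
  define r where "r k = (\<Sum>i\<le>k. N i) + k" for k :: nat
  have r: "r k \<ge> k" "r k \<ge> N k" "r (Suc k) \<ge> r k" for k
    using member_le_sum[of k "{..k}" N] by (auto simp: r_def)
  have "\<forall>k. \<exists>f. square_integrable f \<and> X (r k) = abs_L2 f"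
    by (metis L2_cases)
  then obtain f where f: "\<And>k. square_integrable (f k)" "\<And>k. X (r k) = abs_L2 (f k)" by metis
  define h where "h k x = 4 ^ k * (norm (f (Suc k) x - f k x))\<^sup>2" for k x
  have hm [measurable]: "h k \<in> borel_measurable borel" for k
    using strongly_measurable_norm[of lborel "\<lambda>x. f (Suc k) x - f k x"] f(1)
      square_integrable_diff[OF f(1)[of "Suc k"] f(1)[of k]]
    unfolding h_def by (simp add: square_integrable_def)
  have hi: "(\<integral>\<^sup>+ x. ennreal (h k x) \<partial>lborel) \<le> ennreal ((1 / 4) ^ k)" for k
  proof -
    have i: "integrable lborel (\<lambda>x. (norm (f (Suc k) x - f k x))\<^sup>2)"
      using square_integrable_diff[OF f(1)[of "Suc k"] f(1)[of k]] by (simp add: square_integrable_def)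
    have "(LINT x|lborel. h k x) = 4 ^ k * (norm (X (r (Suc k)) - X (r k)))\<^sup>2"
      unfolding h_def f(2) abs_L2_diff[OF f(1) f(1), symmetric]
      by (simp add: norm_abs_L2 square_integrable_diff f(1))
    also have "\<dots> \<le> 4 ^ k * ((1 / 4) ^ k)\<^sup>2"
      using N[of k "r (Suc k)" "r k"] r(2)[of k] r(3)[of k] by (intro mult_left_mono power_mono) auto
    also have "\<dots> = (1 / 4) ^ k"
      by (simp add: power2_eq_square power_divide)
    finally show ?thesis
      using i by (subst nn_integral_eq_integral) (auto simp: h_def[abs_def])
  qed
  define G where "G x = (\<Sum>k. ennreal (h k x))" for x
  have [measurable]: "G \<in> borel_measurable borel" unfolding G_def by measurable
  have "(\<integral>\<^sup>+ x. G x \<partial>lborel) = (\<Sum>k. \<integral>\<^sup>+ x. ennreal (h k x) \<partial>lborel)"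
    unfolding G_def by (rule nn_integral_suminf) simp
  also have "\<dots> \<le> (\<Sum>k. ennreal ((1 / 4) ^ k))"
    by (rule suminf_le[OF hi]) auto
  also have "\<dots> = ennreal (\<Sum>k. (1 / 4) ^ k)"
    by (rule suminf_ennreal2) (auto intro: summable_geometric)
  finally have Gfin: "(\<integral>\<^sup>+ x. G x \<partial>lborel) < \<infinity>" by (simp add: le_less_trans)
  have AE: "AE x in lborel. G x \<noteq> \<infinity>"
    by (rule nn_integral_noteq_infinite) (use Gfin in auto)
  define g where "g x = enn2real (G x)" for x
  have [measurable]: "g \<in> borel_measurable borel" unfolding g_def by measurable
  have "(\<integral>\<^sup>+ x. ennreal (norm (g x)) \<partial>lborel) \<le> (\<integral>\<^sup>+ x. G x \<partial>lborel)"
    by (rule nn_integral_mono) (simp add: g_def ennreal_enn2real_if)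
  then have g: "integrable lborel g"
    using Gfin by (intro integrableI_bounded) auto
  have inc: "norm (f (Suc k) x - f k x) \<le> sqrt (g x) * (1 / 2) ^ k" if "G x \<noteq> \<infinity>" for k x
  proof -
    have "ennreal (h k x) \<le> G x"
      unfolding G_def using sum_le_suminf[of "\<lambda>k. ennreal (h k x)" "{k}"] by simp
    also have "G x = ennreal (g x)" using that by (simp add: g_def less_top)
    finally have "h k x \<le> g x" by (simp add: g_def)
    then have "sqrt (h k x) \<le> sqrt (g x)" by simp
    then have "2 ^ k * norm (f (Suc k) x - f k x) \<le> sqrt (g x)"
      by (simp add: h_def real_sqrt_mult real_sqrt_power)
    then show ?thesis by (simp add: field_simps)
  qed
  \<comment> \<open>Putting the value 0 where \<open>G\<close> is infinite changes the
    representatives only on a null set and makes the increment bound hold at every point, so the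
    limit exists everywhere.\<close>
  define f' where "f' k x = (if G x \<noteq> \<infinity> then f k x else 0)" for k x
  have "\<exists>l. (\<lambda>k. f' k x) \<longlonglongrightarrow> l \<and> (\<forall>k. norm (l - f' k x) \<le> 2 * sqrt (g x) * (1 / 2) ^ k)" for x
    using inc[of x] by (intro geometric_increments_convergent) (auto simp: f'_def g_def)
  then obtain l where l: "\<And>x. (\<lambda>k. f' k x) \<longlonglongrightarrow> l x"
    "\<And>x k. norm (l x - f' k x) \<le> 2 * sqrt (g x) * (1 / 2) ^ k" by metis
  have f'm: "strongly_measurable lborel (f' k)" for k
    unfolding f'_def using f(1) by (intro strongly_measurable_if strongly_measurable_const)
      (auto simp: square_integrable_def)
  have lm: "strongly_measurable lborel l"
    by (rule strongly_measurable_LIMSEQ[OF f'm l(1)])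
  have le: "(norm (l x - f' k x))\<^sup>2 \<le> 4 * (1 / 4) ^ k * g x" for k x
  proof -
    have "(norm (l x - f' k x))\<^sup>2 \<le> (2 * sqrt (g x) * (1 / 2) ^ k)\<^sup>2"
      by (rule power_mono[OF l(2)]) simp
    also have "\<dots> = 4 * ((1 / 2) ^ k)\<^sup>2 * g x"
      by (simp add: power_mult_distrib g_def)
    also have "((1 / 2 :: real) ^ k)\<^sup>2 = (1 / 4) ^ k"
      by (simp add: power_divide) (simp add: power2_eq_square flip: power_mult_distrib)
    finally show ?thesis .
  qed
  have gk: "integrable lborel (\<lambda>x. 4 * (1 / 4) ^ k * g x)" for k using g by simp
  have d: "square_integrable (\<lambda>x. l x - f' k x)" for k
    by (rule square_integrable_bound[OF strongly_measurable_diff[OF lm f'm] gk le])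
  have f': "square_integrable (f' k)" for k
    by (rule square_integrable_bound[OF f'm, of "\<lambda>x. (norm (f k x))\<^sup>2"])
      (use f(1) in \<open>auto simp: f'_def square_integrable_def\<close>)
  have lsq: "square_integrable l"
    using square_integrable_add[OF d[of 0] f'[of 0]] by simp
  have eq: "X (r k) = abs_L2 (f' k)" for k
    unfolding f(2) by (rule abs_L2_cong_AE[OF f(1) f']) (use AE in \<open>auto simp: f'_def\<close>)
  have "(\<lambda>k. X (r k)) \<longlonglongrightarrow> abs_L2 l"
  proof -
    have "(\<lambda>k. abs_L2 l - X (r k)) \<longlonglongrightarrow> 0"
    proof (rule Lim_null_comparison[OF always_eventually], rule allI)
      show "norm (abs_L2 l - X (r k)) \<le> sqrt (4 * (1 / 4) ^ k * (LINT x|lborel. g x))" for k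
        using norm_abs_L2_le[OF d gk le, of k]
        by (simp add: eq abs_L2_diff[OF lsq f'] real_le_rsqrt)
      have "(\<lambda>k. sqrt (4 * (1 / 4) ^ k * (LINT x|lborel. g x))) \<longlonglongrightarrow> sqrt (4 * 0 * (LINT x|lborel. g x))"
        by (intro tendsto_intros) auto
      then show "(\<lambda>k. sqrt (4 * (1 / 4) ^ k * (LINT x|lborel. g x))) \<longlonglongrightarrow> 0" by simp
    qed
    from tendsto_diff[OF tendsto_const[of "abs_L2 l"] this] show ?thesis by simp
  qed
  from Cauchy_imp_convergent_subfamily[OF X this r(1)]
  show "convergent X" by (auto simp: convergent_def)
qed

subsection \<open>Unitary extension of densely defined isometries\<close>

text \<open>The operator is given by a graph, so well-definedness need not be checked beforehand: a
  pair (0, w) in \<open>G\<close> has w = 0 by \<open>iso\<close>. \<open>R\<close> is the closure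
  of \<open>G\<close>. The two factors play symmetric roles: density of the first projection makes
  \<open>R\<close> total, density of the second makes \<open>V\<close> surjective.\<close>

lemma unitary_extension:
  fixes G :: "('a :: complex_hilbert \<times> 'b :: complex_hilbert) set"
  assumes add: "\<And>v w v' w'. (v, w) \<in> G \<Longrightarrow> (v', w') \<in> G \<Longrightarrow> (v + v', w + w') \<in> G"
    and scale: "\<And>c v w. (v, w) \<in> G \<Longrightarrow> (c *\<^sub>C v, c *\<^sub>C w) \<in> G"
    and iso: "\<And>v w v' w'. (v, w) \<in> G \<Longrightarrow> (v', w') \<in> G \<Longrightarrow> cinner v v' = cinner w w'"
    and dense1: "\<And>x. x \<in> closure (fst ` G)" and dense2: "\<And>y. y \<in> closure (snd ` G)"
  shows "\<exists>V. unitary V \<and> (\<forall>(v, w)\<in>G. V v = w)"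
proof -
  have diff: "(v - v', w - w') \<in> G" if "(v, w) \<in> G" "(v', w') \<in> G" for v w v' w'
    using add[OF that(1) scale[OF that(2), of "- 1"]] by (simp add: scaleC_minus1)
  have nrm: "norm v = norm w" if "(v, w) \<in> G" for v w
    using iso[OF that that] by (simp add: csnorm_def flip: csnorm_eq_norm)
  define R where "R x y \<longleftrightarrow> (\<exists>p q. (\<forall>n :: nat. (p n, q n) \<in> G) \<and> p \<longlonglongrightarrow> x \<and> q \<longlonglongrightarrow> y)" for x y
  have tot1: "\<exists>y. R x y" for x
  proof -
    obtain p where p: "\<And>n :: nat. p n \<in> fst ` G" "p \<longlonglongrightarrow> x"
      using dense1[of x] unfolding closure_sequential by blast
    have "\<forall>n. \<exists>w. (p n, w) \<in> G" using p(1) by force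
    then obtain q where q: "\<And>n. (p n, q n) \<in> G" by metis
    have "Cauchy p" using p(2) by (rule LIMSEQ_imp_Cauchy)
    moreover have "norm (q m - q n) = norm (p m - p n)" for m n
      using nrm[OF diff[OF q q]] by simp
    ultimately have "Cauchy q" by (simp add: Cauchy_iff)
    then obtain y where "q \<longlonglongrightarrow> y" using Cauchy_convergent by (auto simp: convergent_def)
    then show ?thesis using p(2) q unfolding R_def by blast
  qed
  have tot2: "\<exists>x. R x y" for y
  proof -
    obtain q where q: "\<And>n :: nat. q n \<in> snd ` G" "q \<longlonglongrightarrow> y"
      using dense2[of y] unfolding closure_sequential by blast
    have "\<forall>n. \<exists>v. (v, q n) \<in> G" using q(1) by force
    then obtain p where p: "\<And>n. (p n, q n) \<in> G" by metis
    have "Cauchy q" using q(2) by (rule LIMSEQ_imp_Cauchy)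
    moreover have "norm (p m - p n) = norm (q m - q n)" for m n
      using nrm[OF diff[OF p p]] by simp
    ultimately have "Cauchy p" by (simp add: Cauchy_iff)
    then obtain x where "p \<longlonglongrightarrow> x" using Cauchy_convergent by (auto simp: convergent_def)
    then show ?thesis using q(2) p unfolding R_def by blast
  qed
  have Riso: "cinner x x' = cinner y y'" if xy: "R x y" "R x' y'" for x y x' y'
  proof -
    obtain p q p' q' where *: "\<And>n. (p n, q n) \<in> G" "p \<longlonglongrightarrow> x" "q \<longlonglongrightarrow> y"
      "\<And>n. (p' n, q' n) \<in> G" "p' \<longlonglongrightarrow> x'" "q' \<longlonglongrightarrow> y'"
      using xy unfolding R_def by blast
    have "(\<lambda>n. cinner (p n) (p' n)) \<longlonglongrightarrow> cinner x x'"
      by (rule bounded_bilinear.tendsto[OF bounded_bilinear_cinner *(2,5)])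
    moreover have "(\<lambda>n. cinner (q n) (q' n)) \<longlonglongrightarrow> cinner y y'"
      by (rule bounded_bilinear.tendsto[OF bounded_bilinear_cinner *(3,6)])
    moreover have "cinner (p n) (p' n) = cinner (q n) (q' n)" for n
      by (rule iso[OF *(1,4)])
    ultimately show ?thesis using LIMSEQ_unique by simp
  qed
  have Radd: "R (x + x') (y + y')" if xy: "R x y" "R x' y'" for x y x' y'
  proof -
    obtain p q p' q' where "\<And>n. (p n, q n) \<in> G" "p \<longlonglongrightarrow> x" "q \<longlonglongrightarrow> y"
      "\<And>n. (p' n, q' n) \<in> G" "p' \<longlonglongrightarrow> x'" "q' \<longlonglongrightarrow> y'"
      using xy unfolding R_def by blast
    then show ?thesis unfolding R_def
      by (intro exI[of _ "\<lambda>n. p n + p' n"] exI[of _ "\<lambda>n. q n + q' n"]) (auto intro: add tendsto_add)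
  qed
  have Rdiff: "R (x - x') (y - y')" if xy: "R x y" "R x' y'" for x y x' y'
  proof -
    obtain p q p' q' where "\<And>n. (p n, q n) \<in> G" "p \<longlonglongrightarrow> x" "q \<longlonglongrightarrow> y"
      "\<And>n. (p' n, q' n) \<in> G" "p' \<longlonglongrightarrow> x'" "q' \<longlonglongrightarrow> y'"
      using xy unfolding R_def by blast
    then show ?thesis unfolding R_def
      by (intro exI[of _ "\<lambda>n. p n - p' n"] exI[of _ "\<lambda>n. q n - q' n"]) (auto intro: diff tendsto_diff)
  qed
  have Rscale: "R (c *\<^sub>C x) (c *\<^sub>C y)" if xy: "R x y" for c x y
  proof -
    obtain p q where "\<And>n. (p n, q n) \<in> G" "p \<longlonglongrightarrow> x" "q \<longlonglongrightarrow> y"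
      using xy unfolding R_def by blast
    then show ?thesis unfolding R_def
      by (intro exI[of _ "\<lambda>n. c *\<^sub>C p n"] exI[of _ "\<lambda>n. c *\<^sub>C q n"])
        (auto intro: scale bounded_linear.tendsto[OF bounded_linear_scaleC])
  qed
  have Rnorm: "norm x = norm y" if "R x y" for x y
    using Riso[OF that that] by (simp add: csnorm_def flip: csnorm_eq_norm)
  have Runique: "y = y'" if "R x y" "R x y'" for x y y'
    using Rnorm[OF Rdiff[OF that]] by simp
  obtain V where V: "\<And>x. R x (V x)" using tot1 by metis
  have VI: "V x = y" if "R x y" for x y using Runique[OF V that] .
  have "bounded_linear V"
  proof (rule bounded_linear_intro[where K = 1])
    show "V (x + y) = V x + V y" for x y by (intro VI Radd V)
    show "V (r *\<^sub>R x) = r *\<^sub>R V x" for r x unfolding scaleR_scaleC by (intro VI Rscale V)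
    show "norm (V x) \<le> norm x * 1" for x using Rnorm[OF V] by simp
  qed
  moreover have "V (c *\<^sub>C x) = c *\<^sub>C V x" for c x by (intro VI Rscale V)
  moreover have "surj V" using tot2 VI by (metis surjI)
  moreover have "cinner (V x) (V y) = cinner x y" for x y by (rule Riso[OF V V, symmetric])
  ultimately have "unitary V" by (simp add: unitary_def bounded_clinear_def)
  moreover have "V v = w" if "(v, w) \<in> G" for v w
    by (rule VI) (use that in \<open>auto simp: R_def intro!: exI[of _ "\<lambda>_. v"] exI[of _ "\<lambda>_. w"]\<close>)
  ultimately show ?thesis by auto
qed

subsection \<open>Characters in the Besicovitch space and tensor products\<close>

lemma to_completion_add: "to_completion (x + y) = to_completion x + to_completion y"
  by transfer (simp add: completion_rel_def csCauchy_const csnull_def)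

lemma to_completion_scaleC: "to_completion (c *\<^sub>C x) = c *\<^sub>C to_completion x"
  by transfer (simp add: completion_rel_def csCauchy_const csnull_def)

lemma to_completion_0: "to_completion 0 = 0"
  by transfer (simp add: completion_rel_def csCauchy_const csnull_def)

lemma to_completion_sum: "to_completion (sum f A) = (\<Sum>i\<in>A. to_completion (f i))"
  by (induction A rule: infinite_finite_induct) (simp_all add: to_completion_0 to_completion_add)

lemma cinner_cap: "cinner f g = mean_value (\<lambda>x. Rep_cap f x * cnj (Rep_cap g x))"
  by (rule cinner_cap.rep_eq)

lemma Rep_cap_expc [simp]: "Rep_cap (Abs_cap (expc l)) = expc l"
  by (simp add: Abs_cap_inverse expc_C_ap)

lemma mean_value_expc: "mean_value (expc l) = (if l = 0 then 1 else 0)"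
  by (rule mean_value_eqI[OF cube_avg_expc_tendsto])

lemma cinner_expc_cap: "cinner (Abs_cap (expc k)) (Abs_cap (expc l)) = (if k = l then 1 else 0)"
  by (simp add: cinner_cap expc_diff[symmetric] mean_value_expc)

lemma cinner_expc_B2: "cinner (expc_B2 k) (expc_B2 l) = (if k = l then 1 else 0)"
  by (simp add: expc_B2_def cinner_to_completion cinner_expc_cap)

lemma cmod_mean_value_le:
  assumes "f \<in> C_ap" "\<And>x. cmod (f x) \<le> B"
  shows "cmod (mean_value f) \<le> B"
proof (rule tendsto_upperbound[OF tendsto_norm[OF mean_value_tendsto[OF assms(1)]]])
  show "\<forall>\<^sub>F T in at_top. cmod (cube_avg f T) \<le> B"
    using eventually_gt_at_top[of 0] by eventually_elim (rule norm_cube_avg_le[OF assms])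
qed simp

lemma csnorm_cap_le:
  assumes "\<And>x. cmod (Rep_cap f x) \<le> B"
  shows "csnorm f \<le> B"
proof -
  have B: "0 \<le> B" using order_trans[OF norm_ge_zero assms] .
  have "Re (cinner f f) \<le> cmod (mean_value (\<lambda>x. Rep_cap f x * cnj (Rep_cap f x)))"
    unfolding cinner_cap by (rule complex_Re_le_cmod)
  also have "\<dots> \<le> B * B"
    by (rule cmod_mean_value_le)
      (use Rep_cap[of f] B in \<open>auto intro!: C_ap_mult_cnj mult_mono assms simp: norm_mult\<close>)
  finally show ?thesis
    using B unfolding csnorm_def by (intro real_le_lsqrt) (auto simp: power2_eq_square)
qed

text \<open>For formal pairs the two sides are different elements. In the completion they agree
  because their difference has inner product 0 with itself; the relations for the left factor have
  the same proof.\<close>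

lemma htensor_scaleC_right: "x \<otimes>\<^sub>H (c *\<^sub>C y) = c *\<^sub>C (x \<otimes>\<^sub>H y)"
proof -
  let ?d = "x \<otimes>\<^sub>H (c *\<^sub>C y) - c *\<^sub>C (x \<otimes>\<^sub>H y)"
  have "cinner ?d ?d = 0"
    by (simp add: cinner_diff_left cinner_diff_right cinner_scaleC_left cinner_scaleC_right cinner_htensor algebra_simps)
  then show ?thesis by (simp add: cinner_self_norm)
qed

lemma htensor_scaleC_left: "(c *\<^sub>C x) \<otimes>\<^sub>H y = c *\<^sub>C (x \<otimes>\<^sub>H y)"
proof -
  let ?d = "(c *\<^sub>C x) \<otimes>\<^sub>H y - c *\<^sub>C (x \<otimes>\<^sub>H y)"
  have "cinner ?d ?d = 0"
    by (simp add: cinner_diff_left cinner_diff_right cinner_scaleC_left cinner_scaleC_right cinner_htensor algebra_simps)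
  then show ?thesis by (simp add: cinner_self_norm)
qed

lemma htensor_add_left: "(x + x') \<otimes>\<^sub>H y = x \<otimes>\<^sub>H y + x' \<otimes>\<^sub>H y"
proof -
  let ?d = "(x + x') \<otimes>\<^sub>H y - (x \<otimes>\<^sub>H y + x' \<otimes>\<^sub>H y)"
  have "cinner ?d ?d = 0"
    by (simp add: cinner_diff_left cinner_diff_right cinner_add_left cinner_add_right cinner_htensor algebra_simps)
  then show ?thesis by (simp add: cinner_self_norm)
qed

lemma htensor_diff_left: "(x - x') \<otimes>\<^sub>H y = x \<otimes>\<^sub>H y - x' \<otimes>\<^sub>H y"
  using htensor_add_left[of "x - x'" x' y] by simp

lemma htensor_0_left: "0 \<otimes>\<^sub>H y = 0"
  using htensor_scaleC_left[of 0 0 y] by simp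

lemma htensor_sum_left: "(\<Sum>i\<in>A. f i) \<otimes>\<^sub>H y = (\<Sum>i\<in>A. f i \<otimes>\<^sub>H y)"
  by (induction A rule: infinite_finite_induct) (simp_all add: htensor_0_left htensor_add_left)

lemma norm_htensor: "norm (x \<otimes>\<^sub>H y) = norm x * norm y"
proof -
  have "complex_of_real ((norm (x \<otimes>\<^sub>H y))\<^sup>2) = complex_of_real ((norm x * norm y)\<^sup>2)"
    by (simp only: cinner_self_norm[symmetric] cinner_htensor power_mult_distrib of_real_mult)
  then have "(norm (x \<otimes>\<^sub>H y))\<^sup>2 = (norm x * norm y)\<^sup>2" by (simp only: of_real_eq_iff)
  then show ?thesis by (rule power2_eq_imp_eq) simp_all
qed

text \<open>Two approximations: of the completion by almost periodic functions, and of these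
  uniformly by trigonometric polynomials. The sup norm dominates the mean square norm.\<close>

lemma B2_trig_dense:
  fixes b :: "'n :: finite B2"
  assumes "e > 0"
  shows "\<exists>S c. finite S \<and> norm (b - (\<Sum>l\<in>S. c l *\<^sub>C expc_B2 l)) < e"
proof -
  obtain f where f: "norm (b - to_completion f) < e / 2"
    using to_completion_dense[of "e / 2"] assms by auto
  obtain p where p: "p \<in> trig_polynomials" "\<And>x. cmod (Rep_cap f x - p x) < e / 3"
    using Rep_cap[of f] assms unfolding C_ap_iff by (meson divide_pos_pos zero_less_numeral)
  obtain S c where S: "finite S" "p = (\<lambda>x. \<Sum>l\<in>S. c l * expc l x)"
    using p(1) unfolding trig_polynomials_def by blast
  define q where "q = (\<Sum>l\<in>S. c l *\<^sub>C Abs_cap (expc l))"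
  have "Rep_cap (\<Sum>l\<in>T. c l *\<^sub>C Abs_cap (expc l)) x = (\<Sum>l\<in>T. c l * expc l x)" for T x
    by (induction T rule: infinite_finite_induct)
      (simp_all add: zero_cap.rep_eq plus_cap.rep_eq scaleC_cap.rep_eq)
  then have "Rep_cap q x = p x" for x by (simp add: q_def S(2))
  then have "csnorm (f - q) \<le> e / 3"
    using p(2) by (intro csnorm_cap_le less_imp_le) (simp add: minus_cap.rep_eq)
  then have "norm (to_completion f - to_completion q) \<le> e / 3"
    by (simp add: to_completion_diff[symmetric] norm_to_completion)
  then have "norm (b - to_completion q) < e"
    using f assms norm_triangle_ineq[of "b - to_completion f" "to_completion f - to_completion q"] by simp
  moreover have "to_completion q = (\<Sum>l\<in>S. c l *\<^sub>C expc_B2 l)"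
    by (simp add: q_def to_completion_sum to_completion_scaleC expc_B2_def)
  ultimately show ?thesis using S(1) by auto
qed

lemma pre_tensor_sum_pairs:
  fixes y :: "('a :: complex_semi_inner, 'b :: complex_semi_inner) pre_tensor"
  shows "y = (\<Sum>p\<in>{p. pre_tensor_nth y p \<noteq> 0}. pre_tensor_nth y p *\<^sub>C pre_tensor_pair (fst p) (snd p))"
    (is "y = (\<Sum>p\<in>?S. ?t p)")
proof -
  have fin: "finite ?S" using pre_tensor_nth[of y] by simp
  have nth_sum: "pre_tensor_nth (sum ?t A) q = (\<Sum>p\<in>A. if p = q then pre_tensor_nth y p else 0)" for A q
    by (induction A rule: infinite_finite_induct)
      (simp_all add: zero_pre_tensor.rep_eq plus_pre_tensor.rep_eq scaleC_pre_tensor.rep_eq pre_tensor_pair.rep_eq)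
  have "pre_tensor_nth (sum ?t ?S) q = pre_tensor_nth y q" for q
    unfolding nth_sum using fin by (simp add: sum.delta')
  then show ?thesis by (simp add: pre_tensor_nth_inject[symmetric] fun_eq_iff)
qed

lemma closure_add_mem:
  fixes M :: "'a :: real_normed_vector set"
  assumes M: "\<And>v w. v \<in> M \<Longrightarrow> w \<in> M \<Longrightarrow> v + w \<in> M" and vw: "v \<in> closure M" "w \<in> closure M"
  shows "v + w \<in> closure M"
proof -
  obtain p q where "\<And>n :: nat. p n \<in> M" "p \<longlonglongrightarrow> v" "\<And>n :: nat. q n \<in> M" "q \<longlonglongrightarrow> w"
    using vw unfolding closure_sequential by blast
  then show ?thesis unfolding closure_sequential
    by (intro exI[of _ "\<lambda>n. p n + q n"]) (auto intro: M tendsto_add)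
qed

lemma closure_sum_mem:
  fixes M :: "'a :: real_normed_vector set"
  assumes "0 \<in> M" "\<And>v w. v \<in> M \<Longrightarrow> w \<in> M \<Longrightarrow> v + w \<in> M" "\<And>i. i \<in> A \<Longrightarrow> f i \<in> closure M"
  shows "sum f A \<in> closure M"
  using assms(3) closure_subset[THEN subsetD, OF assms(1)]
  by (induction A rule: infinite_finite_induct) (auto intro: closure_add_mem assms(2))

text \<open>Scalars are absorbed into the second factor, c (e_l \<otimes> h) = e_l \<otimes> (c h),
  which is why additivity of \<open>M\<close> suffices once every h is allowed in the
  generators.\<close>

lemma htensor_dense_span:
  fixes M :: "('n :: finite B2, 'h :: complex_inner) htensor set"
  assumes gen: "\<And>l h. expc_B2 l \<otimes>\<^sub>H h \<in> M"
    and zero: "0 \<in> M" and add: "\<And>v w. v \<in> M \<Longrightarrow> w \<in> M \<Longrightarrow> v + w \<in> M"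
  shows "k \<in> closure M"
proof -
  have sumM: "sum f A \<in> M" if "\<And>i. i \<in> A \<Longrightarrow> f i \<in> M" for f and A :: "'i set"
    using that by (induction A rule: infinite_finite_induct) (auto intro: zero add)
  have tens: "b \<otimes>\<^sub>H h \<in> closure M" for b h
    unfolding closure_approachable
  proof (intro allI impI)
    fix e :: real assume e: "e > 0"
    then have "e / (norm h + 1) > 0" by (simp add: add_nonneg_pos)
    then obtain S c where S: "finite S" "norm (b - (\<Sum>l\<in>S. c l *\<^sub>C expc_B2 l)) < e / (norm h + 1)"
      using B2_trig_dense by blast
    let ?b = "\<Sum>l\<in>S. c l *\<^sub>C expc_B2 l"
    have "?b \<otimes>\<^sub>H h = (\<Sum>l\<in>S. expc_B2 l \<otimes>\<^sub>H (c l *\<^sub>C h))"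
      by (simp add: htensor_sum_left htensor_scaleC_left htensor_scaleC_right)
    then have "?b \<otimes>\<^sub>H h \<in> M" by (auto intro: sumM gen)
    moreover have "dist (?b \<otimes>\<^sub>H h) (b \<otimes>\<^sub>H h) < e"
    proof -
      have "dist (?b \<otimes>\<^sub>H h) (b \<otimes>\<^sub>H h) = norm (b - ?b) * norm h"
        by (simp add: dist_norm norm_htensor norm_minus_commute flip: htensor_diff_left)
      also have "\<dots> \<le> norm (b - ?b) * (norm h + 1)" by (intro mult_left_mono) auto
      also have "\<dots> < e / (norm h + 1) * (norm h + 1)"
        by (intro mult_strict_right_mono S) (simp add: add_nonneg_pos)
      also have "\<dots> = e" using norm_ge_zero[of h] by (simp add: add_nonneg_eq_0_iff)
      finally show ?thesis .
    qed
    ultimately show "\<exists>y\<in>M. dist y (b \<otimes>\<^sub>H h) < e" by blast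
  qed
  have "to_completion y \<in> closure M" for y :: "('n B2, 'h) pre_tensor"
  proof -
    have "to_completion y = (\<Sum>p\<in>{p. pre_tensor_nth y p \<noteq> 0}. fst p \<otimes>\<^sub>H (pre_tensor_nth y p *\<^sub>C snd p))"
      by (subst pre_tensor_sum_pairs[of y])
        (simp add: to_completion_sum to_completion_scaleC htensor_scaleC_right htensor_def[symmetric])
    then show ?thesis by (auto intro!: closure_sum_mem zero add tens)
  qed
  then have "\<exists>y\<in>closure M. dist y k < e" if "e > 0" for e
    using to_completion_dense[OF that, of k] by (metis dist_norm norm_minus_commute)
  then have "k \<in> closure (closure M)" by (subst closure_approachable) blast
  then show ?thesis by simp
qed

section \<open>Uniform norm and tensor norm of vector valued trigonometric polynomials\<close>

text \<open>The norm in \<open>B\<^sup>2 \<otimes> H\<close> of a vector valued trigonometric polynomial is the square mean of its pointwise norms.\<close>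

lemma norm_trig_tensor_le:
  fixes l :: "'i \<Rightarrow> real^'n" and h :: "'i \<Rightarrow> 'h :: complex_inner"
  assumes "finite I" "\<And>x. norm (\<Sum>j\<in>I. expc (l j) x *\<^sub>C h j) \<le> B"
  shows "norm (\<Sum>j\<in>I. expc_B2 (l j) \<otimes>\<^sub>H h j) \<le> B"
proof -
  have B: "0 \<le> B" using order_trans[OF norm_ge_zero assms(2)] .
  let ?Q = "\<lambda>x. \<Sum>j\<in>I. expc (l j) x *\<^sub>C h j" and ?K = "\<Sum>j\<in>I. expc_B2 (l j) \<otimes>\<^sub>H h j"
  \<comment> \<open>\<open>f\<close> is the squared pointwise norm, expanded as a scalar
    trigonometric polynomial. Its mean value keeps only the pairs of equal frequencies, and this is
    the Gram sum of the tensors.\<close>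
  define f where "f = (\<lambda>x. \<Sum>j\<in>I. \<Sum>k\<in>I. cinner (h j) (h k) * expc (l j - l k) x)"
  have fQ: "f x = complex_of_real ((norm (?Q x))\<^sup>2)" for x
    unfolding cinner_self_norm[symmetric] f_def
    by (subst cinner_sum_left, subst cinner_sum_right)
      (simp add: cinner_scaleC_left cinner_scaleC_right expc_diff mult_ac)
  have fC: "f \<in> C_ap"
    unfolding f_def by (intro trig_C_ap trig_sum assms(1) trig_expc)
  have "cube_avg f T = (\<Sum>j\<in>I. \<Sum>k\<in>I. cinner (h j) (h k) * cube_avg (expc (l j - l k)) T)" for T
  proof -
    have 1: "(\<lambda>x. \<Sum>k\<in>I. cinner (h j) (h k) * expc (l j - l k) x) \<in> C_ap" for j
      by (intro trig_C_ap trig_sum assms(1) trig_expc)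
    have 2: "(\<lambda>x. c * expc m x) \<in> C_ap" for c and m :: "real^'n"
      by (intro trig_C_ap trig_expc)
    show ?thesis
      unfolding f_def by (simp only: cube_avg_sum[OF assms(1) 1] cube_avg_sum[OF assms(1) 2] cube_avg_cmult)
  qed
  then have "cube_avg f = (\<lambda>T. \<Sum>j\<in>I. \<Sum>k\<in>I. cinner (h j) (h k) * cube_avg (expc (l j - l k)) T)"
    by (rule ext)
  then have "(cube_avg f \<longlongrightarrow> (\<Sum>j\<in>I. \<Sum>k\<in>I. cinner (h j) (h k) * (if l j - l k = 0 then 1 else 0))) at_top"
    by (simp only:) (intro tendsto_sum tendsto_mult tendsto_const cube_avg_expc_tendsto)
  then have "mean_value f = (\<Sum>j\<in>I. \<Sum>k\<in>I. cinner (h j) (h k) * (if l j - l k = 0 then 1 else 0))"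
    by (rule mean_value_eqI)
  also have "\<dots> = cinner ?K ?K"
    by (subst cinner_sum_left, subst cinner_sum_right)
      (simp add: cinner_htensor cinner_expc_B2 mult.commute cong: if_cong)
  finally have "complex_of_real ((norm ?K)\<^sup>2) = mean_value f" by (simp only: cinner_self_norm)
  then have "(norm ?K)\<^sup>2 = cmod (mean_value f)"
    by (metis abs_of_nonneg norm_of_real zero_le_power2)
  also have "\<dots> \<le> B\<^sup>2"
  proof (rule cmod_mean_value_le[OF fC])
    show "cmod (f x) \<le> B\<^sup>2" for x
      unfolding fQ norm_of_real using power_mono[OF assms(2)[of x], of 2] by simp
  qed
  finally show ?thesis using B by (rule power2_le_imp_le)
qed

text \<open>Approximants may be indexed by finite sets of any one type. Pairs of a cell and a
  frequency, and disjoint sums, occur as index sets below.\<close>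

lemma represents_apI:
  assumes "\<And>\<epsilon>. \<epsilon> > 0 \<Longrightarrow> \<exists>(I :: 'i set) l h. finite I \<and> (\<forall>x. norm (W x - (\<Sum>j\<in>I. expc (l j) x *\<^sub>C h j)) < \<epsilon>) \<and>
    norm (k - (\<Sum>j\<in>I. expc_B2 (l j) \<otimes>\<^sub>H h j)) < \<epsilon>"
  shows "represents_ap W k"
  unfolding represents_ap_def
proof (intro allI impI)
  fix \<epsilon> :: real assume "\<epsilon> > 0"
  then obtain I :: "'i set" and l h where I: "finite I" "\<And>x. norm (W x - (\<Sum>j\<in>I. expc (l j) x *\<^sub>C h j)) < \<epsilon>"
    "norm (k - (\<Sum>j\<in>I. expc_B2 (l j) \<otimes>\<^sub>H h j)) < \<epsilon>"
    using assms by meson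
  obtain r where r: "bij_betw r {..<card I} I"
    using ex_bij_betw_nat_finite[OF I(1)] by (auto simp: atLeast0LessThan)
  show "\<exists>(m :: nat) l h. (\<forall>x. norm (W x - (\<Sum>j<m. expc (l j) x *\<^sub>C h j)) < \<epsilon>) \<and>
      norm (k - (\<Sum>j<m. expc_B2 (l j) \<otimes>\<^sub>H h j)) < \<epsilon>"
    by (intro exI[of _ "card I"] exI[of _ "\<lambda>j. l (r j)"] exI[of _ "\<lambda>j. h (r j)"])
      (use I(2,3) in \<open>simp add: sum.reindex_bij_betw[OF r, of "\<lambda>j. expc (l j) _ *\<^sub>C h j"]
          sum.reindex_bij_betw[OF r, of "\<lambda>j. expc_B2 (l j) \<otimes>\<^sub>H h j"]\<close>)
qed

lemma represents_ap_add:
  assumes "represents_ap W k" "represents_ap W' k'"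
  shows "represents_ap (\<lambda>x. W x + W' x) (k + k')"
proof (rule represents_apI)
  fix \<epsilon> :: real assume "\<epsilon> > 0"
  then obtain m l h m' l' h' where *: "\<And>x. norm (W x - (\<Sum>j<(m::nat). expc (l j) x *\<^sub>C h j)) < \<epsilon> / 2"
    "norm (k - (\<Sum>j<m. expc_B2 (l j) \<otimes>\<^sub>H h j)) < \<epsilon> / 2"
    "\<And>x. norm (W' x - (\<Sum>j<(m'::nat). expc (l' j) x *\<^sub>C h' j)) < \<epsilon> / 2"
    "norm (k' - (\<Sum>j<m'. expc_B2 (l' j) \<otimes>\<^sub>H h' j)) < \<epsilon> / 2"
    using assms unfolding represents_ap_def by (meson half_gt_zero)
  have **: "norm (a + b - (c + d)) < \<epsilon>" if "norm (a - c) < \<epsilon> / 2" "norm (b - d) < \<epsilon> / 2"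
    for a b c d :: "'z :: real_normed_vector"
    using norm_diff_triangle_ineq[of a b c d] that by simp
  show "\<exists>(I :: (nat + nat) set) l h. finite I \<and> (\<forall>x. norm (W x + W' x - (\<Sum>j\<in>I. expc (l j) x *\<^sub>C h j)) < \<epsilon>) \<and>
      norm (k + k' - (\<Sum>j\<in>I. expc_B2 (l j) \<otimes>\<^sub>H h j)) < \<epsilon>"
    by (intro exI[of _ "{..<m} <+> {..<m'}"] exI[of _ "case_sum l l'"] exI[of _ "case_sum h h'"])
      (auto simp: sum.Plus o_def intro!: ** *)
qed

text \<open>Two approximants of \<open>W\<close> differ by a trigonometric polynomial that is
  uniformly small, hence small in the tensor norm. As \<open>A_op\<close> is prescribed on finite
  sums of tensors only through \<open>represents_ap\<close>, this is what determines its values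
  there.\<close>

lemma represents_ap_unique:
  assumes "represents_ap W k" "represents_ap W k'"
  shows "k = k'"
proof -
  have "norm (k - k') \<le> \<epsilon>" if e: "\<epsilon> > 0" for \<epsilon>
  proof -
    have e4: "\<epsilon> / 4 > 0" using e by simp
    obtain m l h m' l' h' where *: "\<And>x. norm (W x - (\<Sum>j<(m::nat). expc (l j) x *\<^sub>C h j)) < \<epsilon> / 4"
      "norm (k - (\<Sum>j<m. expc_B2 (l j) \<otimes>\<^sub>H h j)) < \<epsilon> / 4"
      "\<And>x. norm (W x - (\<Sum>j<(m'::nat). expc (l' j) x *\<^sub>C h' j)) < \<epsilon> / 4"
      "norm (k' - (\<Sum>j<m'. expc_B2 (l' j) \<otimes>\<^sub>H h' j)) < \<epsilon> / 4"
      using assms(1)[unfolded represents_ap_def, rule_format, OF e4]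
        assms(2)[unfolded represents_ap_def, rule_format, OF e4] by blast
    have three: "norm (a - b) \<le> norm (a - c) + norm (c - d) + norm (b - d)" for a b c d :: "'z :: real_normed_vector"
      using norm_triangle_ineq4[of "a - c + (c - d)" "b - d"] norm_triangle_ineq[of "a - c" "c - d"] by simp
    have neg: "x \<otimes>\<^sub>H (- y) = - (x \<otimes>\<^sub>H y)" "c *\<^sub>C (- y) = - (c *\<^sub>C y)" for x :: "'a B2" and y :: 'b and c
      using htensor_scaleC_right[of x "- 1" y] by (simp_all add: scaleC_minus1 scaleC_minus_right)
    \<comment> \<open>Over the disjoint sum of the index sets, with the second family negated, the
      difference of the approximants becomes one trigonometric polynomial.\<close>
    have "norm (\<Sum>j\<in>{..<m} <+> {..<m'}. expc_B2 (case_sum l l' j) \<otimes>\<^sub>H case_sum h (\<lambda>j. - h' j) j) \<le> \<epsilon> / 2"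
    proof (rule norm_trig_tensor_le)
      show "norm (\<Sum>j\<in>{..<m} <+> {..<m'}. expc (case_sum l l' j) x *\<^sub>C case_sum h (\<lambda>j. - h' j) j) \<le> \<epsilon> / 2" for x
        using three[of "\<Sum>j<m. expc (l j) x *\<^sub>C h j" "\<Sum>j<m'. expc (l' j) x *\<^sub>C h' j" "W x" "W x"]
          *(1)[of x] *(3)[of x]
        by (simp add: sum.Plus o_def neg sum_negf norm_minus_commute)
    qed simp
    then have "norm ((\<Sum>j<m. expc_B2 (l j) \<otimes>\<^sub>H h j) - (\<Sum>j<m'. expc_B2 (l' j) \<otimes>\<^sub>H h' j)) \<le> \<epsilon> / 2"
      by (simp add: sum.Plus o_def neg sum_negf)
    then show ?thesis
        using three[of k k' "\<Sum>j<m. expc_B2 (l j) \<otimes>\<^sub>H h j" "\<Sum>j<m'. expc_B2 (l' j) \<otimes>\<^sub>H h' j"] *(2,4)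
      by simp
  qed
  then have "norm (k - k') \<le> 0" using field_le_epsilon[of "norm (k - k')" 0] by simp
  then show ?thesis by simp
qed

subsection \<open>Schwartz functions\<close>

lemma iter_deriv_Nil [simp]: "iter_deriv [] f = f"
  by (simp add: iter_deriv_def)

lemma iter_deriv_Cons: "iter_deriv (v # vs) f = iter_deriv [v] (iter_deriv vs f)"
  by (simp add: iter_deriv_def)

lemma iter_deriv_snoc: "iter_deriv (vs @ [v]) f = iter_deriv vs (iter_deriv [v] f)"
  by (simp add: iter_deriv_def)

lemma iter_deriv_single: "(f has_derivative f') (at x) \<Longrightarrow> iter_deriv [v] f x = f' v"
  by (simp add: iter_deriv_def frechet_derivative_at[symmetric])

lemma has_derivative_iter_deriv:
  "f differentiable (at x) \<Longrightarrow> (f has_derivative (\<lambda>v. iter_deriv [v] f x)) (at x)"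
  by (simp add: iter_deriv_def frechet_derivative_works[symmetric])

text \<open>Decay is asked only of the members of a family that is closed under partial derivatives,
  so no iterated derivative is ever computed. Each use chooses a family large enough to contain the
  derivatives of the function at hand.\<close>

lemma schwartz_coinduct:
  fixes P :: "('a :: euclidean_space \<Rightarrow> complex) \<Rightarrow> bool"
  assumes "P f"
    and diff: "\<And>f x. P f \<Longrightarrow> f differentiable (at x)"
    and dec: "\<And>f k. P f \<Longrightarrow> \<exists>C. \<forall>x. norm x ^ k * cmod (f x) \<le> C"
    and deriv: "\<And>f v. P f \<Longrightarrow> v \<in> Basis \<Longrightarrow> P (iter_deriv [v] f)"
  shows "schwartz f"
proof -
  have P: "P (iter_deriv vs f)" if "set vs \<subseteq> Basis" for vs
    using that
  proof (induction vs)
    case (Cons v vs)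
    then show ?case by (subst iter_deriv_Cons) (auto intro: deriv)
  qed (simp add: assms(1))
  have "bounded (range (\<lambda>x. norm x ^ k *\<^sub>R iter_deriv vs f x))" if "set vs \<subseteq> Basis" for k vs
    using dec[OF P[OF that], of k] by (auto simp: bounded_iff)
  then show ?thesis unfolding schwartz_def smooth_def using diff[OF P] by blast
qed

lemma schwartz_differentiable: "schwartz f \<Longrightarrow> f differentiable (at x)"
  using iter_deriv_Nil[of f] unfolding schwartz_def smooth_def
  by (metis empty_subsetI list.set(1))

lemma schwartz_iter_deriv:
  assumes "schwartz f" "v \<in> Basis"
  shows "schwartz (iter_deriv [v] f)"
  using assms unfolding schwartz_def smooth_def
  by (metis iter_deriv_snoc Un_subset_iff empty_subsetI insert_subset list.simps(15) list.set(1) set_append)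

lemma schwartz_decay:
  assumes "schwartz f"
  obtains C where "C \<ge> 0" "\<And>x. norm x ^ k * cmod (f x) \<le> C"
proof -
  have "bounded (range (\<lambda>x. norm x ^ k *\<^sub>R f x))"
    using assms iter_deriv_Nil[of f] unfolding schwartz_def by (metis empty_subsetI list.set(1))
  then obtain C where "\<And>x. norm x ^ k * cmod (f x) \<le> C" by (auto simp: bounded_iff)
  then show ?thesis using that[of "max 0 C"] by (meson max.cobounded1 max.coboundedI2)
qed

lemma schwartz_linear_combination:
  fixes f g :: "'a :: euclidean_space \<Rightarrow> complex"
  assumes "schwartz f" "schwartz g"
  shows "schwartz (\<lambda>x. c * f x + g x)"
proof (rule schwartz_coinduct[where P = "\<lambda>h. \<exists>f g. schwartz f \<and> schwartz g \<and> h = (\<lambda>x. c * f x + g x)"])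
  show "\<exists>f' g'. schwartz f' \<and> schwartz g' \<and> (\<lambda>x. c * f x + g x) = (\<lambda>x. c * f' x + g' x)"
    using assms by blast
next
  fix h :: "'a \<Rightarrow> complex" and x
  assume "\<exists>f g. schwartz f \<and> schwartz g \<and> h = (\<lambda>x. c * f x + g x)"
  then obtain f g where fg: "schwartz f" "schwartz g" "h = (\<lambda>x. c * f x + g x)" by blast
  show "h differentiable (at x)"
    unfolding fg(3)
    by (rule differentiableI, rule has_derivative_add, rule has_derivative_mult_right)
      (rule has_derivative_iter_deriv[OF schwartz_differentiable], rule fg)+
next
  fix h :: "'a \<Rightarrow> complex" and k
  assume "\<exists>f g. schwartz f \<and> schwartz g \<and> h = (\<lambda>x. c * f x + g x)"
  then obtain f g where fg: "schwartz f" "schwartz g" "h = (\<lambda>x. c * f x + g x)" by blast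
  obtain C where C: "\<And>x. norm x ^ k * cmod (f x) \<le> C" using schwartz_decay[OF fg(1)] by blast
  obtain D where D: "\<And>x. norm x ^ k * cmod (g x) \<le> D" using schwartz_decay[OF fg(2)] by blast
  have "norm x ^ k * cmod (h x) \<le> cmod c * C + D" for x
  proof -
    have "norm x ^ k * cmod (h x) \<le> norm x ^ k * (cmod c * cmod (f x) + cmod (g x))"
      unfolding fg(3) by (intro mult_left_mono) (auto intro: order_trans[OF norm_triangle_ineq] simp: norm_mult)
    also have "\<dots> = cmod c * (norm x ^ k * cmod (f x)) + norm x ^ k * cmod (g x)"
      by (simp add: algebra_simps)
    also have "\<dots> \<le> cmod c * C + D"
      by (intro add_mono mult_left_mono C D) simp
    finally show ?thesis .
  qed
  then show "\<exists>C. \<forall>x. norm x ^ k * cmod (h x) \<le> C" by blast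
next
  fix h :: "'a \<Rightarrow> complex" and v :: 'a
  assume "\<exists>f g. schwartz f \<and> schwartz g \<and> h = (\<lambda>x. c * f x + g x)" and v: "v \<in> Basis"
  then obtain f g where fg: "schwartz f" "schwartz g" "h = (\<lambda>x. c * f x + g x)" by blast
  have "iter_deriv [v] h x = c * iter_deriv [v] f x + iter_deriv [v] g x" for x
    unfolding fg(3)
    by (rule iter_deriv_single[of _ "\<lambda>v. c * iter_deriv [v] f x + iter_deriv [v] g x"])
      (intro has_derivative_add has_derivative_mult_right has_derivative_iter_deriv schwartz_differentiable fg)
  then show "\<exists>f g. schwartz f \<and> schwartz g \<and> iter_deriv [v] h = (\<lambda>x. c * f x + g x)"
    using schwartz_iter_deriv[OF fg(1) v] schwartz_iter_deriv[OF fg(2) v] by blast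
qed

lemma schwartz_zero: "schwartz (\<lambda>_. 0)"
  by (rule schwartz_coinduct[where P = "\<lambda>h. h = (\<lambda>_. 0)"])
    (auto intro!: ext iter_deriv_single[where f' = "\<lambda>_. 0"])

lemma schwartz_add: "schwartz f \<Longrightarrow> schwartz g \<Longrightarrow> schwartz (\<lambda>x. f x + g x)"
  using schwartz_linear_combination[of f g 1] by simp

lemma schwartz_cmult: "schwartz f \<Longrightarrow> schwartz (\<lambda>x. c * f x)"
  using schwartz_linear_combination[of f "\<lambda>_. 0" c] schwartz_zero by simp

text \<open>Differentiating (x \<bullet> w) f leaves a term (v \<bullet> w) f without coordinate
  factor; the summand g in the invariant family absorbs it.\<close>

lemma schwartz_mult_coordinate:
  fixes f :: "'a :: euclidean_space \<Rightarrow> complex"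
  assumes "schwartz f"
  shows "schwartz (\<lambda>x. complex_of_real (x \<bullet> w) * f x)"
proof (rule schwartz_coinduct[where P = "\<lambda>h. \<exists>f g. schwartz f \<and> schwartz g \<and> h = (\<lambda>x. complex_of_real (x \<bullet> w) * f x + g x)"])
  show "\<exists>f' g. schwartz f' \<and> schwartz g \<and> (\<lambda>x. complex_of_real (x \<bullet> w) * f x) = (\<lambda>x. complex_of_real (x \<bullet> w) * f' x + g x)"
    using assms schwartz_zero by (intro exI[of _ f] exI[of _ "\<lambda>_. 0"]) auto
next
  fix h :: "'a \<Rightarrow> complex" and x
  assume "\<exists>f g. schwartz f \<and> schwartz g \<and> h = (\<lambda>x. complex_of_real (x \<bullet> w) * f x + g x)"
  then obtain f g where fg: "schwartz f" "schwartz g" "h = (\<lambda>x. complex_of_real (x \<bullet> w) * f x + g x)" by blast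
  have "(\<lambda>x. complex_of_real (x \<bullet> w)) differentiable (at x)"
    by (rule differentiableI, rule has_derivative_of_real, rule has_derivative_inner_left, rule has_derivative_ident)
  then show "h differentiable (at x)"
    unfolding fg(3)
    by (rule differentiable_add[OF differentiable_mult]) (rule schwartz_differentiable, rule fg)+
next
  fix h :: "'a \<Rightarrow> complex" and k
  assume "\<exists>f g. schwartz f \<and> schwartz g \<and> h = (\<lambda>x. complex_of_real (x \<bullet> w) * f x + g x)"
  then obtain f g where fg: "schwartz f" "schwartz g" "h = (\<lambda>x. complex_of_real (x \<bullet> w) * f x + g x)" by blast
  obtain C where C: "\<And>x. norm x ^ Suc k * cmod (f x) \<le> C" using schwartz_decay[OF fg(1)] by blast
  obtain D where D: "\<And>x. norm x ^ k * cmod (g x) \<le> D" using schwartz_decay[OF fg(2)] by blast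
  have "norm x ^ k * cmod (h x) \<le> norm w * C + D" for x
  proof -
    have "cmod (h x) \<le> norm x * norm w * cmod (f x) + cmod (g x)"
      unfolding fg(3) by (rule order_trans[OF norm_triangle_ineq])
        (auto simp: norm_mult intro!: mult_right_mono Cauchy_Schwarz_ineq2)
    then have "norm x ^ k * cmod (h x) \<le> norm x ^ k * (norm x * norm w * cmod (f x) + cmod (g x))"
      by (rule mult_left_mono) simp
    also have "\<dots> = norm w * (norm x ^ Suc k * cmod (f x)) + norm x ^ k * cmod (g x)"
      by (simp add: algebra_simps)
    also have "\<dots> \<le> norm w * C + D"
      by (intro add_mono mult_left_mono C D) simp
    finally show ?thesis .
  qed
  then show "\<exists>C. \<forall>x. norm x ^ k * cmod (h x) \<le> C" by blast
next
  fix h :: "'a \<Rightarrow> complex" and v :: 'a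
  assume "\<exists>f g. schwartz f \<and> schwartz g \<and> h = (\<lambda>x. complex_of_real (x \<bullet> w) * f x + g x)" and v: "v \<in> Basis"
  then obtain f g where fg: "schwartz f" "schwartz g" "h = (\<lambda>x. complex_of_real (x \<bullet> w) * f x + g x)" by blast
  have "iter_deriv [v] h x = complex_of_real (x \<bullet> w) * iter_deriv [v] f x + complex_of_real (v \<bullet> w) * f x + iter_deriv [v] g x" for x
    unfolding fg(3)
    by (rule iter_deriv_single[of _ "\<lambda>v. complex_of_real (x \<bullet> w) * iter_deriv [v] f x + complex_of_real (v \<bullet> w) * f x + iter_deriv [v] g x"])
      (intro has_derivative_add has_derivative_mult has_derivative_of_real has_derivative_inner_left has_derivative_ident
        has_derivative_iter_deriv schwartz_differentiable fg)
  then have "iter_deriv [v] h = (\<lambda>x. complex_of_real (x \<bullet> w) * iter_deriv [v] f x + (complex_of_real (v \<bullet> w) * f x + iter_deriv [v] g x))"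
    by (simp add: fun_eq_iff add.assoc)
  then show "\<exists>f g. schwartz f \<and> schwartz g \<and> iter_deriv [v] h = (\<lambda>x. complex_of_real (x \<bullet> w) * f x + g x)"
    using schwartz_iter_deriv[OF fg(1) v] schwartz_linear_combination[OF fg(1) schwartz_iter_deriv[OF fg(2) v]] by blast
qed

lemma has_derivative_cis:
  "(g has_derivative g') (at x) \<Longrightarrow> ((\<lambda>x. cis (g x)) has_derivative (\<lambda>v. \<i> * complex_of_real (g' v) * cis (g x))) (at x)"
proof -
  assume "(g has_derivative g') (at x)"
  then have "((\<lambda>x. \<i> * complex_of_real (g x)) has_derivative (\<lambda>v. \<i> * complex_of_real (g' v))) (at x)"
    by (intro has_derivative_mult_right has_derivative_of_real)
  from has_derivative_compose[OF this has_field_derivative_imp_has_derivative[OF DERIV_exp]] show ?thesis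
    by (simp add: cis_conv_exp mult_ac)
qed

lemma has_derivative_expc:
  "(expc l has_derivative (\<lambda>v. 2 * pi * \<i> * complex_of_real (l \<bullet> v) * expc l x)) (at x)"
proof -
  have "((\<lambda>x. 2 * pi * (l \<bullet> x)) has_derivative (\<lambda>v. 2 * pi * (l \<bullet> v))) (at x)"
    by (intro has_derivative_mult_right has_derivative_inner_right has_derivative_ident)
  from has_derivative_cis[OF this] show ?thesis
    unfolding expc_def[abs_def] by (simp add: mult_ac)
qed

lemma schwartz_expc_mult:
  fixes f :: "real^'n \<Rightarrow> complex"
  assumes "schwartz f"
  shows "schwartz (\<lambda>x. expc l x * f x)"
proof (rule schwartz_coinduct[where P = "\<lambda>h. \<exists>f. schwartz f \<and> h = (\<lambda>x. expc l x * f x)"])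
  show "\<exists>f'. schwartz f' \<and> (\<lambda>x. expc l x * f x) = (\<lambda>x. expc l x * f' x)"
    using assms by blast
next
  fix h :: "real^'n \<Rightarrow> complex" and x
  assume "\<exists>f. schwartz f \<and> h = (\<lambda>x. expc l x * f x)"
  then obtain f where f: "schwartz f" "h = (\<lambda>x. expc l x * f x)" by blast
  show "h differentiable (at x)"
    unfolding f(2)
    by (rule differentiable_mult[OF differentiableI[OF has_derivative_expc] schwartz_differentiable[OF f(1)]])
next
  fix h :: "real^'n \<Rightarrow> complex" and k
  assume "\<exists>f. schwartz f \<and> h = (\<lambda>x. expc l x * f x)"
  then obtain f where f: "schwartz f" "h = (\<lambda>x. expc l x * f x)" by blast
  show "\<exists>C. \<forall>x. norm x ^ k * cmod (h x) \<le> C"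
    using schwartz_decay[OF f(1), of k] by (metis f(2) mult_1 norm_expc norm_mult)
next
  fix h :: "real^'n \<Rightarrow> complex" and v :: "real^'n"
  assume "\<exists>f. schwartz f \<and> h = (\<lambda>x. expc l x * f x)" and v: "v \<in> Basis"
  then obtain f where f: "schwartz f" "h = (\<lambda>x. expc l x * f x)" by blast
  have "iter_deriv [v] h x = expc l x * iter_deriv [v] f x + 2 * pi * \<i> * complex_of_real (l \<bullet> v) * expc l x * f x" for x
    unfolding f(2)
    by (rule iter_deriv_single[of _ "\<lambda>v. expc l x * iter_deriv [v] f x + 2 * pi * \<i> * complex_of_real (l \<bullet> v) * expc l x * f x"])
      (intro has_derivative_mult has_derivative_expc has_derivative_iter_deriv schwartz_differentiable f)
  then have "iter_deriv [v] h = (\<lambda>x. expc l x * (2 * pi * \<i> * complex_of_real (l \<bullet> v) * f x + iter_deriv [v] f x))"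
    by (simp add: fun_eq_iff algebra_simps)
  then show "\<exists>f. schwartz f \<and> iter_deriv [v] h = (\<lambda>x. expc l x * f x)"
    using schwartz_linear_combination[OF f(1) schwartz_iter_deriv[OF f(1) v]] by blast
qed

section \<open>Weighted bounds and integrability\<close>

lemma one_plus_power_le: "0 \<le> r \<Longrightarrow> (1 + r) ^ m \<le> 2 ^ m * (1 + r ^ m)" for r :: real
proof -
  assume r: "0 \<le> r"
  have "(1 + r) ^ m \<le> (2 * max 1 r) ^ m" using r by (intro power_mono) auto
  also have "\<dots> \<le> 2 ^ m * (1 + r ^ m)" using r by (auto simp: power_mult_distrib max_def)
  finally show ?thesis .
qed

lemma schwartz_bound:
  assumes "schwartz f"
  obtains C where "C \<ge> 0" "\<And>x. cmod (f x) \<le> C / (1 + norm x) ^ m"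
proof -
  obtain A where A: "A \<ge> 0" "\<And>x. norm x ^ m * cmod (f x) \<le> A" using schwartz_decay[OF assms] by blast
  obtain B where B: "B \<ge> 0" "\<And>x. norm x ^ 0 * cmod (f x) \<le> B" using schwartz_decay[OF assms] by blast
  have "cmod (f x) \<le> 2 ^ m * (B + A) / (1 + norm x) ^ m" for x
  proof -
    have "(1 + norm x) ^ m * cmod (f x) \<le> 2 ^ m * (1 + norm x ^ m) * cmod (f x)"
      by (intro mult_right_mono one_plus_power_le) auto
    also have "\<dots> = 2 ^ m * (norm x ^ 0 * cmod (f x) + norm x ^ m * cmod (f x))"
      by (simp add: algebra_simps)
    also have "\<dots> \<le> 2 ^ m * (B + A)"
      by (intro mult_left_mono add_mono A B) simp
    finally show ?thesis
      by (simp add: pos_le_divide_eq add_pos_nonneg mult.commute)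
  qed
  then show ?thesis using A(1) B(1) by (intro that[of "2 ^ m * (B + A)"]) auto
qed

text \<open>Summation over shells: where n <= |x| < n + 1 the integrand is at most (n + 1)^-(d+2),
  and the ball of radius n + 1 has volume a constant times (n + 1)^d. The exponent d + 2 leaves the
  convergent series of 1 / (n + 1)^2.\<close>

lemma integrable_inverse_power_norm:
  "integrable lborel (\<lambda>x :: 'a :: euclidean_space. 1 / (1 + norm x) ^ (DIM('a) + 2))"
proof (rule integrableI_bounded)
  have [measurable]: "ball (0 :: 'a) r \<in> sets borel" for r by simp
  have le_suminf: "u n \<le> (\<Sum>n. u n)" for u :: "nat \<Rightarrow> ennreal" and n
    using sum_le_suminf[of u "{n}"] by simp
  let ?d = "DIM('a)"
  let ?h = "\<lambda>n (x :: 'a). ennreal (1 / real (Suc n) ^ (?d + 2)) * indicator (ball 0 (real (Suc n))) x"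
  have "ennreal (norm (1 / (1 + norm x) ^ (?d + 2))) \<le> (\<Sum>n. ?h n x)" for x :: 'a
  proof -
    define n where "n = nat \<lfloor>norm x\<rfloor>"
    have n: "norm x < real (Suc n)" "real n \<le> norm x" by (simp_all add: n_def) linarith+
    have "1 / (1 + norm x) ^ (?d + 2) \<le> 1 / real (Suc n) ^ (?d + 2)"
      using n by (intro divide_left_mono power_mono mult_pos_pos zero_less_power) (auto simp: add_pos_nonneg)
    then have "ennreal (norm (1 / (1 + norm x) ^ (?d + 2))) \<le> ?h n x"
      using n by (simp add: ennreal_leI)
    also have "\<dots> \<le> (\<Sum>n. ?h n x)"
      by (rule le_suminf)
    finally show ?thesis .
  qed
  then have "(\<integral>\<^sup>+ x. ennreal (norm (1 / (1 + norm (x :: 'a)) ^ (?d + 2))) \<partial>lborel) \<le> (\<integral>\<^sup>+ x. (\<Sum>n. ?h n x) \<partial>lborel)"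
    by (rule nn_integral_mono)
  also have "\<dots> = (\<Sum>n. \<integral>\<^sup>+ x. ?h n x \<partial>lborel)"
    by (rule nn_integral_suminf) measurable
  also have "\<dots> = (\<Sum>n. ennreal (unit_ball_vol (real ?d) * (1 / real (Suc n) ^ 2)))"
  proof (rule arg_cong[of _ _ suminf], rule ext)
    fix n
    have "(\<integral>\<^sup>+ x. ?h n x \<partial>lborel) = ennreal (1 / real (Suc n) ^ (?d + 2)) * ennreal (unit_ball_vol (real ?d) * real (Suc n) ^ ?d)"
      by (subst nn_integral_cmult_indicator) (simp_all add: emeasure_ball)
    also have "\<dots> = ennreal (1 / real (Suc n) ^ (?d + 2) * (unit_ball_vol (real ?d) * real (Suc n) ^ ?d))"
      by (rule ennreal_mult[symmetric]) auto
    also have "1 / real (Suc n) ^ (?d + 2) * (unit_ball_vol (real ?d) * real (Suc n) ^ ?d) = unit_ball_vol (real ?d) * (1 / real (Suc n) ^ 2)"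
      by (simp add: power_add field_simps power2_eq_square del: of_nat_Suc)
    finally show "(\<integral>\<^sup>+ x. ?h n x \<partial>lborel) = ennreal (unit_ball_vol (real ?d) * (1 / real (Suc n) ^ 2))" .
  qed
  also have "\<dots> < \<infinity>"
  proof -
    have "summable (\<lambda>n. 1 / real (Suc n) ^ 2)"
      using inverse_power_summable[of 2, where 'a = real] by (subst summable_Suc_iff) (simp add: divide_inverse)
    then have "summable (\<lambda>n. unit_ball_vol (real ?d) * (1 / real (Suc n) ^ 2))" by (rule summable_mult)
    then show ?thesis by (subst suminf_ennreal2) auto
  qed
  finally show "(\<integral>\<^sup>+ x. ennreal (norm (1 / (1 + norm (x :: 'a)) ^ (?d + 2))) \<partial>lborel) < \<infinity>" .
qed measurable

lemma differentiable_continuous_UNIV: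
  "(\<And>x. f differentiable (at x)) \<Longrightarrow> continuous_on UNIV f"
  by (simp add: continuous_on_eq_continuous_at differentiable_imp_continuous_within)

lemma schwartz_continuous: "schwartz f \<Longrightarrow> continuous_on UNIV f"
  by (rule differentiable_continuous_UNIV) (rule schwartz_differentiable)

lemma schwartz_measurable: "schwartz f \<Longrightarrow> f \<in> borel_measurable borel"
  by (intro borel_measurable_continuous_onI schwartz_continuous)

lemma schwartz_integrable:
  fixes f :: "'a :: euclidean_space \<Rightarrow> complex"
  assumes "schwartz f"
  shows "integrable lborel f"
proof -
  obtain C where C: "C \<ge> 0" "\<And>x. cmod (f x) \<le> C / (1 + norm x) ^ (DIM('a) + 2)" using schwartz_bound[OF assms] by blast
  show ?thesis
  proof (rule Bochner_Integration.integrable_bound)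
    show "integrable lborel (\<lambda>x :: 'a. C * (1 / (1 + norm x) ^ (DIM('a) + 2)))"
      by (intro integrable_mult_right integrable_inverse_power_norm)
    show "AE x in lborel. cmod (f x) \<le> norm (C * (1 / (1 + norm x) ^ (DIM('a) + 2)))"
      using C by (intro AE_I2) (simp add: add_pos_nonneg abs_of_nonneg)
  qed (use schwartz_measurable[OF assms] in simp)
qed

lemma schwartz_norm_integrable:
  fixes f :: "real^'n \<Rightarrow> complex"
  assumes "schwartz f"
  shows "integrable lborel (\<lambda>x. norm x ^ k * cmod (f x))"
proof -
  obtain C where C: "C \<ge> 0" "\<And>x. cmod (f x) \<le> C / (1 + norm x) ^ (k + (DIM(real^'n) + 2))" using schwartz_bound[OF assms] by blast
  show ?thesis
  proof (rule Bochner_Integration.integrable_bound)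
    show "integrable lborel (\<lambda>x :: real^'n. C * (1 / (1 + norm x) ^ (DIM(real^'n) + 2)))"
      by (intro integrable_mult_right integrable_inverse_power_norm)
    have "norm x ^ k * cmod (f x) \<le> C * (1 / (1 + norm x) ^ (DIM(real^'n) + 2))" for x
    proof -
      have "norm x ^ k * cmod (f x) \<le> (1 + norm x) ^ k * (C / (1 + norm x) ^ (k + (DIM(real^'n) + 2)))"
        by (intro mult_mono power_mono C) auto
      also have "\<dots> = C * (1 / (1 + norm x) ^ (DIM(real^'n) + 2))"
        unfolding power_add[of _ k] by (simp add: add_pos_nonneg add_nonneg_eq_0_iff)
      finally show ?thesis .
    qed
    then show "AE x in lborel. norm (norm x ^ k * cmod (f x)) \<le> norm (C * (1 / (1 + norm x) ^ (DIM(real^'n) + 2)))"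
      using C by (intro AE_I2) (simp add: add_pos_nonneg abs_of_nonneg)
  qed (use schwartz_measurable[OF assms] in simp)
qed

lemma schwartz_square_integrable:
  fixes f :: "'a :: euclidean_space \<Rightarrow> complex"
  assumes "schwartz f"
  shows "square_integrable f"
proof -
  obtain B where B: "B \<ge> 0" "\<And>x. norm x ^ 0 * cmod (f x) \<le> B" using schwartz_decay[OF assms] by blast
  show ?thesis
  proof (rule square_integrable_bound)
    show "integrable lborel (\<lambda>x. B * cmod (f x))"
      by (intro integrable_mult_right integrable_norm schwartz_integrable assms)
    show "(cmod (f x))\<^sup>2 \<le> B * cmod (f x)" for x
      using B(2)[of x] by (simp add: power2_eq_square mult_right_mono)
    show "strongly_measurable lborel f"
      using schwartz_measurable[OF assms] by (simp add: strongly_measurable_iff_borel)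
  qed
qed

subsection \<open>Density of the Schwartz functions\<close>

lemma real_polynomial_function_bound:
  fixes q :: "'a :: real_normed_vector \<Rightarrow> real"
  assumes "real_polynomial_function q"
  shows "\<exists>C k. C \<ge> 0 \<and> (\<forall>x. \<bar>q x\<bar> \<le> C * (1 + norm x) ^ k)"
  using assms
proof induction
  case (linear f)
  then obtain K where K: "K > 0" "\<And>x. norm (f x) \<le> norm x * K" by (meson bounded_linear.pos_bounded)
  have "\<bar>f x\<bar> \<le> K * (1 + norm x) ^ 1" for x
    using K(2)[of x] K(1) by (simp add: algebra_simps)
  then show ?case using K(1) by (meson less_imp_le)
next
  case (const c)
  show ?case by (rule exI[of _ "\<bar>c\<bar>"], rule exI[of _ 0]) simp
next
  case (add f g)
  then obtain C k D m where *: "C \<ge> 0" "\<And>x. \<bar>f x\<bar> \<le> C * (1 + norm x) ^ k" "D \<ge> 0" "\<And>x. \<bar>g x\<bar> \<le> D * (1 + norm x) ^ m"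
    by blast
  have "\<bar>f x + g x\<bar> \<le> (C + D) * (1 + norm x) ^ (k + m)" for x
  proof -
    have "\<bar>f x + g x\<bar> \<le> C * (1 + norm x) ^ k + D * (1 + norm x) ^ m"
      using *(2,4)[of x] by linarith
    also have "\<dots> \<le> C * (1 + norm x) ^ (k + m) + D * (1 + norm x) ^ (k + m)"
      by (intro add_mono mult_left_mono power_increasing *) auto
    finally show ?thesis by (simp add: algebra_simps)
  qed
  then show ?case using *(1,3) by (meson add_nonneg_nonneg)
next
  case (mult f g)
  then obtain C k D m where *: "C \<ge> 0" "\<And>x. \<bar>f x\<bar> \<le> C * (1 + norm x) ^ k" "D \<ge> 0" "\<And>x. \<bar>g x\<bar> \<le> D * (1 + norm x) ^ m"
    by blast
  have "\<bar>f x * g x\<bar> \<le> (C * D) * (1 + norm x) ^ (k + m)" for x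
  proof -
    have "\<bar>f x * g x\<bar> \<le> (C * (1 + norm x) ^ k) * (D * (1 + norm x) ^ m)"
      unfolding abs_mult by (intro mult_mono *) (auto simp: *)
    then show ?thesis by (simp add: power_add mult_ac)
  qed
  then show ?case using *(1,3) by (meson mult_nonneg_nonneg)
qed

lemma real_polynomial_function_derivative:
  fixes q :: "'a :: real_normed_vector \<Rightarrow> real"
  assumes "real_polynomial_function q"
  shows "\<exists>D. (\<forall>x. (q has_derivative D x) (at x)) \<and> (\<forall>v. real_polynomial_function (\<lambda>x. D x v))"
  using assms
proof induction
  case (linear f)
  then show ?case
    by (intro exI[of _ "\<lambda>_. f"]) (auto intro: bounded_linear_imp_has_derivative real_polynomial_function.intros)
next
  case (const c)
  show ?case by (intro exI[of _ "\<lambda>_ _. 0"]) (auto intro: real_polynomial_function.intros)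
next
  case (add f g)
  then obtain D E where "\<And>x. (f has_derivative D x) (at x)" "\<And>v. real_polynomial_function (\<lambda>x. D x v)"
    "\<And>x. (g has_derivative E x) (at x)" "\<And>v. real_polynomial_function (\<lambda>x. E x v)" by blast
  then show ?case
    by (intro exI[of _ "\<lambda>x v. D x v + E x v"]) (auto intro: has_derivative_add real_polynomial_function.intros)
next
  case (mult f g)
  then obtain D E where "\<And>x. (f has_derivative D x) (at x)" "\<And>v. real_polynomial_function (\<lambda>x. D x v)"
    "\<And>x. (g has_derivative E x) (at x)" "\<And>v. real_polynomial_function (\<lambda>x. E x v)" by blast
  then show ?case
    using mult.hyps
    by (intro exI[of _ "\<lambda>x v. f x * E x v + D x v * g x"]) (auto intro!: has_derivative_mult real_polynomial_function.intros(3,4))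
qed

text \<open>The n-th root is bounded first: 1 + r <= 2 (1 + r^2), and r^2 exp(-c r^2 / n) <= n / c
  follows from t <= exp t. The witness is the n-th power of the resulting bound.\<close>

lemma power_times_gaussian_bounded:
  fixes c :: real
  assumes "c > 0"
  shows "\<exists>B. \<forall>r\<ge>0. (1 + r) ^ n * exp (- c * r\<^sup>2) \<le> B"
proof -
  have "(1 + r) ^ n * exp (- c * r\<^sup>2) \<le> (2 * (1 + real n / c)) ^ n" if r: "r \<ge> 0" for r
  proof (cases "n = 0")
    case True
    then show ?thesis using assms by simp
  next
    case False
    have "(1 + r) * exp (- c * r\<^sup>2 / n) \<le> 2 * (1 + real n / c)"
    proof -
      have "r\<^sup>2 * exp (- c * r\<^sup>2 / n) \<le> real n / c"
      proof -
        have "c * r\<^sup>2 / n \<le> exp (c * r\<^sup>2 / n)"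
          using exp_ge_add_one_self[of "c * r\<^sup>2 / n"] by linarith
        then have "r\<^sup>2 \<le> real n / c * exp (c * r\<^sup>2 / n)"
          using assms False by (simp add: field_simps)
        then have "r\<^sup>2 * exp (- c * r\<^sup>2 / n) \<le> real n / c * exp (c * r\<^sup>2 / n) * exp (- c * r\<^sup>2 / n)"
          by (rule mult_right_mono) simp
        then show ?thesis by (simp add: mult.assoc flip: exp_add)
      qed
      moreover have "1 + r \<le> 2 * (1 + r\<^sup>2)"
        using sum_squares_bound[of r 1] zero_le_power2[of r] by (simp only: power_one mult_1_right distrib_left)
      then have "(1 + r) * exp (- c * r\<^sup>2 / n) \<le> 2 * (1 + r\<^sup>2) * exp (- c * r\<^sup>2 / n)"
        by (rule mult_right_mono) simp
      moreover have "exp (- c * r\<^sup>2 / n) \<le> 1" using assms by simp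
      moreover have "2 * (1 + r\<^sup>2) * exp (- c * r\<^sup>2 / n) = 2 * exp (- c * r\<^sup>2 / n) + 2 * (r\<^sup>2 * exp (- c * r\<^sup>2 / n))"
        by (simp add: algebra_simps)
      ultimately show ?thesis unfolding distrib_left by linarith
    qed
    then have "((1 + r) * exp (- c * r\<^sup>2 / n)) ^ n \<le> (2 * (1 + real n / c)) ^ n"
      using r by (intro power_mono) auto
    then show ?thesis
      using False by (simp add: power_mult_distrib flip: exp_of_nat_mult)
  qed
  then show ?thesis by blast
qed

text \<open>The invariant family consists of q exp(-P) with polynomial q. Differentiation replaces q
  by another polynomial, and the quadratic lower bound of P gives Gaussian decay that beats the
  growth of q.\<close>

lemma schwartz_exp_polynomial:
  fixes P :: "'a :: euclidean_space \<Rightarrow> real"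
  assumes P: "real_polynomial_function P" and c: "c > 0" and lower: "\<And>x. c * (norm x)\<^sup>2 - K \<le> P x"
  shows "schwartz (\<lambda>x. complex_of_real (exp (- P x)))"
proof -
  obtain D where D: "\<And>x. (P has_derivative D x) (at x)" "\<And>v. real_polynomial_function (\<lambda>x. D x v)"
    using real_polynomial_function_derivative[OF P] by blast
  have deriv: "((\<lambda>x. complex_of_real (q x * exp (- P x))) has_derivative
      (\<lambda>v. complex_of_real (q x * (exp (- P x) * (- D x v)) + E x v * exp (- P x)))) (at x)"
    if "\<And>x. (q has_derivative E x) (at x)" for q E x
    by (intro has_derivative_of_real has_derivative_mult that has_derivative_exp has_derivative_minus D)
      (auto intro!: derivative_eq_intros D)
  show ?thesis
  proof (rule schwartz_coinduct[where P = "\<lambda>h. \<exists>q. real_polynomial_function q \<and> h = (\<lambda>x. complex_of_real (q x * exp (- P x)))"])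
    show "\<exists>q. real_polynomial_function q \<and> (\<lambda>x. complex_of_real (exp (- P x))) = (\<lambda>x. complex_of_real (q x * exp (- P x)))"
      by (intro exI[of _ "\<lambda>_. 1"]) (auto intro: real_polynomial_function.intros)
  next
    fix h :: "'a \<Rightarrow> complex" and x
    assume "\<exists>q. real_polynomial_function q \<and> h = (\<lambda>x. complex_of_real (q x * exp (- P x)))"
    then obtain q where q: "real_polynomial_function q" "h = (\<lambda>x. complex_of_real (q x * exp (- P x)))" by blast
    obtain E where "\<And>x. (q has_derivative E x) (at x)"
      using real_polynomial_function_derivative[OF q(1)] by blast
    from deriv[OF this] show "h differentiable (at x)" unfolding q(2) by (rule differentiableI)
  next
    fix h :: "'a \<Rightarrow> complex" and k
    assume "\<exists>q. real_polynomial_function q \<and> h = (\<lambda>x. complex_of_real (q x * exp (- P x)))"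
    then obtain q where q: "real_polynomial_function q" "h = (\<lambda>x. complex_of_real (q x * exp (- P x)))" by blast
    obtain C m where C: "C \<ge> 0" "\<And>x. \<bar>q x\<bar> \<le> C * (1 + norm x) ^ m"
      using real_polynomial_function_bound[OF q(1)] by blast
    obtain B where B: "\<And>r. r \<ge> 0 \<Longrightarrow> (1 + r) ^ (k + m) * exp (- c * r\<^sup>2) \<le> B"
      using power_times_gaussian_bounded[OF c] by blast
    have "norm x ^ k * cmod (h x) \<le> C * exp K * B" for x
    proof -
      have "norm x ^ k * cmod (h x) = norm x ^ k * (\<bar>q x\<bar> * exp (- P x))"
        by (simp add: q(2) norm_mult abs_mult)
      also have "\<dots> \<le> (1 + norm x) ^ k * ((C * (1 + norm x) ^ m) * exp (K - c * (norm x)\<^sup>2))"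
        using lower[of x] by (intro mult_mono power_mono C) (auto simp: C(1))
      also have "\<dots> = C * exp K * ((1 + norm x) ^ (k + m) * exp (- c * (norm x)\<^sup>2))"
        by (simp add: power_add exp_diff exp_minus field_simps)
      also have "\<dots> \<le> C * exp K * B"
        by (intro mult_left_mono B) (auto simp: C(1))
      finally show ?thesis .
    qed
    then show "\<exists>C. \<forall>x. norm x ^ k * cmod (h x) \<le> C" by blast
  next
    fix h :: "'a \<Rightarrow> complex" and v :: 'a
    assume "\<exists>q. real_polynomial_function q \<and> h = (\<lambda>x. complex_of_real (q x * exp (- P x)))"
    then obtain q where q: "real_polynomial_function q" "h = (\<lambda>x. complex_of_real (q x * exp (- P x)))" by blast
    obtain E where E: "\<And>x. (q has_derivative E x) (at x)" "\<And>v. real_polynomial_function (\<lambda>x. E x v)"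
      using real_polynomial_function_derivative[OF q(1)] by blast
    have "iter_deriv [v] h = (\<lambda>x. complex_of_real (((- 1) * (q x * D x v) + E x v) * exp (- P x)))"
      unfolding q(2) using iter_deriv_single[OF deriv[OF E(1)], of v] by (simp add: fun_eq_iff algebra_simps)
    moreover have "real_polynomial_function (\<lambda>x. (- 1) * (q x * D x v) + E x v)"
      by (intro real_polynomial_function.intros q D E)
    ultimately show "\<exists>q. real_polynomial_function q \<and> iter_deriv [v] h = (\<lambda>x. complex_of_real (q x * exp (- P x)))"
      by blast
  qed
qed

section \<open>Indicator functions as L^2 limits of Schwartz functions\<close>

lemma abs_L2_LIMSEQ:
  fixes F :: "nat \<Rightarrow> 'a :: euclidean_space \<Rightarrow> 'b :: complex_inner"
  assumes F: "\<And>n. square_integrable (F n)" and f: "square_integrable f"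
    and w: "integrable lborel w" "\<And>n x. (norm (F n x - f x))\<^sup>2 \<le> w x"
    and lim: "AE x in lborel. (\<lambda>n. F n x) \<longlonglongrightarrow> f x"
  shows "(\<lambda>n. abs_L2 (F n)) \<longlonglongrightarrow> abs_L2 f"
proof -
  have d: "square_integrable (\<lambda>x. F n x - f x)" for n by (rule square_integrable_diff[OF F f])
  have "(\<lambda>n. LINT x|lborel. (norm (F n x - f x))\<^sup>2) \<longlonglongrightarrow> (LINT x|(lborel :: 'a measure). 0)"
  proof (rule integral_dominated_convergence[where w = w])
    show "(\<lambda>x. (norm (F n x - f x))\<^sup>2) \<in> borel_measurable lborel" for n
      using d[of n] by (intro borel_measurable_integrable) (simp add: square_integrable_def)
    show "AE x in lborel. (\<lambda>n. (norm (F n x - f x))\<^sup>2) \<longlonglongrightarrow> 0"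
      using lim
    proof eventually_elim
      case (elim x)
      then have "(\<lambda>n. (norm (F n x - f x))\<^sup>2) \<longlonglongrightarrow> (norm (f x - f x))\<^sup>2" by (intro tendsto_intros)
      then show ?case by simp
    qed
  qed (use w in auto)
  then have "(\<lambda>n. (norm (abs_L2 (F n) - abs_L2 f))\<^sup>2) \<longlonglongrightarrow> 0"
    by (simp add: norm_abs_L2[OF d] flip: abs_L2_diff[OF F f])
  then have "(\<lambda>n. sqrt ((norm (abs_L2 (F n) - abs_L2 f))\<^sup>2)) \<longlonglongrightarrow> sqrt 0" by (rule tendsto_real_sqrt)
  then show ?thesis by (simp add: LIM_zero_iff tendsto_norm_zero_iff)
qed

lemma square_integrable_scaleC_vec:
  assumes "square_integrable H"
  shows "square_integrable (\<lambda>x. H x *\<^sub>C (v :: 'b :: complex_inner))"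
proof (rule square_integrable_bound)
  show "strongly_measurable lborel (\<lambda>x. H x *\<^sub>C v)"
    using assms by (intro strongly_measurable_scaleC_fun strongly_measurable_const)
      (auto simp: square_integrable_def strongly_measurable_iff_borel)
  show "integrable lborel (\<lambda>x. (norm (H x))\<^sup>2 * (norm v)\<^sup>2)"
    using assms by (simp add: square_integrable_def)
  show "(norm (H x *\<^sub>C v))\<^sup>2 \<le> (norm (H x))\<^sup>2 * (norm v)\<^sup>2" for x
    by (simp add: norm_scaleC power_mult_distrib)
qed

lemma norm_abs_L2_scaleC_vec:
  assumes "square_integrable H"
  shows "norm (abs_L2 (\<lambda>x. H x *\<^sub>C (v :: 'b :: complex_inner))) = norm (abs_L2 H) * norm v"
proof -
  have "(norm (abs_L2 (\<lambda>x. H x *\<^sub>C v)))\<^sup>2 = (norm (abs_L2 H) * norm v)\<^sup>2"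
    by (simp add: norm_abs_L2 assms square_integrable_scaleC_vec norm_scaleC power_mult_distrib)
  then show ?thesis by (rule power2_eq_imp_eq) simp_all
qed

lemma square_integrable_indicator:
  assumes "A \<in> sets borel" "emeasure lborel A < \<infinity>"
  shows "square_integrable (\<lambda>x :: 'a :: euclidean_space. indicator A x :: complex)"
proof (rule square_integrable_bound)
  show "strongly_measurable lborel (\<lambda>x. indicator A x :: complex)"
    using assms by (simp add: strongly_measurable_iff_borel)
  show "integrable lborel (indicat_real A)" using assms by simp
qed (simp add: indicator_def)

definition schwartz_L2 :: "('a :: euclidean_space, complex) L2 set" where
  "schwartz_L2 = {abs_L2 f | f. schwartz f}"

lemma schwartz_L2_0: "0 \<in> schwartz_L2"
  unfolding schwartz_L2_def using schwartz_zero abs_L2_0 by (metis (mono_tags, lifting) mem_Collect_eq)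

lemma schwartz_L2_add:
  assumes "v \<in> schwartz_L2" "w \<in> schwartz_L2" shows "v + w \<in> schwartz_L2"
proof -
  obtain f g where "schwartz f" "schwartz g" "v = abs_L2 f" "w = abs_L2 g"
    using assms by (auto simp: schwartz_L2_def)
  then show ?thesis unfolding schwartz_L2_def
    by (intro CollectI exI[of _ "\<lambda>x. f x + g x"]) (simp add: abs_L2_add schwartz_square_integrable schwartz_add)
qed

lemma schwartz_L2_scaleC:
  assumes "v \<in> schwartz_L2" shows "c *\<^sub>C v \<in> schwartz_L2"
proof -
  obtain f where "schwartz f" "v = abs_L2 f"
    using assms by (auto simp: schwartz_L2_def)
  then show ?thesis unfolding schwartz_L2_def
    using abs_L2_scaleC[OF schwartz_square_integrable, of f c]
    by (intro CollectI exI[of _ "\<lambda>x. c * f x"]) (simp add: schwartz_cmult scaleC_complex_def)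
qed

text \<open>The functions \<open>exp (- \<Sum>\<^sub>i t\<^sub>i\<^sup>2\<^sup>n)\<close> converge to the indicator of the cube \<open>\<bar>t\<^sub>i\<bar> < 1\<close>.\<close>

lemma indicator_box_in_closure_schwartz:
  fixes a b :: "'a :: euclidean_space"
  shows "abs_L2 (\<lambda>x. indicator (box a b) x) \<in> closure schwartz_L2"
proof (cases "box a b = {}")
  case True
  then show ?thesis using closure_subset[THEN subsetD, OF schwartz_L2_0] by (simp add: abs_L2_0)
next
  case False
  then have ab: "a \<bullet> i < b \<bullet> i" if "i \<in> Basis" for i using that by (simp add: box_ne_empty)
  \<comment> \<open>The affine coordinate that takes the i-th edge of the box onto (-1, 1); below,
    \<open>s i\<close> is its slope and \<open>m i\<close> the midpoint of the edge.\<close>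
  define t where "t i x = (2 * (x \<bullet> i) - a \<bullet> i - b \<bullet> i) / (b \<bullet> i - a \<bullet> i)" for i x
  define P where "P n x = (\<Sum>i\<in>Basis. ((t i x)\<^sup>2) ^ n)" for n x
  define s where "s i = 2 / (b \<bullet> i - a \<bullet> i)" for i
  have s0: "s i \<noteq> 0" if "i \<in> Basis" for i using ab[OF that] by (simp add: s_def)
  define \<sigma> where "\<sigma> = Min ((\<lambda>i. (s i)\<^sup>2) ` Basis)"
  have \<sigma>: "\<sigma> > 0" "\<And>i. i \<in> Basis \<Longrightarrow> \<sigma> \<le> (s i)\<^sup>2"
    unfolding \<sigma>_def using s0 by auto
  define m where "m i = (a \<bullet> i + b \<bullet> i) / 2" for i
  have t_eq: "t i x = s i * (x \<bullet> i - m i)" if "i \<in> Basis" for i x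
    using ab[OF that] by (simp add: t_def s_def m_def field_simps)
  \<comment> \<open>Quadratic growth after recentring: (x - m)^2 >= x^2 / 2 - m^2 in each
    coordinate, and \<open>\<sigma>\<close> is the smallest squared slope.\<close>
  have P1: "\<sigma> / 2 * (norm x)\<^sup>2 - (\<Sum>i\<in>Basis. (s i)\<^sup>2 * (m i)\<^sup>2) \<le> P 1 x" for x
  proof -
    have "\<sigma> / 2 * (x \<bullet> i)\<^sup>2 - (s i)\<^sup>2 * (m i)\<^sup>2 \<le> (t i x)\<^sup>2" if "i \<in> Basis" for i
    proof -
      have "\<sigma> / 2 * (x \<bullet> i)\<^sup>2 \<le> (s i)\<^sup>2 * ((x \<bullet> i)\<^sup>2 / 2)"
        using mult_right_mono[OF \<sigma>(2)[OF that], of "(x \<bullet> i)\<^sup>2 / 2"] by simp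
      moreover have "(x \<bullet> i)\<^sup>2 / 2 - (m i)\<^sup>2 \<le> (x \<bullet> i - m i)\<^sup>2"
        using zero_le_power2[of "x \<bullet> i - 2 * m i"] by (simp add: power2_eq_square algebra_simps)
      then have "(s i)\<^sup>2 * ((x \<bullet> i)\<^sup>2 / 2 - (m i)\<^sup>2) \<le> (s i)\<^sup>2 * (x \<bullet> i - m i)\<^sup>2"
        by (rule mult_left_mono) simp
      ultimately show ?thesis
        unfolding t_eq[OF that] power_mult_distrib right_diff_distrib[of "(s i)\<^sup>2" "(x \<bullet> i)\<^sup>2 / 2"] by linarith
    qed
    then have "(\<Sum>i\<in>Basis. \<sigma> / 2 * (x \<bullet> i)\<^sup>2 - (s i)\<^sup>2 * (m i)\<^sup>2) \<le> P 1 x"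
      unfolding P_def by (intro sum_mono) simp
    moreover have "(norm x)\<^sup>2 = (\<Sum>i\<in>Basis. (x \<bullet> i)\<^sup>2)"
      by (subst power2_norm_eq_inner, subst euclidean_inner) (simp add: power2_eq_square)
    ultimately show ?thesis by (simp add: sum_subtractf sum_distrib_left)
  qed
  \<comment> \<open>By u - 1 <= u^(n+1) all higher powers inherit the growth of the first one. The
    same inequality later bounds every \<open>f n\<close> by exp(d) times \<open>f 0\<close>, the
    majorant for dominated convergence.\<close>
  have Pn: "P 1 x - real DIM('a) \<le> P (Suc n) x" for n x
  proof -
    have "u - 1 \<le> u ^ Suc n" if "u \<ge> 0" for u :: real
    proof (cases "u \<le> 1")
      case True
      then show ?thesis using zero_le_power[OF that, of "Suc n"] by linarith
    next
      case False
      then show ?thesis using power_increasing[of 1 "Suc n" u] unfolding power_one_right by linarith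
    qed
    then have "(\<Sum>i\<in>Basis. (t i x)\<^sup>2 - 1) \<le> P (Suc n) x"
      unfolding P_def by (intro sum_mono) simp
    then show ?thesis by (simp add: P_def sum_subtractf)
  qed
  have poly: "real_polynomial_function (P n)" for n
  proof -
    have "bounded_linear (\<lambda>x :: 'a. x \<bullet> i)" for i by (rule bounded_linear_inner_left)
    then have "real_polynomial_function (\<lambda>x. (1 / (b \<bullet> i - a \<bullet> i)) * (2 * (x \<bullet> i) + (- a \<bullet> i - b \<bullet> i)))" for i
      by (intro real_polynomial_function.intros)
    moreover have "(\<lambda>x. (1 / (b \<bullet> i - a \<bullet> i)) * (2 * (x \<bullet> i) + (- a \<bullet> i - b \<bullet> i))) = t i" for i
      by (simp add: t_def fun_eq_iff divide_inverse algebra_simps)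
    ultimately have "real_polynomial_function (t i)" for i by simp
    then show ?thesis unfolding P_def
      by (intro real_polynomial_function_sum real_polynomial_function_power) auto
  qed
  \<comment> \<open>The exponent starts at 1: with exponent 0 the polynomial would be constant and
    exp(-P) no Schwartz function.\<close>
  define f where "f n x = complex_of_real (exp (- P (Suc n) x))" for n x
  have f: "schwartz (f n)" for n
    unfolding f_def
  proof (rule schwartz_exp_polynomial[OF poly])
    show "\<sigma> / 2 > 0" using \<sigma> by simp
    show "\<sigma> / 2 * (norm x)\<^sup>2 - ((\<Sum>i\<in>Basis. (s i)\<^sup>2 * (m i)\<^sup>2) + real DIM('a)) \<le> P (Suc n) x" for x
      using P1[of x] Pn[of x n] by linarith
  qed
  have box_iff: "x \<in> box a b \<longleftrightarrow> (\<forall>i\<in>Basis. (t i x)\<^sup>2 < 1)" and cbox_iff: "x \<in> cbox a b \<longleftrightarrow> (\<forall>i\<in>Basis. (t i x)\<^sup>2 \<le> 1)" for x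
  proof -
    have "a \<bullet> i < x \<bullet> i \<and> x \<bullet> i < b \<bullet> i \<longleftrightarrow> (t i x)\<^sup>2 < 1" "a \<bullet> i \<le> x \<bullet> i \<and> x \<bullet> i \<le> b \<bullet> i \<longleftrightarrow> (t i x)\<^sup>2 \<le> 1" if "i \<in> Basis" for i
      unfolding abs_square_less_1 abs_square_le_1 abs_less_iff abs_le_iff
      using ab[OF that] by (auto simp: t_def field_simps)
    then show "x \<in> box a b \<longleftrightarrow> (\<forall>i\<in>Basis. (t i x)\<^sup>2 < 1)" "x \<in> cbox a b \<longleftrightarrow> (\<forall>i\<in>Basis. (t i x)\<^sup>2 \<le> 1)"
      by (auto simp: mem_box)
  qed
  have lim_in: "(\<lambda>n. f n x) \<longlonglongrightarrow> 1" if "x \<in> box a b" for x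
  proof -
    have "(\<lambda>n. exp (- P n x)) \<longlonglongrightarrow> exp (- (\<Sum>i\<in>(Basis :: 'a set). 0))"
      unfolding P_def using that box_iff[of x] by (intro tendsto_intros LIMSEQ_power_zero) auto
    then have "(\<lambda>n. complex_of_real (exp (- P (Suc n) x))) \<longlonglongrightarrow> complex_of_real 1"
      by (intro tendsto_of_real) (simp add: filterlim_sequentially_Suc[of "\<lambda>n. exp (- P n x)"])
    then show ?thesis by (simp add: f_def)
  qed
  have lim_out: "(\<lambda>n. f n x) \<longlonglongrightarrow> 0" if x: "x \<notin> cbox a b" for x
  proof -
    obtain i where i: "i \<in> Basis" "(t i x)\<^sup>2 > 1" using x by (auto simp: cbox_iff not_le)
    have "norm (f n x) \<le> (1 / (t i x)\<^sup>2) ^ n" for n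
    proof -
      have "((t i x)\<^sup>2) ^ n \<le> ((t i x)\<^sup>2) ^ Suc n" using i by (intro power_increasing) auto
      also have "\<dots> \<le> P (Suc n) x" unfolding P_def by (rule member_le_sum) (use i in auto)
      also have "\<dots> \<le> exp (P (Suc n) x)" using exp_ge_add_one_self[of "P (Suc n) x"] by linarith
      finally have le: "((t i x)\<^sup>2) ^ n \<le> exp (P (Suc n) x)" .
      have pos: "0 < ((t i x)\<^sup>2) ^ n" by (rule zero_less_power) (use i in linarith)
      have "1 / exp (P (Suc n) x) \<le> 1 / ((t i x)\<^sup>2) ^ n"
        by (rule divide_left_mono[OF le]) (use pos in auto)
      moreover have "norm (f n x) = 1 / exp (P (Suc n) x)"
        unfolding f_def norm_of_real by (simp add: exp_minus inverse_eq_divide)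
      ultimately show ?thesis by (simp add: power_one_over)
    qed
    moreover have "(\<lambda>n. (1 / (t i x)\<^sup>2) ^ n) \<longlonglongrightarrow> 0"
      using i by (intro LIMSEQ_power_zero) (simp add: divide_less_eq)
    ultimately show ?thesis
      by (rule Lim_null_comparison[OF always_eventually[OF allI]])
  qed
  have fin: "emeasure lborel (box a b) < \<infinity>" by (rule emeasure_lborel_box_finite)
  have "(\<lambda>n. abs_L2 (f n)) \<longlonglongrightarrow> abs_L2 (\<lambda>x. indicator (box a b) x)"
  proof (rule abs_L2_LIMSEQ)
    show "square_integrable (f n)" for n by (rule schwartz_square_integrable[OF f])
    show "square_integrable (\<lambda>x. indicator (box a b) x :: complex)"
      by (rule square_integrable_indicator[OF _ fin]) simp
    show "integrable lborel (\<lambda>x. exp (real DIM('a)) * cmod (f 0 x) + indicat_real (box a b) x)"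
      using fin by (intro Bochner_Integration.integrable_add integrable_mult_right integrable_norm schwartz_integrable f) auto
    show "(norm (f n x - indicator (box a b) x))\<^sup>2 \<le> exp (real DIM('a)) * cmod (f 0 x) + indicat_real (box a b) x" for n x
    proof -
      let ?e = "exp (- P (Suc n) x)" and ?i = "indicat_real (box a b) x"
      have e: "0 \<le> ?e" "?e \<le> 1" "?i \<in> {0, 1}"
        by (auto simp: P_def sum_nonneg indicator_def)
      have "norm (f n x - indicator (box a b) x) = \<bar>?e - ?i\<bar>"
      proof -
        have "f n x - indicator (box a b) x = complex_of_real (?e - ?i)" by (simp add: f_def indicator_def)
        then show ?thesis by (simp only: norm_of_real)
      qed
      moreover have "\<bar>?e - ?i\<bar>\<^sup>2 \<le> ?e + ?i"
      proof -
        have "\<bar>?e - ?i\<bar> * \<bar>?e - ?i\<bar> \<le> \<bar>?e - ?i\<bar> * 1" by (rule mult_left_mono) (use e in auto)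
        moreover have "\<bar>?e - ?i\<bar> \<le> ?e + ?i" unfolding abs_le_iff using e by auto
        ultimately show ?thesis unfolding power2_eq_square mult_1_right by (rule order_trans)
      qed
      moreover have "?e \<le> exp (real DIM('a)) * cmod (f 0 x)"
        using Pn[of x n] by (simp add: f_def flip: exp_add)
      ultimately show ?thesis by simp
    qed
    \<comment> \<open>On the faces of the box the functions do not tend to the indicator, so the
      faces have to be removed as a null set.\<close>
    have "emeasure lborel (cbox a b - box a b) = emeasure lborel (cbox a b) - emeasure lborel (box a b)"
      using fin by (intro emeasure_Diff) (auto simp: box_subset_cbox)
    also have "\<dots> = 0"
      by (simp add: emeasure_lborel_box_eq emeasure_lborel_cbox_eq)
    finally have "AE x in lborel. x \<notin> cbox a b - box a b"
      by (intro AE_not_in) (simp add: null_sets_def)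
    then show "AE x in lborel. (\<lambda>n. f n x) \<longlonglongrightarrow> indicator (box a b) x"
    proof eventually_elim
      case (elim x)
      then show ?case using lim_in[of x] lim_out[of x] by (auto simp: indicator_def)
    qed
  qed
  then show ?thesis
    unfolding closure_sequential schwartz_L2_def using f
    by (intro exI[of _ "\<lambda>n. abs_L2 (f n)"]) auto
qed

lemma closure_schwartz_L2_diff:
  assumes "v \<in> closure schwartz_L2" "w \<in> closure schwartz_L2"
  shows "v - w \<in> closure schwartz_L2"
proof -
  obtain p q where pq: "\<And>n :: nat. p n \<in> schwartz_L2" "p \<longlonglongrightarrow> v" "\<And>n :: nat. q n \<in> schwartz_L2" "q \<longlonglongrightarrow> w"
    using assms unfolding closure_sequential by blast
  have "p n - q n \<in> schwartz_L2" for n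
    using schwartz_L2_add[OF pq(1)[of n] schwartz_L2_scaleC[OF pq(3)[of n], of "- 1"]] by (simp add: scaleC_minus1)
  then show ?thesis using pq unfolding closure_sequential
    by (intro exI[of _ "\<lambda>n. p n - q n"]) (auto intro: tendsto_diff)
qed

lemma closure_LIMSEQ:
  fixes l :: "'a :: metric_space"
  assumes "X \<longlonglongrightarrow> l" "\<And>n :: nat. X n \<in> closure S"
  shows "l \<in> closure S"
  using closed_sequentially[OF closed_closure] assms by blast

lemma abs_L2_indicator_LIMSEQ:
  fixes B :: "nat \<Rightarrow> 'a :: euclidean_space set"
  assumes "\<And>n. B n \<in> sets borel" "\<And>n. B n \<subseteq> C" "C \<in> sets borel" "emeasure lborel C < \<infinity>"
    and lim: "\<And>x. (\<lambda>n. indicator (B n) x :: complex) \<longlonglongrightarrow> indicator (\<Union>n. B n) x"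
  shows "(\<lambda>n. abs_L2 (\<lambda>x. indicator (B n) x :: complex)) \<longlonglongrightarrow> abs_L2 (indicator (\<Union>n. B n))"
proof (rule abs_L2_LIMSEQ)
  have fin: "emeasure lborel A < \<infinity>" if "A \<subseteq> C" for A
    using emeasure_mono[OF that, of lborel] assms(3,4) by simp
  show "square_integrable (\<lambda>x. indicator (B n) x :: complex)" for n
    by (intro square_integrable_indicator assms fin)
  show "square_integrable (indicator (\<Union>n. B n) :: _ \<Rightarrow> complex)"
    by (intro square_integrable_indicator fin sets.countable_UN) (use assms in auto)
  show "integrable lborel (indicat_real C)" using assms by simp
  show "(norm (indicator (B n) x - indicator (\<Union>n. B n) x :: complex))\<^sup>2 \<le> indicat_real C x" for n x
    using assms(2) by (auto simp: indicator_def)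
  show "AE x in lborel. (\<lambda>n. indicator (B n) x :: complex) \<longlonglongrightarrow> indicator (\<Union>n. B n) x"
    using lim by simp
qed

text \<open>Boxes are a generator of the Borel sets that is stable under intersections, so it
  suffices that the sets with this property form a Dynkin system. Intersecting with a fixed box
  keeps all measures finite, so a complement becomes a difference in L^2.\<close>

lemma indicator_Int_box_in_closure_schwartz:
  fixes a b :: "'a :: euclidean_space"
  assumes "A \<in> sets borel"
  shows "abs_L2 (\<lambda>x. indicator (A \<inter> box a b) x) \<in> closure schwartz_L2"
proof -
  let ?G = "range (\<lambda>(a, b). box a b) :: 'a set set" and ?Q = "box a b"
  have sets: "sets borel = sigma_sets UNIV ?G"
    by (subst borel_eq_box) (simp add: sets_measure_of)
  have finQ: "emeasure lborel ?Q < \<infinity>" by (rule emeasure_lborel_box_finite)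
  have sq: "square_integrable (\<lambda>x. indicator (A \<inter> ?Q) x :: complex)" if "A \<in> sets borel" for A
    using emeasure_mono[of "A \<inter> ?Q" ?Q lborel] finQ that by (intro square_integrable_indicator) auto
  have "Int_stable ?G"
    unfolding Int_stable_def by (auto simp: box_Int_box)
  moreover have "?G \<subseteq> Pow UNIV" by simp
  moreover have "A \<in> sigma_sets UNIV ?G" using assms sets by simp
  ultimately show ?thesis
  proof (induction A rule: sigma_sets_induct_disjoint)
    case (basic A)
    then obtain c d where "A = box c d" by auto
    then show ?case by (simp add: box_Int_box indicator_box_in_closure_schwartz)
  next
    case empty
    show ?case using closure_subset[THEN subsetD, OF schwartz_L2_0] by (simp add: abs_L2_0)
  next
    case (compl A)
    have A: "A \<in> sets borel" using compl sets by simp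
    have "abs_L2 (\<lambda>x. indicator ((UNIV - A) \<inter> ?Q) x) =
        abs_L2 (\<lambda>x. indicator (UNIV \<inter> ?Q) x - indicator (A \<inter> ?Q) x :: complex)"
      by (rule arg_cong[of _ _ abs_L2]) (auto simp: indicator_def)
    also have "\<dots> = abs_L2 (\<lambda>x. indicator (UNIV \<inter> ?Q) x) - abs_L2 (\<lambda>x. indicator (A \<inter> ?Q) x)"
      by (rule abs_L2_diff[OF sq sq[OF A]]) simp
    finally show ?case
      using compl(2) indicator_box_in_closure_schwartz[of a b] by (simp add: closure_schwartz_L2_diff)
  next
    case (union A)
    have A: "A i \<in> sets borel" for i using union(2) sets by auto
    let ?B = "\<lambda>n. (\<Union>i<n. A i)"
    have B: "?B n \<in> sets borel" for n using A by auto
    have mem: "abs_L2 (\<lambda>x. indicator (?B n \<inter> ?Q) x) \<in> closure schwartz_L2" for n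
    proof (induction n)
      case 0
      show ?case using closure_subset[THEN subsetD, OF schwartz_L2_0] by (simp add: abs_L2_0)
    next
      case (Suc n)
      have "?B n \<inter> A n = {}"
      proof -
        have "A i \<inter> A n = {}" if "i < n" for i using union(1) that by (simp add: disjoint_family_on_def)
        then show ?thesis by auto
      qed
      then have "abs_L2 (\<lambda>x. indicator (?B (Suc n) \<inter> ?Q) x) =
          abs_L2 (\<lambda>x. indicator (?B n \<inter> ?Q) x + indicator (A n \<inter> ?Q) x :: complex)"
        by (intro arg_cong[of _ _ abs_L2] ext) (auto simp: indicator_def lessThan_Suc)
      also have "\<dots> = abs_L2 (\<lambda>x. indicator (?B n \<inter> ?Q) x) + abs_L2 (\<lambda>x. indicator (A n \<inter> ?Q) x)"
        by (rule abs_L2_add[OF sq[OF B] sq[OF A]])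
      finally show ?case
        using closure_add_mem[OF schwartz_L2_add Suc union(3)] by simp
    qed
    have "(\<lambda>n. abs_L2 (\<lambda>x. indicator (?B n \<inter> ?Q) x :: complex)) \<longlonglongrightarrow> abs_L2 (indicator (\<Union>n. ?B n \<inter> ?Q))"
    proof (rule abs_L2_indicator_LIMSEQ[where C = ?Q])
      show "(\<lambda>n. indicator (?B n \<inter> ?Q) x :: complex) \<longlonglongrightarrow> indicator (\<Union>n. ?B n \<inter> ?Q) x" for x
        by (rule LIMSEQ_indicator_incseq) (force simp: incseq_def)
    qed (use B finQ in auto)
    then have "abs_L2 (indicator (\<Union>n. ?B n \<inter> ?Q)) \<in> closure schwartz_L2"
      using mem by (rule closure_LIMSEQ)
    moreover have "(\<Union>n. ?B n \<inter> ?Q) = (\<Union>i. A i) \<inter> ?Q" by blast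
    ultimately show ?case by simp
  qed
qed

text \<open>Exhaustion by growing cubes removes the restriction to a box; the finite measure of
  \<open>A\<close> gives the majorant.\<close>

lemma indicator_in_closure_schwartz:
  fixes A :: "'a :: euclidean_space set"
  assumes "A \<in> sets borel" "emeasure lborel A < \<infinity>"
  shows "abs_L2 (\<lambda>x. indicator A x) \<in> closure schwartz_L2"
proof -
  let ?Q = "\<lambda>n :: nat. box (- (real n *\<^sub>R One)) (real n *\<^sub>R One) :: 'a set"
  have "(\<lambda>n. abs_L2 (\<lambda>x. indicator (A \<inter> ?Q n) x :: complex)) \<longlonglongrightarrow> abs_L2 (indicator (\<Union>n. A \<inter> ?Q n))"
  proof (rule abs_L2_indicator_LIMSEQ[where C = A])
    show "(\<lambda>n. indicator (A \<inter> ?Q n) x :: complex) \<longlonglongrightarrow> indicator (\<Union>n. A \<inter> ?Q n) x" for x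
      by (rule LIMSEQ_indicator_incseq) (fastforce simp: incseq_def mem_box)
  qed (use assms in auto)
  then have "abs_L2 (indicator (\<Union>n. A \<inter> ?Q n)) \<in> closure schwartz_L2"
    using indicator_Int_box_in_closure_schwartz[OF assms(1)] by (rule closure_LIMSEQ)
  moreover have "(\<Union>n. A \<inter> ?Q n) = A"
    using UN_box_eq_UNIV[where 'a = 'a] by blast
  ultimately show ?thesis by simp
qed

text \<open>Simple approximants truncated at twice \<open>norm (f x)\<close> converge in L^2 by
  domination: the error is at most 3 \<open>norm (f x)\<close>, whence the constant 9. Each
  approximant is a finite sum of indicators times vectors.\<close>

lemma simple_functions_dense_L2:
  fixes f :: "'a :: euclidean_space \<Rightarrow> 'b :: complex_inner"
  assumes f: "square_integrable f"
    and M: "0 \<in> M" "\<And>v w. v \<in> M \<Longrightarrow> w \<in> M \<Longrightarrow> v + w \<in> M"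
    and ind: "\<And>A y. A \<in> sets borel \<Longrightarrow> emeasure lborel A < \<infinity> \<Longrightarrow> abs_L2 (\<lambda>x. indicator A x *\<^sub>C y) \<in> closure M"
  shows "abs_L2 f \<in> closure M"
proof -
  obtain s where s: "\<And>n. simple_function lborel (s n)" "\<And>x. (\<lambda>n. s n x) \<longlonglongrightarrow> f x"
    using f unfolding square_integrable_def strongly_measurable_def by auto
  have [measurable]: "(\<lambda>x. norm (f x)) \<in> borel_measurable borel"
    using f strongly_measurable_norm[of lborel f] by (simp add: square_integrable_def)
  have sm: "strongly_measurable lborel (s n)" for n
    unfolding strongly_measurable_def by (intro exI[of _ "\<lambda>_. s n"]) (auto simp: s(1))
  have [measurable]: "(\<lambda>x. norm (s n x)) \<in> borel_measurable borel" for n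
    using strongly_measurable_norm[OF sm] by simp
  define t where "t n x = (if norm (s n x) \<le> 2 * norm (f x) then s n x else 0)" for n x
  have t_simple: "simple_function lborel (t n)" for n
    unfolding t_def by (intro simple_function_If s(1)) auto
  have t_le: "norm (t n x) \<le> 2 * norm (f x)" for n x by (simp add: t_def)
  have t_lim: "(\<lambda>n. t n x) \<longlonglongrightarrow> f x" for x
  proof (cases "f x = 0")
    case True
    then have "t n x = 0" for n using t_le[of n x] by simp
    then show ?thesis using True by simp
  next
    case False
    have "(\<lambda>n. norm (s n x)) \<longlonglongrightarrow> norm (f x)" by (intro tendsto_norm s)
    then have "\<forall>\<^sub>F n in sequentially. norm (s n x) < 2 * norm (f x)"
      by (rule order_tendstoD(2)) (use False in simp)
    then have "\<forall>\<^sub>F n in sequentially. s n x = t n x"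
      by eventually_elim (simp add: t_def)
    then show ?thesis using s(2) by (rule Lim_transform_eventually[rotated])
  qed
  have f2: "integrable lborel (\<lambda>x. (norm (f x))\<^sup>2)" using f by (simp add: square_integrable_def)
  have t_sq: "square_integrable (t n)" for n
  proof (rule square_integrable_bound)
    show "strongly_measurable lborel (t n)"
      unfolding strongly_measurable_def by (intro exI[of _ "\<lambda>_. t n"]) (auto simp: t_simple)
    show "integrable lborel (\<lambda>x. 4 * (norm (f x))\<^sup>2)" using f2 by simp
    show "(norm (t n x))\<^sup>2 \<le> 4 * (norm (f x))\<^sup>2" for x
      using power_mono[OF t_le[of n x], of 2] by (simp add: power_mult_distrib)
  qed
  have "(\<lambda>n. abs_L2 (t n)) \<longlonglongrightarrow> abs_L2 f"
  proof (rule abs_L2_LIMSEQ[OF t_sq f])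
    show "integrable lborel (\<lambda>x. 9 * (norm (f x))\<^sup>2)" using f2 by simp
    show "(norm (t n x - f x))\<^sup>2 \<le> 9 * (norm (f x))\<^sup>2" for n x
    proof -
      have "norm (t n x - f x) \<le> 3 * norm (f x)"
        using norm_triangle_ineq4[of "t n x" "f x"] t_le[of n x] by simp
      from power_mono[OF this, of 2] show ?thesis by (simp add: power_mult_distrib)
    qed
  qed (simp add: t_lim)
  then show ?thesis
  proof (rule closure_LIMSEQ)
    fix n
    let ?A = "\<lambda>y. t n -` {y}"
    have fin: "finite (range (t n))" using t_simple[of n] by (simp add: simple_function_def)
    have meas: "?A y \<in> sets borel" for y
    proof (cases "y \<in> range (t n)")
      case True
      then show ?thesis using t_simple[of n] by (auto simp: simple_function_def)
    next
      case False
      then have "?A y = {}" by auto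
      then show ?thesis by simp
    qed
    \<comment> \<open>Chebyshev: on the level set of a nonzero value y the truncation forces norm y
      <= 2 norm (f x).\<close>
    have finm: "emeasure lborel (?A y) < \<infinity>" if "y \<noteq> 0" for y
    proof -
      have "integrable lborel (indicat_real (?A y))"
      proof (rule Bochner_Integration.integrable_bound)
        show "integrable lborel (\<lambda>x. 4 / (norm y)\<^sup>2 * (norm (f x))\<^sup>2)" using f2 by simp
        have "indicat_real (?A y) x \<le> 4 / (norm y)\<^sup>2 * (norm (f x))\<^sup>2" for x
          using power_mono[OF t_le[of n x], of 2] that
          by (auto simp: indicator_def power_mult_distrib field_simps)
        then show "AE x in lborel. norm (indicat_real (?A y) x) \<le> norm (4 / (norm y)\<^sup>2 * (norm (f x))\<^sup>2)"
          by (intro AE_I2) simp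
      qed (use meas in simp)
      then show ?thesis by (simp add: integrable_indicator_iff)
    qed
    have "t n x = (\<Sum>y\<in>range (t n) - {0}. indicator (?A y) x *\<^sub>C y)" for x
    proof -
      have "(\<Sum>y\<in>range (t n) - {0}. indicator (?A y) x *\<^sub>C y) = (\<Sum>y\<in>range (t n) - {0}. if y = t n x then y else 0)"
        by (intro sum.cong) (auto simp: indicator_def scaleC_one)
      also have "\<dots> = t n x" using fin by (simp add: sum.delta)
      finally show ?thesis by simp
    qed
    then have "t n = (\<lambda>x. \<Sum>y\<in>range (t n) - {0}. indicator (?A y) x *\<^sub>C y)" by (rule ext)
    then have "abs_L2 (t n) = abs_L2 (\<lambda>x. \<Sum>y\<in>range (t n) - {0}. indicator (?A y) x *\<^sub>C y)"
      by (rule arg_cong)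
    also have "\<dots> = (\<Sum>y\<in>range (t n) - {0}. abs_L2 (\<lambda>x. indicator (?A y) x *\<^sub>C y))"
      by (intro abs_L2_sum square_integrable_scaleC_vec square_integrable_indicator meas finm) auto
    also have "\<dots> \<in> closure M"
      by (intro closure_sum_mem M ind meas finm) auto
    finally show "abs_L2 (t n) \<in> closure M" .
  qed
qed

section \<open>Density for sequence valued functions\<close>

lemma ell2_finite_approximation:
  assumes "e > 0"
  shows "\<exists>S. finite S \<and> norm (z - (\<Sum>k\<in>S. ell2_nth z k *\<^sub>C ell2_delta k)) < e"
proof -
  have "((\<lambda>i. (cmod (ell2_nth z i))\<^sup>2) has_sum (norm z)\<^sup>2) UNIV"
    unfolding norm_ell2_power2 by (rule has_sum_infsum[OF ell2_summable])
  moreover have "e\<^sup>2 / 2 > 0" using assms by simp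
  ultimately obtain S where S: "finite S" "dist (\<Sum>i\<in>S. (cmod (ell2_nth z i))\<^sup>2) ((norm z)\<^sup>2) \<le> e\<^sup>2 / 2"
    using has_sum_finite_approximation by blast
  let ?p = "\<Sum>k\<in>S. ell2_nth z k *\<^sub>C ell2_delta k"
  have nth_p: "ell2_nth ?p i = (if i \<in> S then ell2_nth z i else 0)" for i
    using S(1) by (simp add: ell2_nth_sum ell2_nth_delta if_distrib cong: if_cong)
  have sq: "u * cnj u = complex_of_real ((cmod u)\<^sup>2)" for u
    by (metis complex_norm_square of_real_power)
  have pp: "cinner w ?p = (\<Sum>k\<in>S. cnj (ell2_nth z k) * ell2_nth w k)" for w
    by (simp add: cinner_sum_right cinner_scaleC_right cinner_ell2_delta)
  have "cinner (z - ?p) (z - ?p) = cinner z z - cnj (cinner z ?p) - cinner z ?p + cinner ?p ?p"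
    using cinner_commute[of ?p z] by (simp add: cinner_diff_left cinner_diff_right)
  also have "\<dots> = complex_of_real ((norm z)\<^sup>2 - (\<Sum>i\<in>S. (cmod (ell2_nth z i))\<^sup>2))"
    unfolding pp nth_p by (simp add: cinner_self_norm sq mult.commute del: of_real_power)
  finally have "(norm (z - ?p))\<^sup>2 = (norm z)\<^sup>2 - (\<Sum>i\<in>S. (cmod (ell2_nth z i))\<^sup>2)"
    unfolding cinner_self_norm by (simp only: of_real_eq_iff)
  also have "\<dots> \<le> e\<^sup>2 / 2" using S(2) unfolding dist_real_def by linarith
  also have "\<dots> < e\<^sup>2" using assms by simp
  finally have "norm (z - ?p) < e" by (rule power2_less_imp_less) (use assms in simp)
  then show ?thesis using S(1) by blast
qed

lemma schwartz_l2fI: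
  fixes I :: "'i set" and \<phi> :: "'i \<Rightarrow> real^'n \<Rightarrow> complex"
  assumes "finite I" "\<And>i. i \<in> I \<Longrightarrow> schwartz (\<phi> i)"
  shows "(\<lambda>x. \<Sum>i\<in>I. \<phi> i x *\<^sub>C ell2_delta (l i)) \<in> schwartz_l2f"
proof -
  obtain r where r: "bij_betw r {..<card I} I"
    using ex_bij_betw_nat_finite[OF assms(1)] by (auto simp: atLeast0LessThan)
  show ?thesis unfolding schwartz_l2f_def
  proof (intro CollectI exI conjI)
    show "\<forall>j<card I. schwartz (\<phi> (r j))"
      using assms(2) bij_betwE[OF r] by auto
    show "(\<lambda>x. \<Sum>i\<in>I. \<phi> i x *\<^sub>C ell2_delta (l i)) = (\<lambda>x. \<Sum>j<card I. \<phi> (r j) x *\<^sub>C ell2_delta (l (r j)))"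
      by (simp add: sum.reindex_bij_betw[OF r, of "\<lambda>i. \<phi> i _ *\<^sub>C ell2_delta (l i)"])
  qed
qed

lemma schwartz_l2f_square_integrable: "F \<in> schwartz_l2f \<Longrightarrow> square_integrable F"
  unfolding schwartz_l2f_def
  by (auto intro!: square_integrable_sum square_integrable_scaleC_vec schwartz_square_integrable)

lemma schwartz_l2f_add:
  fixes F G :: "real^'n \<Rightarrow> (real^'n) ell2"
  assumes "F \<in> schwartz_l2f" "G \<in> schwartz_l2f"
  shows "(\<lambda>x. F x + G x) \<in> schwartz_l2f"
proof -
  obtain m m' :: nat and \<phi> l \<phi>' l' where *: "\<forall>j<m. schwartz (\<phi> j)" "F = (\<lambda>x. \<Sum>j<m. \<phi> j x *\<^sub>C ell2_delta (l j))"
    "\<forall>j<m'. schwartz (\<phi>' j)" "G = (\<lambda>x. \<Sum>j<m'. \<phi>' j x *\<^sub>C ell2_delta (l' j))"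
    using assms unfolding schwartz_l2f_def by blast
  have "(\<lambda>x. F x + G x) = (\<lambda>x. \<Sum>j\<in>{..<m} <+> {..<m'}. case_sum \<phi> \<phi>' j x *\<^sub>C ell2_delta (case_sum l l' j))"
    by (simp add: sum.Plus o_def *(2,4))
  also have "\<dots> \<in> schwartz_l2f"
    by (rule schwartz_l2fI) (use *(1,3) in auto)
  finally show ?thesis .
qed

text \<open>Simple functions reduce the claim to an indicator times a sequence y. First y is
  replaced by finitely many of its coordinates, then each scalar factor by a Schwartz function. As
  the second replacement only reaches \<open>closure ?M\<close>, the first one proves membership in
  the closure of that closure.\<close>

lemma schwartz_l2f_dense:
  fixes v :: "(real^'n, (real^'n) ell2) L2"
  shows "v \<in> closure (abs_L2 ` schwartz_l2f)"
proof -
  let ?M = "abs_L2 ` schwartz_l2f :: (real^'n, (real^'n) ell2) L2 set"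
  have M0: "0 \<in> ?M"
    using schwartz_l2fI[of "{} :: nat set"] by (intro image_eqI[of _ _ "\<lambda>_. 0"]) (auto simp: abs_L2_0)
  have Madd: "v + w \<in> ?M" if "v \<in> ?M" "w \<in> ?M" for v w
    using that by (auto simp: schwartz_l2f_square_integrable schwartz_l2f_add intro!: imageI simp flip: abs_L2_add)
  have single: "abs_L2 (\<lambda>x. H x *\<^sub>C ell2_delta k) \<in> closure ?M"
    if H: "square_integrable H" "abs_L2 H \<in> closure schwartz_L2" for H k
  proof -
    obtain p where p: "\<And>n :: nat. p n \<in> schwartz_L2" "p \<longlonglongrightarrow> abs_L2 H"
      using H(2) unfolding closure_sequential by blast
    have "\<forall>n. \<exists>\<phi>. schwartz \<phi> \<and> p n = abs_L2 \<phi>" using p(1) by (auto simp: schwartz_L2_def)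
    then obtain \<phi> where \<phi>: "\<And>n. schwartz (\<phi> n)" "\<And>n. p n = abs_L2 (\<phi> n)" by metis
    note \<phi>sq = schwartz_square_integrable[OF \<phi>(1)]
    have "abs_L2 (\<lambda>x. \<phi> n x *\<^sub>C ell2_delta k) \<in> ?M" for n
      using schwartz_l2fI[of "{()}" "\<lambda>_. \<phi> n" "\<lambda>_. k"] \<phi>(1) by simp
    moreover have "(\<lambda>n. abs_L2 (\<lambda>x. \<phi> n x *\<^sub>C ell2_delta k)) \<longlonglongrightarrow> abs_L2 (\<lambda>x. H x *\<^sub>C ell2_delta k)"
    proof -
      have "norm (abs_L2 (\<lambda>x. \<phi> n x *\<^sub>C ell2_delta k) - abs_L2 (\<lambda>x. H x *\<^sub>C ell2_delta k)) = norm (p n - abs_L2 H) * norm (ell2_delta k)" for n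
      proof -
        have "abs_L2 (\<lambda>x. \<phi> n x *\<^sub>C ell2_delta k) - abs_L2 (\<lambda>x. H x *\<^sub>C ell2_delta k) =
            abs_L2 (\<lambda>x. (\<phi> n x - H x) *\<^sub>C ell2_delta k)"
          by (simp add: bounded_bilinear.diff_left[OF bounded_bilinear_scaleC] abs_L2_diff
              square_integrable_scaleC_vec \<phi>sq H(1))
        then show ?thesis
          by (simp add: norm_abs_L2_scaleC_vec square_integrable_diff \<phi>sq H(1) abs_L2_diff \<phi>(2))
      qed
      moreover have "(\<lambda>n. norm (p n - abs_L2 H) * norm (ell2_delta k)) \<longlonglongrightarrow> 0"
        using p(2) by (intro tendsto_mult_left_zero tendsto_norm_zero) (simp add: LIM_zero_iff)
      ultimately show ?thesis
        by (simp add: LIM_zero_iff[of _ "abs_L2 (\<lambda>x. H x *\<^sub>C ell2_delta k)", symmetric] tendsto_norm_zero_iff[symmetric, of "\<lambda>n. _ n - _"])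
    qed
    ultimately show ?thesis
      unfolding closure_sequential by (intro exI[of _ "\<lambda>n. abs_L2 (\<lambda>x. \<phi> n x *\<^sub>C ell2_delta k)"] conjI allI)
  qed
  have ind: "abs_L2 (\<lambda>x. indicator A x *\<^sub>C y) \<in> closure ?M"
    if A: "A \<in> sets borel" "emeasure lborel A < \<infinity>" for A y
  proof -
    let ?i = "\<lambda>x. indicator A x :: complex"
    have sq: "square_integrable ?i" by (rule square_integrable_indicator[OF A])
    have "abs_L2 (\<lambda>x. ?i x *\<^sub>C y) \<in> closure (closure ?M)"
      unfolding closure_approachable[of _ "closure ?M"]
    proof (intro allI impI)
      fix e :: real assume e: "e > 0"
      let ?N = "norm (abs_L2 ?i) + 1"
      have N: "?N > 0" by (simp add: add_nonneg_pos)
      then obtain S where S: "finite S" "norm (y - (\<Sum>k\<in>S. ell2_nth y k *\<^sub>C ell2_delta k)) < e / ?N"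
        using ell2_finite_approximation[of "e / ?N" y] e by auto
      let ?p = "\<Sum>k\<in>S. ell2_nth y k *\<^sub>C ell2_delta k"
      have sum: "abs_L2 (\<lambda>x. ?i x *\<^sub>C ?p) = (\<Sum>k\<in>S. abs_L2 (\<lambda>x. (ell2_nth y k *\<^sub>C ?i x) *\<^sub>C ell2_delta k))"
      proof -
        have "(\<lambda>x. ?i x *\<^sub>C ?p) = (\<lambda>x. \<Sum>k\<in>S. (ell2_nth y k *\<^sub>C ?i x) *\<^sub>C ell2_delta k)"
          by (simp add: bounded_bilinear.sum_right[OF bounded_bilinear_scaleC] scaleC_scaleC scaleC_complex_def mult.commute)
        then show ?thesis
          by (simp add: abs_L2_sum square_integrable_scaleC_vec square_integrable_scaleC sq)
      qed
      have sch: "abs_L2 (\<lambda>x. c *\<^sub>C ?i x) \<in> closure schwartz_L2" for c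
      proof -
        obtain p where p: "\<And>n :: nat. p n \<in> schwartz_L2" "p \<longlonglongrightarrow> abs_L2 ?i"
          using indicator_in_closure_schwartz[OF A] unfolding closure_sequential by blast
        have "(\<lambda>n. c *\<^sub>C p n) \<longlonglongrightarrow> c *\<^sub>C abs_L2 ?i"
          by (rule bounded_linear.tendsto[OF bounded_linear_scaleC p(2)])
        then show ?thesis
          unfolding abs_L2_scaleC[OF sq] closure_sequential using schwartz_L2_scaleC[OF p(1)]
          by (intro exI[of _ "\<lambda>n. c *\<^sub>C p n"] conjI allI)
      qed
      have "abs_L2 (\<lambda>x. ?i x *\<^sub>C ?p) \<in> closure ?M"
        unfolding sum by (intro closure_sum_mem M0 Madd single square_integrable_scaleC sq sch)
      moreover have "dist (abs_L2 (\<lambda>x. ?i x *\<^sub>C ?p)) (abs_L2 (\<lambda>x. ?i x *\<^sub>C y)) < e"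
      proof -
        have "abs_L2 (\<lambda>x. ?i x *\<^sub>C y) - abs_L2 (\<lambda>x. ?i x *\<^sub>C ?p) = abs_L2 (\<lambda>x. ?i x *\<^sub>C (y - ?p))"
          by (simp add: scaleC_diff_right abs_L2_diff square_integrable_scaleC_vec sq)
        then have "dist (abs_L2 (\<lambda>x. ?i x *\<^sub>C ?p)) (abs_L2 (\<lambda>x. ?i x *\<^sub>C y)) = norm (abs_L2 ?i) * norm (y - ?p)"
          by (simp add: dist_norm norm_minus_commute norm_abs_L2_scaleC_vec sq)
        also have "\<dots> \<le> ?N * norm (y - ?p)" by (intro mult_right_mono) auto
        also have "\<dots> < ?N * (e / ?N)" by (intro mult_strict_left_mono S N)
        also have "\<dots> = e" using N by simp
        finally show ?thesis .
      qed
      ultimately show "\<exists>z\<in>closure ?M. dist z (abs_L2 (\<lambda>x. ?i x *\<^sub>C y)) < e" by blast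
    qed
    then show ?thesis by simp
  qed
  obtain f where f: "square_integrable f" "v = abs_L2 f" by (rule L2_cases)
  show ?thesis unfolding f(2) by (rule simple_functions_dense_L2[OF f(1) M0 Madd ind])
qed

subsection \<open>The intertwining unitary\<close>

lemma square_integrable_mult_bounded:
  fixes H :: "'a :: euclidean_space \<Rightarrow> complex"
  assumes H: "square_integrable H" and u: "u \<in> borel_measurable borel" "\<And>x. cmod (u x) \<le> 1"
  shows "square_integrable (\<lambda>x. u x * H x)"
proof (rule square_integrable_bound)
  show "strongly_measurable lborel (\<lambda>x. u x * H x)"
    using H u(1) borel_measurable_times[of u borel H] by (simp add: square_integrable_def strongly_measurable_iff_borel)
  show "integrable lborel (\<lambda>x. (norm (H x))\<^sup>2)" using H by (simp add: square_integrable_def)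
  show "(norm (u x * H x))\<^sup>2 \<le> (norm (H x))\<^sup>2" for x
    using u(2)[of x] by (intro power_mono) (auto simp: norm_mult mult_left_le_one_le)
qed

lemma expc_measurable [measurable]: "expc k \<in> borel_measurable borel"
  by (intro borel_measurable_continuous_onI continuous_expc)

lemma square_integrable_expc_mult: "square_integrable H \<Longrightarrow> square_integrable (\<lambda>x. expc k x * H x)"
  by (rule square_integrable_mult_bounded) auto

lemma expc_mult_inverse: "expc (- k) x * (expc k x * c) = c" "expc k x * (expc (- k) x * c) = c"
  using expc_add[of "- k" k x] expc_add[of k "- k" x] by (simp_all add: expc_def flip: mult.assoc)

inductive_set twist_graph :: "((real^'n, (real^'n) ell2) L2 \<times> 'n :: finite B2_L2) set" where
  zero: "(0, 0) \<in> twist_graph"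
| step: "(v, w) \<in> twist_graph \<Longrightarrow> square_integrable H \<Longrightarrow>
    (v + abs_L2 (\<lambda>x. H x *\<^sub>C ell2_delta k), w + expc_B2 (- k) \<otimes>\<^sub>H abs_L2 (\<lambda>x. expc (- k) x * H x)) \<in> twist_graph"

lemma twist_graph_add:
  assumes "(v', w') \<in> twist_graph" "(v, w) \<in> twist_graph"
  shows "(v + v', w + w') \<in> twist_graph"
  using assms(1)
proof induction
  case zero
  show ?case using assms(2) by simp
next
  case (step v' w' H k)
  from twist_graph.step[OF step.IH step.hyps(2), of k] show ?case by (simp add: add.assoc)
qed

lemma twist_graph_scaleC: "(v, w) \<in> twist_graph \<Longrightarrow> (c *\<^sub>C v, c *\<^sub>C w) \<in> twist_graph"
proof (induction rule: twist_graph.induct)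
  case zero
  show ?case by (simp add: twist_graph.zero)
next
  case (step v w H k)
  have e: "(c *\<^sub>C H x) *\<^sub>C ell2_delta k = c *\<^sub>C H x *\<^sub>C ell2_delta k" "expc (- k) x * (c *\<^sub>C H x) = c *\<^sub>C (expc (- k) x * H x)" for x
    by (simp_all add: scaleC_complex_def scaleC_scaleC)
  from twist_graph.step[OF step.IH square_integrable_scaleC[OF step.hyps(2), of c], of k] show ?case
    by (simp add: e abs_L2_scaleC square_integrable_scaleC_vec square_integrable_expc_mult step.hyps
        scaleC_add_right htensor_scaleC_right)
qed

text \<open>For different indices both sides vanish, by orthogonality of the unit sequences on the
  left and of the characters on the right. For equal indices the two modulations cancel, having
  modulus 1.\<close>

lemma cinner_twist_generators:
  fixes H H' :: "real^'n \<Rightarrow> complex"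
  assumes "square_integrable H" "square_integrable H'"
  shows "cinner (abs_L2 (\<lambda>x. H x *\<^sub>C ell2_delta k)) (abs_L2 (\<lambda>x. H' x *\<^sub>C ell2_delta k')) =
    cinner (expc_B2 (- k) \<otimes>\<^sub>H abs_L2 (\<lambda>x. expc (- k) x * H x)) (expc_B2 (- k') \<otimes>\<^sub>H abs_L2 (\<lambda>x. expc (- k') x * H' x))"
proof -
  have dd: "cinner (ell2_delta k) (ell2_delta k') = (if k = k' then 1 else 0)"
    by (auto simp: cinner_ell2_delta ell2_nth_delta)
  have ee: "expc (- k') x * cnj (expc (- k') x) = 1" for x
    using expc_diff[of "- k'" "- k'" x] by (simp add: expc_def)
  show ?thesis
    by (simp add: cinner_abs_L2 cinner_htensor cinner_expc_B2 assms square_integrable_scaleC_vec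
        square_integrable_expc_mult cinner_scaleC_left cinner_scaleC_right dd cinner_complex_def)
      (simp add: mult_ac ee)
qed

lemma twist_graph_isometric:
  assumes "(v, w) \<in> twist_graph" "(v', w') \<in> twist_graph"
  shows "cinner v v' = cinner w w'"
  using assms(1)
proof (induction rule: twist_graph.induct)
  case (step v w H k)
  note H = step.hyps(2)
  have "cinner (abs_L2 (\<lambda>x. H x *\<^sub>C ell2_delta k)) v' =
      cinner (expc_B2 (- k) \<otimes>\<^sub>H abs_L2 (\<lambda>x. expc (- k) x * H x)) w'"
    using assms(2)
  proof (induction rule: twist_graph.induct)
    case (step v w H' k')
    then show ?case by (simp add: cinner_add_right cinner_twist_generators H)
  qed simp
  then show ?case by (simp add: cinner_add_left step.IH)
qed simp

lemma twist_unitary_exists: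
  "\<exists>V :: (real^'n, (real^'n) ell2) L2 \<Rightarrow> 'n B2_L2. unitary V \<and> (\<forall>H k. square_integrable H \<longrightarrow>
    V (abs_L2 (\<lambda>x. H x *\<^sub>C ell2_delta k)) = expc_B2 (- k) \<otimes>\<^sub>H abs_L2 (\<lambda>x. expc (- k) x * H x))"
proof -
  let ?G = "twist_graph :: ((real^'n, (real^'n) ell2) L2 \<times> 'n B2_L2) set"
  have gen: "(abs_L2 (\<lambda>x. H x *\<^sub>C ell2_delta k), expc_B2 (- k) \<otimes>\<^sub>H abs_L2 (\<lambda>x. expc (- k) x * H x)) \<in> ?G"
    if "square_integrable H" for H k
    using twist_graph.step[OF twist_graph.zero that] by simp
  have "\<exists>V. unitary V \<and> (\<forall>(v, w)\<in>?G. V v = w)"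
  proof (rule unitary_extension)
    show "x \<in> closure (fst ` ?G)" for x
    proof -
      have "abs_L2 F \<in> fst ` ?G" if F: "F \<in> schwartz_l2f" for F :: "real^'n \<Rightarrow> (real^'n) ell2"
      proof -
        obtain m :: nat and \<phi> l where *: "\<forall>j<m. schwartz (\<phi> j)" "F = (\<lambda>x. \<Sum>j<m. \<phi> j x *\<^sub>C ell2_delta (l j))"
          using F unfolding schwartz_l2f_def by blast
        have "(\<Sum>j<n. abs_L2 (\<lambda>x. \<phi> j x *\<^sub>C ell2_delta (l j))) \<in> fst ` ?G" if "n \<le> m" for n
          using that
        proof (induction n)
          case 0
          show ?case using twist_graph.zero by (force intro: image_eqI[of _ _ "(0, 0)"])
        next
          case (Suc n)
          then obtain w where "((\<Sum>j<n. abs_L2 (\<lambda>x. \<phi> j x *\<^sub>C ell2_delta (l j))), w) \<in> ?G" by auto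
          from twist_graph.step[OF this schwartz_square_integrable[of "\<phi> n"], of "l n"]
          show ?case using *(1) Suc.prems by (force intro: image_eqI)
        qed
        then show ?thesis
          unfolding *(2) using *(1)
          by (subst abs_L2_sum) (auto intro: square_integrable_scaleC_vec schwartz_square_integrable)
      qed
      then have "closure (abs_L2 ` schwartz_l2f) \<subseteq> closure (fst ` ?G)"
        by (intro closure_mono) auto
      then show ?thesis using schwartz_l2f_dense[of x] by blast
    qed
    show "y \<in> closure (snd ` ?G)" for y
    proof (rule htensor_dense_span)
      show "expc_B2 l \<otimes>\<^sub>H h \<in> snd ` ?G" for l h
      proof -
        obtain f where f: "square_integrable f" "h = abs_L2 f" by (rule L2_cases)
        \<comment> \<open>The generator for the index -l and the function e_-l f has second
          component e_l \<otimes> f, as the two modulations cancel.\<close>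
        from gen[OF square_integrable_expc_mult[OF f(1), of "- l"], of "- l"] show ?thesis
          by (force simp: f(2) expc_mult_inverse intro: image_eqI)
      qed
      show "0 \<in> snd ` ?G" using twist_graph.zero by (force intro: image_eqI)
      show "v + w \<in> snd ` ?G" if "v \<in> snd ` ?G" "w \<in> snd ` ?G" for v w
        using that twist_graph_add by (force intro: image_eqI)
    qed
  qed (auto intro: twist_graph_add twist_graph_scaleC twist_graph_isometric)
  then show ?thesis using gen by fastforce
qed

subsection \<open>Fourier transforms of Schwartz functions\<close>

lemma lborel_translate:
  fixes f :: "'a :: euclidean_space \<Rightarrow> 'b :: {banach, second_countable_topology}"
  assumes "integrable lborel f"
  shows "integrable lborel (\<lambda>x. f (x + c))" "(LINT x|lborel. f (x + c)) = (LINT x|lborel. f x)"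
proof -
  have [measurable]: "f \<in> borel_measurable borel" using borel_measurable_integrable[OF assms] by simp
  have d: "integrable (distr lborel borel ((+) c)) f" using assms by (subst lborel_distr_plus)
  then have "integrable lborel (\<lambda>x. f (c + x))" by (subst (asm) integrable_distr_eq) auto
  then show "integrable lborel (\<lambda>x. f (x + c))" by (simp add: add.commute)
  have "(LINT x|lborel. f x) = (LINT x|distr lborel borel ((+) c). f x)" by (subst lborel_distr_plus) simp
  also have "\<dots> = (LINT x|lborel. f (c + x))" by (rule integral_distr) auto
  finally show "(LINT x|lborel. f (x + c)) = (LINT x|lborel. f x)" by (simp add: add.commute)
qed

text \<open>Integrating the fundamental theorem of calculus along segments of direction \<open>v\<close> over all base points.\<close>

lemma integral_directional_derivative_eq_0:
  fixes B :: "'a :: euclidean_space \<Rightarrow> complex"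
  assumes der: "\<And>x. ((\<lambda>s :: real. B (x + s *\<^sub>R v)) has_vector_derivative B' x) (at 0)"
    and B: "integrable lborel B" and B': "integrable lborel B'" "continuous_on UNIV B'"
  shows "(LINT x|lborel. B' x) = 0"
proof -
  have der': "((\<lambda>s :: real. B (x + s *\<^sub>R v)) has_vector_derivative B' (x + s *\<^sub>R v)) (at s)" for x s
  proof -
    have "((\<lambda>r :: real. r - s) has_vector_derivative 1) (at s)"
      by (auto intro!: derivative_eq_intros)
    from vector_diff_chain_at[OF this, of "\<lambda>r. B ((x + s *\<^sub>R v) + r *\<^sub>R v)" "B' (x + s *\<^sub>R v)"] der[of "x + s *\<^sub>R v"]
    show ?thesis by (simp add: o_def algebra_simps)
  qed
  have cont: "continuous_on {0..1} (\<lambda>s :: real. B' (x + s *\<^sub>R v))" for x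
    by (rule continuous_on_compose2[OF B'(2)]) (auto intro!: continuous_intros)
  have FTC: "(LINT s|lborel. indicator {0..1} s *\<^sub>R B' (x + s *\<^sub>R v)) = B (x + v) - B x" for x
    using has_bochner_integral_integral_eq[OF has_bochner_integral_FTC_Icc[of 0 1 "\<lambda>s. B (x + s *\<^sub>R v)" "\<lambda>s. B' (x + s *\<^sub>R v)"]]
      der'[of x] cont[of x] by (auto intro: has_vector_derivative_at_within)
  define F where "F = (\<lambda>(s :: real, x). indicator {0..1} s *\<^sub>R B' (x + s *\<^sub>R v))"
  have [measurable]: "B' \<in> borel_measurable borel" by (intro borel_measurable_continuous_onI B')
  have Fm: "F \<in> borel_measurable (lborel \<Otimes>\<^sub>M lborel)"
    unfolding F_def by measurable
  have Fi: "integrable (lborel \<Otimes>\<^sub>M lborel) F"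
  proof (rule lborel_pair.Fubini_integrable[OF Fm])
    have "(LINT x|lborel. norm (F (s, x))) = indicator {0..1} s * (LINT x|lborel. cmod (B' x))" for s
      using lborel_translate(2)[OF integrable_norm[OF B'(1)], of "s *\<^sub>R v"] by (simp add: F_def)
    moreover have "integrable lborel (\<lambda>s :: real. indicat_real {0..1} s * (LINT x|lborel. cmod (B' x)))"
      by (intro integrable_mult_left) (simp add: integrable_indicator_iff)
    ultimately show "integrable lborel (\<lambda>s. LINT x|lborel. norm (F (s, x)))" by simp
    show "AE s in lborel. integrable lborel (\<lambda>x. F (s, x))"
      using lborel_translate(1)[OF B'(1)] by (simp add: F_def)
  qed
  have "(LINT s|lborel. LINT x|lborel. F (s, x)) = (LINT x|lborel. LINT s|lborel. F (s, x))"
    using lborel_pair.Fubini_integral[of "\<lambda>s x. F (s, x)"] Fi by simp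
  moreover have "(LINT s|lborel. LINT x|lborel. F (s, x)) = (LINT x|lborel. B' x)"
  proof -
    have "(LINT x|lborel. F (s, x)) = indicat_real {0..1} s *\<^sub>R (LINT x|lborel. B' x)" for s
      using lborel_translate(2)[OF B'(1), of "s *\<^sub>R v"] by (simp add: F_def)
    then show ?thesis by (simp add: integral_scaleR_left integrable_indicator_iff)
  qed
  moreover have "(LINT x|lborel. LINT s|lborel. F (s, x)) = 0"
    unfolding F_def by (simp add: FTC lborel_translate[OF B] B)
  ultimately show ?thesis by simp
qed

section \<open>Derivatives along lines and Taylor estimates for \<open>cis\<close>\<close>

lemma has_vector_derivative_along_line:
  assumes "(h has_derivative D) (at x)"
  shows "((\<lambda>s :: real. h (x + s *\<^sub>R v)) has_vector_derivative D v) (at 0)"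
proof -
  have 1: "((\<lambda>s :: real. x + s *\<^sub>R v) has_derivative (\<lambda>s. s *\<^sub>R v)) (at 0)"
    by (auto intro!: derivative_eq_intros)
  have "(h has_derivative D) (at (x + 0 *\<^sub>R v))" using assms by simp
  from has_derivative_compose[OF 1 this] show ?thesis
    unfolding has_vector_derivative_def
    using has_derivative_bounded_linear[OF assms] by (simp add: linear_simps)
qed

text \<open>Stands in for differentiation under the integral sign: a quadratic Taylor remainder with
  one integrable majorant is all that has to be checked.\<close>

lemma has_vector_derivative_quadratic:
  fixes \<phi> :: "real \<Rightarrow> complex"
  assumes "\<And>s. cmod (\<phi> s - \<phi> 0 - s *\<^sub>R D) \<le> C * s\<^sup>2"
  shows "(\<phi> has_vector_derivative D) (at 0)"
  unfolding has_vector_derivative_def has_derivative_at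
proof
  show "bounded_linear (\<lambda>s. s *\<^sub>R D)" by (rule bounded_linear_scaleR_left)
  have "((\<lambda>h. C * \<bar>h\<bar>) \<longlongrightarrow> C * \<bar>0\<bar>) (at (0 :: real))" by (intro tendsto_intros)
  then have "((\<lambda>h. C * \<bar>h\<bar>) \<longlongrightarrow> 0) (at (0 :: real))" by simp
  then show "(\<lambda>h. norm (\<phi> (0 + h) - \<phi> 0 - h *\<^sub>R D) / norm h) \<midarrow>0\<rightarrow> 0"
  proof (rule Lim_null_comparison[rotated], intro always_eventually allI)
    fix h
    show "norm (norm (\<phi> (0 + h) - \<phi> 0 - h *\<^sub>R D) / norm h) \<le> C * \<bar>h\<bar>"
      using assms[of h] by (cases "h = 0") (auto simp: divide_le_eq power2_eq_square mult.assoc abs_mult_self_eq)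
  qed
qed

lemma cmod_cis_minus_1_le: "cmod (cis t - 1) \<le> \<bar>t\<bar>"
proof -
  have "(cmod (cis t - 1))\<^sup>2 = (cos t)\<^sup>2 + (sin t)\<^sup>2 + 1 - 2 * cos t"
    by (simp add: cmod_power2) (simp add: power2_eq_square algebra_simps)
  also have "\<dots> = 2 - 2 * cos t" by simp
  also have "\<dots> = (2 * sin (t / 2))\<^sup>2"
    using cos_double_sin[of "t / 2"] by (simp add: power_mult_distrib)
  also have "\<dots> \<le> \<bar>t\<bar>\<^sup>2"
    unfolding power2_abs[of "2 * sin (t / 2)", symmetric]
    using abs_sin_le_one abs_sin_x_le_abs_x[of "t / 2"] by (intro power_mono) auto
  finally show ?thesis by (rule power2_le_imp_le) simp
qed

text \<open>For positive t the derivative i (cis s - 1) has norm at most s, so the remainder is at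
  most t^2 / 2; conjugation reduces negative t to this case.\<close>

lemma cmod_cis_taylor_le: "cmod (cis t - 1 - \<i> * t) \<le> t\<^sup>2"
proof -
  have pos: "cmod (cis t - 1 - \<i> * t) \<le> t\<^sup>2" if t: "t > 0" for t :: real
  proof -
    have d: "((\<lambda>s. cis s - 1 - \<i> * complex_of_real s) has_vector_derivative (\<i> * (cis s - 1))) (at s)" for s
    proof -
      have "((\<lambda>s. cis s - 1 - \<i> * complex_of_real s) has_derivative (\<lambda>v. \<i> * complex_of_real v * cis s - 0 - \<i> * complex_of_real v)) (at s)"
        by (intro has_derivative_diff has_derivative_cis has_derivative_ident has_derivative_const
            has_derivative_mult_right has_derivative_of_real)
      then show ?thesis unfolding has_vector_derivative_def
        by (rule has_derivative_eq_rhs) (simp add: fun_eq_iff scaleR_conv_of_real algebra_simps)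
    qed
    have "norm ((cis t - 1 - \<i> * complex_of_real t) - (cis 0 - 1 - \<i> * complex_of_real 0)) \<le> t\<^sup>2 / 2 - 0\<^sup>2 / 2"
    proof (rule differentiable_bound_general[OF t])
      show "continuous_on {0..t} (\<lambda>s. cis s - 1 - \<i> * complex_of_real s)" by (intro continuous_intros)
      show "continuous_on {0..t} (\<lambda>s. s\<^sup>2 / 2)" by (intro continuous_intros) auto
      show "((\<lambda>s. cis s - 1 - \<i> * complex_of_real s) has_vector_derivative (\<i> * (cis s - 1))) (at s)" for s by (rule d)
      show "((\<lambda>s. s\<^sup>2 / 2) has_vector_derivative s) (at s)" for s :: real
        unfolding has_real_derivative_iff_has_vector_derivative[symmetric]
        by (auto intro!: derivative_eq_intros)
      show "cmod (\<i> * (cis s - 1)) \<le> s" if "0 < s" for s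
        using cmod_cis_minus_1_le[of s] that by (simp add: norm_mult)
    qed
    then show ?thesis by (simp add: field_simps) (use zero_le_power2[of t] in linarith)
  qed
  show ?thesis
  proof (cases "t = 0")
    case False
    have "cmod (cis t - 1 - \<i> * t) = cmod (cnj (cis t - 1 - \<i> * t))" by (simp only: complex_mod_cnj)
    also have "\<dots> = cmod (cis (- t) - 1 - \<i> * (- t))" by (simp add: cis_cnj)
    finally have "cmod (cis t - 1 - \<i> * t) = cmod (cis (- t) - 1 - \<i> * (- t))" .
    then show ?thesis using pos[of t] pos[of "- t"] False by (cases "t > 0") auto
  qed simp
qed

section \<open>Fourier transforms of complex Schwartz functions: continuity, derivatives,
  decay\<close>

lemma fourier_complex: "fourier f xi = (LINT x|lborel. expc (- xi) x * f x)"
  for f :: "real^'n \<Rightarrow> complex"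
  by (simp add: fourier_def strong_integral_eq_integral scaleC_complex_def)

lemma integrable_expc_mult:
  fixes f :: "real^'n \<Rightarrow> complex"
  assumes "integrable lborel f"
  shows "integrable lborel (\<lambda>x. expc k x * f x)"
  by (rule Bochner_Integration.integrable_bound[OF assms])
    (use borel_measurable_integrable[OF assms] in \<open>auto simp: norm_mult\<close>)

lemma expc_commute: "expc x y = expc y x"
  by (simp add: expc_def inner_commute)

lemma cmod_fourier_le:
  fixes f :: "real^'n \<Rightarrow> complex"
  shows "cmod (fourier f xi) \<le> (LINT x|lborel. cmod (f x))"
  unfolding fourier_complex
  using integral_norm_bound[of lborel "\<lambda>x. expc (- xi) x * f x"] by (simp add: norm_mult)

lemma fourier_lipschitz:
  fixes f :: "real^'n \<Rightarrow> complex"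
  assumes f: "integrable lborel f" "integrable lborel (\<lambda>x. norm x * cmod (f x))"
  shows "cmod (fourier f xi - fourier f eta) \<le> 2 * pi * (LINT x|lborel. norm x * cmod (f x)) * norm (xi - eta)"
proof -
  have "fourier f xi - fourier f eta = (LINT x|lborel. expc (- xi) x * f x - expc (- eta) x * f x)"
    unfolding fourier_complex by (rule Bochner_Integration.integral_diff[symmetric]; rule integrable_expc_mult[OF f(1)])
  also have "cmod \<dots> \<le> (LINT x|lborel. 2 * pi * norm (xi - eta) * (norm x * cmod (f x)))"
  proof (rule Bochner_Integration.integral_norm_bound_integral)
    show "integrable lborel (\<lambda>x. expc (- xi) x * f x - expc (- eta) x * f x)"
      by (intro Bochner_Integration.integrable_diff integrable_expc_mult f)
    show "integrable lborel (\<lambda>x. 2 * pi * norm (xi - eta) * (norm x * cmod (f x)))"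
      by (intro integrable_mult_right f)
    fix x
    have "expc (- xi) x * f x - expc (- eta) x * f x = expc (- eta) x * (expc (eta - xi) x - 1) * f x"
      using expc_add[of "- eta" "eta - xi" x] by (simp add: algebra_simps)
    then have "cmod (expc (- xi) x * f x - expc (- eta) x * f x) = cmod (expc (eta - xi) x - 1) * cmod (f x)"
      by (simp add: norm_mult)
    also have "\<dots> \<le> (2 * pi * (norm (xi - eta) * norm x)) * cmod (f x)"
    proof (rule mult_right_mono)
      have "cmod (expc (eta - xi) x - 1) \<le> 2 * pi * \<bar>(eta - xi) \<bullet> x\<bar>"
        unfolding expc_def using cmod_cis_minus_1_le[of "2 * pi * ((eta - xi) \<bullet> x)"] by (simp add: abs_mult)
      also have "\<dots> \<le> 2 * pi * (norm (xi - eta) * norm x)"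
        using Cauchy_Schwarz_ineq2[of "eta - xi" x] by (intro mult_left_mono) (auto simp: norm_minus_commute)
      finally show "cmod (expc (eta - xi) x - 1) \<le> 2 * pi * (norm (xi - eta) * norm x)" .
    qed simp
    finally show "cmod (expc (- xi) x * f x - expc (- eta) x * f x) \<le> 2 * pi * norm (xi - eta) * (norm x * cmod (f x))"
      by (simp add: mult_ac)
  qed
  also have "\<dots> = 2 * pi * norm (xi - eta) * (LINT x|lborel. norm x * cmod (f x))"
    by (rule integral_mult_right_zero)
  finally show ?thesis by (simp only: mult_ac)
qed

lemma lipschitz_continuous_UNIV:
  fixes f :: "'a :: real_normed_vector \<Rightarrow> 'b :: real_normed_vector"
  assumes "\<And>x y. norm (f x - f y) \<le> C * norm (x - y)"
  shows "continuous_on UNIV f"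
proof (rule lipschitz_on_continuous_on)
  show "(max 0 C)-lipschitz_on UNIV f"
    by (intro lipschitz_onI) (auto simp: dist_norm intro!: order_trans[OF assms] mult_right_mono)
qed

lemma schwartz_fourier_continuous:
  fixes f :: "real^'n \<Rightarrow> complex"
  assumes "schwartz f"
  shows "continuous_on UNIV (fourier f)"
  using fourier_lipschitz[OF schwartz_integrable[OF assms]] schwartz_norm_integrable[OF assms, of 1]
  by (intro lipschitz_continuous_UNIV) simp

text \<open>Under the integral the remainder is e_-\<xi>(x) f(x) (cis t - 1 - i t) with t = -2 pi s
  (v \<bullet> x), of modulus at most t^2 |f(x)|. The second moment of f makes it integrable and
  yields the constant \<open>?C\<close>.\<close>

lemma schwartz_fourier_derivative:
  fixes f :: "real^'n \<Rightarrow> complex"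
  assumes f: "schwartz f"
  shows "((\<lambda>s. fourier f (xi + s *\<^sub>R v)) has_vector_derivative
    fourier (\<lambda>x. - (2 * pi * \<i>) * (complex_of_real (x \<bullet> v) * f x)) xi) (at 0)"
proof -
  let ?f' = "\<lambda>x. - (2 * pi * \<i>) * (complex_of_real (x \<bullet> v) * f x)"
  have f': "schwartz ?f'" by (intro schwartz_cmult schwartz_mult_coordinate f)
  note int = integrable_expc_mult[OF schwartz_integrable[OF f]] integrable_expc_mult[OF schwartz_integrable[OF f']]
  let ?C = "(2 * pi * norm v)\<^sup>2 * (LINT x|lborel. norm x ^ 2 * cmod (f x))"
  show ?thesis
  proof (rule has_vector_derivative_quadratic[where C = ?C])
    fix s :: real
    have "fourier f (xi + s *\<^sub>R v) - fourier f (xi + 0 *\<^sub>R v) - s *\<^sub>R fourier ?f' xi =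
        (LINT x|lborel. expc (- (xi + s *\<^sub>R v)) x * f x - expc (- xi) x * f x - s *\<^sub>R (expc (- xi) x * ?f' x))"
      unfolding fourier_complex
      by (subst Bochner_Integration.integral_diff, (intro Bochner_Integration.integrable_diff integrable_scaleR_right int)+)
        (subst Bochner_Integration.integral_diff, (intro int)+, simp)
    also have "cmod \<dots> \<le> (LINT x|lborel. (2 * pi * norm v)\<^sup>2 * s\<^sup>2 * (norm x ^ 2 * cmod (f x)))"
    proof (rule Bochner_Integration.integral_norm_bound_integral)
      show "integrable lborel (\<lambda>x. expc (- (xi + s *\<^sub>R v)) x * f x - expc (- xi) x * f x - s *\<^sub>R (expc (- xi) x * ?f' x))"
        by (intro Bochner_Integration.integrable_diff integrable_scaleR_right int)
      show "integrable lborel (\<lambda>x. (2 * pi * norm v)\<^sup>2 * s\<^sup>2 * (norm x ^ 2 * cmod (f x)))"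
        by (intro integrable_mult_right schwartz_norm_integrable f)
      fix x
      let ?t = "- (2 * pi * s * (v \<bullet> x))"
      have "expc (- (xi + s *\<^sub>R v)) x = expc (- xi) x * cis ?t"
        unfolding expc_def cis_mult by (simp add: inner_add_left algebra_simps)
      then have "expc (- (xi + s *\<^sub>R v)) x * f x - expc (- xi) x * f x - s *\<^sub>R (expc (- xi) x * ?f' x) =
          expc (- xi) x * (cis ?t - 1 - \<i> * ?t) * f x"
        by (simp add: scaleR_conv_of_real algebra_simps inner_commute)
      then have "cmod (expc (- (xi + s *\<^sub>R v)) x * f x - expc (- xi) x * f x - s *\<^sub>R (expc (- xi) x * ?f' x)) =
          cmod (cis ?t - 1 - \<i> * ?t) * cmod (f x)"
        by (simp only: norm_mult norm_expc mult_1)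
      also have "\<dots> \<le> ?t\<^sup>2 * cmod (f x)"
        by (rule mult_right_mono[OF cmod_cis_taylor_le]) simp
      also have "\<dots> \<le> ((2 * pi * norm v)\<^sup>2 * s\<^sup>2 * norm x ^ 2) * cmod (f x)"
      proof (rule mult_right_mono)
        have "(v \<bullet> x)\<^sup>2 \<le> (norm v * norm x)\<^sup>2"
          unfolding power2_abs[of "v \<bullet> x", symmetric] by (intro power_mono Cauchy_Schwarz_ineq2) simp
        then have "(2 * pi * s)\<^sup>2 * (v \<bullet> x)\<^sup>2 \<le> (2 * pi * s)\<^sup>2 * (norm v * norm x)\<^sup>2"
          by (rule mult_left_mono) simp
        then show "?t\<^sup>2 \<le> (2 * pi * norm v)\<^sup>2 * s\<^sup>2 * norm x ^ 2"
          by (simp add: power_mult_distrib mult_ac)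
      qed simp
      finally show "cmod (expc (- (xi + s *\<^sub>R v)) x * f x - expc (- xi) x * f x - s *\<^sub>R (expc (- xi) x * ?f' x)) \<le>
          (2 * pi * norm v)\<^sup>2 * s\<^sup>2 * (norm x ^ 2 * cmod (f x))"
        by (simp only: mult.assoc)
    qed
    also have "\<dots> = ?C * s\<^sup>2" unfolding integral_mult_right_zero by (simp only: mult_ac)
    finally show "cmod (fourier f (xi + s *\<^sub>R v) - fourier f (xi + 0 *\<^sub>R v) - s *\<^sub>R fourier ?f' xi) \<le> ?C * s\<^sup>2" .
  qed
qed

text \<open>Integration by parts without boundary terms: the v-derivative of e_-\<xi> f has integral
  0.\<close>

lemma fourier_iter_deriv:
  fixes f :: "real^'n \<Rightarrow> complex"
  assumes f: "schwartz f" and v: "v \<in> Basis"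
  shows "fourier (iter_deriv [v] f) xi = 2 * pi * \<i> * complex_of_real (xi \<bullet> v) * fourier f xi"
proof -
  have f': "schwartz (iter_deriv [v] f)" by (rule schwartz_iter_deriv[OF f v])
  note int = integrable_expc_mult[OF schwartz_integrable[OF f], of "- xi"] integrable_expc_mult[OF schwartz_integrable[OF f'], of "- xi"]
  let ?c = "2 * pi * \<i> * complex_of_real ((- xi) \<bullet> v)"
  have "(LINT x|lborel. expc (- xi) x * iter_deriv [v] f x + ?c * (expc (- xi) x * f x)) = 0"
  proof (rule integral_directional_derivative_eq_0[of "\<lambda>x. expc (- xi) x * f x" v])
    show "((\<lambda>s. expc (- xi) (x + s *\<^sub>R v) * f (x + s *\<^sub>R v)) has_vector_derivative
        expc (- xi) x * iter_deriv [v] f x + ?c * (expc (- xi) x * f x)) (at 0)" for x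
      using has_vector_derivative_along_line[OF has_derivative_mult[OF has_derivative_expc[of "- xi" x]
          has_derivative_iter_deriv[OF schwartz_differentiable[OF f]]], of v]
      by (simp add: mult.assoc)
    show "continuous_on UNIV (\<lambda>x. expc (- xi) x * iter_deriv [v] f x + ?c * (expc (- xi) x * f x))"
      by (intro continuous_intros continuous_expc schwartz_continuous f f')
  qed (intro Bochner_Integration.integrable_add integrable_mult_right int)+
  then have "fourier (iter_deriv [v] f) xi + ?c * fourier f xi = 0"
    unfolding fourier_complex by (subst (asm) Bochner_Integration.integral_add) (auto intro: int)
  then show ?thesis by (simp add: add_eq_0_iff2)
qed

lemma norm_power_Suc_le_sum:
  fixes y :: "'a :: euclidean_space"
  assumes "c \<ge> 0"
  shows "norm y ^ Suc k * c \<le> (\<Sum>v\<in>Basis. norm y ^ k * (\<bar>y \<bullet> v\<bar> * c))"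
proof -
  have "norm y ^ Suc k * c = norm y * (norm y ^ k * c)" by simp
  also have "\<dots> \<le> (\<Sum>v\<in>Basis. \<bar>y \<bullet> v\<bar>) * (norm y ^ k * c)"
    by (intro mult_right_mono norm_le_l1) (use assms in auto)
  also have "\<dots> = (\<Sum>v\<in>Basis. norm y ^ k * (\<bar>y \<bullet> v\<bar> * c))"
    by (simp add: sum_distrib_left sum_distrib_right mult_ac)
  finally show ?thesis .
qed

text \<open>After |\<xi>| is bounded by the sum of its coordinates, each power of it is paid for by
  one partial derivative of f; hence the induction ranges over all Schwartz functions f.\<close>

lemma schwartz_fourier_decay:
  fixes f :: "real^'n \<Rightarrow> complex"
  assumes "schwartz f"
  shows "\<exists>C. \<forall>xi. norm xi ^ k * cmod (fourier f xi) \<le> C"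
  using assms
proof (induction k arbitrary: f)
  case 0
  show ?case using cmod_fourier_le[of f] by (intro exI[of _ "LINT x|lborel. cmod (f x)"]) simp
next
  case (Suc k)
  have "\<forall>v\<in>Basis. \<exists>C. \<forall>xi. norm xi ^ k * cmod (fourier (iter_deriv [v] f) xi) \<le> C"
    using Suc.IH schwartz_iter_deriv[OF Suc.prems] by blast
  then obtain C where C: "\<And>v xi. v \<in> Basis \<Longrightarrow> norm xi ^ k * cmod (fourier (iter_deriv [v] f) xi) \<le> C v"
    by metis
  have "norm xi ^ Suc k * cmod (fourier f xi) \<le> (\<Sum>v\<in>Basis. C v)" for xi
  proof -
    have "norm xi ^ Suc k * cmod (fourier f xi) \<le> (\<Sum>v\<in>Basis. norm xi ^ k * (\<bar>xi \<bullet> v\<bar> * cmod (fourier f xi)))"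
      by (rule norm_power_Suc_le_sum) simp
    also have "\<dots> \<le> (\<Sum>v\<in>Basis. C v)"
    proof (rule sum_mono)
      fix v :: "real^'n" assume v: "v \<in> Basis"
      have "\<bar>xi \<bullet> v\<bar> * cmod (fourier f xi) \<le> 2 * pi * (\<bar>xi \<bullet> v\<bar> * cmod (fourier f xi))"
        using pi_ge_two mult_right_mono[of 1 "2 * pi" "\<bar>xi \<bullet> v\<bar> * cmod (fourier f xi)"] by simp
      also have "\<dots> = cmod (fourier (iter_deriv [v] f) xi)"
        by (simp add: fourier_iter_deriv[OF Suc.prems v] norm_mult)
      finally have "norm xi ^ k * (\<bar>xi \<bullet> v\<bar> * cmod (fourier f xi)) \<le> norm xi ^ k * cmod (fourier (iter_deriv [v] f) xi)"
        by (rule mult_left_mono) simp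
      also have "\<dots> \<le> C v" by (rule C[OF v])
      finally show "norm xi ^ k * (\<bar>xi \<bullet> v\<bar> * cmod (fourier f xi)) \<le> C v" .
    qed
    finally show ?thesis .
  qed
  then show ?case by blast
qed

lemma decay_imp_integrable:
  fixes h :: "'a :: euclidean_space \<Rightarrow> complex"
  assumes h: "h \<in> borel_measurable borel" and dec: "\<And>k. \<exists>C. \<forall>x. norm x ^ k * cmod (h x) \<le> C"
  shows "integrable lborel h"
proof (rule Bochner_Integration.integrable_bound)
  obtain A B where A: "\<And>x. norm x ^ 0 * cmod (h x) \<le> A" and B: "\<And>x. norm x ^ (DIM('a) + 2) * cmod (h x) \<le> B"
    using dec by meson
  show "integrable lborel (\<lambda>x. cmod (h x))"
  proof (rule Bochner_Integration.integrable_bound)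
    show "integrable lborel (\<lambda>x :: 'a. (2 ^ (DIM('a) + 2) * (A + B)) * (1 / (1 + norm x) ^ (DIM('a) + 2)))"
      by (intro integrable_mult_right integrable_inverse_power_norm)
    have "cmod (h x) \<le> (2 ^ (DIM('a) + 2) * (A + B)) * (1 / (1 + norm x) ^ (DIM('a) + 2))" for x
    proof -
      have "(1 + norm x) ^ (DIM('a) + 2) * cmod (h x) \<le> 2 ^ (DIM('a) + 2) * (1 + norm x ^ (DIM('a) + 2)) * cmod (h x)"
        by (intro mult_right_mono one_plus_power_le) auto
      also have "\<dots> = 2 ^ (DIM('a) + 2) * (norm x ^ 0 * cmod (h x) + norm x ^ (DIM('a) + 2) * cmod (h x))"
        by (simp add: algebra_simps)
      also have "\<dots> \<le> 2 ^ (DIM('a) + 2) * (A + B)"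
        by (intro mult_left_mono add_mono A B) simp
      finally show ?thesis by (simp add: pos_le_divide_eq add_pos_nonneg mult.commute del: power_Suc)
    qed
    then show "AE x in lborel. norm (cmod (h x)) \<le> norm ((2 ^ (DIM('a) + 2) * (A + B)) * (1 / (1 + norm x) ^ (DIM('a) + 2)))"
      unfolding real_norm_def abs_norm_cancel by (intro AE_I2 order_trans[OF _ abs_ge_self])
  qed (use h in simp)
qed (use h in simp_all)

lemma schwartz_fourier_integrable:
  fixes f :: "real^'n \<Rightarrow> complex"
  assumes "schwartz f"
  shows "integrable lborel (fourier f)"
  by (rule decay_imp_integrable)
    (auto intro: borel_measurable_continuous_onI schwartz_fourier_continuous schwartz_fourier_decay assms)

subsection \<open>Pseudodifferential integrals\<close>

definition symbol_deriv :: "((real^'n) \<times> (real^'n) \<Rightarrow> complex) \<Rightarrow> (real^'n) list \<Rightarrow> real^'n \<Rightarrow> real^'n \<Rightarrow> complex" where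
  "symbol_deriv a vs z xi = iter_deriv (map (\<lambda>v. (0, v)) vs) a (z, xi)"

lemma symbol_deriv_Nil: "symbol_deriv a [] = (\<lambda>z xi. a (z, xi))"
  by (simp add: symbol_deriv_def fun_eq_iff)

text \<open>For pure frequency derivatives the weight is the bracket raised to \<rho> times the
  order. This is at least 1 since \<rho> is nonnegative, so removing the weight only decreases the
  left side.\<close>

lemma APS0_symbol_deriv_bounded:
  assumes a: "a \<in> APS0 \<rho> \<delta>" and "0 \<le> \<rho>" and vs: "set vs \<subseteq> Basis"
  shows "\<exists>C. \<forall>z xi. cmod (symbol_deriv a vs z xi) \<le> C"
proof -
  have "\<forall>\<alpha> \<beta>. set \<alpha> \<subseteq> Basis \<and> set \<beta> \<subseteq> Basis \<longrightarrow>
      bounded (range (\<lambda>(x, xi). japanese_bracket xi powr (\<rho> * real (length \<alpha>) - \<delta> * real (length \<beta>)) *\<^sub>R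
        iter_deriv (map (\<lambda>v. (0, v)) \<alpha> @ map (\<lambda>v. (v, 0)) \<beta>) a (x, xi)))"
    using a unfolding APS0_def by blast
  from this[rule_format, of vs "[]"] vs
  have "bounded (range (\<lambda>(x, xi). japanese_bracket xi powr (\<rho> * real (length vs)) *\<^sub>R
      iter_deriv (map (\<lambda>v. (0, v)) vs) a (x, xi)))" by simp
  then obtain C where C: "\<And>z xi. norm (japanese_bracket xi powr (\<rho> * real (length vs)) *\<^sub>R symbol_deriv a vs z xi) \<le> C"
    by (auto simp: bounded_iff symbol_deriv_def)
  have "cmod (symbol_deriv a vs z xi) \<le> C" for z xi
  proof -
    have "1 \<le> japanese_bracket xi" by (simp add: japanese_bracket_def)
    then have "1 \<le> japanese_bracket xi powr (\<rho> * real (length vs))"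
      using assms(2) by (intro ge_one_powr_ge_zero) auto
    then have "cmod (symbol_deriv a vs z xi) \<le> japanese_bracket xi powr (\<rho> * real (length vs)) * cmod (symbol_deriv a vs z xi)"
      using mult_right_mono[of 1 _ "cmod (symbol_deriv a vs z xi)"] by simp
    then show ?thesis using C[of xi z] by simp
  qed
  then show ?thesis by blast
qed

lemma APS0_differentiable:
  assumes "a \<in> APS0 \<rho> \<delta>" "set vs \<subseteq> Basis"
  shows "iter_deriv (map (\<lambda>v. (0, v)) vs) a differentiable (at p)"
proof -
  have "set (map (\<lambda>v. (0 :: real^'a, v)) vs) \<subseteq> Basis" using assms(2) by (auto simp: Basis_prod_def)
  then show ?thesis using assms(1) unfolding APS0_def smooth_def by blast
qed

lemma APS0_symbol_deriv_along_line:
  assumes "a \<in> APS0 \<rho> \<delta>" "set vs \<subseteq> Basis"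
  shows "((\<lambda>s. symbol_deriv a vs z (xi + s *\<^sub>R v)) has_vector_derivative symbol_deriv a (v # vs) z xi) (at 0)"
  using has_vector_derivative_along_line[OF has_derivative_iter_deriv[OF APS0_differentiable[OF assms]],
      of "(z, xi)" "(0, v)"]
  by (simp add: symbol_deriv_def iter_deriv_Cons[of "(0, v)" "map (\<lambda>v. (0, v)) vs"])

lemma APS0_symbol_deriv_continuous:
  assumes "a \<in> APS0 \<rho> \<delta>" "set vs \<subseteq> Basis"
  shows "continuous_on S (\<lambda>p. symbol_deriv a vs (fst p) (snd p))"
  using differentiable_continuous_UNIV[OF APS0_differentiable[OF assms]]
  by (auto simp: symbol_deriv_def intro: continuous_on_subset)

lemma APS0_symbol_deriv_continuous_snd:
  assumes "a \<in> APS0 \<rho> \<delta>" "set vs \<subseteq> Basis"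
  shows "continuous_on S (symbol_deriv a vs z)"
proof -
  have "continuous_on S (\<lambda>xi. (z, xi))" by (intro continuous_intros)
  from continuous_on_compose2[OF APS0_symbol_deriv_continuous[OF assms, of UNIV] this] show ?thesis by simp
qed

text \<open>\<open>A\<close> is left arbitrary so that integration by parts can put derivatives of
  the symbol in its place. The point z is kept apart from y, which allows both Bohr coefficients in
  z at fixed y and the substitution z = x + y.\<close>

definition pdo :: "(real^'n \<Rightarrow> real^'n \<Rightarrow> complex) \<Rightarrow> (real^'n \<Rightarrow> complex) \<Rightarrow> real^'n \<Rightarrow> real^'n \<Rightarrow> complex" where
  "pdo A m z y = (LINT xi|lborel. expc xi y * A z xi * m xi)"

lemma pdo_integrable:
  fixes A :: "real^'n \<Rightarrow> real^'n \<Rightarrow> complex"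
  assumes m: "integrable lborel m" and A: "continuous_on UNIV (A z)" "\<And>xi. cmod (A z xi) \<le> B"
  shows "integrable lborel (\<lambda>xi. expc xi y * A z xi * m xi)"
proof (rule Bochner_Integration.integrable_bound)
  have [measurable]: "A z \<in> borel_measurable borel" "m \<in> borel_measurable borel"
    using borel_measurable_integrable[OF m] borel_measurable_continuous_onI[OF A(1)] by auto
  show "integrable lborel (\<lambda>xi. B * cmod (m xi))" by (intro integrable_mult_right integrable_norm m)
  show "(\<lambda>xi. expc xi y * A z xi * m xi) \<in> borel_measurable lborel"
    unfolding expc_commute[of _ y] by measurable
  show "AE xi in lborel. cmod (expc xi y * A z xi * m xi) \<le> norm (B * cmod (m xi))"
    using order_trans[OF A(2) abs_ge_self] by (intro AE_I2) (simp add: norm_mult abs_mult mult_right_mono)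
qed

lemma cmod_pdo_le:
  fixes A :: "real^'n \<Rightarrow> real^'n \<Rightarrow> complex"
  assumes m: "integrable lborel m" and A: "continuous_on UNIV (A z)" "\<And>xi. cmod (A z xi) \<le> B"
  shows "cmod (pdo A m z y) \<le> B * (LINT xi|lborel. cmod (m xi))"
proof -
  have "cmod (pdo A m z y) \<le> (LINT xi|lborel. B * cmod (m xi))"
    unfolding pdo_def
  proof (rule Bochner_Integration.integral_norm_bound_integral)
    show "integrable lborel (\<lambda>xi. expc xi y * A z xi * m xi)" by (rule pdo_integrable[where A = A and z = z]) (rule assms)+
    show "integrable lborel (\<lambda>xi. B * cmod (m xi))" by (intro integrable_mult_right integrable_norm m)
  qed (auto simp: norm_mult intro!: mult_right_mono A)
  then show ?thesis by simp
qed

text \<open>The v-derivative of the integrand in \<xi> has integral 0. The derivative of the Fourier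
  transform of f is again the transform of a Schwartz function, so both remaining terms have the
  shape of the original integral and the identity can be iterated.\<close>

lemma pdo_integration_by_parts:
  fixes a :: "(real^'n) \<times> (real^'n) \<Rightarrow> complex"
  assumes a: "a \<in> APS0 \<rho> \<delta>" "0 \<le> \<rho>" and vs: "set vs \<subseteq> Basis" and v: "v \<in> Basis" and f: "schwartz f"
  shows "2 * pi * \<i> * complex_of_real (y \<bullet> v) * pdo (symbol_deriv a vs) (fourier f) z y =
    - pdo (symbol_deriv a (v # vs)) (fourier f) z y
    - pdo (symbol_deriv a vs) (fourier (\<lambda>x. - (2 * pi * \<i>) * (complex_of_real (x \<bullet> v) * f x))) z y"
proof -
  let ?f' = "\<lambda>x. - (2 * pi * \<i>) * (complex_of_real (x \<bullet> v) * f x)"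
  let ?A = "symbol_deriv a vs z" and ?A' = "symbol_deriv a (v # vs) z"
  let ?c = "2 * pi * \<i> * complex_of_real (y \<bullet> v)"
  have f': "schwartz ?f'" by (intro schwartz_cmult schwartz_mult_coordinate f)
  have vs': "set (v # vs) \<subseteq> Basis" using v vs by simp
  obtain C where C: "\<And>z xi. cmod (symbol_deriv a vs z xi) \<le> C"
    using APS0_symbol_deriv_bounded[OF a vs] by blast
  obtain C' where C': "\<And>z xi. cmod (symbol_deriv a (v # vs) z xi) \<le> C'"
    using APS0_symbol_deriv_bounded[OF a vs'] by blast
  note cont = APS0_symbol_deriv_continuous_snd[OF a(1) vs] APS0_symbol_deriv_continuous_snd[OF a(1) vs']
  have i1: "integrable lborel (\<lambda>xi. expc xi y * ?A xi * fourier f xi)"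
    by (rule pdo_integrable[where A = "symbol_deriv a vs" and z = z]) (rule schwartz_fourier_integrable f cont C)+
  have i2: "integrable lborel (\<lambda>xi. expc xi y * ?A' xi * fourier f xi)"
    by (rule pdo_integrable[where A = "symbol_deriv a (v # vs)" and z = z]) (rule schwartz_fourier_integrable f cont C')+
  have i3: "integrable lborel (\<lambda>xi. expc xi y * ?A xi * fourier ?f' xi)"
    by (rule pdo_integrable[where A = "symbol_deriv a vs" and z = z]) (rule schwartz_fourier_integrable f' cont C)+
  have "(LINT xi|lborel. (expc xi y * ?A xi * fourier ?f' xi + expc xi y * ?A' xi * fourier f xi) +
      ?c * (expc xi y * ?A xi * fourier f xi)) = 0"
  proof (rule integral_directional_derivative_eq_0[of "\<lambda>xi. expc xi y * ?A xi * fourier f xi" v])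
    show "((\<lambda>s. expc (xi + s *\<^sub>R v) y * ?A (xi + s *\<^sub>R v) * fourier f (xi + s *\<^sub>R v)) has_vector_derivative
        (expc xi y * ?A xi * fourier ?f' xi + expc xi y * ?A' xi * fourier f xi) +
        ?c * (expc xi y * ?A xi * fourier f xi)) (at 0)" for xi
      using has_vector_derivative_mult[OF has_vector_derivative_mult[OF
          has_vector_derivative_along_line[OF has_derivative_expc[of y xi], of v]
          APS0_symbol_deriv_along_line[OF a(1) vs, of z xi v]] schwartz_fourier_derivative[OF f, of xi v]]
      by (simp add: expc_commute[of _ y] algebra_simps)
    show "continuous_on UNIV (\<lambda>xi. (expc xi y * ?A xi * fourier ?f' xi + expc xi y * ?A' xi * fourier f xi) +
        ?c * (expc xi y * ?A xi * fourier f xi))"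
      unfolding expc_commute[of _ y]
      by (intro continuous_intros continuous_expc schwartz_fourier_continuous f f' cont)
  qed (intro Bochner_Integration.integrable_add integrable_mult_right i1 i2 i3)+
  also have "(LINT xi|lborel. (expc xi y * ?A xi * fourier ?f' xi + expc xi y * ?A' xi * fourier f xi) +
      ?c * (expc xi y * ?A xi * fourier f xi)) =
      (pdo (symbol_deriv a vs) (fourier ?f') z y + pdo (symbol_deriv a (v # vs)) (fourier f) z y) +
      ?c * pdo (symbol_deriv a vs) (fourier f) z y"
    unfolding pdo_def
    by (subst Bochner_Integration.integral_add, (intro Bochner_Integration.integrable_add integrable_mult_right i1 i2 i3)+)
      (subst Bochner_Integration.integral_add, (intro i2 i3)+, simp)
  finally have "(pdo (symbol_deriv a vs) (fourier ?f') z y + pdo (symbol_deriv a (v # vs)) (fourier f) z y) +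
      ?c * pdo (symbol_deriv a vs) (fourier f) z y = 0" .
  moreover have "w = - q - p" if "(p + q) + w = 0" for p q w :: complex
    using that unfolding add_eq_0_iff by simp
  ultimately show ?thesis by blast
qed

text \<open>Each power of |y| is traded for one more derivative of the symbol or one coordinate
  factor on f, so the induction generalises over \<open>vs\<close> and \<open>f\<close>. The
  constants are free of z because the symbol bounds are.\<close>

lemma pdo_decay_aux:
  fixes a :: "(real^'n) \<times> (real^'n) \<Rightarrow> complex"
  assumes a: "a \<in> APS0 \<rho> \<delta>" "0 \<le> \<rho>" and "set vs \<subseteq> Basis" and "schwartz f"
  shows "\<exists>C. \<forall>z y. norm y ^ k * cmod (pdo (symbol_deriv a vs) (fourier f) z y) \<le> C"
  using assms(3,4)
proof (induction k arbitrary: vs f)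
  case 0
  obtain C where C: "\<And>z xi. cmod (symbol_deriv a vs z xi) \<le> C"
    using APS0_symbol_deriv_bounded[OF a 0(1)] by blast
  have "cmod (pdo (symbol_deriv a vs) (fourier f) z y) \<le> C * (LINT xi|lborel. cmod (fourier f xi))" for z y
    by (rule cmod_pdo_le) (rule schwartz_fourier_integrable 0 APS0_symbol_deriv_continuous_snd a C)+
  then show ?case
    by (intro exI[of _ "C * (LINT xi|lborel. cmod (fourier f xi))"]) simp
next
  case (Suc k)
  let ?f' = "\<lambda>v x. - (2 * pi * \<i>) * (complex_of_real (x \<bullet> v) * f x)"
  have "\<forall>v\<in>Basis. \<exists>C. \<forall>z y. norm y ^ k * cmod (pdo (symbol_deriv a (v # vs)) (fourier f) z y) \<le> C"
    using Suc.IH[OF _ Suc.prems(2)] Suc.prems(1) by simp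
  then obtain C where C: "\<And>v z y. v \<in> Basis \<Longrightarrow> norm y ^ k * cmod (pdo (symbol_deriv a (v # vs)) (fourier f) z y) \<le> C v"
    by metis
  have "schwartz (?f' v)" for v by (intro schwartz_cmult schwartz_mult_coordinate Suc.prems)
  then have "\<forall>v\<in>Basis. \<exists>C. \<forall>z y. norm y ^ k * cmod (pdo (symbol_deriv a vs) (fourier (?f' v)) z y) \<le> C"
    using Suc.IH[OF Suc.prems(1)] by blast
  from bchoice[OF this] obtain D
    where "\<forall>v\<in>Basis. \<forall>z y. norm y ^ k * cmod (pdo (symbol_deriv a vs) (fourier (?f' v)) z y) \<le> D v" ..
  then have D: "norm y ^ k * cmod (pdo (symbol_deriv a vs) (fourier (?f' v)) z y) \<le> D v" if "v \<in> Basis" for v z y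
    using that by simp
  have "norm y ^ Suc k * cmod (pdo (symbol_deriv a vs) (fourier f) z y) \<le> (\<Sum>v\<in>Basis. C v + D v)" for z y
  proof -
    let ?g = "pdo (symbol_deriv a vs) (fourier f) z y"
    have "norm y ^ Suc k * cmod ?g \<le> (\<Sum>v\<in>Basis. norm y ^ k * (\<bar>y \<bullet> v\<bar> * cmod ?g))"
      by (rule norm_power_Suc_le_sum) simp
    also have "\<dots> \<le> (\<Sum>v\<in>Basis. C v + D v)"
    proof (rule sum_mono)
      fix v :: "real^'n" assume v: "v \<in> Basis"
      have "\<bar>y \<bullet> v\<bar> * cmod ?g \<le> 2 * pi * (\<bar>y \<bullet> v\<bar> * cmod ?g)"
        using pi_ge_two mult_right_mono[of 1 "2 * pi" "\<bar>y \<bullet> v\<bar> * cmod ?g"] by simp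
      also have "\<dots> = cmod (2 * pi * \<i> * complex_of_real (y \<bullet> v) * ?g)"
        by (simp add: norm_mult)
      also have "\<dots> \<le> cmod (pdo (symbol_deriv a (v # vs)) (fourier f) z y) + cmod (pdo (symbol_deriv a vs) (fourier (?f' v)) z y)"
        unfolding pdo_integration_by_parts[OF a Suc.prems(1) v Suc.prems(2)]
        by (rule order_trans[OF norm_triangle_ineq4]) simp
      finally have "norm y ^ k * (\<bar>y \<bullet> v\<bar> * cmod ?g) \<le>
          norm y ^ k * (cmod (pdo (symbol_deriv a (v # vs)) (fourier f) z y) + cmod (pdo (symbol_deriv a vs) (fourier (?f' v)) z y))"
        by (rule mult_left_mono) simp
      also have "\<dots> \<le> C v + D v"
        unfolding distrib_left by (intro add_mono C D v)
      finally show "norm y ^ k * (\<bar>y \<bullet> v\<bar> * cmod ?g) \<le> C v + D v" .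
    qed
    finally show ?thesis .
  qed
  then show ?case by blast
qed

lemma pdo_decay:
  fixes a :: "(real^'n) \<times> (real^'n) \<Rightarrow> complex"
  assumes a: "a \<in> APS0 \<rho> \<delta>" "0 \<le> \<rho>" and f: "schwartz f"
  shows "\<exists>C\<ge>0. \<forall>z y. cmod (pdo (\<lambda>z xi. a (z, xi)) (fourier f) z y) \<le> C / (1 + norm y) ^ k"
proof -
  let ?g = "pdo (\<lambda>z xi. a (z, xi)) (fourier f)"
  obtain A where A: "\<And>z y. norm y ^ 0 * cmod (?g z y) \<le> A"
    using pdo_decay_aux[OF a _ f, of "[]" 0] unfolding symbol_deriv_Nil by auto
  obtain B where B: "\<And>z y. norm y ^ k * cmod (?g z y) \<le> B"
    using pdo_decay_aux[OF a _ f, of "[]" k] unfolding symbol_deriv_Nil by auto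
  have "cmod (?g z y) \<le> (2 ^ k * (A + B)) / (1 + norm y) ^ k" for z y
  proof -
    have "(1 + norm y) ^ k * cmod (?g z y) \<le> 2 ^ k * (1 + norm y ^ k) * cmod (?g z y)"
      by (intro mult_right_mono one_plus_power_le) auto
    also have "\<dots> = 2 ^ k * (norm y ^ 0 * cmod (?g z y) + norm y ^ k * cmod (?g z y))"
      by (simp add: algebra_simps)
    also have "\<dots> \<le> 2 ^ k * (A + B)"
      by (intro mult_left_mono add_mono A B) simp
    finally show ?thesis by (simp add: pos_le_divide_eq add_pos_nonneg mult.commute)
  qed
  moreover have "0 \<le> 2 ^ k * (A + B)"
  proof -
    have "0 \<le> A" by (rule order_trans[OF _ A[of 0 0]]) simp
    moreover have "0 \<le> B" by (rule order_trans[OF _ B[of 0 0]]) simp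
    ultimately show ?thesis by simp
  qed
  ultimately show ?thesis by blast
qed

section \<open>Approximation of the integral by trigonometric polynomials, and its Bohr
  coefficients\<close>

lemma APS0_bounded:
  assumes "a \<in> APS0 \<rho> \<delta>" "0 \<le> \<rho>"
  obtains B where "B \<ge> 0" "\<And>z xi. cmod (a (z, xi)) \<le> B"
proof -
  obtain B where B: "\<And>z xi. cmod (a (z, xi)) \<le> B"
    using APS0_symbol_deriv_bounded[OF assms, of "[]"] unfolding symbol_deriv_Nil by auto
  then show ?thesis using that[of B] order_trans[OF norm_ge_zero B] by blast
qed

lemma APS0_continuous: "a \<in> APS0 \<rho> \<delta> \<Longrightarrow> continuous_on UNIV a"
  using APS0_symbol_deriv_continuous[of a \<rho> \<delta> "[]" UNIV] by (simp add: symbol_deriv_Nil)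

text \<open>The constant is uniform in z. This allows the symbol to be frozen on a cell of
  frequencies for all z at once, and gives continuity in \<xi> of its coefficient sequences in
  l^2.\<close>

lemma APS0_lipschitz:
  fixes a :: "(real^'n) \<times> (real^'n) \<Rightarrow> complex"
  assumes a: "a \<in> APS0 \<rho> \<delta>" "0 \<le> \<rho>"
  obtains L where "L \<ge> 0" "\<And>z xi eta. cmod (a (z, xi) - a (z, eta)) \<le> L * norm (xi - eta)"
proof -
  have "\<forall>v\<in>Basis. \<exists>C. \<forall>z xi. cmod (symbol_deriv a [v] z xi) \<le> C"
    using APS0_symbol_deriv_bounded[OF a] by simp
  then obtain C where C: "\<And>v z xi. v \<in> Basis \<Longrightarrow> cmod (symbol_deriv a [v] z xi) \<le> C v" by metis
  define L where "L = (\<Sum>v\<in>(Basis :: (real^'n) set). C v)"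
  have C0: "C v \<ge> 0" if "v \<in> Basis" for v using order_trans[OF norm_ge_zero C[OF that]] .
  have D: "(a has_derivative (\<lambda>w. iter_deriv [w] a p)) (at p)" for p
    using has_derivative_iter_deriv[OF APS0_differentiable[OF a(1), of "[]"]] by simp
  have "cmod (a (z, xi) - a (z, eta)) \<le> L * norm (xi - eta)" for z xi eta
  proof (rule differentiable_bound[where S = UNIV and f = "\<lambda>xi. a (z, xi)"])
    show "((\<lambda>xi. a (z, xi)) has_derivative (\<lambda>w. iter_deriv [(0, w)] a (z, x))) (at x within UNIV)" for x
      using has_derivative_compose[OF has_derivative_Pair[OF has_derivative_const has_derivative_ident] D, of z x UNIV] by simp
    show "onorm (\<lambda>w. iter_deriv [(0, w)] a (z, x)) \<le> L" for x
    proof (rule onorm_bound)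
      show "0 \<le> L" unfolding L_def by (intro sum_nonneg C0)
      fix w :: "real^'n"
      interpret D: bounded_linear "\<lambda>w. iter_deriv [w] a (z, x)" by (rule has_derivative_bounded_linear[OF D])
      have "(0, w) = (\<Sum>v\<in>Basis. (w \<bullet> v) *\<^sub>R (0 :: real^'n, v))"
        using euclidean_representation[of w] by (simp add: prod_eq_iff fst_sum snd_sum)
      then have "iter_deriv [(0, w)] a (z, x) = (\<Sum>v\<in>Basis. (w \<bullet> v) *\<^sub>R iter_deriv [(0, v)] a (z, x))"
        by (simp only: D.sum D.scaleR)
      also have "cmod \<dots> \<le> (\<Sum>v\<in>Basis. norm w * C v)"
      proof (rule sum_norm_le)
        fix v :: "real^'n" assume v: "v \<in> Basis"
        have "cmod ((w \<bullet> v) *\<^sub>R iter_deriv [(0, v)] a (z, x)) = \<bar>w \<bullet> v\<bar> * cmod (symbol_deriv a [v] z x)"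
          by (simp add: symbol_deriv_def)
        also have "\<dots> \<le> norm w * C v" by (intro mult_mono C v Basis_le_norm) auto
        finally show "cmod ((w \<bullet> v) *\<^sub>R iter_deriv [(0, v)] a (z, x)) \<le> norm w * C v" .
      qed
      also have "\<dots> = L * norm w" by (simp add: L_def sum_distrib_left mult.commute)
      finally show "cmod (iter_deriv [(0, w)] a (z, x)) \<le> L * norm w" .
    qed
  qed auto
  moreover have "L \<ge> 0" unfolding L_def by (intro sum_nonneg C0)
  ultimately show ?thesis using that by blast
qed

text \<open>The frequency space is cut into countably many small cells; on each of finitely many of them the
  symbol is frozen at the centre and replaced by a trigonometric polynomial in \<open>z\<close>.\<close>

lemma pdo_trig_approx:
  fixes A :: "real^'n \<Rightarrow> real^'n \<Rightarrow> complex"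
  assumes ap: "\<And>xi. (\<lambda>z. A z xi) \<in> C_ap" and bdd: "\<And>z xi. cmod (A z xi) \<le> B"
    and lip: "\<And>z xi eta. cmod (A z xi - A z eta) \<le> L * norm (xi - eta)" and L: "L \<ge> 0"
    and m: "integrable lborel m" and e: "e > 0"
  shows "\<exists>(I :: (nat \<times> (real^'n)) set) h K. finite I \<and> (\<forall>i\<in>I. h i \<in> borel_measurable borel) \<and> (\<forall>i\<in>I. \<forall>y. cmod (h i y) \<le> K) \<and>
    (\<forall>z y. cmod (pdo A m z y - (\<Sum>i\<in>I. expc (snd i) z * h i y)) < e)"
proof -
  have B: "B \<ge> 0" using order_trans[OF norm_ge_zero bdd] .
  have [measurable]: "m \<in> borel_measurable borel" using borel_measurable_integrable[OF m] by simp
  define N where "N = (LINT xi|lborel. cmod (m xi))"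
  have N: "N \<ge> 0" by (simp add: N_def)
  \<comment> \<open>Freezing costs L \<delta> <= \<epsilon> and the trigonometric polynomial another
    \<epsilon>, so the cells contribute at most 2 \<epsilon> N <= e / 2, and e / 2 is left for the
    rest. The summands 1 in N + 1 and L + 1 avoid division by 0.\<close>
  define \<epsilon> where "\<epsilon> = e / 4 / (N + 1)"
  define \<delta> where "\<delta> = \<epsilon> / (L + 1)"
  have d: "\<delta> > 0" "\<epsilon> > 0" using e L N by (simp_all add: \<delta>_def \<epsilon>_def)
  have LN: "(L * \<delta> + \<epsilon>) * N \<le> e / 2"
  proof -
    have "L * \<delta> \<le> (L + 1) * \<delta>" using d by (intro mult_right_mono) auto
    also have "\<dots> = \<epsilon>" using L by (simp add: \<delta>_def)
    finally have "(L * \<delta> + \<epsilon>) * N \<le> (2 * \<epsilon>) * (N + 1)"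
      using d L N by (intro mult_mono) auto
    also have "\<dots> = 2 * (\<epsilon> * (N + 1))" by (rule mult.assoc)
    also have "\<epsilon> * (N + 1) = e / 4" unfolding \<epsilon>_def by (rule nonzero_eq_divide_eq[THEN iffD1, OF _ refl]) (use N in linarith)
    finally show ?thesis by simp
  qed
  obtain D :: "(real^'n) set" where D: "countable D" "D \<subseteq> UNIV" "UNIV \<subseteq> closure D"
    by (rule separable)
  define q where "q = from_nat_into D"
  have cover: "\<exists>k. xi \<in> ball (q k) \<delta>" for xi
  proof -
    obtain y where "y \<in> D" "dist y xi < \<delta>" using D(3) d(1) by (meson UNIV_I closure_approachable subsetD)
    then show ?thesis unfolding q_def using D(1) by (metis from_nat_into_to_nat_on mem_ball)
  qed
  define cell where "cell = disjointed (\<lambda>k. ball (q k) \<delta>)"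
  have [measurable]: "cell k \<in> sets borel" for k
    unfolding cell_def disjointed_def by (intro sets.Diff sets.finite_UN) auto
  have cell_sub: "cell k \<subseteq> ball (q k) \<delta>" for k unfolding cell_def by (rule disjointed_subset)
  have cell_UN: "(\<Union>k<n. cell k) = (\<Union>k<n. ball (q k) \<delta>)" for n
    unfolding cell_def using finite_UN_disjointed_eq[of "\<lambda>k. ball (q k) \<delta>" n] by (simp add: atLeast0LessThan)
  have cell_disj: "k = j" if "x \<in> cell k" "x \<in> cell j" for x k j
    using disjoint_family_disjointed[of "\<lambda>k. ball (q k) \<delta>"] that unfolding cell_def disjoint_family_on_def by blast
  \<comment> \<open>The frequencies missed by the first n cells. They cost at most \<open>B\<close>
    times the mass of \<open>m\<close> there, which tends to 0 since every frequency lies in some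
    cell.\<close>
  define R where "R n = - (\<Union>k<n. cell k)" for n
  have [measurable]: "R n \<in> sets borel" for n unfolding R_def by measurable
  have "(\<lambda>n. LINT xi|lborel. indicat_real (R n) xi * cmod (m xi)) \<longlonglongrightarrow> (LINT xi|(lborel :: (real^'n) measure). 0)"
  proof (rule integral_dominated_convergence[where w = "\<lambda>xi. cmod (m xi)"])
    show "AE xi in lborel. (\<lambda>n. indicat_real (R n) xi * cmod (m xi)) \<longlonglongrightarrow> 0"
    proof (rule AE_I2)
      fix xi
      obtain k where k: "xi \<in> ball (q k) \<delta>" using cover by blast
      have "indicat_real (R n) xi * cmod (m xi) = 0" if "n \<ge> Suc k" for n
        using k that unfolding R_def cell_UN by (auto simp: indicator_def)
      then show "(\<lambda>n. indicat_real (R n) xi * cmod (m xi)) \<longlonglongrightarrow> 0"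
        by (intro tendsto_eventually) (auto simp: eventually_sequentially)
    qed
  qed (use m in \<open>auto simp: indicator_def\<close>)
  then have "(\<lambda>n. B * (LINT xi|lborel. indicat_real (R n) xi * cmod (m xi))) \<longlonglongrightarrow> B * 0"
    by (intro tendsto_mult tendsto_const) simp
  then have "\<forall>\<^sub>F n in sequentially. B * (LINT xi|lborel. indicat_real (R n) xi * cmod (m xi)) < e / 2"
    by (rule order_tendstoD(2)) (use e in simp)
  then obtain n where n: "B * (LINT xi|lborel. indicat_real (R n) xi * cmod (m xi)) < e / 2"
    unfolding eventually_sequentially by blast
  have "\<forall>k. \<exists>p. p \<in> trig_polynomials \<and> (\<forall>z. cmod (A z (q k) - p z) < \<epsilon>)"
    using ap d(2) unfolding C_ap_iff by blast
  then obtain p where p: "\<And>k. p k \<in> trig_polynomials" "\<And>k z. cmod (A z (q k) - p k z) < \<epsilon>" by metis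
  have "\<forall>k. \<exists>S c. finite S \<and> p k = (\<lambda>z. \<Sum>l\<in>S. c l * expc l z)"
    using p(1) unfolding trig_polynomials_def by blast
  then obtain S c where S: "\<And>k. finite (S k)" "\<And>k. p k = (\<lambda>z. \<Sum>l\<in>S k. c k l * expc l z)" by metis
  define H where "H k y = (LINT xi|lborel. indicat_real (cell k) xi *\<^sub>R (expc xi y * m xi))" for k y
  \<comment> \<open>The index keeps the cell next to the frequency, as one frequency may occur on
    several cells.\<close>
  define h where "h = (\<lambda>(k, l) y. c k l * H k y)"
  define I where "I = Sigma {..<n} S"
  have "(\<lambda>p. expc (snd p) (fst p)) \<in> borel_measurable (borel :: ((real^'n) \<times> (real^'n)) measure)"
    unfolding expc_def by (intro borel_measurable_continuous_onI continuous_intros)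
  then have [measurable]: "(\<lambda>(y :: real^'n, xi :: real^'n). expc xi y) \<in> borel_measurable (borel \<Otimes>\<^sub>M borel)"
    by (simp add: borel_prod case_prod_beta')
  have em: "integrable lborel (\<lambda>xi. expc xi y * m xi)" for y
    unfolding expc_commute[of _ y] by (rule integrable_expc_mult[OF m])
  have iem: "integrable lborel (\<lambda>xi. indicat_real (cell k) xi *\<^sub>R (expc xi y * m xi))" for k y
    by (rule Bochner_Integration.integrable_bound[OF em[of y]])
      (use borel_measurable_integrable[OF em[of y]] in \<open>auto simp: indicator_def\<close>)
  have Hm: "H k \<in> borel_measurable borel" for k
    unfolding H_def by measurable
  have HN: "cmod (H k y) \<le> N" for k y
    unfolding H_def N_def
    by (rule Bochner_Integration.integral_norm_bound_integral[OF iem integrable_norm[OF m]])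
      (auto simp: norm_mult indicator_def)
  have finI: "finite I" using S(1) by (simp add: I_def)
  let ?At = "\<lambda>z xi. \<Sum>k<n. indicat_real (cell k) xi *\<^sub>R p k z"
  have At: "cmod (A z xi - ?At z xi) \<le> (L * \<delta> + \<epsilon>) + B * indicat_real (R n) xi" for z xi
  proof (cases "xi \<in> R n")
    case True
    then have "?At z xi = 0" by (intro sum.neutral) (auto simp: R_def)
    then show ?thesis using True bdd[of z xi] d L by (simp add: add_increasing)
  next
    case False
    then obtain k where k: "k < n" "xi \<in> cell k" by (auto simp: R_def)
    have "?At z xi = (\<Sum>j<n. if j = k then p k z else 0)"
      using k(2) cell_disj by (intro sum.cong) (auto simp: indicator_def)
    also have "\<dots> = p k z" using k(1) by simp
    finally have "A z xi - ?At z xi = (A z xi - A z (q k)) + (A z (q k) - p k z)" by simp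
    then have "cmod (A z xi - ?At z xi) \<le> cmod (A z xi - A z (q k)) + cmod (A z (q k) - p k z)"
      by (metis norm_triangle_ineq)
    also have "\<dots> \<le> L * \<delta> + \<epsilon>"
    proof (rule add_mono)
      have "norm (xi - q k) \<le> \<delta>" using cell_sub[of k] k(2) by (auto simp: dist_norm norm_minus_commute)
      then show "cmod (A z xi - A z (q k)) \<le> L * \<delta>"
        using order_trans[OF lip mult_left_mono[OF _ L]] by blast
      show "cmod (A z (q k) - p k z) \<le> \<epsilon>" using p(2) by (rule less_imp_le)
    qed
    finally show ?thesis using False by simp
  qed
  have "cmod (pdo A m z y - (\<Sum>i\<in>I. expc (snd i) z * h i y)) < e" for z y
  proof -
    have Ac: "continuous_on UNIV (A z)" by (rule lipschitz_continuous_UNIV[OF lip])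
    have iA: "integrable lborel (\<lambda>xi. expc xi y * A z xi * m xi)"
      by (rule pdo_integrable[where A = A and z = z]) (rule m Ac bdd)+
    have it: "integrable lborel (\<lambda>xi. \<Sum>k<n. p k z * (indicat_real (cell k) xi *\<^sub>R (expc xi y * m xi)))"
      by (intro Bochner_Integration.integrable_sum integrable_mult_right iem)
    have "(\<Sum>i\<in>I. expc (snd i) z * h i y) = (\<Sum>k<n. \<Sum>l\<in>S k. c k l * expc l z * H k y)"
      unfolding I_def h_def by (subst sum.Sigma) (use S(1) in \<open>auto simp: mult_ac intro!: sum.cong\<close>)
    also have "\<dots> = (\<Sum>k<n. p k z * H k y)"
      by (simp add: S(2) sum_distrib_right)
    also have "\<dots> = (LINT xi|lborel. (\<Sum>k<n. p k z * (indicat_real (cell k) xi *\<^sub>R (expc xi y * m xi))))"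
      unfolding H_def integral_mult_right_zero[symmetric]
      by (rule Bochner_Integration.integral_sum[symmetric]) (intro integrable_mult_right iem)
    finally have "pdo A m z y - (\<Sum>i\<in>I. expc (snd i) z * h i y) =
        (LINT xi|lborel. expc xi y * A z xi * m xi - (\<Sum>k<n. p k z * (indicat_real (cell k) xi *\<^sub>R (expc xi y * m xi))))"
      unfolding pdo_def by (simp only: Bochner_Integration.integral_diff[OF iA it])
    also have "cmod \<dots> \<le> (LINT xi|lborel. (L * \<delta> + \<epsilon>) * cmod (m xi) + B * (indicat_real (R n) xi * cmod (m xi)))"
    proof (rule Bochner_Integration.integral_norm_bound_integral)
      show "integrable lborel (\<lambda>xi. expc xi y * A z xi * m xi - (\<Sum>k<n. p k z * (indicat_real (cell k) xi *\<^sub>R (expc xi y * m xi))))"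
        by (rule Bochner_Integration.integrable_diff[OF iA it])
      have "integrable lborel (\<lambda>xi. indicat_real (R n) xi * cmod (m xi))"
        by (rule Bochner_Integration.integrable_bound[OF integrable_norm[OF m]]) (auto simp: indicator_def)
      then show "integrable lborel (\<lambda>xi. (L * \<delta> + \<epsilon>) * cmod (m xi) + B * (indicat_real (R n) xi * cmod (m xi)))"
        by (intro Bochner_Integration.integrable_add integrable_mult_right integrable_norm m)
      fix xi
      have "expc xi y * A z xi * m xi - (\<Sum>k<n. p k z * (indicat_real (cell k) xi *\<^sub>R (expc xi y * m xi))) =
          expc xi y * (A z xi - ?At z xi) * m xi"
        by (simp add: sum_distrib_left sum_distrib_right algebra_simps)
      then have "cmod (expc xi y * A z xi * m xi - (\<Sum>k<n. p k z * (indicat_real (cell k) xi *\<^sub>R (expc xi y * m xi)))) =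
          cmod (A z xi - ?At z xi) * cmod (m xi)"
        by (simp only: norm_mult norm_expc mult_1)
      also have "\<dots> \<le> ((L * \<delta> + \<epsilon>) + B * indicat_real (R n) xi) * cmod (m xi)"
        by (rule mult_right_mono[OF At]) simp
      finally show "cmod (expc xi y * A z xi * m xi - (\<Sum>k<n. p k z * (indicat_real (cell k) xi *\<^sub>R (expc xi y * m xi)))) \<le>
          (L * \<delta> + \<epsilon>) * cmod (m xi) + B * (indicat_real (R n) xi * cmod (m xi))"
        by (simp add: algebra_simps)
    qed
    also have "\<dots> = (L * \<delta> + \<epsilon>) * N + B * (LINT xi|lborel. indicat_real (R n) xi * cmod (m xi))"
    proof -
      have "integrable lborel (\<lambda>xi. indicat_real (R n) xi * cmod (m xi))"
        by (rule Bochner_Integration.integrable_bound[OF integrable_norm[OF m]]) (auto simp: indicator_def)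
      then show ?thesis
        by (subst Bochner_Integration.integral_add) (auto simp: N_def intro: m)
    qed
    also have "\<dots> < e" using LN n by linarith
    finally show ?thesis .
  qed
  moreover have "\<forall>i\<in>I. h i \<in> borel_measurable borel"
    using Hm by (auto simp: h_def)
  moreover have "\<forall>i\<in>I. \<forall>y. cmod (h i y) \<le> (\<Sum>(k, l)\<in>I. cmod (c k l)) * N"
  proof (intro ballI allI)
    fix i y assume i: "i \<in> I"
    obtain k l where kl: "i = (k, l)" by force
    have "cmod (c k l) \<le> (\<Sum>(k, l)\<in>I. cmod (c k l))"
      using member_le_sum[of i I "\<lambda>(k, l). cmod (c k l)"] i finI kl by auto
    then show "cmod (h i y) \<le> (\<Sum>(k, l)\<in>I. cmod (c k l)) * N"
      using HN[of k y] N by (auto simp: kl h_def norm_mult intro!: mult_mono sum_nonneg)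
  qed
  ultimately show ?thesis using finI by blast
qed

lemma pdo_C_ap:
  fixes A :: "real^'n \<Rightarrow> real^'n \<Rightarrow> complex"
  assumes ap: "\<And>xi. (\<lambda>z. A z xi) \<in> C_ap" and bdd: "\<And>z xi. cmod (A z xi) \<le> B"
    and lip: "\<And>z xi eta. cmod (A z xi - A z eta) \<le> L * norm (xi - eta)" and L: "L \<ge> 0"
    and m: "integrable lborel m"
  shows "(\<lambda>z. pdo A m z y) \<in> C_ap"
  unfolding C_ap_iff
proof (intro allI impI)
  fix e :: real assume e: "e > 0"
  have "\<exists>(I :: (nat \<times> (real^'n)) set) h K. finite I \<and> (\<forall>i\<in>I. h i \<in> borel_measurable borel) \<and> (\<forall>i\<in>I. \<forall>y. cmod (h i y) \<le> K) \<and>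
      (\<forall>z y. cmod (pdo A m z y - (\<Sum>i\<in>I. expc (snd i) z * h i y)) < e)"
    by (rule pdo_trig_approx[where A = A]) (rule assms e)+
  then obtain I :: "(nat \<times> (real^'n)) set" and h where I: "finite I"
    "\<forall>z y. cmod (pdo A m z y - (\<Sum>i\<in>I. expc (snd i) z * h i y)) < e"
    by (elim exE conjE)
  show "\<exists>p\<in>trig_polynomials. \<forall>z. cmod (pdo A m z y - p z) < e"
  proof (rule bexI)
    show "\<forall>z. cmod (pdo A m z y - (\<Sum>i\<in>I. h i y * expc (snd i) z)) < e" using I(2) by (simp add: mult.commute)
    show "(\<lambda>z. \<Sum>i\<in>I. h i y * expc (snd i) z) \<in> trig_polynomials" by (intro trig_sum trig_expc I)
  qed
qed

text \<open>Fubini on the averaging cubes, then dominated convergence as the cubes grow: averages of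
  a function bounded by \<open>B\<close> are bounded by \<open>B\<close>, so
  \<open>B * cmod (m xi)\<close> is a majorant.\<close>

lemma mean_value_pdo:
  fixes A :: "real^'n \<Rightarrow> real^'n \<Rightarrow> complex"
  assumes ap: "\<And>xi. (\<lambda>z. A z xi) \<in> C_ap" and bdd: "\<And>z xi. cmod (A z xi) \<le> B"
    and cont: "continuous_on UNIV (\<lambda>p. A (fst p) (snd p))" and m: "integrable lborel m"
  shows "mean_value (\<lambda>z. pdo A m z y * expc (- k) z) =
    (LINT xi|lborel. expc xi y * mean_value (\<lambda>z. A z xi * expc (- k) z) * m xi)"
proof (rule mean_value_eqI)
  have B: "B \<ge> 0" using order_trans[OF norm_ge_zero bdd] .
  have [measurable]: "m \<in> borel_measurable borel" using borel_measurable_integrable[OF m] by simp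
  have "(\<lambda>p. A (fst p) (snd p)) \<in> borel_measurable borel" by (rule borel_measurable_continuous_onI[OF cont])
  then have Am [measurable]: "(\<lambda>(z, xi). A z xi) \<in> borel_measurable (borel \<Otimes>\<^sub>M borel)"
    by (simp add: borel_prod case_prod_beta')
  have [measurable]: "(\<lambda>xi. expc xi y) \<in> borel_measurable borel"
    unfolding expc_commute[of _ y] by measurable
  have apk: "(\<lambda>z. A z xi * expc (- k) z) \<in> C_ap" for xi
    using C_ap_mult_cnj[OF ap expc_C_ap[of k]] by (simp add: expc_def cis_cnj)
  have bk: "cmod (A z xi * expc (- k) z) \<le> B" for z xi using bdd by (simp add: norm_mult)
  let ?s = "\<lambda>T xi. expc xi y * cube_avg (\<lambda>z. A z xi * expc (- k) z) T * m xi"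
  have avg: "cube_avg (\<lambda>z. pdo A m z y * expc (- k) z) T = (LINT xi|lborel. ?s T xi)" and sm: "?s T \<in> borel_measurable lborel" for T
  proof -
    let ?Q = "cbox (0 :: real^'n) (\<chi> i. T)"
    define F where "F = (\<lambda>(z, xi). indicat_real ?Q z *\<^sub>R (expc xi y * A z xi * m xi * expc (- k) z))"
    have Fm: "F \<in> borel_measurable (lborel \<Otimes>\<^sub>M lborel)" unfolding F_def by measurable
    have sl: "integrable lborel (\<lambda>xi. F (z, xi))" for z
    proof (rule Bochner_Integration.integrable_bound)
      show "integrable lborel (\<lambda>xi. B * cmod (m xi))" by (intro integrable_mult_right integrable_norm m)
      have [measurable]: "A z \<in> borel_measurable borel"
        using measurable_Pair2[OF Am, of z] by simp
      show "(\<lambda>xi. F (z, xi)) \<in> borel_measurable lborel" unfolding F_def case_prod_conv by measurable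
      show "AE xi in lborel. cmod (F (z, xi)) \<le> norm (B * cmod (m xi))"
        using bdd B by (intro AE_I2) (auto simp: F_def indicator_def norm_mult abs_mult intro!: mult_right_mono)
    qed
    have Fi: "integrable (lborel \<Otimes>\<^sub>M lborel) F"
    proof (rule lborel_pair.Fubini_integrable[OF Fm])
      show "AE z in lborel. integrable lborel (\<lambda>xi. F (z, xi))" using sl by simp
      show "integrable lborel (\<lambda>z. LINT xi|lborel. norm (F (z, xi)))"
      proof (rule Bochner_Integration.integrable_bound)
        show "integrable lborel (\<lambda>z. indicat_real ?Q z * (B * (LINT xi|lborel. cmod (m xi))))"
          by (intro integrable_mult_left integrable_indicator_cbox)
        show "(\<lambda>z. LINT xi|lborel. norm (F (z, xi))) \<in> borel_measurable lborel"
          using Fm by measurable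
        have "(LINT xi|lborel. norm (F (z, xi))) \<le> indicat_real ?Q z * (B * (LINT xi|lborel. cmod (m xi)))" for z
        proof -
          have "(LINT xi|lborel. norm (F (z, xi))) \<le> (LINT xi|lborel. indicat_real ?Q z * (B * cmod (m xi)))"
            using bdd by (intro integral_mono integrable_norm sl integrable_mult_right m)
              (auto simp: F_def indicator_def norm_mult intro!: mult_right_mono)
          then show ?thesis by simp
        qed
        then show "AE z in lborel. norm (LINT xi|lborel. norm (F (z, xi))) \<le> norm (indicat_real ?Q z * (B * (LINT xi|lborel. cmod (m xi))))"
          by (intro AE_I2) (simp add: order_trans[OF _ abs_ge_self])
      qed
    qed
    have "(LINT z|lborel. LINT xi|lborel. F (z, xi)) = (LINT xi|lborel. LINT z|lborel. F (z, xi))"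
      using lborel_pair.Fubini_integral[of "\<lambda>z xi. F (z, xi)"] Fi by simp
    moreover have "(LINT xi|lborel. F (z, xi)) = indicat_real ?Q z *\<^sub>R (pdo A m z y * expc (- k) z)" for z
      unfolding F_def pdo_def by simp
    moreover have "(LINT z|lborel. F (z, xi)) = expc xi y * (LINT z:?Q|lborel. A z xi * expc (- k) z) * m xi" for xi
    proof -
      have "(LINT z|lborel. F (z, xi)) = (LINT z|lborel. (expc xi y * m xi) * (indicat_real ?Q z *\<^sub>R (A z xi * expc (- k) z)))"
        unfolding F_def by (intro Bochner_Integration.integral_cong) (auto simp: indicator_def)
      then show ?thesis
        unfolding integral_mult_right_zero set_lebesgue_integral_def by (simp only: mult_ac)
    qed
    ultimately have eq: "(LINT z:?Q|lborel. pdo A m z y * expc (- k) z) =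
        (LINT xi|lborel. expc xi y * (LINT z:?Q|lborel. A z xi * expc (- k) z) * m xi)"
      by (simp add: set_lebesgue_integral_def)
    have s_eq: "?s T xi = (expc xi y * (LINT z:?Q|lborel. A z xi * expc (- k) z) * m xi) / complex_of_real T ^ CARD('n)" for xi
      by (simp add: cube_avg_def)
    show "cube_avg (\<lambda>z. pdo A m z y * expc (- k) z) T = (LINT xi|lborel. ?s T xi)"
      unfolding s_eq by (simp add: cube_avg_def eq)
    have "(\<lambda>xi. LINT z:?Q|lborel. A z xi * expc (- k) z) \<in> borel_measurable borel"
      unfolding set_lebesgue_integral_def by measurable
    then show "?s T \<in> borel_measurable lborel" unfolding s_eq by measurable
  qed
  have lim: "((\<lambda>T. cube_avg (\<lambda>z. A z xi * expc (- k) z) T) \<longlongrightarrow> mean_value (\<lambda>z. A z xi * expc (- k) z)) at_top" for xi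
    by (rule mean_value_tendsto[OF apk])
  have "((\<lambda>T. LINT xi|lborel. ?s T xi) \<longlongrightarrow> (LINT xi|lborel. expc xi y * mean_value (\<lambda>z. A z xi * expc (- k) z) * m xi)) at_top"
  proof (rule integral_dominated_convergence_at_top[where w = "\<lambda>xi. B * cmod (m xi)"])
    show "integrable lborel (\<lambda>xi. B * cmod (m xi))" by (intro integrable_mult_right integrable_norm m)
    show "?s T \<in> borel_measurable lborel" for T by (rule sm)
    show "AE xi in lborel. ((\<lambda>T. ?s T xi) \<longlongrightarrow> expc xi y * mean_value (\<lambda>z. A z xi * expc (- k) z) * m xi) at_top"
      by (intro AE_I2 tendsto_intros lim)
    show "\<forall>\<^sub>F T in at_top. AE xi in lborel. norm (?s T xi) \<le> B * cmod (m xi)"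
      using eventually_gt_at_top[of 0]
    proof eventually_elim
      case (elim T)
      show ?case
        by (intro AE_I2) (auto simp: norm_mult intro!: mult_right_mono norm_cube_avg_le[OF apk bk elim])
    qed
    \<comment> \<open>Measurability of the limit is read off from the sequence of cubes with integer
      edges.\<close>
    have "?s (real n) \<in> borel_measurable lborel" for n by (rule sm)
    moreover have "(\<lambda>n. ?s (real n) xi) \<longlonglongrightarrow> expc xi y * mean_value (\<lambda>z. A z xi * expc (- k) z) * m xi" for xi
      by (intro tendsto_intros filterlim_compose[OF lim filterlim_real_sequentially])
    ultimately show "(\<lambda>xi. expc xi y * mean_value (\<lambda>z. A z xi * expc (- k) z) * m xi) \<in> borel_measurable lborel"
      by (rule borel_measurable_LIMSEQ_metric)
  qed
  then show "(cube_avg (\<lambda>z. pdo A m z y * expc (- k) z) \<longlongrightarrow>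
      (LINT xi|lborel. expc xi y * mean_value (\<lambda>z. A z xi * expc (- k) z) * m xi)) at_top"
    by (simp add: avg[abs_def])
qed

subsection \<open>Coefficient sequences of almost periodic functions\<close>

lemma bessel_inequality:
  fixes x :: "'a :: complex_semi_inner" and u :: "'i \<Rightarrow> 'a"
  assumes fin: "finite S" and on: "\<And>k j. k \<in> S \<Longrightarrow> j \<in> S \<Longrightarrow> cinner (u k) (u j) = (if k = j then 1 else 0)"
  shows "(\<Sum>k\<in>S. (cmod (cinner x (u k)))\<^sup>2) \<le> (csnorm x)\<^sup>2"
proof -
  let ?c = "\<lambda>k. cinner x (u k)"
  let ?p = "\<Sum>k\<in>S. ?c k *\<^sub>C u k"
  have sq: "w * cnj w = complex_of_real ((cmod w)\<^sup>2)" for w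
    by (metis complex_norm_square of_real_power)
  have xp: "cinner x ?p = (\<Sum>k\<in>S. complex_of_real ((cmod (?c k))\<^sup>2))"
    by (simp add: cinner_sum_right cinner_scaleC_right sq[symmetric] mult.commute del: of_real_power)
  have uj: "cinner ?p (u j) = ?c j" if "j \<in> S" for j
  proof -
    have "cinner ?p (u j) = (\<Sum>k\<in>S. if k = j then ?c k else 0)"
      unfolding cinner_sum_left cinner_scaleC_left by (rule sum.cong[OF refl]) (use on that in auto)
    then show ?thesis using fin that by simp
  qed
  have pp: "cinner ?p ?p = (\<Sum>k\<in>S. complex_of_real ((cmod (?c k))\<^sup>2))"
    unfolding cinner_sum_right[of ?p] cinner_scaleC_right
    by (intro sum.cong refl) (simp add: uj sq[symmetric] mult.commute del: of_real_power)
  have "cinner (x - ?p) (x - ?p) = cinner x x - cinner x ?p - cnj (cinner x ?p) + cinner ?p ?p"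
    using cinner_commute[of ?p x] by (simp add: cinner_diff_left cinner_diff_right)
  also have "\<dots> = cinner x x - complex_of_real (\<Sum>k\<in>S. (cmod (?c k))\<^sup>2)"
    unfolding pp xp by simp
  finally show ?thesis
    using cinner_ge_zero[of "x - ?p"] by (simp add: csnorm_power2)
qed

text \<open>The index is reflected, k to l - k, because column l of the matrix U(a)(\<xi>) has the
  entries a_{l-k}(\<xi> - l).\<close>

definition coeff_vec :: "real^'n \<Rightarrow> (real^'n \<Rightarrow> complex) \<Rightarrow> (real^'n) ell2" where
  "coeff_vec l h = Abs_ell2 (\<lambda>k. mean_value (\<lambda>x. h x * expc (- (l - k)) x))"

lemma expc_minus: "expc (- k) x = cnj (expc k x)"
  by (simp add: expc_def cis_cnj)

lemma mean_value_expc_cinner: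
  "h \<in> C_ap \<Longrightarrow> mean_value (\<lambda>x. h x * expc (- k) x) = cinner (Abs_cap h) (Abs_cap (expc k))"
  by (simp add: cinner_cap Abs_cap_inverse expc_minus)

text \<open>Bessel's inequality for the characters, with the mean square bounded by the supremum. It
  makes the sequence square summable and turns uniform approximation of h into approximation in l^2
  with the same error.\<close>

lemma coeff_vec_bound:
  assumes h: "h \<in> C_ap" "\<And>x. cmod (h x) \<le> B"
  shows "ell2_nth (coeff_vec l h) k = mean_value (\<lambda>x. h x * expc (- (l - k)) x)" "norm (coeff_vec l h) \<le> B"
proof -
  have B: "B \<ge> 0" using order_trans[OF norm_ge_zero h(2)] .
  have "(\<Sum>k\<in>S. (cmod (mean_value (\<lambda>x. h x * expc (- (l - k)) x)))\<^sup>2) \<le> B\<^sup>2" if "finite S" for S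
  proof -
    have "(\<Sum>k\<in>S. (cmod (mean_value (\<lambda>x. h x * expc (- (l - k)) x)))\<^sup>2) \<le> (csnorm (Abs_cap h))\<^sup>2"
      unfolding mean_value_expc_cinner[OF h(1)]
      by (rule bessel_inequality[OF that]) (auto simp: cinner_expc_cap)
    also have "\<dots> \<le> B\<^sup>2"
      by (intro power_mono csnorm_cap_le) (auto simp: Abs_cap_inverse h)
    finally show ?thesis .
  qed
  from Abs_ell2_bound[OF this B]
  show "ell2_nth (coeff_vec l h) k = mean_value (\<lambda>x. h x * expc (- (l - k)) x)" "norm (coeff_vec l h) \<le> B"
    by (simp_all add: coeff_vec_def)
qed

lemma ell2_nth_coeff_vec:
  "h \<in> C_ap \<Longrightarrow> ell2_nth (coeff_vec l h) k = mean_value (\<lambda>x. h x * expc (- (l - k)) x)"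
  by (metis C_ap_bounded coeff_vec_bound(1))

lemma Abs_cap_add: "f \<in> C_ap \<Longrightarrow> g \<in> C_ap \<Longrightarrow> Abs_cap (\<lambda>x. f x + g x) = Abs_cap f + Abs_cap g"
  by (simp add: Rep_cap_inject[symmetric] plus_cap.rep_eq Abs_cap_inverse C_ap_add)

lemma Abs_cap_diff: "f \<in> C_ap \<Longrightarrow> g \<in> C_ap \<Longrightarrow> Abs_cap (\<lambda>x. f x - g x) = Abs_cap f - Abs_cap g"
  by (simp add: Rep_cap_inject[symmetric] minus_cap.rep_eq Abs_cap_inverse C_ap_diff)

lemma Abs_cap_cmult: "f \<in> C_ap \<Longrightarrow> Abs_cap (\<lambda>x. c * f x) = c *\<^sub>C Abs_cap f"
  by (simp add: Rep_cap_inject[symmetric] scaleC_cap.rep_eq Abs_cap_inverse C_ap_cmult)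

lemma coeff_vec_diff:
  assumes "f \<in> C_ap" "g \<in> C_ap"
  shows "coeff_vec l (\<lambda>x. f x - g x) = coeff_vec l f - coeff_vec l g"
  by (rule ell2_eqI)
    (simp add: ell2_nth_coeff_vec assms C_ap_diff mean_value_expc_cinner Abs_cap_diff cinner_diff_left del: minus_diff_eq)

lemma coeff_vec_add:
  assumes "f \<in> C_ap" "g \<in> C_ap"
  shows "coeff_vec l (\<lambda>x. f x + g x) = coeff_vec l f + coeff_vec l g"
  by (rule ell2_eqI)
    (simp add: ell2_nth_coeff_vec assms C_ap_add mean_value_expc_cinner Abs_cap_add cinner_add_left del: minus_diff_eq)

lemma coeff_vec_expc: "coeff_vec l (\<lambda>x. expc k x * c) = c *\<^sub>C ell2_delta (l - k)"
proof (rule ell2_eqI)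
  fix j
  have 1: "(\<lambda>x. expc k x * c) = (\<lambda>x. c * expc k x)" by (simp add: mult.commute)
  have "ell2_nth (coeff_vec l (\<lambda>x. expc k x * c)) j = cinner (Abs_cap (\<lambda>x. c * expc k x)) (Abs_cap (expc (l - j)))"
    unfolding 1 by (simp add: ell2_nth_coeff_vec C_ap_cmult expc_C_ap mean_value_expc_cinner del: minus_diff_eq)
  then show "ell2_nth (coeff_vec l (\<lambda>x. expc k x * c)) j = ell2_nth (c *\<^sub>C ell2_delta (l - k)) j"
    by (auto simp: Abs_cap_cmult expc_C_ap cinner_scaleC_left cinner_expc_cap ell2_nth_delta)
qed

lemma coeff_vec_trig:
  assumes "finite I"
  shows "coeff_vec l (\<lambda>x. \<Sum>i\<in>I. expc (\<kappa> i) x * c i) = (\<Sum>i\<in>I. c i *\<^sub>C ell2_delta (l - \<kappa> i)) \<and>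
    (\<lambda>x. \<Sum>i\<in>I. expc (\<kappa> i) x * c i) \<in> C_ap"
  using assms
proof induction
  case empty
  have "coeff_vec l (\<lambda>_. 0) = 0" using coeff_vec_expc[of l 0 0] by simp
  then show ?case by (simp add: C_ap_const)
next
  case (insert i I)
  have "(\<lambda>x. expc (\<kappa> i) x * c i) \<in> C_ap"
    using C_ap_cmult[OF expc_C_ap, of "c i" "\<kappa> i"] by (simp add: mult.commute)
  then show ?case using insert by (simp add: coeff_vec_add C_ap_add coeff_vec_expc)
qed

section \<open>The operator U(a)(D) on finite sums\<close>

lemma U_symbol_finite:
  fixes a :: "(real^'n) \<times> (real^'n) \<Rightarrow> complex"
  assumes ap: "\<And>xi. (\<lambda>x. a (x, xi)) \<in> C_ap"
  shows "U_symbol a xi (\<Sum>j<(m::nat). \<phi> j *\<^sub>C ell2_delta (l j)) =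
    (\<Sum>j<m. \<phi> j *\<^sub>C coeff_vec (l j) (\<lambda>x. a (x, xi - l j)))"
proof -
  let ?z = "\<Sum>j<m. \<phi> j *\<^sub>C ell2_delta (l j)"
  have "(\<Sum>\<^sub>\<infinity>l'. symbol_coeff a (l' - k) (xi - l') * ell2_nth ?z l') =
      ell2_nth (\<Sum>j<m. \<phi> j *\<^sub>C coeff_vec (l j) (\<lambda>x. a (x, xi - l j))) k" for k
  proof -
    let ?t = "\<lambda>j l'. symbol_coeff a (l' - k) (xi - l') * (\<phi> j * (if l' = l j then 1 else 0))"
    have "(?t j has_sum ?t j (l j)) UNIV" for j
      by (rule has_sum_finite_neutralI[of "{l j}"]) auto
    then have "((\<lambda>l'. \<Sum>j<m. ?t j l') has_sum (\<Sum>j<m. ?t j (l j))) UNIV"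
      by (induction m) (simp_all add: has_sum_add has_sum_0)
    then have "(\<Sum>\<^sub>\<infinity>l'. symbol_coeff a (l' - k) (xi - l') * ell2_nth ?z l') = (\<Sum>j<m. ?t j (l j))"
      by (intro infsumI) (simp add: ell2_nth_sum ell2_nth_delta sum_distrib_left)
    also have "\<dots> = ell2_nth (\<Sum>j<m. \<phi> j *\<^sub>C coeff_vec (l j) (\<lambda>x. a (x, xi - l j))) k"
      by (simp add: ell2_nth_sum ell2_nth_coeff_vec[OF ap] symbol_coeff_def mult.commute)
    finally show ?thesis .
  qed
  then show ?thesis by (simp add: U_symbol_def ell2_nth_inverse)
qed

text \<open>Coordinates are bounded functionals, so the vector valued integral reduces to scalar
  ones once strong measurability and integrability of the norm are supplied.\<close>

lemma fourier_schwartz_l2f: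
  fixes \<phi> :: "nat \<Rightarrow> real^'n \<Rightarrow> complex"
  assumes \<phi>: "\<And>j. j < m \<Longrightarrow> schwartz (\<phi> j)"
  shows "fourier (\<lambda>x. \<Sum>j<m. \<phi> j x *\<^sub>C ell2_delta (l j :: real^'n)) xi = (\<Sum>j<m. fourier (\<phi> j) xi *\<^sub>C ell2_delta (l j))"
proof (rule ell2_eqI)
  fix k
  let ?F = "\<lambda>x. \<Sum>j<m. (expc (- xi) x * \<phi> j x) *\<^sub>C ell2_delta (l j)"
  have F: "(\<lambda>x. expc (- xi) x *\<^sub>C (\<Sum>j<m. \<phi> j x *\<^sub>C ell2_delta (l j))) = ?F"
    by (simp add: bounded_bilinear.sum_right[OF bounded_bilinear_scaleC] scaleC_scaleC)
  have int: "integrable lborel (\<lambda>x. expc (- xi) x * \<phi> j x)" if "j < m" for j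
    by (intro integrable_expc_mult schwartz_integrable \<phi> that)
  have m1: "strongly_measurable lborel ?F"
  proof -
    have "strongly_measurable lborel (\<lambda>x. \<Sum>j<n. (expc (- xi) x * \<phi> j x) *\<^sub>C ell2_delta (l j))" if "n \<le> m" for n
      using that
    proof (induction n)
      case (Suc n)
      have "strongly_measurable lborel (\<lambda>x. (expc (- xi) x * \<phi> n x) *\<^sub>C ell2_delta (l n))"
        using Suc.prems int[of n] by (intro strongly_measurable_scaleC_fun strongly_measurable_const) auto
      then show ?case using Suc by (simp add: strongly_measurable_add)
    qed (simp add: strongly_measurable_const)
    then show ?thesis by simp
  qed
  have m2: "integrable lborel (\<lambda>x. norm (?F x))"
  proof (rule Bochner_Integration.integrable_bound)
    show "integrable lborel (\<lambda>x. \<Sum>j<m. cmod (expc (- xi) x * \<phi> j x) * norm (ell2_delta (l j)))"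
      by (intro Bochner_Integration.integrable_sum integrable_mult_left integrable_norm int) auto
    show "(\<lambda>x. norm (?F x)) \<in> borel_measurable lborel" by (rule strongly_measurable_norm[OF m1])
    have "norm (?F x) \<le> (\<Sum>j<m. cmod (expc (- xi) x * \<phi> j x) * norm (ell2_delta (l j)))" for x
      by (rule sum_norm_le) (simp add: norm_scaleC)
    then show "AE x in lborel. norm (norm (?F x)) \<le> norm (\<Sum>j<m. cmod (expc (- xi) x * \<phi> j x) * norm (ell2_delta (l j)))"
      by (intro AE_I2) (simp add: order_trans[OF _ abs_ge_self])
  qed
  have "ell2_nth (fourier (\<lambda>x. \<Sum>j<m. \<phi> j x *\<^sub>C ell2_delta (l j)) xi) k = (LINT x|lborel. ell2_nth (?F x) k)"
    unfolding fourier_def F by (rule strong_integral_bounded_linear[OF m1 m2 bounded_linear_ell2_nth])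
  also have "\<dots> = (LINT x|lborel. (\<Sum>j<m. (expc (- xi) x * \<phi> j x) * ell2_nth (ell2_delta (l j)) k))"
    by (simp add: ell2_nth_sum)
  also have "\<dots> = (\<Sum>j<m. fourier (\<phi> j) xi * ell2_nth (ell2_delta (l j)) k)"
    unfolding fourier_complex by (subst Bochner_Integration.integral_sum) (auto intro: int)
  finally show "ell2_nth (fourier (\<lambda>x. \<Sum>j<m. \<phi> j x *\<^sub>C ell2_delta (l j)) xi) k =
      ell2_nth (\<Sum>j<m. fourier (\<phi> j) xi *\<^sub>C ell2_delta (l j)) k"
    by (simp add: ell2_nth_sum)
qed

lemma fourier_modulation: "fourier (\<lambda>x. expc (- l) x * f x) xi = fourier f (xi + l)"
  for f :: "real^'n \<Rightarrow> complex"
  unfolding fourier_complex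
  by (intro Bochner_Integration.integral_cong refl) (simp add: expc_add[of "- xi" "- l", symmetric] flip: mult.assoc)

text \<open>In each coordinate the translation of \<xi> by \<open>l j\<close> removes the shift from
  the symbol, produces the character in front and turns the transform of \<open>\<phi> j\<close>
  into that of its modulation. \<open>mean_value_pdo\<close> then moves the Bohr coefficient outside
  the integral.\<close>

lemma U_fun_eq:
  fixes a :: "(real^'n) \<times> (real^'n) \<Rightarrow> complex"
  assumes a: "a \<in> APS0 \<rho> \<delta>" "0 \<le> \<rho>" and \<phi>: "\<And>j. j < m \<Longrightarrow> schwartz (\<phi> j)"
  shows "U_fun a (\<lambda>x. \<Sum>j<(m::nat). \<phi> j x *\<^sub>C ell2_delta (l j)) x =
    (\<Sum>j<m. expc (l j) x *\<^sub>C coeff_vec (l j) (\<lambda>z. pdo (\<lambda>z xi. a (z, xi)) (fourier (\<lambda>x. expc (- l j) x * \<phi> j x)) z x))"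
proof (rule ell2_eqI)
  fix k :: "real^'n"
  have ap: "(\<lambda>z. a (z, xi)) \<in> C_ap" for xi using a(1) by (simp add: APS0_def)
  obtain B where B: "B \<ge> 0" "\<And>z xi. cmod (a (z, xi)) \<le> B" using APS0_bounded[OF a] by blast
  obtain L where L: "L \<ge> 0" "\<And>z xi eta. cmod (a (z, xi) - a (z, eta)) \<le> L * norm (xi - eta)"
    using APS0_lipschitz[OF a] by blast
  let ?c = "\<lambda>j xi. coeff_vec (l j) (\<lambda>z. a (z, xi - l j))"
  have c_le: "norm (?c j xi) \<le> B" for j xi by (rule coeff_vec_bound(2)[OF ap B(2)])
  \<comment> \<open>The Lipschitz bound of the symbol, uniform in z, passes to the coefficient
    sequences by \<open>coeff_vec_bound\<close>. Continuity then gives strong measurability of the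
    integrand despite the nonseparable target.\<close>
  have c_cont: "continuous_on UNIV (?c j)" for j
  proof (rule lipschitz_continuous_UNIV)
    fix xi eta
    have "?c j xi - ?c j eta = coeff_vec (l j) (\<lambda>z. a (z, xi - l j) - a (z, eta - l j))"
      by (rule coeff_vec_diff[OF ap ap, symmetric])
    also have "norm \<dots> \<le> L * norm (xi - eta)"
      using L(2)[of _ "xi - l j" "eta - l j"] by (intro coeff_vec_bound(2) C_ap_diff ap) simp
    finally show "norm (?c j xi - ?c j eta) \<le> L * norm (xi - eta)" .
  qed
  let ?H = "\<lambda>xi. \<Sum>j<m. (expc xi x * fourier (\<phi> j) xi) *\<^sub>C ?c j xi"
  have H: "(\<lambda>xi. expc xi x *\<^sub>C U_symbol a xi (fourier (\<lambda>x. \<Sum>j<m. \<phi> j x *\<^sub>C ell2_delta (l j)) xi)) = ?H"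
    by (simp add: fourier_schwartz_l2f[OF \<phi>] U_symbol_finite[OF ap] scaleC_scaleC
        bounded_bilinear.sum_right[OF bounded_bilinear_scaleC])
  have int: "integrable lborel (\<lambda>xi. expc xi x * fourier (\<phi> j) xi)" if "j < m" for j
    unfolding expc_commute[of _ x] by (intro integrable_expc_mult schwartz_fourier_integrable \<phi> that)
  have m1: "strongly_measurable lborel ?H"
  proof -
    have "strongly_measurable lborel (\<lambda>xi. \<Sum>j<n. (expc xi x * fourier (\<phi> j) xi) *\<^sub>C ?c j xi)" if "n \<le> m" for n
      using that
    proof (induction n)
      case (Suc n)
      have "strongly_measurable lborel (\<lambda>xi. (expc xi x * fourier (\<phi> n) xi) *\<^sub>C ?c n xi)"
        using Suc.prems int[of n]
        by (intro strongly_measurable_scaleC_fun continuous_strongly_measurable c_cont) auto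
      then show ?case using Suc by (simp add: strongly_measurable_add)
    qed (simp add: strongly_measurable_const)
    then show ?thesis by simp
  qed
  have m2: "integrable lborel (\<lambda>xi. norm (?H xi))"
  proof (rule Bochner_Integration.integrable_bound)
    show "integrable lborel (\<lambda>xi. \<Sum>j<m. cmod (expc xi x * fourier (\<phi> j) xi) * B)"
      by (intro Bochner_Integration.integrable_sum integrable_mult_left integrable_norm int) auto
    show "(\<lambda>xi. norm (?H xi)) \<in> borel_measurable lborel" by (rule strongly_measurable_norm[OF m1])
    have "norm (?H xi) \<le> (\<Sum>j<m. cmod (expc xi x * fourier (\<phi> j) xi) * B)" for xi
      by (rule sum_norm_le) (simp add: norm_scaleC mult_left_mono c_le)
    then show "AE xi in lborel. norm (norm (?H xi)) \<le> norm (\<Sum>j<m. cmod (expc xi x * fourier (\<phi> j) xi) * B)"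
      by (intro AE_I2) (simp add: order_trans[OF _ abs_ge_self])
  qed
  have nthc: "bounded_linear (\<lambda>z. ell2_nth z k)" by (rule bounded_linear_ell2_nth)
  have c_nth: "ell2_nth (?c j xi) k = symbol_coeff a (l j - k) (xi - l j)" for j xi
    by (simp add: ell2_nth_coeff_vec[OF ap] symbol_coeff_def)
  have ik: "integrable lborel (\<lambda>xi. expc xi x * fourier (\<phi> j) xi * symbol_coeff a (l j - k) (xi - l j))" if "j < m" for j
  proof (rule Bochner_Integration.integrable_bound)
    show "integrable lborel (\<lambda>xi. cmod (expc xi x * fourier (\<phi> j) xi) * B)"
      by (intro integrable_mult_left integrable_norm int that)
    have "continuous_on UNIV (\<lambda>xi. ell2_nth (?c j xi) k)"
      by (rule bounded_linear.continuous_on[OF nthc c_cont])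
    then have "(\<lambda>xi. symbol_coeff a (l j - k) (xi - l j)) \<in> borel_measurable borel"
      unfolding c_nth by (rule borel_measurable_continuous_onI)
    then show "(\<lambda>xi. expc xi x * fourier (\<phi> j) xi * symbol_coeff a (l j - k) (xi - l j)) \<in> borel_measurable lborel"
      using borel_measurable_integrable[OF int[OF that]] by simp
    have "cmod (symbol_coeff a (l j - k) (xi - l j)) \<le> B" for xi
      unfolding symbol_coeff_def using C_ap_mult_cnj[OF ap[of "xi - l j"] expc_C_ap[of "l j - k"]] B(2)
      by (intro cmod_mean_value_le) (auto simp: expc_minus norm_mult simp del: minus_diff_eq)
    then show "AE xi in lborel. cmod (expc xi x * fourier (\<phi> j) xi * symbol_coeff a (l j - k) (xi - l j)) \<le>
        norm (cmod (expc xi x * fourier (\<phi> j) xi) * B)"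
      using B(1) by (intro AE_I2) (simp add: norm_mult mult_left_mono)
  qed
  have "ell2_nth (U_fun a (\<lambda>x. \<Sum>j<m. \<phi> j x *\<^sub>C ell2_delta (l j)) x) k = (LINT xi|lborel. ell2_nth (?H xi) k)"
    unfolding U_fun_def H by (rule strong_integral_bounded_linear[OF m1 m2 nthc])
  also have "\<dots> = (LINT xi|lborel. (\<Sum>j<m. expc xi x * fourier (\<phi> j) xi * symbol_coeff a (l j - k) (xi - l j)))"
    by (simp add: ell2_nth_sum c_nth)
  also have "\<dots> = (\<Sum>j<m. LINT xi|lborel. expc xi x * fourier (\<phi> j) xi * symbol_coeff a (l j - k) (xi - l j))"
    by (rule Bochner_Integration.integral_sum) (simp add: ik)
  also have "\<dots> = (\<Sum>j<m. expc (l j) x * ell2_nth (coeff_vec (l j)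
      (\<lambda>z. pdo (\<lambda>z xi. a (z, xi)) (fourier (\<lambda>x. expc (- l j) x * \<phi> j x)) z x)) k)"
  proof (rule sum.cong[OF refl])
    fix j assume j: "j \<in> {..<m}"
    let ?f = "\<lambda>x. expc (- l j) x * \<phi> j x"
    have f: "schwartz ?f" using j by (intro schwartz_expc_mult \<phi>) simp
    have "(LINT xi|lborel. expc xi x * fourier (\<phi> j) xi * symbol_coeff a (l j - k) (xi - l j)) =
        (LINT xi|lborel. expc (xi + l j) x * fourier (\<phi> j) (xi + l j) * symbol_coeff a (l j - k) (xi + l j - l j))"
      by (rule lborel_translate(2)[symmetric, OF ik]) (use j in simp)
    also have "\<dots> = (LINT xi|lborel. expc (l j) x * (expc xi x * symbol_coeff a (l j - k) xi * fourier ?f xi))"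
      unfolding fourier_modulation by (simp add: expc_add mult_ac)
    also have "\<dots> = expc (l j) x * (LINT xi|lborel. expc xi x * mean_value (\<lambda>z. a (z, xi) * expc (- (l j - k)) z) * fourier ?f xi)"
      by (simp add: symbol_coeff_def)
    also have "(LINT xi|lborel. expc xi x * mean_value (\<lambda>z. a (z, xi) * expc (- (l j - k)) z) * fourier ?f xi) =
        mean_value (\<lambda>z. pdo (\<lambda>z xi. a (z, xi)) (fourier ?f) z x * expc (- (l j - k)) z)"
      by (rule mean_value_pdo[where A = "\<lambda>z xi. a (z, xi)" and B = B, symmetric])
        (use APS0_continuous[OF a(1)] in \<open>simp_all add: ap B(2) schwartz_fourier_integrable[OF f]\<close>)
    also have "\<dots> = ell2_nth (coeff_vec (l j) (\<lambda>z. pdo (\<lambda>z xi. a (z, xi)) (fourier ?f) z x)) k"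
    proof -
      have "(\<lambda>z. pdo (\<lambda>z xi. a (z, xi)) (fourier ?f) z x) \<in> C_ap"
        by (rule pdo_C_ap[where A = "\<lambda>z xi. a (z, xi)"]) (rule ap B(2) L schwartz_fourier_integrable f)+
      then show ?thesis by (simp add: ell2_nth_coeff_vec)
    qed
    finally show "(LINT xi|lborel. expc xi x * fourier (\<phi> j) xi * symbol_coeff a (l j - k) (xi - l j)) =
        expc (l j) x * ell2_nth (coeff_vec (l j) (\<lambda>z. pdo (\<lambda>z xi. a (z, xi)) (fourier ?f) z x)) k" .
  qed
  finally show "ell2_nth (U_fun a (\<lambda>x. \<Sum>j<m. \<phi> j x *\<^sub>C ell2_delta (l j)) x) k =
      ell2_nth (\<Sum>j<m. expc (l j) x *\<^sub>C coeff_vec (l j)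
        (\<lambda>z. pdo (\<lambda>z xi. a (z, xi)) (fourier (\<lambda>x. expc (- l j) x * \<phi> j x)) z x)) k"
    by (simp add: ell2_nth_sum)
qed

subsection \<open>The intertwining relation\<close>

lemma integrable_inverse_power_norm_square:
  "integrable lborel (\<lambda>y :: 'a :: euclidean_space. (C / (1 + norm y) ^ (DIM('a) + 2))\<^sup>2)"
proof (rule Bochner_Integration.integrable_bound)
  show "integrable lborel (\<lambda>y :: 'a. C\<^sup>2 * (1 / (1 + norm y) ^ (DIM('a) + 2)))"
    by (intro integrable_mult_right integrable_inverse_power_norm)
  have "(C / (1 + norm y) ^ (DIM('a) + 2))\<^sup>2 \<le> C\<^sup>2 * (1 / (1 + norm y) ^ (DIM('a) + 2))" for y :: 'a
  proof -
    have "1 / (1 + norm y) ^ (DIM('a) + 2) \<le> 1"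
      by (simp add: divide_le_eq_1 add_pos_nonneg one_le_power del: power_Suc)
    then have "(1 / (1 + norm y) ^ (DIM('a) + 2))\<^sup>2 \<le> 1 / (1 + norm y) ^ (DIM('a) + 2)"
      unfolding power2_eq_square by (intro mult_left_le) auto
    then have "C\<^sup>2 * (1 / (1 + norm y) ^ (DIM('a) + 2))\<^sup>2 \<le> C\<^sup>2 * (1 / (1 + norm y) ^ (DIM('a) + 2))"
      by (rule mult_left_mono) simp
    then show ?thesis by (simp only: power_divide power_one times_divide_eq_right mult_1_right)
  qed
  then show "AE y :: 'a in lborel. norm ((C / (1 + norm y) ^ (DIM('a) + 2))\<^sup>2) \<le> norm (C\<^sup>2 * (1 / (1 + norm y) ^ (DIM('a) + 2)))"
    by (intro AE_I2) (simp only: real_norm_def abs_power2 order_trans[OF _ abs_ge_self])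
qed measurable

text \<open>Near the origin the approximation is uniform, far out the decay of the integral is used.\<close>

lemma pdo_L2_approx:
  fixes a :: "(real^'n) \<times> (real^'n) \<Rightarrow> complex"
  assumes a: "a \<in> APS0 \<rho> \<delta>" "0 \<le> \<rho>" and f: "schwartz f" and e: "e > 0"
  shows "\<exists>(I :: (nat \<times> (real^'n)) set) h E. finite I \<and> (\<forall>i\<in>I. square_integrable (h i)) \<and> integrable lborel E \<and> (LINT y|lborel. E y) < e \<and>
    (\<forall>z y. (cmod (pdo (\<lambda>z xi. a (z, xi)) (fourier f) z y - (\<Sum>i\<in>I. expc (snd i) z * h i y)))\<^sup>2 \<le> E y)"
proof -
  let ?g = "pdo (\<lambda>z xi. a (z, xi)) (fourier f)"
  have ap: "(\<lambda>z. a (z, xi)) \<in> C_ap" for xi using a(1) by (simp add: APS0_def)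
  obtain B where B: "B \<ge> 0" "\<And>z xi. cmod (a (z, xi)) \<le> B" using APS0_bounded[OF a] by blast
  obtain L where L: "L \<ge> 0" "\<And>z xi eta. cmod (a (z, xi) - a (z, eta)) \<le> L * norm (xi - eta)"
    using APS0_lipschitz[OF a] by blast
  obtain C where C: "C \<ge> 0" "\<And>z y. cmod (?g z y) \<le> C / (1 + norm y) ^ (DIM(real^'n) + 2)"
    using pdo_decay[OF a f] by blast
  \<comment> \<open>A majorant of the squared modulus of g(z, y) for all z at once. Being
    integrable, it has integral below e / 2 outside a large ball.\<close>
  define D where "D y = (C / (1 + norm y) ^ (DIM(real^'n) + 2))\<^sup>2" for y :: "real^'n"
  have D: "integrable lborel D" unfolding D_def by (rule integrable_inverse_power_norm_square)
  have D0: "D y \<ge> 0" for y by (simp add: D_def)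
  have gD: "(cmod (?g z y))\<^sup>2 \<le> D y" for z y
    unfolding D_def by (intro power_mono C) simp
  have [measurable]: "D \<in> borel_measurable borel" using borel_measurable_integrable[OF D] by simp
  let ?b = "\<lambda>n :: nat. ball (0 :: real^'n) (real n)"
  have [measurable]: "?b n \<in> sets borel" for n by simp
  have "(\<lambda>n. LINT y|lborel. indicat_real (- ?b n) y * D y) \<longlonglongrightarrow> (LINT y|(lborel :: (real^'n) measure). 0)"
  proof (rule integral_dominated_convergence[where w = D])
    show "AE y in lborel. (\<lambda>n. indicat_real (- ?b n) y * D y) \<longlonglongrightarrow> 0"
    proof (rule AE_I2)
      fix y :: "real^'n"
      obtain N :: nat where "norm y < real N" using reals_Archimedean2 by blast
      then have "indicat_real (- ?b n) y * D y = 0" if "n \<ge> N" for n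
        using that by (auto simp: indicator_def)
      then show "(\<lambda>n. indicat_real (- ?b n) y * D y) \<longlonglongrightarrow> 0"
        by (intro tendsto_eventually) (auto simp: eventually_sequentially)
    qed
  qed (use D D0 in \<open>auto simp: indicator_def\<close>)
  then have "(\<lambda>n. LINT y|lborel. indicat_real (- ?b n) y * D y) \<longlonglongrightarrow> 0" by simp
  then have "\<forall>\<^sub>F n in sequentially. (LINT y|lborel. indicat_real (- ?b n) y * D y) < e / 2"
    by (rule order_tendstoD(2)) (use e in simp)
  then obtain n where n: "(LINT y|lborel. indicat_real (- ?b n) y * D y) < e / 2"
    unfolding eventually_sequentially by blast
  define \<mu> where "\<mu> = measure lborel (?b n)"
  have fin: "emeasure lborel (?b n) < \<infinity>" by (simp add: emeasure_ball)
  \<comment> \<open>The uniform error allowed on the ball: d^2 times its volume is at most e / 2.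
    The summand 1 guards against a ball of measure 0.\<close>
  define d where "d = sqrt (e / (2 * (\<mu> + 1)))"
  have \<mu>: "\<mu> \<ge> 0" by (simp add: \<mu>_def)
  have d: "d > 0" "d\<^sup>2 * \<mu> \<le> e / 2"
  proof -
    show "d > 0" using e \<mu> by (simp add: d_def)
    have "d\<^sup>2 = e / 2 / (\<mu> + 1)" using e \<mu> by (simp add: d_def)
    then have "d\<^sup>2 * (\<mu> + 1) = e / 2" using \<mu> nonzero_eq_divide_eq[of "\<mu> + 1" "d\<^sup>2" "e / 2"] by linarith
    moreover have "d\<^sup>2 * \<mu> \<le> d\<^sup>2 * (\<mu> + 1)" by (intro mult_left_mono) auto
    ultimately show "d\<^sup>2 * \<mu> \<le> e / 2" by simp
  qed
  have "\<exists>(I :: (nat \<times> (real^'n)) set) h K. finite I \<and> (\<forall>i\<in>I. h i \<in> borel_measurable borel) \<and> (\<forall>i\<in>I. \<forall>y. cmod (h i y) \<le> K) \<and>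
      (\<forall>z y. cmod (?g z y - (\<Sum>i\<in>I. expc (snd i) z * h i y)) < d)"
    by (rule pdo_trig_approx[where A = "\<lambda>z xi. a (z, xi)"]) (rule ap B(2) L schwartz_fourier_integrable f d(1))+
  then obtain I :: "(nat \<times> (real^'n)) set" and h K where I: "finite I" "\<forall>i\<in>I. h i \<in> borel_measurable borel"
    "\<forall>i\<in>I. \<forall>y. cmod (h i y) \<le> K" "\<forall>z y. cmod (?g z y - (\<Sum>i\<in>I. expc (snd i) z * h i y)) < d"
    by (elim exE conjE)
  \<comment> \<open>The cutoff makes the bounded functions \<open>h i\<close> square integrable. Off
    the ball the approximant is 0 and the error is g itself, controlled by \<open>D\<close>.\<close>
  define h' where "h' i y = indicator (?b n) y * h i y" for i y
  define E where "E y = d\<^sup>2 * indicat_real (?b n) y + indicat_real (- ?b n) y * D y" for y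
  have i1: "integrable lborel (\<lambda>y. d\<^sup>2 * indicat_real (?b n) y)"
    using fin by (intro integrable_mult_right integrable_real_indicator) auto
  have i2: "integrable lborel (\<lambda>y. indicat_real (- ?b n) y * D y)"
    by (rule Bochner_Integration.integrable_bound[OF D]) (auto simp: indicator_def)
  have "integrable lborel E" unfolding E_def by (intro Bochner_Integration.integrable_add i1 i2)
  moreover have "(LINT y|lborel. E y) < e"
  proof -
    have "(LINT y|lborel. E y) = d\<^sup>2 * \<mu> + (LINT y|lborel. indicat_real (- ?b n) y * D y)"
      unfolding E_def by (subst Bochner_Integration.integral_add[OF i1 i2]) (simp add: \<mu>_def)
    then show ?thesis using d(2) n by linarith
  qed
  moreover have "(cmod (?g z y - (\<Sum>i\<in>I. expc (snd i) z * h' i y)))\<^sup>2 \<le> E y" for z y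
  proof (cases "y \<in> ?b n")
    case True
    have "(cmod (?g z y - (\<Sum>i\<in>I. expc (snd i) z * h i y)))\<^sup>2 \<le> d\<^sup>2"
      using I(4) by (intro power_mono) (auto intro: less_imp_le)
    then show ?thesis using True by (simp add: h'_def E_def)
  next
    case False
    then show ?thesis using gD[of z y] by (simp add: h'_def E_def)
  qed
  moreover have "square_integrable (h' i)" if "i \<in> I" for i
  proof (rule square_integrable_bound)
    show "strongly_measurable lborel (h' i)"
      using I(2) that borel_measurable_times[of "indicator (?b n)" borel "h i"]
      unfolding h'_def[abs_def] strongly_measurable_iff_borel by simp
    show "integrable lborel (\<lambda>y. K\<^sup>2 * indicat_real (?b n) y)"
      using fin by (intro integrable_mult_right integrable_real_indicator) auto
    show "(cmod (h' i y))\<^sup>2 \<le> K\<^sup>2 * indicat_real (?b n) y" for y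
      using I(3) that by (auto simp: h'_def indicator_def intro!: power_mono)
  qed
  ultimately show ?thesis using I(1) by blast
qed

section \<open>Intertwining on a single generator\<close>

lemma expc_add_right: "expc k (x + y) = expc k x * expc k y"
  by (simp add: expc_commute[of k] expc_add)

lemma unitary_norm: "unitary V \<Longrightarrow> norm (V x) = norm x"
  by (simp add: unitary_def csnorm_def flip: csnorm_eq_norm)

lemma unitary_linear:
  assumes "unitary V"
  shows "V (x + y) = V x + V y" "V (x - y) = V x - V y" "V (sum f A) = (\<Sum>i\<in>A. V (f i))" "V 0 = 0"
proof -
  interpret bounded_linear V using assms by (simp add: unitary_def bounded_clinear_def)
  show "V (x + y) = V x + V y" "V (x - y) = V x - V y" "V (sum f A) = (\<Sum>i\<in>A. V (f i))" "V 0 = 0"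
    by (simp_all add: add diff sum zero)
qed

context
  fixes a :: "(real^'n) \<times> (real^'n) \<Rightarrow> complex" and \<rho> \<delta> :: real
    and V :: "(real^'n, (real^'n) ell2) L2 \<Rightarrow> 'n B2_L2"
  assumes a: "a \<in> APS0 \<rho> \<delta>" "0 \<le> \<rho>"
    and V: "unitary V"
    and V_delta: "\<And>H k. square_integrable H \<Longrightarrow>
      V (abs_L2 (\<lambda>x. H x *\<^sub>C ell2_delta k)) = expc_B2 (- k) \<otimes>\<^sub>H abs_L2 (\<lambda>x. expc (- k) x * H x)"
begin

abbreviation pdo_a :: "(real^'n \<Rightarrow> complex) \<Rightarrow> real^'n \<Rightarrow> real^'n \<Rightarrow> complex" where
  "pdo_a f \<equiv> pdo (\<lambda>z xi. a (z, xi)) (fourier f)"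

lemma pdo_a_C_ap:
  assumes "schwartz f"
  shows "(\<lambda>z. pdo_a f z y) \<in> C_ap"
proof -
  obtain B where B: "B \<ge> 0" "\<And>z xi. cmod (a (z, xi)) \<le> B" using APS0_bounded[OF a] by blast
  obtain L where L: "L \<ge> 0" "\<And>z xi eta. cmod (a (z, xi) - a (z, eta)) \<le> L * norm (xi - eta)"
    using APS0_lipschitz[OF a] by blast
  have ap: "(\<lambda>z. a (z, xi)) \<in> C_ap" for xi using a(1) by (simp add: APS0_def)
  show ?thesis
    by (rule pdo_C_ap[where A = "\<lambda>z xi. a (z, xi)"]) (rule ap B(2) L schwartz_fourier_integrable assms)+
qed

text \<open>The two vectors differ by e_l(y) times the coefficient sequence of the approximation
  error in z, and \<open>coeff_vec\<close> does not increase the sup norm.\<close>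

lemma coeff_vec_pdo_approx:
  assumes f: "schwartz f" and I: "finite I"
    and le: "\<And>z. cmod (pdo_a f z y - (\<Sum>i\<in>I. expc (snd i) z * h i y)) \<le> \<epsilon>"
  shows "norm (expc l y *\<^sub>C coeff_vec l (\<lambda>z. pdo_a f z y) - (\<Sum>i\<in>I. (expc l y * h i y) *\<^sub>C ell2_delta (l - snd i))) \<le> \<epsilon>"
proof -
  note trig = coeff_vec_trig[OF I, of l snd "\<lambda>i. h i y"]
  have "expc l y *\<^sub>C coeff_vec l (\<lambda>z. pdo_a f z y) - (\<Sum>i\<in>I. (expc l y * h i y) *\<^sub>C ell2_delta (l - snd i)) =
      expc l y *\<^sub>C (coeff_vec l (\<lambda>z. pdo_a f z y) - (\<Sum>i\<in>I. h i y *\<^sub>C ell2_delta (l - snd i)))"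
    by (simp add: scaleC_diff_right bounded_bilinear.sum_right[OF bounded_bilinear_scaleC] scaleC_scaleC)
  also have "\<dots> = expc l y *\<^sub>C coeff_vec l (\<lambda>z. pdo_a f z y - (\<Sum>i\<in>I. expc (snd i) z * h i y))"
    using trig by (simp add: coeff_vec_diff pdo_a_C_ap[OF f])
  also have "norm \<dots> \<le> \<epsilon>"
    using coeff_vec_bound(2)[OF C_ap_diff[OF pdo_a_C_ap[OF f] conjunct2[OF trig]] le, of l] by (simp add: norm_scaleC)
  finally show ?thesis .
qed

text \<open>Strong measurability: approximation uniform in z and y exhibits the function as a
  uniform limit of finite sums of measurable terms. Size: the decay of g in y, uniform in z, bounds
  the l^2 norm.\<close>

lemma coeff_vec_pdo_square_integrable:
  assumes f: "schwartz f"
  shows "square_integrable (\<lambda>y. expc l y *\<^sub>C coeff_vec l (\<lambda>z. pdo_a f z y))"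
proof -
  have ap: "(\<lambda>z. a (z, xi)) \<in> C_ap" for xi using a(1) by (simp add: APS0_def)
  obtain B where B: "B \<ge> 0" "\<And>z xi. cmod (a (z, xi)) \<le> B" using APS0_bounded[OF a] by blast
  obtain L where L: "L \<ge> 0" "\<And>z xi eta. cmod (a (z, xi) - a (z, eta)) \<le> L * norm (xi - eta)"
    using APS0_lipschitz[OF a] by blast
  obtain C where C: "C \<ge> 0" "\<And>z y. cmod (pdo_a f z y) \<le> C / (1 + norm y) ^ (DIM(real^'n) + 2)"
    using pdo_decay[OF a f] by blast
  let ?G = "\<lambda>y. expc l y *\<^sub>C coeff_vec l (\<lambda>z. pdo_a f z y)"
  have "\<exists>G'. strongly_measurable lborel G' \<and> (\<forall>y. norm (?G y - G' y) \<le> 1 / real (Suc n))" for n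
  proof -
    have "\<exists>(I :: (nat \<times> (real^'n)) set) h K. finite I \<and> (\<forall>i\<in>I. h i \<in> borel_measurable borel) \<and> (\<forall>i\<in>I. \<forall>y. cmod (h i y) \<le> K) \<and>
        (\<forall>z y. cmod (pdo_a f z y - (\<Sum>i\<in>I. expc (snd i) z * h i y)) < 1 / real (Suc n))"
      by (rule pdo_trig_approx[where A = "\<lambda>z xi. a (z, xi)"]) (rule ap B(2) L schwartz_fourier_integrable f | simp)+
    then obtain I :: "(nat \<times> (real^'n)) set" and h where I: "finite I" "\<forall>i\<in>I. h i \<in> borel_measurable borel"
      "\<forall>z y. cmod (pdo_a f z y - (\<Sum>i\<in>I. expc (snd i) z * h i y)) < 1 / real (Suc n)"
      by (elim exE conjE)
    have "strongly_measurable lborel (\<lambda>y. \<Sum>i\<in>I. (expc l y * h i y) *\<^sub>C ell2_delta (l - snd i))"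
      using I(1,2)
    proof (induction I)
      case (insert i I)
      have "strongly_measurable lborel (\<lambda>y. (expc l y * h i y) *\<^sub>C ell2_delta (l - snd i))"
        using insert.prems borel_measurable_times[of "expc l" borel "h i"]
        by (intro strongly_measurable_scaleC_fun strongly_measurable_const) simp
      then show ?case using insert by (simp add: strongly_measurable_add)
    qed (simp add: strongly_measurable_const)
    moreover have "norm (?G y - (\<Sum>i\<in>I. (expc l y * h i y) *\<^sub>C ell2_delta (l - snd i))) \<le> 1 / real (Suc n)" for y
      using I(3) by (intro coeff_vec_pdo_approx f I(1) less_imp_le) blast
    ultimately show ?thesis by blast
  qed
  then obtain G' where G': "\<And>n. strongly_measurable lborel (G' n)" "\<And>n y. norm (?G y - G' n y) \<le> 1 / real (Suc n)"
    by metis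
  have Gm: "strongly_measurable lborel ?G"
  proof (rule strongly_measurable_LIMSEQ[OF G'(1)])
    fix y
    have "(\<lambda>n. ?G y - G' n y) \<longlonglongrightarrow> 0"
      by (rule Lim_null_comparison[OF always_eventually LIMSEQ_inverse_real_of_nat])
        (use G'(2) in \<open>simp add: inverse_eq_divide del: of_nat_Suc\<close>)
    from tendsto_diff[OF tendsto_const[of "?G y"] this] show "(\<lambda>n. G' n y) \<longlonglongrightarrow> ?G y" by simp
  qed
  show ?thesis
  proof (rule square_integrable_bound[OF Gm integrable_inverse_power_norm_square])
    fix y
    have "norm (coeff_vec l (\<lambda>z. pdo_a f z y)) \<le> C / (1 + norm y) ^ (DIM(real^'n) + 2)"
      by (rule coeff_vec_bound(2)[OF pdo_a_C_ap[OF f] C(2)])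
    then show "(norm (?G y))\<^sup>2 \<le> (C / (1 + norm y) ^ (DIM(real^'n) + 2))\<^sup>2"
      by (intro power_mono) (auto simp: norm_scaleC)
  qed
qed

lemma pdo_translate_square_integrable:
  assumes f: "schwartz f"
  shows "square_integrable (\<lambda>y. c * pdo_a f (x + y) y)"
proof -
  obtain C where C: "C \<ge> 0" "\<And>z y. cmod (pdo_a f z y) \<le> C / (1 + norm y) ^ (DIM(real^'n) + 2)"
    using pdo_decay[OF a f] by blast
  have "continuous_on UNIV (\<lambda>p :: (real^'n) \<times> (real^'n). expc (snd p) (fst p) * a (x + fst p, snd p) * fourier f (snd p))"
    unfolding expc_def
    by (intro continuous_intros continuous_on_compose2[OF APS0_continuous[OF a(1)]]
        continuous_on_compose2[OF schwartz_fourier_continuous[OF f]]) auto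
  then have "(\<lambda>p :: (real^'n) \<times> (real^'n). expc (snd p) (fst p) * a (x + fst p, snd p) * fourier f (snd p)) \<in> borel_measurable borel"
    by (rule borel_measurable_continuous_onI)
  then have [measurable]: "(\<lambda>(y :: real^'n, xi). expc xi y * a (x + y, xi) * fourier f xi) \<in> borel_measurable (borel \<Otimes>\<^sub>M borel)"
    by (simp add: borel_prod case_prod_beta')
  have m: "(\<lambda>y. pdo_a f (x + y) y) \<in> borel_measurable borel"
    unfolding pdo_def by measurable
  have "square_integrable (\<lambda>y. pdo_a f (x + y) y)"
    by (rule square_integrable_bound[OF _ integrable_inverse_power_norm_square[of C]])
      (use m in \<open>simp add: strongly_measurable_iff_borel\<close>, intro power_mono C norm_ge_zero)
  from square_integrable_scaleC[OF this, of c] show ?thesis by (simp add: scaleC_complex_def)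
qed

text \<open>The same finite sum of terms e_\<kappa>(z) h(y) approximates both objects. At z = x + y
  a term splits into e_\<kappa>(x) e_\<kappa>(y) h(y), and the modulation lowers the frequency in x
  to \<kappa> - l. On the other side \<open>V\<close> takes e_l h \<delta>_{l-\<kappa>} to
  e_{\<kappa>-l} \<otimes> e_\<kappa> h, the matching tensor.\<close>

lemma represents_ap_pdo:
  assumes f: "schwartz f"
  shows "represents_ap (\<lambda>x. abs_L2 (\<lambda>y. expc (- l) x * pdo_a f (x + y) y))
    (V (abs_L2 (\<lambda>y. expc l y *\<^sub>C coeff_vec l (\<lambda>z. pdo_a f z y))))"
proof (rule represents_apI)
  fix \<epsilon> :: real assume \<epsilon>: "\<epsilon> > 0"
  let ?G = "\<lambda>y. expc l y *\<^sub>C coeff_vec l (\<lambda>z. pdo_a f z y)"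
  have "\<epsilon>\<^sup>2 > 0" using \<epsilon> by simp
  from pdo_L2_approx[OF a f this] obtain I :: "(nat \<times> (real^'n)) set" and h E where I: "finite I"
    "\<forall>i\<in>I. square_integrable (h i)" "integrable lborel E" "(LINT y|lborel. E y) < \<epsilon>\<^sup>2"
    "\<forall>z y. (cmod (pdo_a f z y - (\<Sum>i\<in>I. expc (snd i) z * h i y)))\<^sup>2 \<le> E y"
    by (elim exE conjE)
  have E0: "E y \<ge> 0" for y using I(5) order_trans[OF zero_le_power2] by blast
  note G = coeff_vec_pdo_square_integrable[OF f, of l]
  let ?k = "\<lambda>i. snd i - l" and ?h = "\<lambda>i. abs_L2 (\<lambda>y. expc (snd i) y * h i y)"
  have hs: "square_integrable (\<lambda>y. expc k y * h i y)" if "i \<in> I" for i k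
    using I(2) that by (intro square_integrable_expc_mult) blast
  have below: "r < \<epsilon>" if "r\<^sup>2 \<le> (LINT y|lborel. E y)" for r
    using that I(4) \<epsilon> by (intro power2_less_imp_less[of r \<epsilon>]) auto
  show "\<exists>(I :: (nat \<times> (real^'n)) set) k h. finite I \<and>
      (\<forall>x. norm (abs_L2 (\<lambda>y. expc (- l) x * pdo_a f (x + y) y) - (\<Sum>j\<in>I. expc (k j) x *\<^sub>C h j)) < \<epsilon>) \<and>
      norm (V (abs_L2 ?G) - (\<Sum>j\<in>I. expc_B2 (k j) \<otimes>\<^sub>H h j)) < \<epsilon>"
  proof (intro exI[of _ I] exI[of _ ?k] exI[of _ ?h] conjI allI)
    fix x
    let ?w = "\<lambda>y. \<Sum>i\<in>I. expc (?k i) x *\<^sub>C (expc (snd i) y * h i y)"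
    have w: "square_integrable ?w" by (intro square_integrable_sum square_integrable_scaleC hs)
    have "(\<Sum>i\<in>I. expc (?k i) x *\<^sub>C ?h i) = abs_L2 ?w"
      by (subst abs_L2_sum) (auto intro!: sum.cong simp: abs_L2_scaleC hs square_integrable_scaleC)
    then have "abs_L2 (\<lambda>y. expc (- l) x * pdo_a f (x + y) y) - (\<Sum>i\<in>I. expc (?k i) x *\<^sub>C ?h i) =
        abs_L2 (\<lambda>y. expc (- l) x * pdo_a f (x + y) y - ?w y)"
      by (simp add: abs_L2_diff pdo_translate_square_integrable[OF f] w)
    \<comment> \<open>\<open>E\<close> bounds the squared error for every z, so it may be used along
      z = x + y, and the resulting L^2 bound is uniform in x.\<close>
    moreover have "(norm (abs_L2 (\<lambda>y. expc (- l) x * pdo_a f (x + y) y - ?w y)))\<^sup>2 \<le> (LINT y|lborel. E y)"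
    proof (rule norm_abs_L2_le[OF _ I(3)])
      show "square_integrable (\<lambda>y. expc (- l) x * pdo_a f (x + y) y - ?w y)"
        by (intro square_integrable_diff pdo_translate_square_integrable f w)
      fix y
      have "expc (- l) x * pdo_a f (x + y) y - ?w y =
          expc (- l) x * (pdo_a f (x + y) y - (\<Sum>i\<in>I. expc (snd i) (x + y) * h i y))"
        using expc_add[of "- l" _ x]
        by (simp add: expc_add_right scaleC_complex_def right_diff_distrib sum_distrib_left mult_ac)
      then show "(cmod (expc (- l) x * pdo_a f (x + y) y - ?w y))\<^sup>2 \<le> E y"
        using I(5) by (simp add: norm_mult)
    qed
    ultimately show "norm (abs_L2 (\<lambda>y. expc (- l) x * pdo_a f (x + y) y) - (\<Sum>i\<in>I. expc (?k i) x *\<^sub>C ?h i)) < \<epsilon>"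
      using below by simp
  next
    let ?w = "\<lambda>y. \<Sum>i\<in>I. (expc l y * h i y) *\<^sub>C ell2_delta (l - snd i)"
    have w: "square_integrable ?w" by (intro square_integrable_sum square_integrable_scaleC_vec hs)
    have "V (abs_L2 ?w) = (\<Sum>i\<in>I. expc_B2 (?k i) \<otimes>\<^sub>H ?h i)"
    proof -
      have e: "expc (snd i - l) y * (expc l y * h i y) = expc (snd i) y * h i y" for i :: "nat \<times> (real^'n)" and y
        using expc_add[of "snd i - l" l y] by (simp flip: mult.assoc)
      show ?thesis
        by (subst abs_L2_sum) (auto intro!: sum.cong square_integrable_scaleC_vec simp: hs unitary_linear[OF V] V_delta e)
    qed
    then have "V (abs_L2 ?G) - (\<Sum>i\<in>I. expc_B2 (?k i) \<otimes>\<^sub>H ?h i) = V (abs_L2 (\<lambda>y. ?G y - ?w y))"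
      by (simp add: abs_L2_diff G w unitary_linear[OF V])
    moreover have "(norm (abs_L2 (\<lambda>y. ?G y - ?w y)))\<^sup>2 \<le> (LINT y|lborel. E y)"
    proof (rule norm_abs_L2_le[OF square_integrable_diff[OF G w] I(3)])
      fix y
      have "norm (?G y - ?w y) \<le> sqrt (E y)"
        using I(5) by (intro coeff_vec_pdo_approx f I(1) real_le_rsqrt) blast
      then have "(norm (?G y - ?w y))\<^sup>2 \<le> (sqrt (E y))\<^sup>2" by (rule power_mono) simp
      then show "(norm (?G y - ?w y))\<^sup>2 \<le> E y" using E0 by simp
    qed
    ultimately show "norm (V (abs_L2 ?G) - (\<Sum>i\<in>I. expc_B2 (?k i) \<otimes>\<^sub>H ?h i)) < \<epsilon>"
      using below by (simp add: unitary_norm[OF V])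
  qed (rule I(1))
qed

section \<open>Both operators on finite sums\<close>

lemma A_fun_eq:
  assumes f: "\<And>j. j < m \<Longrightarrow> schwartz (f j)"
  shows "A_fun a (\<lambda>x y. \<Sum>j<(m::nat). expc (k j) x * f j y) x = (\<lambda>y. \<Sum>j<m. expc (k j) x * pdo_a (f j) (x + y) y)"
proof
  fix y
  obtain B where B: "B \<ge> 0" "\<And>z xi. cmod (a (z, xi)) \<le> B" using APS0_bounded[OF a] by blast
  have "fourier (\<lambda>y. \<Sum>j<m. expc (k j) x * f j y) xi = (\<Sum>j<m. expc (k j) x * fourier (f j) xi)" for xi
  proof -
    have "fourier (\<lambda>y. \<Sum>j<m. expc (k j) x * f j y) xi = (LINT y|lborel. (\<Sum>j<m. expc (k j) x * (expc (- xi) y * f j y)))"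
      unfolding fourier_complex by (simp add: sum_distrib_left mult_ac)
    also have "\<dots> = (\<Sum>j<m. LINT y|lborel. expc (k j) x * (expc (- xi) y * f j y))"
      by (rule Bochner_Integration.integral_sum)
        (intro integrable_mult_right integrable_expc_mult schwartz_integrable f, simp)
    finally show ?thesis by (simp add: fourier_complex)
  qed
  then have "A_fun a (\<lambda>x y. \<Sum>j<m. expc (k j) x * f j y) x y =
      (LINT xi|lborel. (\<Sum>j<m. expc (k j) x * (expc xi y * a (x + y, xi) * fourier (f j) xi)))"
    by (simp add: A_fun_def sum_distrib_left mult_ac)
  also have "\<dots> = (\<Sum>j<m. LINT xi|lborel. expc (k j) x * (expc xi y * a (x + y, xi) * fourier (f j) xi))"
  proof (rule Bochner_Integration.integral_sum)
    fix j assume j: "j \<in> {..<m}"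
    have "continuous_on UNIV (\<lambda>xi. a (x + y, xi))"
      by (rule continuous_on_compose2[OF APS0_continuous[OF a(1)]]) (auto intro!: continuous_intros)
    then have "integrable lborel (\<lambda>xi. expc xi y * a (x + y, xi) * fourier (f j) xi)"
      using j by (intro pdo_integrable[where A = "\<lambda>z xi. a (z, xi)" and z = "x + y" and B = B]
          schwartz_fourier_integrable f B(2)) auto
    then show "integrable lborel (\<lambda>xi. expc (k j) x * (expc xi y * a (x + y, xi) * fourier (f j) xi))"
      by (rule integrable_mult_right)
  qed
  finally show "A_fun a (\<lambda>x y. \<Sum>j<m. expc (k j) x * f j y) x y = (\<Sum>j<m. expc (k j) x * pdo_a (f j) (x + y) y)"
    by (simp add: pdo_def)
qed

lemma A_fun_square_integrable:
  assumes "\<And>j. j < m \<Longrightarrow> schwartz (f j)"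
  shows "square_integrable (A_fun a (\<lambda>x y. \<Sum>j<(m::nat). expc (k j) x * f j y) x)"
  by (subst A_fun_eq[OF assms], simp)
    (intro square_integrable_sum pdo_translate_square_integrable assms, simp)

lemma U_fun_square_integrable:
  assumes "\<And>j. j < m \<Longrightarrow> schwartz (\<phi> j)"
  shows "square_integrable (U_fun a (\<lambda>x. \<Sum>j<(m::nat). \<phi> j x *\<^sub>C ell2_delta (l j)))"
proof -
  have "U_fun a (\<lambda>x. \<Sum>j<m. \<phi> j x *\<^sub>C ell2_delta (l j)) =
      (\<lambda>x. \<Sum>j<m. expc (l j) x *\<^sub>C coeff_vec (l j) (\<lambda>z. pdo_a (\<lambda>x. expc (- l j) x * \<phi> j x) z x))"
    by (rule ext) (rule U_fun_eq[OF a assms])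
  then show ?thesis
    by (simp only:) (intro square_integrable_sum coeff_vec_pdo_square_integrable schwartz_expc_mult assms, simp)
qed

lemma V_schwartz_l2f:
  assumes "\<And>j. j < m \<Longrightarrow> schwartz (\<phi> j)"
  shows "V (abs_L2 (\<lambda>x. \<Sum>j<(m::nat). \<phi> j x *\<^sub>C ell2_delta (l j))) =
    (\<Sum>j<m. expc_B2 (- l j) \<otimes>\<^sub>H abs_L2 (\<lambda>x. expc (- l j) x * \<phi> j x))"
  using assms
  by (subst abs_L2_sum)
    (auto intro!: sum.cong square_integrable_scaleC_vec schwartz_square_integrable simp: unitary_linear[OF V] V_delta schwartz_square_integrable)

lemma represents_ap_zero: "represents_ap (\<lambda>_. 0) 0"
  by (rule represents_apI) (auto intro!: exI[of _ "{}"])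

text \<open>\<open>A_fun\<close> and \<open>U_fun\<close> are finite sums of \<open>pdo\<close>
  expressions with the same modulated functions, so the case of one generator adds up.\<close>

lemma represents_ap_A_fun:
  assumes \<phi>: "\<And>j. j < m \<Longrightarrow> schwartz (\<phi> j)"
  shows "represents_ap (\<lambda>x. abs_L2 (A_fun a (\<lambda>x y. \<Sum>j<(m::nat). expc (- l j) x * (expc (- l j) y * \<phi> j y)) x))
    (V (abs_L2 (U_fun a (\<lambda>x. \<Sum>j<m. \<phi> j x *\<^sub>C ell2_delta (l j)))))"
proof -
  let ?f = "\<lambda>j y. expc (- l j) y * \<phi> j y"
  let ?W = "\<lambda>j x. abs_L2 (\<lambda>y. expc (- l j) x * pdo_a (?f j) (x + y) y)"
  let ?G = "\<lambda>j y. expc (l j) y *\<^sub>C coeff_vec (l j) (\<lambda>z. pdo_a (?f j) z y)"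
  have f: "schwartz (?f j)" if "j < m" for j by (intro schwartz_expc_mult \<phi> that)
  have "represents_ap (\<lambda>x. \<Sum>j<n. ?W j x) (\<Sum>j<n. V (abs_L2 (?G j)))" if "n \<le> m" for n
    using that
  proof (induction n)
    case 0
    show ?case by (simp add: represents_ap_zero)
  next
    case (Suc n)
    then show ?case by (simp add: represents_ap_add represents_ap_pdo f)
  qed
  from this[of m] have "represents_ap (\<lambda>x. \<Sum>j<m. ?W j x) (\<Sum>j<m. V (abs_L2 (?G j)))" by simp
  moreover have "(\<Sum>j<m. ?W j x) = abs_L2 (A_fun a (\<lambda>x y. \<Sum>j<m. expc (- l j) x * ?f j y) x)" for x
    by (subst A_fun_eq[OF f], simp, subst abs_L2_sum) (auto intro: pdo_translate_square_integrable f)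
  moreover have "(\<Sum>j<m. V (abs_L2 (?G j))) = V (abs_L2 (U_fun a (\<lambda>x. \<Sum>j<m. \<phi> j x *\<^sub>C ell2_delta (l j))))"
  proof -
    have "U_fun a (\<lambda>x. \<Sum>j<m. \<phi> j x *\<^sub>C ell2_delta (l j)) = (\<lambda>y. \<Sum>j<m. ?G j y)"
      by (rule ext) (rule U_fun_eq[OF a \<phi>])
    then show ?thesis
      by (simp only:) (subst abs_L2_sum, auto intro: coeff_vec_pdo_square_integrable f simp: unitary_linear[OF V])
  qed
  ultimately show ?thesis by simp
qed

end

subsection \<open>Bounded extensions\<close>

lemma bounded_clinear_compose:
  assumes "bounded_clinear S" "bounded_clinear T"
  shows "bounded_clinear (S \<circ> T)"
  using assms bounded_linear_compose[of S T] by (simp add: bounded_clinear_def o_def)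

lemma unitary_inverse:
  assumes V: "unitary V"
  obtains W where "bounded_clinear W" "\<And>x. W (V x) = x" "\<And>y. V (W y) = y"
proof -
  have inj: "x = y" if "V x = V y" for x y
    using unitary_norm[OF V, of "x - y"] that by (simp add: unitary_linear[OF V])
  have VW: "V (inv V y) = y" for y using V by (simp add: unitary_def surj_f_inv_f)
  have WV: "inv V (V x) = x" for x by (rule inj) (rule VW)
  have Vc: "V (c *\<^sub>C x) = c *\<^sub>C V x" for c x using V by (simp add: unitary_def bounded_clinear_def)
  have Wc: "inv V (c *\<^sub>C y) = c *\<^sub>C inv V y" for c y
    by (rule inj) (simp add: VW Vc)
  have "bounded_linear (inv V)"
  proof (rule bounded_linear_intro[where K = 1])
    show "inv V (x + y) = inv V x + inv V y" for x y
      by (rule inj) (simp add: VW unitary_linear[OF V])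
    show "inv V (r *\<^sub>R x) = r *\<^sub>R inv V x" for r x by (simp add: scaleR_scaleC Wc)
    show "norm (inv V x) \<le> norm x * 1" for x using unitary_norm[OF V, of "inv V x"] by (simp add: VW)
  qed
  then have "bounded_clinear (inv V)" by (simp add: bounded_clinear_def Wc)
  then show ?thesis using that WV VW by blast
qed

lemma bounded_extension_eq:
  assumes "bounded_clinear T" "P T" and "\<And>S. bounded_clinear S \<Longrightarrow> P S \<Longrightarrow> S = T"
  shows "bounded_extension P = T"
proof -
  have "(THE T. bounded_clinear T \<and> P T) = T"
    by (rule the_equality) (use assms in blast)+
  then show ?thesis
    unfolding bounded_extension_def using assms(1,2) by (subst if_P) blast+
qed

text \<open>Conjugation by \<open>V\<close> exchanges the bounded extensions for \<open>P\<close>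
  with those for \<open>Q\<close> and carries uniqueness along. If there are none, both operators
  take the default value 0, which \<open>V\<close> intertwines trivially.\<close>

lemma bounded_extension_conjugate:
  fixes P :: "('a :: complex_inner \<Rightarrow> 'a) \<Rightarrow> bool" and Q :: "('b :: complex_inner \<Rightarrow> 'b) \<Rightarrow> bool"
  assumes V: "unitary V"
    and iff: "\<And>S T. bounded_clinear T \<Longrightarrow> (\<And>x. S (V x) = V (T x)) \<Longrightarrow> Q S \<longleftrightarrow> P T"
    and unique: "\<And>S T. bounded_clinear S \<Longrightarrow> bounded_clinear T \<Longrightarrow> P S \<Longrightarrow> P T \<Longrightarrow> S = T"
  shows "unitarily_equivalent (bounded_extension P) (bounded_extension Q)"
proof -
  obtain W where W: "bounded_clinear W" "\<And>x. W (V x) = x" "\<And>y. V (W y) = y" using unitary_inverse[OF V] by blast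
  have Vb: "bounded_clinear V" using V by (simp add: unitary_def)
  have conj: "bounded_clinear (W \<circ> S \<circ> V)" "P (W \<circ> S \<circ> V)" if "bounded_clinear S" "Q S" for S
  proof -
    show b: "bounded_clinear (W \<circ> S \<circ> V)" by (intro bounded_clinear_compose W Vb that)
    show "P (W \<circ> S \<circ> V)" using iff[OF b, of S] that(2) by (simp add: W)
  qed
  have "V \<circ> bounded_extension P = bounded_extension Q \<circ> V"
  proof (cases "\<exists>T. bounded_clinear T \<and> P T")
    case True
    then obtain T where T: "bounded_clinear T" "P T" by blast
    have "bounded_extension P = T" using T unique by (intro bounded_extension_eq) auto
    moreover have "bounded_extension Q = V \<circ> T \<circ> W"
    proof (rule bounded_extension_eq)
      show "bounded_clinear (V \<circ> T \<circ> W)" by (intro bounded_clinear_compose W Vb T)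
      show "Q (V \<circ> T \<circ> W)" using iff[OF T(1), of "V \<circ> T \<circ> W"] T(2) by (simp add: W)
      fix S assume S: "bounded_clinear S" "Q S"
      have "W \<circ> S \<circ> V = T" by (rule unique[OF conj(1)[OF S] T(1) conj(2)[OF S] T(2)])
      then have "W (S x) = T (W x)" for x by (metis W(3) comp_apply)
      then show "S = V \<circ> T \<circ> W" by (simp add: fun_eq_iff W flip: \<open>\<And>x. W (S x) = T (W x)\<close>)
    qed
    ultimately show ?thesis by (simp add: fun_eq_iff W)
  next
    case False
    then have "\<nexists>S. bounded_clinear S \<and> Q S" using conj by blast
    with False have "bounded_extension P = (\<lambda>_. 0)" "bounded_extension Q = (\<lambda>_. 0)"
      unfolding bounded_extension_def by (simp_all only: if_False)
    then show ?thesis by (simp add: fun_eq_iff unitary_linear[OF V])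
  qed
  with V show ?thesis unfolding unitarily_equivalent_def by blast
qed

theorem proposition5p3:
  fixes a :: "(real^'n) \<times> (real^'n) \<Rightarrow> complex" and \<rho> \<delta> :: real
  assumes "0 < \<rho>" and "\<rho> \<le> 1" and "0 \<le> \<delta>" and "\<delta> < 1" and "\<delta> \<le> \<rho>"
    and "a \<in> APS0 \<rho> \<delta>"
  shows "unitarily_equivalent (U_op a) (A_op a)"
proof -
  have a: "a \<in> APS0 \<rho> \<delta>" "0 \<le> \<rho>" using assms by auto
  obtain V :: "(real^'n, (real^'n) ell2) L2 \<Rightarrow> 'n B2_L2" where V: "unitary V"
    "\<And>H k. square_integrable H \<Longrightarrow> V (abs_L2 (\<lambda>x. H x *\<^sub>C ell2_delta k)) = expc_B2 (- k) \<otimes>\<^sub>H abs_L2 (\<lambda>x. expc (- k) x * H x)"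
    using twist_unitary_exists by blast
  have V_inj: "x = y" if "V x = V y" for x y
    using unitary_norm[OF V(1), of "x - y"] that by (simp add: unitary_linear[OF V(1)])
  show ?thesis
    unfolding U_op_def A_op_def
  proof (rule bounded_extension_conjugate[OF V(1)])
    fix S :: "'n B2_L2 \<Rightarrow> 'n B2_L2" and T :: "(real^'n, (real^'n) ell2) L2 \<Rightarrow> (real^'n, (real^'n) ell2) L2"
    assume ST: "\<And>x. S (V x) = V (T x)"
    show "(\<forall>(m :: nat) l f. (\<forall>j<m. schwartz (f j)) \<longrightarrow>
        (let u = (\<lambda>x y. \<Sum>j<m. expc (l j) x * f j y) in
          (\<forall>x. square_integrable (A_fun a u x)) \<and>
          represents_ap (\<lambda>x. abs_L2 (A_fun a u x)) (S (\<Sum>j<m. expc_B2 (l j) \<otimes>\<^sub>H abs_L2 (f j))))) \<longleftrightarrow>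
      (\<forall>F\<in>schwartz_l2f. square_integrable (U_fun a F) \<and> T (abs_L2 F) = abs_L2 (U_fun a F))"
      (is "?Q \<longleftrightarrow> ?P")
    proof
      assume ?Q
      show ?P
      proof
        fix F :: "real^'n \<Rightarrow> (real^'n) ell2" assume "F \<in> schwartz_l2f"
        then obtain m :: nat and \<phi> l where \<phi>: "\<And>j. j < m \<Longrightarrow> schwartz (\<phi> j)"
          and F: "F = (\<lambda>x. \<Sum>j<m. \<phi> j x *\<^sub>C ell2_delta (l j))"
          unfolding schwartz_l2f_def by blast
        let ?f = "\<lambda>j y. expc (- l j) y * \<phi> j y"
        let ?u = "\<lambda>x y. \<Sum>j<m. expc (- l j) x * ?f j y"
        have "\<forall>j<m. schwartz (?f j)" by (simp add: schwartz_expc_mult \<phi>)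
        with \<open>?Q\<close>[rule_format, of m ?f "\<lambda>j. - l j"]
        have "represents_ap (\<lambda>x. abs_L2 (A_fun a ?u x)) (S (\<Sum>j<m. expc_B2 (- l j) \<otimes>\<^sub>H abs_L2 (?f j)))"
          by (simp add: Let_def)
        then have "represents_ap (\<lambda>x. abs_L2 (A_fun a ?u x)) (V (T (abs_L2 F)))"
          by (simp add: F V_schwartz_l2f[OF a V \<phi>, symmetric] ST)
        moreover have "represents_ap (\<lambda>x. abs_L2 (A_fun a ?u x)) (V (abs_L2 (U_fun a F)))"
          unfolding F by (rule represents_ap_A_fun[OF a V \<phi>])
        \<comment> \<open>One function is represented by two tensors, so these coincide, and
          injectivity of \<open>V\<close> brings the equality back to the Bochner space.\<close>
        ultimately have "T (abs_L2 F) = abs_L2 (U_fun a F)"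
          by (intro V_inj) (rule represents_ap_unique)
        moreover have "square_integrable (U_fun a F)"
          unfolding F by (rule U_fun_square_integrable[OF a V \<phi>])
        ultimately show "square_integrable (U_fun a F) \<and> T (abs_L2 F) = abs_L2 (U_fun a F)" by blast
      qed
    next
      assume P: ?P
      show ?Q
        unfolding Let_def
      proof (intro allI impI conjI)
        fix m :: nat and l :: "nat \<Rightarrow> real^'n" and f :: "nat \<Rightarrow> real^'n \<Rightarrow> complex"
        assume "\<forall>j<m. schwartz (f j)"
        then have f': "schwartz (f j)" if "j < m" for j using that by blast
        show "square_integrable (A_fun a (\<lambda>x y. \<Sum>j<m. expc (l j) x * f j y) x)" for x
          by (rule A_fun_square_integrable[OF a V f'])
        \<comment> \<open>\<open>V\<close> sends the index k to the frequency -k and modulates by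
          e_-k, so e_l \<otimes> f is the image of e_-l f placed at the index -l.\<close>
        let ?\<phi> = "\<lambda>j y. expc (- l j) y * f j y"
        let ?F = "\<lambda>x. \<Sum>j<m. ?\<phi> j x *\<^sub>C ell2_delta (- l j)"
        have \<phi>: "schwartz (?\<phi> j)" if "j < m" for j using f' that by (simp add: schwartz_expc_mult)
        have "?F \<in> schwartz_l2f" by (rule schwartz_l2fI) (simp_all add: \<phi>)
        then have "T (abs_L2 ?F) = abs_L2 (U_fun a ?F)" using P by blast
        moreover have "V (abs_L2 ?F) = (\<Sum>j<m. expc_B2 (l j) \<otimes>\<^sub>H abs_L2 (f j))"
          using V_schwartz_l2f[where m = m and \<phi> = "?\<phi>" and l = "\<lambda>j. - l j", OF a V \<phi>] by (simp add: expc_mult_inverse)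
        moreover have "represents_ap (\<lambda>x. abs_L2 (A_fun a (\<lambda>x y. \<Sum>j<m. expc (l j) x * f j y) x)) (V (abs_L2 (U_fun a ?F)))"
          using represents_ap_A_fun[where m = m and \<phi> = "?\<phi>" and l = "\<lambda>j. - l j", OF a V \<phi>] by (simp add: expc_mult_inverse)
        ultimately show "represents_ap (\<lambda>x. abs_L2 (A_fun a (\<lambda>x y. \<Sum>j<m. expc (l j) x * f j y) x))
            (S (\<Sum>j<m. expc_B2 (l j) \<otimes>\<^sub>H abs_L2 (f j)))"
          using ST[of "abs_L2 ?F"] by simp
      qed
    qed
  next
    fix S T :: "(real^'n, (real^'n) ell2) L2 \<Rightarrow> (real^'n, (real^'n) ell2) L2"
    assume b: "bounded_clinear S" "bounded_clinear T"
      and "\<forall>F\<in>schwartz_l2f. square_integrable (U_fun a F) \<and> S (abs_L2 F) = abs_L2 (U_fun a F)"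
      and "\<forall>F\<in>schwartz_l2f. square_integrable (U_fun a F) \<and> T (abs_L2 F) = abs_L2 (U_fun a F)"
    \<comment> \<open>Uniqueness of the extension by density is needed only on this side;
      conjugation transports it to the tensor product.\<close>
    then have "abs_L2 ` schwartz_l2f \<subseteq> {v. S v = T v}" by auto
    moreover have "closed {v. S v = T v}"
      using b unfolding bounded_clinear_def
      by (intro closed_Collect_eq linear_continuous_on) auto
    ultimately have "closure (abs_L2 ` schwartz_l2f) \<subseteq> {v. S v = T v}" by (rule closure_minimal)
    then show "S = T" using schwartz_l2f_dense by blast
  qed
qed

end
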